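(* Let $k\ge 2$. For every pair of pure $k$-partite states $\varphi,\psi$ (state vectors in finite-dimensional $k$-partite Hilbert spaces, possibly different ones), \[ R_{\mathrm{LOCCq}}(|\varphi\rangle\langle\varphi|,|\psi\rangle\langle\psi|)=\inf_{\substack{E\\ E(\psi)\neq 0}}\frac{E(\varphi)}{E(\psi)}, \] where the infimum ranges over all functions $E$ from $k$-partite pure states (of arbitrary finite local dimensions) to $\mathbb{R}$ that satisfy all of the following: (i) $E(\mathrm{GHZ})=1$; (ii) full additivity: $E(\varphi\otimes\psi)=E(\varphi)+E(\psi)$ for all pure $k$-partite states $\varphi,\psi$; (iii) monotonicity on average under LOCC; (iv) asymptotic continuity (on pure states).
   Context: All logarithms are base 2. A $k$-partite state is a density operator on $\mathcal{H}=\mathcal{H}_1\otimes\cdots\otimes\mathcal{H}_k$ with each $\mathcal{H}_j$ finite-dimensional; for $\rho$ on $\mathcal{H}$ and $\sigma$ on $\mathcal{K}$, $\rho\otimes\sigma$ is regarded as the $k$-partite state on $(\mathcal{H}_1\otimes\mathcal{K}_1)\otimes\cdots\otimes(\mathcal{H}_k\otimes\mathcal{K}_k)$. For a unit vector $\varphi$ we write $E(\varphi)$ for $E(|\varphi\rangle\langle\varphi|)$. $\mathrm{GHZ}_r$ is the state with vector $r^{-1/2}(|11\ldots1\rangle+\cdots+|rr\ldots r\rangle)$ on $(\mathbb{C}^r)^{\otimes k}$, and $\mathrm{GHZ}=\mathrm{GHZ}_2$. The fidelity is $F(\rho,\sigma)=\operatorname{Tr}\sqrt{\sigma^{1/2}\rho\sigma^{1/2}}$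 and the purified distance is $D(\rho,\sigma)=\sqrt{1-F(\rho,\sigma)^2}$. We write $\rho\to_\epsilon\sigma$ if there is an LOCC channel $\Lambda$ (local operations and classical communication among the $k$ parties) with $D(\Lambda(\rho),\sigma)\le\epsilon$. A number $r\ge 0$ is an achievable rate from $\rho$ to $\sigma$ if for every $\delta>0$, $\limsup_{n\to\infty}\inf\{\epsilon\ge 0:\rho^{\otimes n}\otimes\mathrm{GHZ}^{\otimes\lfloor\delta n\rfloor}\to_\epsilon\sigma^{\otimes\lceil rn\rceil}\}=0$; $R_{\mathrm{LOCCq}}(\rho,\sigma)$ is the supremum of achievable rates. A function $E$ on pure states is monotone on average under LOCC if whenever an LOCC channel maps $|\varphi\rangle\langle\varphi|$ to $\sum_{x\in\mathcal{X}}P(x)|x\rangle\langle x|\otimes|\varphi_x\rangle\langle\varphi_x|$ (finite $\mathcal{X}$, $P$ a probability distribution, $|x\rangle$ an orthonormal classical flag available to all parties), then $E(\varphi)\ge\sum_x P(x)E(\varphi_x)$. Asymptotic continuity on pure states: regard the disjoint union of the pure state sets on all $\mathbb{C}^{d_1}\otimes\cdots\otimes\mathbb{C}^{d_k}$ as a metric space, where two states on the same space have distance equal to their purified distance and states on different spaces have distance $1$; let $\dim\mathcal{H}=d_1\cdots d_k$ on the corresponding piece. $E$ is asymptotically continuous if $E/(1+\log\dim\mathcal{H})$ is uniformly continuous on this metric space. The infimum over an empty set is $+\infty$. *)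

theory Defs
  imports "HOL-Analysis.Analysis" "HOL-Library.Extended_Real" "HOL-Library.Liminf_Limsup"
    "Jordan_Normal_Form.Matrix"
begin

text \<open>A k-partite operator is represented as a pair (d, M): d is the list of local
dimensions [d_1,...,d_k], M a matrix on C^(d_1 * ... * d_k) with computational basis
ordered lexicographically (mixed radix, first factor most significant).\<close>

type_synonym kop = "nat list \<times> complex mat"

definition adj :: "complex mat \<Rightarrow> complex mat" where
  "adj A = mat (dim_col A) (dim_row A) (\<lambda>(i,j). cnj (A $$ (j,i)))"

definition mtrace :: "complex mat \<Rightarrow> complex" where
  "mtrace A = (\<Sum>i<dim_row A. A $$ (i,i))"

definition msum :: "nat \<Rightarrow> nat \<Rightarrow> complex mat list \<Rightarrow> complex mat" where
  "msum n m As = foldr (+) As (0\<^sub>m n m)"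

definition qform :: "complex mat \<Rightarrow> complex vec \<Rightarrow> complex" where
  "qform A v = (\<Sum>i<dim_vec v. cnj (v $ i) * (A *\<^sub>v v) $ i)"

definition psd :: "complex mat \<Rightarrow> bool" where
  "psd A \<longleftrightarrow> dim_row A = dim_col A \<and>
     (\<forall>v. dim_vec v = dim_row A \<longrightarrow> Im (qform A v) = 0 \<and> Re (qform A v) \<ge> 0)"

text \<open>Positive semidefinite square root (unique for psd matrices).\<close>
definition msqrt :: "complex mat \<Rightarrow> complex mat" where
  "msqrt A = (THE S. S \<in> carrier_mat (dim_row A) (dim_row A) \<and> psd S \<and> S * S = A)"

definition fidelity :: "complex mat \<Rightarrow> complex mat \<Rightarrow> real" where
  "fidelity \<rho> \<sigma> = Re (mtrace (msqrt (msqrt \<sigma> * \<rho> * msqrt \<sigma>)))"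

definition purified_dist :: "complex mat \<Rightarrow> complex mat \<Rightarrow> real" where
  "purified_dist \<rho> \<sigma> = sqrt (1 - (fidelity \<rho> \<sigma>)\<^sup>2)"

definition proj :: "complex vec \<Rightarrow> complex mat" where
  "proj v = mat (dim_vec v) (dim_vec v) (\<lambda>(i,j). v $ i * cnj (v $ j))"

definition unit_norm :: "complex vec \<Rightarrow> bool" where
  "unit_norm v \<longleftrightarrow> (\<Sum>i<dim_vec v. (cmod (v $ i))\<^sup>2) = 1"

fun digits :: "nat list \<Rightarrow> nat \<Rightarrow> nat list" where
  "digits [] i = []"
| "digits (a # ds) i = (i div prod_list ds) # digits ds (i mod prod_list ds)"

fun enc :: "nat list \<Rightarrow> nat list \<Rightarrow> nat" where
  "enc (a # ds) (x # xs) = x * prod_list ds + enc ds xs"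
| "enc _ _ = 0"

definition valid_dims :: "nat \<Rightarrow> nat list \<Rightarrow> bool" where
  "valid_dims k d \<longleftrightarrow> length d = k \<and> (\<forall>x\<in>set d. 0 < x)"

definition kstate :: "nat \<Rightarrow> kop \<Rightarrow> bool" where
  "kstate k s \<longleftrightarrow> valid_dims k (fst s) \<and>
     snd s \<in> carrier_mat (prod_list (fst s)) (prod_list (fst s)) \<and> psd (snd s) \<and> mtrace (snd s) = 1"

definition kpure :: "nat \<Rightarrow> kop \<Rightarrow> bool" where
  "kpure k s \<longleftrightarrow> valid_dims k (fst s) \<and>
     (\<exists>v. dim_vec v = prod_list (fst s) \<and> unit_norm v \<and> snd s = proj v)"

text \<open>k-partite tensor product: (H_1 x K_1) x ... x (H_k x K_k).\<close>
definition ktensor :: "kop \<Rightarrow> kop \<Rightarrow> kop" where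
  "ktensor s t = (let d = fst s; e = fst t; de = map2 (*) d e; n = prod_list de in
     (de, mat n n (\<lambda>(r,c). let rd = digits de r; cd = digits de c in
        snd s $$ (enc d (map2 (div) rd e), enc d (map2 (div) cd e)) *
        snd t $$ (enc e (map2 (mod) rd e), enc e (map2 (mod) cd e)))))"

definition trivial_kop :: "nat \<Rightarrow> kop" where
  "trivial_kop k = (replicate k 1, 1\<^sub>m 1)"

fun kpow :: "nat \<Rightarrow> kop \<Rightarrow> nat \<Rightarrow> kop" where
  "kpow k s 0 = trivial_kop k"
| "kpow k s (Suc n) = ktensor (kpow k s n) s"

definition ghz_vec :: "nat \<Rightarrow> nat \<Rightarrow> complex vec" where
  "ghz_vec k r = vec (r ^ k) (\<lambda>i. if (\<forall>x\<in>set (digits (replicate k r) i). x = hd (digits (replicate k r) i))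
                                   then complex_of_real (1 / sqrt (real r)) else 0)"

definition GHZ :: "nat \<Rightarrow> nat \<Rightarrow> kop" where
  "GHZ k r = (replicate k r, proj (ghz_vec k r))"

definition local_op :: "nat list \<Rightarrow> nat \<Rightarrow> nat \<Rightarrow> complex mat \<Rightarrow> complex mat" where
  "local_op d j e L = (let d' = d[j := e] in
     mat (prod_list d') (prod_list d) (\<lambda>(r,c). let rd = digits d' r; cd = digits d c in
       if (\<forall>i<length d. i \<noteq> j \<longrightarrow> rd ! i = cd ! i) then L $$ (rd ! j, cd ! j) else 0))"

text \<open>locc d d' Ks: Ks is the list of (fine-grained) Kraus operators, one per classical
  branch (complete record of all broadcast outcomes), of a finite-round LOCC protocol
  from the k-partite system with local dims d to the one with local dims d'.
  In each round some party j performs a local instrument (Kraus operators L_x,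
  possibly changing its local dimension to e_x), broadcasts x, and the
  remaining protocol may depend on x.\<close>
inductive locc :: "nat list \<Rightarrow> nat list \<Rightarrow> complex mat list \<Rightarrow> bool" where
  stop: "(\<forall>x\<in>set d. 0 < x) \<Longrightarrow> locc d d [1\<^sub>m (prod_list d)]"
| round: "\<lbrakk> j < length d; (\<forall>x\<in>set d. 0 < x);
           \<forall>(e, L)\<in>set Ls. 0 < e \<and> L \<in> carrier_mat e (d ! j);
           msum (d ! j) (d ! j) (map (\<lambda>(e, L). adj L * L) Ls) = 1\<^sub>m (d ! j);
           length Ps = length Ls;
           \<forall>i<length Ls. locc (d[j := fst (Ls ! i)]) d' (Ps ! i) \<rbrakk>
         \<Longrightarrow> locc d d' (concat (map2 (\<lambda>(e, L) P. map (\<lambda>K. K * local_op d j e L) P) Ls Ps))"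

definition apply_kraus :: "nat \<Rightarrow> complex mat list \<Rightarrow> complex mat \<Rightarrow> complex mat" where
  "apply_kraus n Ks \<rho> = msum n n (map (\<lambda>K. K * \<rho> * adj K) Ks)"

definition locc_trans :: "kop \<Rightarrow> real \<Rightarrow> kop \<Rightarrow> bool" where
  "locc_trans \<rho> \<epsilon> \<sigma> \<longleftrightarrow> (\<exists>Ks. locc (fst \<rho>) (fst \<sigma>) Ks \<and>
      purified_dist (apply_kraus (prod_list (fst \<sigma>)) Ks (snd \<rho>)) (snd \<sigma>) \<le> \<epsilon>)"

definition achievable :: "nat \<Rightarrow> kop \<Rightarrow> kop \<Rightarrow> real \<Rightarrow> bool" where
  "achievable k \<rho> \<sigma> r \<longleftrightarrow> r \<ge> 0 \<and> (\<forall>\<delta>>0.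
     limsup (\<lambda>n. Inf (ereal ` {\<epsilon>. \<epsilon> \<ge> 0 \<and>
        locc_trans (ktensor (kpow k \<rho> n) (kpow k (GHZ k 2) (nat \<lfloor>\<delta> * real n\<rfloor>)))
                   \<epsilon> (kpow k \<sigma> (nat \<lceil>r * real n\<rceil>))})) = 0)"

definition R_LOCCq :: "nat \<Rightarrow> kop \<Rightarrow> kop \<Rightarrow> ereal" where
  "R_LOCCq k \<rho> \<sigma> = Sup (ereal ` {r. achievable k \<rho> \<sigma> r})"

definition fully_additive :: "nat \<Rightarrow> (kop \<Rightarrow> real) \<Rightarrow> bool" where
  "fully_additive k E \<longleftrightarrow> (\<forall>s t. kpure k s \<and> kpure k t \<longrightarrow> E (ktensor s t) = E s + E t)"

definition monotone_on_average :: "nat \<Rightarrow> (kop \<Rightarrow> real) \<Rightarrow> bool" where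
  "monotone_on_average k E \<longleftrightarrow>
    (\<forall>d \<phi> d' Ks (m::nat) f P \<phi>s.
       kpure k (d, proj \<phi>) \<and> dim_vec \<phi> = prod_list d \<and> locc d d' Ks \<and>
       (\<forall>b<length Ks. f b < m) \<and> (\<forall>x<m. P x \<ge> 0) \<and> (\<Sum>x<m. P x) = 1 \<and>
       (\<forall>x<m. kpure k (d', proj (\<phi>s x)) \<and> dim_vec (\<phi>s x) = prod_list d' \<and>
          msum (prod_list d') (prod_list d')
             (map (\<lambda>b. Ks ! b * proj \<phi> * adj (Ks ! b)) (filter (\<lambda>b. f b = x) [0..<length Ks]))
          = complex_of_real (P x) \<cdot>\<^sub>m proj (\<phi>s x))
       \<longrightarrow> E (d, proj \<phi>) \<ge> (\<Sum>x<m. P x * E (d', proj (\<phi>s x))))"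

definition kdist :: "kop \<Rightarrow> kop \<Rightarrow> real" where
  "kdist s t = (if fst s = fst t then purified_dist (snd s) (snd t) else 1)"

definition asymptotically_continuous :: "nat \<Rightarrow> (kop \<Rightarrow> real) \<Rightarrow> bool" where
  "asymptotically_continuous k E \<longleftrightarrow>
    (\<forall>\<epsilon>>0. \<exists>\<delta>>0. \<forall>s t. kpure k s \<and> kpure k t \<and> kdist s t < \<delta> \<longrightarrow>
        \<bar>E s / (1 + log 2 (real (prod_list (fst s)))) - E t / (1 + log 2 (real (prod_list (fst t))))\<bar> < \<epsilon>)"

definition admissible :: "nat \<Rightarrow> (kop \<Rightarrow> real) \<Rightarrow> bool" where
  "admissible k E \<longleftrightarrow> E (GHZ k 2) = 1 \<and> fully_additive k E \<and>
     monotone_on_average k E \<and> asymptotically_continuous k E"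

end

theory Submission
  imports Defs "HOL-Library.Multiset" "HOL-Real_Asymp.Real_Asymp"
begin

text \<open>Multisets of pure states are ordered by \<open>M \<ge> N\<close> if \<open>n\<close> copies of \<open>M\<close> and \<open>o(n)\<close> GHZ states
  are asymptotically convertible to \<open>n\<close> copies of \<open>N\<close>. This preorder is additive, satisfies cancellation
  and is closed under limits, and every state is bounded by a multiple of GHZ, which is itself not
  degenerate because of the Schmidt rank. If \<open>A \<ge> B\<close> fails, then Zorn's lemma gives a total additive
  preorder that extends \<open>\<ge>\<close> and puts \<open>A\<close> strictly below \<open>B\<close>; comparing with multiples of GHZ it becomes an additive monotone
  \<open>E\<close> with \<open>E A < E B\<close>. Hence the rate is the infimum of \<open>E \<phi> / E \<psi>\<close> over all additive monotones of \<open>\<ge>\<close>.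

  Such an \<open>E\<close> is monotone on average: by the weak law of large numbers, many copies of an ensemble contain every member with its
  expected frequency. It is asymptotically continuous: measuring the flag of
  \<open>a |0\<dots>0\<rangle> \<phi> + b |1\<dots>1\<rangle> \<xi>\<close> in the Hadamard basis shows that the flagged superposition is worth at least
  the average of \<open>E (a \<phi> + b \<xi>)\<close> and \<open>E (a \<phi> - b \<xi>)\<close>, while typical sequences of flags show that for small
  \<open>b\<close> it is worth hardly more than \<open>\<phi>\<close>; this approximate midpoint concavity along great circles, together with
  \<open>0 \<le> E \<le> log dim\<close>, forces continuity. Conversely, the conditions (i)-(iv) bound the rate by the usual
  averaging argument over the branches of a protocol.\<close>

section \<open>Separating functionals of resource theories\<close>

lemma replicate_mset_add: "replicate_mset (m + n) x = replicate_mset m x + replicate_mset n x"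
  by (auto intro: multiset_eqI)

lemma repeat_replicate_mset [simp]: "repeat_mset n (replicate_mset m x) = replicate_mset (n * m) x"
  by (auto intro: multiset_eqI)

lemma repeat_mset_subset: "m \<le> n \<Longrightarrow> repeat_mset m M \<subseteq># repeat_mset n M"
  by (simp add: subseteq_mset_def)

lemma replicate_mset_subset: "m \<le> n \<Longrightarrow> replicate_mset m x \<subseteq># replicate_mset n x"
  by (simp add: subseteq_mset_def)

lemma nat_floor_le_iff: "0 \<le> (x::real) \<Longrightarrow> m \<le> nat \<lfloor>x\<rfloor> \<longleftrightarrow> real m \<le> x"
  by (simp add: le_nat_iff le_floor_iff)

lemma nat_floor_half_add_half_le:
  assumes "0 \<le> (\<delta>::real)"
  shows "nat \<lfloor>\<delta> / 2 * real n\<rfloor> + nat \<lfloor>\<delta> / 2 * real n\<rfloor> \<le> nat \<lfloor>\<delta> * real n\<rfloor>"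
proof -
  have "real (nat \<lfloor>\<delta> / 2 * real n\<rfloor>) \<le> \<delta> / 2 * real n" using assms by (intro of_nat_floor) simp
  then show ?thesis using assms by (subst nat_floor_le_iff) auto
qed

lemma eventually_add_le_nat_floor:
  assumes "0 < (\<delta>::real)" and half: "\<And>n. real (f n) \<le> \<delta> / 2 * real n"
  shows "\<forall>\<^sub>F n in sequentially. f n + b \<le> nat \<lfloor>\<delta> * real n\<rfloor>"
proof -
  obtain n\<^sub>0 :: nat where n\<^sub>0: "2 * real b / \<delta> \<le> real n\<^sub>0" using real_arch_simple by blast
  have "f n + b \<le> nat \<lfloor>\<delta> * real n\<rfloor>" if "n \<ge> n\<^sub>0" for n
  proof -
    have "2 * real b / \<delta> \<le> real n" using n\<^sub>0 that by linarith
    then have "real b \<le> \<delta> / 2 * real n" using assms(1) by (simp add: field_simps)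
    then have "real (f n + b) \<le> \<delta> * real n" using half[of n] by simp
    then show ?thesis using assms(1) by (subst nat_floor_le_iff) auto
  qed
  then show ?thesis by (rule eventually_sequentiallyI)
qed

lemma filterlim_div_at_top:
  assumes "0 < (c::nat)"
  shows "filterlim (\<lambda>n. n div c) at_top sequentially"
  unfolding filterlim_at_top
proof
  fix m
  show "\<forall>\<^sub>F n in sequentially. m \<le> n div c"
    using assms by (intro eventually_sequentiallyI[of "m * c"]) (simp add: less_eq_div_iff_mult_less_eq)
qed

locale resource_theory =
  fixes S :: "'a set" and convertible :: "'a multiset \<Rightarrow> 'a multiset \<Rightarrow> real \<Rightarrow> bool" and g :: 'a
  assumes g_in: "g \<in> S"
    and convertible_antimono: "convertible M N p \<Longrightarrow> q \<le> p \<Longrightarrow> convertible M N q"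
    and convertible_trans: "\<lbrakk>set_mset M \<subseteq> S; set_mset N \<subseteq> S; set_mset K \<subseteq> S; convertible M N p; convertible N K p';
      0 \<le> p'; 0 < \<eta>; \<eta> < 1\<rbrakk> \<Longrightarrow> convertible M K ((1 - \<eta>) * p * p' - (1 - p) / \<eta>)"
    and convertible_add: "\<lbrakk>set_mset M \<subseteq> S; set_mset N \<subseteq> S; set_mset K \<subseteq> S; convertible M N p\<rbrakk>
      \<Longrightarrow> convertible (M + K) (N + K) p"
    and convertible_discard: "\<lbrakk>set_mset M \<subseteq> S; set_mset N \<subseteq> S\<rbrakk> \<Longrightarrow> convertible (M + N) M 1"
    and convertible_from_g: "s \<in> S \<Longrightarrow> \<exists>n. convertible (replicate_mset n g) {#s#} 1"
    and convertible_replicate_g_bound: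
      "convertible (replicate_mset i g) (replicate_mset j g) p \<Longrightarrow> p * 2 ^ j \<le> 2 ^ i"
begin

definition resources :: "'a multiset set" where "resources = {M. set_mset M \<subseteq> S}"

lemma resources_iff: "M \<in> resources \<longleftrightarrow> set_mset M \<subseteq> S" by (simp add: resources_def)

lemma resources_add [simp]: "M + N \<in> resources \<longleftrightarrow> M \<in> resources \<and> N \<in> resources"
  by (auto simp: resources_def)

lemma resources_add_mset [simp]: "add_mset x M \<in> resources \<longleftrightarrow> x \<in> S \<and> M \<in> resources"
  by (auto simp: resources_def)

lemma resources_empty [simp]: "{#} \<in> resources" by (simp add: resources_def)

lemma resources_repeat [simp]: "M \<in> resources \<Longrightarrow> repeat_mset n M \<in> resources"
  by (induction n) auto

lemma resources_g [simp]: "replicate_mset n g \<in> resources" using g_in by (auto simp: resources_def)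

lemma resources_subset: "M \<in> resources \<Longrightarrow> N \<subseteq># M \<Longrightarrow> N \<in> resources"
  using set_mset_mono by (auto simp: resources_def)

lemma convertible_subset: "M \<in> resources \<Longrightarrow> N \<subseteq># M \<Longrightarrow> convertible M N 1"
  using convertible_discard[of N "M - N"] resources_subset[of M N] resources_subset[of M "M - N"]
  by (auto simp: resources_iff)

definition asymp_convertible :: "(nat \<Rightarrow> 'a multiset) \<Rightarrow> (nat \<Rightarrow> 'a multiset) \<Rightarrow> bool" where
  "asymp_convertible A B \<longleftrightarrow> (\<forall>n. A n \<in> resources \<and> B n \<in> resources) \<and>
     (\<forall>\<epsilon>>0. \<forall>\<^sub>F n in sequentially. convertible (A n) (B n) (1 - \<epsilon>))"

lemma asymp_convertibleI:
  assumes "\<And>n. A n \<in> resources" "\<And>n. B n \<in> resources" "\<And>n. convertible (A n) (B n) (p n)"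
    and "\<And>\<epsilon>. 0 < \<epsilon> \<Longrightarrow> \<forall>\<^sub>F n in sequentially. 1 - \<epsilon> \<le> p n"
  shows "asymp_convertible A B"
  unfolding asymp_convertible_def using assms(1,2)
  by (auto intro: eventually_mono[OF assms(4)] convertible_antimono[OF assms(3)])

lemma composed_error_bound:
  fixes \<epsilon> :: real
  assumes "0 < \<epsilon>"
  shows "\<exists>\<eta> \<theta>. 0 < \<eta> \<and> \<eta> < 1 \<and> 0 < \<theta> \<and> \<theta> < 1 \<and>
    1 - \<epsilon> \<le> (1 - \<eta>) * (1 - \<theta>) * (1 - \<theta>) - (1 - (1 - \<theta>)) / \<eta>"
proof -
  define \<eta> where "\<eta> = min (\<epsilon> / 3) (1/3)"
  define \<theta> where "\<theta> = \<eta>\<^sup>2 / 3"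
  have \<eta>: "0 < \<eta>" "\<eta> \<le> 1/3" "2 * \<eta> \<le> \<epsilon>" using assms by (auto simp: \<eta>_def)
  then have \<theta>: "0 < \<theta>" "\<theta> \<le> \<eta> / 9" "\<theta> / \<eta> = \<eta> / 3" by (auto simp: \<theta>_def power2_eq_square)
  have "(1 - \<eta>) * (1 - 2 * \<theta>) \<le> (1 - \<eta>) * ((1 - \<theta>) * (1 - \<theta>))"
    using \<eta> by (intro mult_left_mono) (auto simp: algebra_simps)
  moreover have "1 - \<eta> - 2 * \<theta> \<le> (1 - \<eta>) * (1 - 2 * \<theta>)" using \<eta> \<theta> by (simp add: algebra_simps)
  moreover have "(1 - (1 - \<theta>)) / \<eta> = \<eta> / 3" using \<theta>(3) by simp
  ultimately have "1 - \<epsilon> \<le> (1 - \<eta>) * (1 - \<theta>) * (1 - \<theta>) - (1 - (1 - \<theta>)) / \<eta>"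
    unfolding mult.assoc using \<eta> \<theta>(2) by linarith
  then show ?thesis using \<eta> \<theta> by (intro exI[of _ \<eta>] exI[of _ \<theta>]) auto
qed

lemma asymp_convertible_trans [trans]:
  assumes "asymp_convertible A B" "asymp_convertible B C"
  shows "asymp_convertible A C"
  unfolding asymp_convertible_def
proof (intro conjI allI impI)
  fix n show "A n \<in> resources" "C n \<in> resources" using assms by (auto simp: asymp_convertible_def)
next
  fix \<epsilon> :: real assume "\<epsilon> > 0"
  then obtain \<eta> \<theta> where \<eta>: "0 < \<eta>" "\<eta> < 1" and \<theta>: "0 < \<theta>" "\<theta> < 1"
    and error: "1 - \<epsilon> \<le> (1 - \<eta>) * (1 - \<theta>) * (1 - \<theta>) - (1 - (1 - \<theta>)) / \<eta>"
    using composed_error_bound by blast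
  have "\<forall>\<^sub>F n in sequentially. convertible (A n) (B n) (1 - \<theta>)"
    "\<forall>\<^sub>F n in sequentially. convertible (B n) (C n) (1 - \<theta>)"
    using assms \<theta> by (auto simp: asymp_convertible_def)
  then show "\<forall>\<^sub>F n in sequentially. convertible (A n) (C n) (1 - \<epsilon>)"
  proof eventually_elim
    case (elim n)
    have "convertible (A n) (C n) ((1 - \<eta>) * (1 - \<theta>) * (1 - \<theta>) - (1 - (1 - \<theta>)) / \<eta>)"
      using assms \<eta> \<theta> elim by (intro convertible_trans[where N = "B n"])
        (auto simp: asymp_convertible_def resources_iff)
    then show ?case using error convertible_antimono by blast
  qed
qed

lemma asymp_convertible_add_right:
  assumes "asymp_convertible A B" "\<And>n. K n \<in> resources"
  shows "asymp_convertible (\<lambda>n. A n + K n) (\<lambda>n. B n + K n)"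
  unfolding asymp_convertible_def
proof (intro conjI allI impI)
  fix n show "A n + K n \<in> resources" "B n + K n \<in> resources" using assms by (auto simp: asymp_convertible_def)
next
  fix \<epsilon> :: real assume "\<epsilon> > 0"
  then have "\<forall>\<^sub>F n in sequentially. convertible (A n) (B n) (1 - \<epsilon>)"
    using assms by (auto simp: asymp_convertible_def)
  then show "\<forall>\<^sub>F n in sequentially. convertible (A n + K n) (B n + K n) (1 - \<epsilon>)"
    by eventually_elim (rule convertible_add; use assms in \<open>auto simp: asymp_convertible_def resources_iff\<close>)
qed

lemma asymp_convertible_add:
  assumes "asymp_convertible A B" "asymp_convertible A' B'"
  shows "asymp_convertible (\<lambda>n. A n + A' n) (\<lambda>n. B n + B' n)"
proof -
  have "asymp_convertible (\<lambda>n. A n + A' n) (\<lambda>n. B n + A' n)"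
    using assms by (intro asymp_convertible_add_right) (auto simp: asymp_convertible_def)
  also have "asymp_convertible (\<lambda>n. B n + A' n) (\<lambda>n. B n + B' n)"
    using asymp_convertible_add_right[OF assms(2), of B] assms by (simp add: add.commute asymp_convertible_def)
  finally show ?thesis .
qed

lemma asymp_convertible_subset:
  assumes "\<And>n. A n \<in> resources" "\<And>n. B n \<in> resources" "\<forall>\<^sub>F n in sequentially. B n \<subseteq># A n"
  shows "asymp_convertible A B"
  unfolding asymp_convertible_def
proof (intro conjI allI impI)
  fix \<epsilon> :: real assume "\<epsilon> > 0"
  show "\<forall>\<^sub>F n in sequentially. convertible (A n) (B n) (1 - \<epsilon>)"
    using assms(3)
  proof eventually_elim
    case (elim n)
    show ?case by (rule convertible_antimono[OF convertible_subset[OF assms(1) elim]]) (use \<open>\<epsilon> > 0\<close> in auto)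
  qed
qed (use assms in auto)

lemma asymp_convertible_const_iff:
  "asymp_convertible (\<lambda>_. M) (\<lambda>_. N) \<longleftrightarrow>
     M \<in> resources \<and> N \<in> resources \<and> (\<forall>q<1. convertible M N q)"
proof -
  have "(\<forall>\<epsilon>>0. convertible M N (1 - \<epsilon>)) \<longleftrightarrow> (\<forall>q<1. convertible M N q)"
    by (auto dest: spec[of _ "1 - q" for q])
  then show ?thesis by (simp add: asymp_convertible_def)
qed

lemma asymp_convertible_subseq:
  assumes "asymp_convertible A B" "filterlim f at_top sequentially"
  shows "asymp_convertible (\<lambda>n. A (f n)) (\<lambda>n. B (f n))"
  using assms eventually_compose_filterlim[OF _ assms(2)] by (auto simp: asymp_convertible_def)

lemma asymp_convertible_const_repeat_mset:
  assumes "asymp_convertible (\<lambda>_. M) (\<lambda>_. N)"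
  shows "asymp_convertible (\<lambda>_. repeat_mset n M) (\<lambda>_. repeat_mset n N)"
proof (induction n)
  case 0 show ?case by (intro asymp_convertible_subset) auto
next
  case (Suc n) show ?case using asymp_convertible_add[OF assms Suc] by simp
qed

lemma asymp_convertible_from_g:
  assumes "M \<in> resources"
  shows "\<exists>b. asymp_convertible (\<lambda>_. replicate_mset b g) (\<lambda>_. M)"
  using assms
proof (induction M)
  case empty
  show ?case by (rule exI[of _ 0]) (auto intro!: asymp_convertible_subset)
next
  case (add x M)
  then obtain b where M: "asymp_convertible (\<lambda>_. replicate_mset b g) (\<lambda>_. M)" by auto
  obtain c where "convertible (replicate_mset c g) {#x#} 1" using convertible_from_g add.prems by auto
  then have "asymp_convertible (\<lambda>_. replicate_mset c g) (\<lambda>_. {#x#})"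
    using add.prems convertible_antimono by (auto simp: asymp_convertible_const_iff)
  from asymp_convertible_add[OF this M] show ?case
    by (intro exI[of _ "c + b"]) (simp add: replicate_mset_add)
qed

text \<open>The last, incomplete block of \<open>n mod c\<close> copies is bought with finitely many further copies of \<open>g\<close>.\<close>

lemma asymp_convertible_blocks:
  assumes blocks: "asymp_convertible (\<lambda>l. repeat_mset l A + replicate_mset (h l) g) (\<lambda>l. repeat_mset l B)"
    and resources: "\<And>n. M n \<in> resources" "\<And>n. N n \<in> resources" "A \<in> resources" "B \<in> resources"
    and c: "0 < c" and \<delta>: "0 < \<delta>" and assistance: "\<And>l. real (h l) \<le> \<delta> / 2 * (real c * real l)"
    and M: "\<And>n. repeat_mset (n div c) A \<subseteq># M n" and N: "\<And>n. N n \<subseteq># repeat_mset (n div c) B + B"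
  shows "asymp_convertible (\<lambda>n. M n + replicate_mset (nat \<lfloor>\<delta> * real n\<rfloor>) g) N"
proof -
  obtain b where b: "asymp_convertible (\<lambda>_. replicate_mset b g) (\<lambda>_. B)"
    using asymp_convertible_from_g resources by blast
  have "real (h (n div c)) \<le> \<delta> / 2 * real n" for n
  proof -
    have "c * (n div c) \<le> n" by simp
    then have "real c * real (n div c) \<le> real n" by (metis of_nat_le_iff of_nat_mult)
    then show ?thesis using assistance[of "n div c"] \<delta>
      by (meson divide_pos_pos mult_left_mono order_trans less_imp_le zero_less_numeral)
  qed
  then have "\<forall>\<^sub>F n in sequentially. h (n div c) + b \<le> nat \<lfloor>\<delta> * real n\<rfloor>"
    by (rule eventually_add_le_nat_floor[OF \<delta>])
  then have "asymp_convertible (\<lambda>n. M n + replicate_mset (nat \<lfloor>\<delta> * real n\<rfloor>) g)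
     (\<lambda>n. (repeat_mset (n div c) A + replicate_mset (h (n div c)) g) + replicate_mset b g)"
  proof (intro asymp_convertible_subset, goal_cases)
    case 3
    then show ?case
      by eventually_elim (auto simp: add.assoc M simp flip: replicate_mset_add
          intro!: subset_mset.add_mono replicate_mset_subset)
  qed (use resources in auto)
  also have "asymp_convertible \<dots> (\<lambda>n. repeat_mset (n div c) B + B)"
    using asymp_convertible_add[OF asymp_convertible_subseq[OF blocks filterlim_div_at_top[OF c]] b] .
  also have "asymp_convertible \<dots> N"
    using N resources by (intro asymp_convertible_subset always_eventually allI) auto
  finally show ?thesis .
qed

definition assisted :: "real \<Rightarrow> 'a multiset \<Rightarrow> nat \<Rightarrow> 'a multiset" where
  "assisted \<delta> M n = repeat_mset n M + replicate_mset (nat \<lfloor>\<delta> * real n\<rfloor>) g"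

definition dominates :: "'a multiset \<Rightarrow> 'a multiset \<Rightarrow> bool" where
  "dominates M N \<longleftrightarrow> M \<in> resources \<and> N \<in> resources \<and>
     (\<forall>\<delta>>0. asymp_convertible (assisted \<delta> M) (\<lambda>n. repeat_mset n N))"

lemma resources_assisted [simp]: "M \<in> resources \<Longrightarrow> assisted \<delta> M n \<in> resources"
  by (simp add: assisted_def)

lemma dominatesI:
  assumes "M \<in> resources" "N \<in> resources" "asymp_convertible (\<lambda>n. repeat_mset n M) (\<lambda>n. repeat_mset n N)"
  shows "dominates M N"
  unfolding dominates_def
proof (intro conjI allI impI assms(1,2))
  fix \<delta> :: real
  have "asymp_convertible (assisted \<delta> M) (\<lambda>n. repeat_mset n M)"
    using assms by (intro asymp_convertible_subset) (auto simp: assisted_def)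
  also note assms(3)
  finally show "asymp_convertible (assisted \<delta> M) (\<lambda>n. repeat_mset n N)" .
qed

lemma dominates_subset: "M \<in> resources \<Longrightarrow> N \<subseteq># M \<Longrightarrow> dominates M N"
  by (intro dominatesI asymp_convertible_subset resources_repeat)
    (auto intro: resources_subset simp: subseteq_mset_def)

lemma dominates_of_convertible:
  assumes "asymp_convertible (\<lambda>_. M) (\<lambda>_. N)"
  shows "dominates M N"
proof (rule dominatesI)
  show "asymp_convertible (\<lambda>n. repeat_mset n M) (\<lambda>n. repeat_mset n N)"
    using asymp_convertible_const_repeat_mset[OF assms]
    by (auto simp: asymp_convertible_const_iff asymp_convertible_def intro!: always_eventually)
qed (use assms in \<open>auto simp: asymp_convertible_const_iff\<close>)

lemma dominates_trans:
  assumes "dominates M N" "dominates N K"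
  shows "dominates M K"
  unfolding dominates_def
proof (intro conjI allI impI)
  fix \<delta> :: real assume \<delta>: "\<delta> > 0"
  let ?h = "\<lambda>n. replicate_mset (nat \<lfloor>\<delta> / 2 * real n\<rfloor>) g"
  have "asymp_convertible (assisted \<delta> M) (\<lambda>n. assisted (\<delta> / 2) M n + ?h n)"
    using assms \<delta> nat_floor_half_add_half_le[of \<delta>] unfolding assisted_def dominates_def
    by (intro asymp_convertible_subset)
      (auto simp: add.assoc simp flip: replicate_mset_add intro!: always_eventually replicate_mset_subset)
  also have "asymp_convertible \<dots> (assisted (\<delta> / 2) N)"
    unfolding assisted_def[of _ N]
    using assms(1) \<delta> by (intro asymp_convertible_add_right) (auto simp: dominates_def)
  also have "asymp_convertible \<dots> (\<lambda>n. repeat_mset n K)" using assms(2) \<delta> by (auto simp: dominates_def)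
  finally show "asymp_convertible (assisted \<delta> M) (\<lambda>n. repeat_mset n K)" .
qed (use assms in \<open>auto simp: dominates_def\<close>)

lemma dominates_add_right:
  assumes "dominates M N" "K \<in> resources"
  shows "dominates (M + K) (N + K)"
  unfolding dominates_def
proof (intro conjI allI impI)
  fix \<delta> :: real assume "\<delta> > 0"
  then have "asymp_convertible (assisted \<delta> M) (\<lambda>n. repeat_mset n N)" using assms by (auto simp: dominates_def)
  from asymp_convertible_add_right[OF this, of "\<lambda>n. repeat_mset n K"] assms(2)
  show "asymp_convertible (assisted \<delta> (M + K)) (\<lambda>n. repeat_mset n (N + K))"
    by (simp add: ac_simps assisted_def[abs_def])
qed (use assms in \<open>auto simp: dominates_def\<close>)

lemma dominates_from_g: "M \<in> resources \<Longrightarrow> \<exists>b. dominates (replicate_mset b g) M"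
  using asymp_convertible_from_g dominates_of_convertible by blast

lemma dominates_limit:
  assumes MN: "M \<in> resources" "N \<in> resources"
    and lim: "\<And>c0::nat. \<exists>c\<ge>c0. dominates (repeat_mset c M + replicate_mset b g) (repeat_mset c N)"
  shows "dominates M N"
  unfolding dominates_def
proof (intro conjI allI impI MN)
  fix \<delta> :: real assume \<delta>: "\<delta> > 0"
  obtain c0 :: nat where c0: "2 * (real b + 1) / \<delta> + 1 \<le> real c0" using real_arch_simple by blast
  obtain c where "c \<ge> c0" and dom: "dominates (repeat_mset c M + replicate_mset b g) (repeat_mset c N)"
    using lim by blast
  then have large: "2 * (real b + 1) / \<delta> + 1 \<le> real c" using c0 by linarith
  moreover have "0 < 2 * (real b + 1) / \<delta>" using \<delta> by simp
  ultimately have c: "0 < c" "2 * (real b + 1) / \<delta> \<le> real c" by linarith+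
  have "repeat_mset n N \<subseteq># repeat_mset (n div c) (repeat_mset c N) + repeat_mset c N" for n
  proof -
    have "n \<le> n div c * c + c"
      using div_mult_mod_eq[of n c] mod_less_divisor[of c n] c by linarith
    then show ?thesis
      by (simp add: repeat_mset_subset flip: repeat_mset_distrib)
  qed
  moreover have "real (l * b + l) \<le> \<delta> / 2 * (real c * real l)" for l
  proof -
    have "real b + 1 \<le> \<delta> / 2 * real c" using c(2) \<delta> by (simp add: field_simps)
    then have "(real b + 1) * real l \<le> \<delta> / 2 * real c * real l" by (intro mult_right_mono) auto
    then show ?thesis by (simp add: algebra_simps)
  qed
  moreover have "asymp_convertible (assisted 1 (repeat_mset c M + replicate_mset b g))
      (\<lambda>l. repeat_mset l (repeat_mset c N))"
    using dom by (simp add: dominates_def)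
  then have "asymp_convertible (\<lambda>l. repeat_mset l (repeat_mset c M) + replicate_mset (l * b + l) g)
      (\<lambda>l. repeat_mset l (repeat_mset c N))"
    by (simp add: assisted_def[abs_def] ac_simps replicate_mset_add)
  ultimately show "asymp_convertible (assisted \<delta> M) (\<lambda>n. repeat_mset n N)"
    unfolding assisted_def[abs_def] using MN c(1) \<delta>
    by (intro asymp_convertible_blocks[where c = c and A = "repeat_mset c M" and B = "repeat_mset c N"])
      (auto intro!: repeat_mset_subset)
qed

lemma dominates_rate:
  assumes "s \<in> S" "t \<in> S" "0 < q" "0 < \<delta>" and dom: "dominates (replicate_mset q s) (replicate_mset p t)"
  shows "asymp_convertible (\<lambda>n. replicate_mset n s + replicate_mset (nat \<lfloor>\<delta> * real n\<rfloor>) g)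
     (\<lambda>n. replicate_mset (nat \<lceil>real p / real q * real n\<rceil>) t)"
proof (rule asymp_convertible_blocks)
  have "asymp_convertible (assisted (\<delta> / 2) (replicate_mset q s)) (\<lambda>l. repeat_mset l (replicate_mset p t))"
    using dom \<open>0 < \<delta>\<close> by (simp add: dominates_def)
  then show "asymp_convertible (\<lambda>l. repeat_mset l (replicate_mset q s)
      + replicate_mset (nat \<lfloor>\<delta> / 2 * real l\<rfloor>) g)
      (\<lambda>l. repeat_mset l (replicate_mset p t))"
    unfolding assisted_def[abs_def] .
  show "real (nat \<lfloor>\<delta> / 2 * real l\<rfloor>) \<le> \<delta> / 2 * (real q * real l)" for l
  proof -
    have "real (nat \<lfloor>\<delta> / 2 * real l\<rfloor>) \<le> \<delta> / 2 * real l" using \<open>0 < \<delta>\<close> by (intro of_nat_floor) simp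
    also have "\<dots> \<le> \<delta> / 2 * (real q * real l)"
      using \<open>0 < \<delta>\<close> \<open>0 < q\<close> by (intro mult_left_mono) (auto simp: mult_le_cancel_right1)
    finally show ?thesis .
  qed
  show "replicate_mset (nat \<lceil>real p / real q * real n\<rceil>) t
      \<subseteq># repeat_mset (n div q) (replicate_mset p t) + replicate_mset p t" for n
  proof -
    have "n < (n div q + 1) * q" using \<open>0 < q\<close> by (metis Suc_eq_plus1 add.commute div_less_iff_less_mult lessI)
    then have "real n \<le> (real (n div q) + 1) * real q"
      by (metis less_imp_le of_nat_1 of_nat_add of_nat_le_iff of_nat_mult)
    then have "real p * real n \<le> real p * ((real (n div q) + 1) * real q)" by (intro mult_left_mono) auto
    then have "real p / real q * real n \<le> real (n div q * p + p)" using \<open>0 < q\<close> by (simp add: field_simps)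
    then have "nat \<lceil>real p / real q * real n\<rceil> \<le> n div q * p + p"
      by (metis ceiling_le_iff nat_le_iff of_int_of_nat_eq)
    then show ?thesis by (simp add: replicate_mset_subset flip: replicate_mset_add)
  qed
qed (use assms in \<open>auto simp: resources_iff intro!: replicate_mset_subset\<close>)

lemma dominates_replicate_g_imp_le:
  assumes "dominates (replicate_mset i g) (replicate_mset j g)"
  shows "j \<le> i"
proof (rule ccontr)
  assume "\<not> j \<le> i"
  have "asymp_convertible (assisted (1/2) (replicate_mset i g)) (\<lambda>n. repeat_mset n (replicate_mset j g))"
    using assms by (simp add: dominates_def)
  then have "\<forall>\<^sub>F n in sequentially.
      convertible (assisted (1/2) (replicate_mset i g) n) (repeat_mset n (replicate_mset j g)) (1 - 1/4)"
    unfolding asymp_convertible_def by (elim conjE allE[of _ "1/4"]) simp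
  then obtain n where n: "n \<ge> 2"
    and "convertible (assisted (1/2) (replicate_mset i g) n) (repeat_mset n (replicate_mset j g)) (1 - 1/4)"
    unfolding eventually_sequentially by (meson max.cobounded1 max.cobounded2)
  then have bound: "3/4 * 2 ^ (n * j) \<le> (2::real) ^ (n * i + nat \<lfloor>1/2 * real n\<rfloor>)"
    using convertible_replicate_g_bound by (fastforce simp: assisted_def simp flip: replicate_mset_add)
  have "real (nat \<lfloor>1/2 * real n\<rfloor>) \<le> 1/2 * real n" by (intro of_nat_floor) simp
  then have "nat \<lfloor>1/2 * real n\<rfloor> + 1 \<le> n" using n by linarith
  moreover have "n * (i + 1) \<le> n * j" using \<open>\<not> j \<le> i\<close> by (intro mult_left_mono) auto
  ultimately have "(2::real) ^ (n * i + nat \<lfloor>1/2 * real n\<rfloor> + 1) \<le> 2 ^ (n * j)" by (intro power_increasing) auto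
  then have "2 * (2::real) ^ (n * i + nat \<lfloor>1/2 * real n\<rfloor>) \<le> 2 ^ (n * j)" by simp
  then have "(2::real) ^ (n * i + nat \<lfloor>1/2 * real n\<rfloor>) \<le> 0" using bound by linarith
  then show False by (metis not_le zero_less_numeral zero_less_power)
qed

definition compatible :: "('a multiset \<times> 'a multiset) set \<Rightarrow> bool" where
  "compatible R \<longleftrightarrow> R \<subseteq> resources \<times> resources \<and> (\<forall>M N. dominates M N \<longrightarrow> (M, N) \<in> R) \<and> trans R \<and>
     (\<forall>M N K. (M, N) \<in> R \<and> K \<in> resources \<longrightarrow> (M + K, N + K) \<in> R) \<and>
     (\<forall>i j. (replicate_mset i g, replicate_mset j g) \<in> R \<longrightarrow> j \<le> i)"

definition adjoin :: "('a multiset \<times> 'a multiset) set \<Rightarrow> 'a multiset \<Rightarrow> 'a multiset \<Rightarrow>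
    ('a multiset \<times> 'a multiset) set" where
  "adjoin R s t = {(a, b). a \<in> resources \<and> b \<in> resources
      \<and> (\<exists>n. (a + repeat_mset n t, b + repeat_mset n s) \<in> R)}"

lemma compatible_dominates: "compatible {(M, N). dominates M N}"
  unfolding compatible_def
proof (intro conjI allI impI; (elim conjE)?)
  show "{(M, N). dominates M N} \<subseteq> resources \<times> resources" by (auto simp: dominates_def)
  show "trans {(M, N). dominates M N}" by (auto intro!: transI dest: dominates_trans)
qed (auto intro: dominates_replicate_g_imp_le dominates_add_right)

lemma compatible_subset: "compatible R \<Longrightarrow> M \<in> resources \<Longrightarrow> N \<subseteq># M \<Longrightarrow> (M, N) \<in> R"
  by (simp add: compatible_def dominates_subset)

lemma compatible_trans: "compatible R \<Longrightarrow> (M, N) \<in> R \<Longrightarrow> (N, K) \<in> R \<Longrightarrow> (M, K) \<in> R"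
  by (auto simp: compatible_def dest: transD)

lemma compatible_add_right: "compatible R \<Longrightarrow> (M, N) \<in> R \<Longrightarrow> K \<in> resources \<Longrightarrow> (M + K, N + K) \<in> R"
  by (simp add: compatible_def)

lemma compatible_replicate_g_imp_le: "compatible R \<Longrightarrow> (replicate_mset i g, replicate_mset j g) \<in> R \<Longrightarrow> j \<le> i"
  by (simp add: compatible_def)

lemma compatible_in_resources: "compatible R \<Longrightarrow> (M, N) \<in> R \<Longrightarrow> M \<in> resources \<and> N \<in> resources"
  by (auto simp: compatible_def)

lemma compatible_add:
  assumes R: "compatible R" and "(M, N) \<in> R" "(M', N') \<in> R"
  shows "(M + M', N + N') \<in> R"
proof -
  have "(M + M', N + M') \<in> R" "(M' + N, N' + N) \<in> R"
    using assms compatible_in_resources[OF R] by (auto intro: compatible_add_right)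
  then show ?thesis by (metis compatible_trans[OF R] add.commute)
qed

lemma compatible_repeat_mset: "compatible R \<Longrightarrow> (M, N) \<in> R \<Longrightarrow> (repeat_mset n M, repeat_mset n N) \<in> R"
  by (induction n) (auto intro: compatible_add compatible_subset)

lemma compatible_from_g: "compatible R \<Longrightarrow> M \<in> resources \<Longrightarrow> \<exists>b. (replicate_mset b g, M) \<in> R"
  using dominates_from_g[of M] by (auto simp: compatible_def)

lemma compatible_catalysis_repeat_mset:
  assumes R: "compatible R" and MNX: "M \<in> resources" "N \<in> resources" "X \<in> resources"
    and step: "(M + X, N + X) \<in> R"
  shows "(repeat_mset n M + X, repeat_mset n N + X) \<in> R"
proof (induction n)
  case 0 show ?case using compatible_subset R MNX by simp
next
  case (Suc n)
  have "(repeat_mset n M + X + M, repeat_mset n N + X + M) \<in> R"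
    using Suc compatible_add_right R MNX by blast
  moreover have "(repeat_mset n N + X + M, repeat_mset n N + X + N) \<in> R"
    using compatible_add_right[OF R step, of "repeat_mset n N"] MNX
    by (simp add: add.assoc add.commute add.left_commute)
  ultimately have "(repeat_mset n M + X + M, repeat_mset n N + X + N) \<in> R" by (rule compatible_trans[OF R])
  then show ?case by (simp add: add.assoc add.commute add.left_commute)
qed

lemma dominates_cancel:
  assumes MNX: "M \<in> resources" "N \<in> resources" "X \<in> resources" and cat: "dominates (M + X) (N + X)"
  shows "dominates M N"
proof -
  obtain b where b: "dominates (replicate_mset b g) X" using dominates_from_g MNX by blast
  have "dominates (repeat_mset c M + replicate_mset b g) (repeat_mset c N)" for c
  proof -
    have "dominates (repeat_mset c M + replicate_mset b g) (repeat_mset c M + X)"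
      using dominates_add_right[OF b, of "repeat_mset c M"] MNX by (simp add: add.commute)
    moreover have "dominates (repeat_mset c M + X) (repeat_mset c N + X)"
      using compatible_catalysis_repeat_mset[OF compatible_dominates MNX, of c] cat by simp
    moreover have "dominates (repeat_mset c N + X) (repeat_mset c N)"
      using MNX by (intro dominates_subset) auto
    ultimately show ?thesis using dominates_trans by blast
  qed
  then show ?thesis using MNX by (intro dominates_limit[where b = b]) auto
qed

lemma dominates_of_repeat_mset:
  assumes "M \<in> resources" "N \<in> resources" "n > 0" "dominates (repeat_mset n M) (repeat_mset n N)"
  shows "dominates M N"
proof (rule dominates_limit[where b = 0])
  fix c0 :: nat
  have "dominates (repeat_mset (c0 * n) M + replicate_mset 0 g) (repeat_mset (c0 * n) N)"
    using compatible_repeat_mset[OF compatible_dominates, of "repeat_mset n M" "repeat_mset n N" c0] assms(4)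
    by simp
  moreover have "c0 * n \<ge> c0" using assms by simp
  ultimately show "\<exists>c\<ge>c0. dominates (repeat_mset c M + replicate_mset 0 g) (repeat_mset c N)" by blast
qed (use assms in auto)

lemma trans_adjoin:
  assumes R: "compatible R" and st: "s \<in> resources" "t \<in> resources"
  shows "trans (adjoin R s t)"
proof (rule transI)
  fix a b c assume ab: "(a, b) \<in> adjoin R s t" and bc: "(b, c) \<in> adjoin R s t"
  then obtain n m where n: "(a + repeat_mset n t, b + repeat_mset n s) \<in> R"
    and m: "(b + repeat_mset m t, c + repeat_mset m s) \<in> R" by (auto simp: adjoin_def)
  have "(a + repeat_mset n t + repeat_mset m t, b + repeat_mset n s + repeat_mset m t) \<in> R"
    using compatible_add_right[OF R n] st by simp
  moreover have "(b + repeat_mset n s + repeat_mset m t, c + repeat_mset m s + repeat_mset n s) \<in> R"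
    using compatible_add_right[OF R m, of "repeat_mset n s"] st
    by (simp add: add.assoc add.commute[of "repeat_mset n s"])
  ultimately have "(a + repeat_mset n t + repeat_mset m t, c + repeat_mset m s + repeat_mset n s) \<in> R"
    by (rule compatible_trans[OF R])
  then have "(a + repeat_mset (n + m) t, c + repeat_mset (n + m) s) \<in> R"
    by (simp add: repeat_mset_distrib add.assoc add.commute[of "repeat_mset m s"])
  then show "(a, c) \<in> adjoin R s t" using ab bc by (auto simp: adjoin_def)
qed

lemma adjoin_add_right:
  assumes "compatible R" "(M, N) \<in> adjoin R s t" "K \<in> resources"
  shows "(M + K, N + K) \<in> adjoin R s t"
proof -
  obtain n where "(M + repeat_mset n t, N + repeat_mset n s) \<in> R" and MN: "M \<in> resources" "N \<in> resources"
    using assms(2) by (auto simp: adjoin_def)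
  then have "(M + repeat_mset n t + K, N + repeat_mset n s + K) \<in> R"
    using assms by (auto intro: compatible_add_right)
  then show ?thesis using assms(3) MN by (auto simp: adjoin_def ac_simps intro!: exI[of _ n])
qed

lemma compatible_adjoin:
  assumes R: "compatible R" and st: "s \<in> resources" "t \<in> resources"
    and nondegenerate: "\<And>n i j. (replicate_mset i g + repeat_mset n t, replicate_mset j g + repeat_mset n s) \<in> R
        \<Longrightarrow> j \<le> i"
  shows "compatible (adjoin R s t)" "R \<subseteq> adjoin R s t" "(s, t) \<in> adjoin R s t"
proof -
  show subset: "R \<subseteq> adjoin R s t"
    using compatible_in_resources[OF R] by (auto simp: adjoin_def intro!: exI[of _ 0])
  have "(s + repeat_mset 1 t, t + repeat_mset 1 s) \<in> R"
    using compatible_subset[OF R, of "s + t"] st by (simp add: add.commute)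
  then show "(s, t) \<in> adjoin R s t" using st by (auto simp: adjoin_def simp del: repeat_mset_Suc)
  show "compatible (adjoin R s t)"
    unfolding compatible_def
  proof (intro conjI allI impI; (elim conjE)?)
    show "adjoin R s t \<subseteq> resources \<times> resources" by (auto simp: adjoin_def)
    show "(M, N) \<in> adjoin R s t" if "dominates M N" for M N using that subset R by (auto simp: compatible_def)
    show "trans (adjoin R s t)" by (rule trans_adjoin[OF R st])
    show "j \<le> i" if "(replicate_mset i g, replicate_mset j g) \<in> adjoin R s t" for i j
      using that nondegenerate by (auto simp: adjoin_def)
  qed (rule adjoin_add_right[OF R])
qed

lemma compatible_Union_chain:
  assumes "\<C> \<noteq> {}" and compatible: "\<And>R. R \<in> \<C> \<Longrightarrow> compatible R"
    and chain: "\<And>R R'. R \<in> \<C> \<Longrightarrow> R' \<in> \<C> \<Longrightarrow> R \<subseteq> R' \<or> R' \<subseteq> R"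
  shows "compatible (\<Union>\<C>)"
  unfolding compatible_def
proof (intro conjI allI impI; (elim conjE)?)
  show "\<Union>\<C> \<subseteq> resources \<times> resources" using compatible by (fastforce simp: compatible_def)
  show "(M, N) \<in> \<Union>\<C>" if "dominates M N" for M N
    using that compatible \<open>\<C> \<noteq> {}\<close> by (auto simp: compatible_def)
  show "trans (\<Union>\<C>)"
  proof (rule transI)
    fix a b c assume "(a, b) \<in> \<Union>\<C>" "(b, c) \<in> \<Union>\<C>"
    then obtain R where "R \<in> \<C>" "(a, b) \<in> R" "(b, c) \<in> R" using chain by blast
    then show "(a, c) \<in> \<Union>\<C>" using compatible compatible_trans by blast
  qed
  show "(M + K, N + K) \<in> \<Union>\<C>" if "(M, N) \<in> \<Union>\<C>" "K \<in> resources" for M N K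
    using that compatible by (fastforce simp: compatible_def)
  show "j \<le> i" if "(replicate_mset i g, replicate_mset j g) \<in> \<Union>\<C>" for i j
    using that compatible by (auto simp: compatible_def)
qed

lemma compatible_maximal_exists:
  assumes "compatible R0"
  shows "\<exists>R. compatible R \<and> R0 \<subseteq> R \<and> (\<forall>R'. compatible R' \<and> R \<subseteq> R' \<longrightarrow> R' = R)"
proof -
  let ?A = "{R. compatible R \<and> R0 \<subseteq> R}"
  have "\<exists>M\<in>?A. \<forall>X\<in>?A. M \<subseteq> X \<longrightarrow> X = M"
  proof (rule subset_Zorn_nonempty)
    show "?A \<noteq> {}" using assms by auto
    fix \<C> assume "\<C> \<noteq> {}" "subset.chain ?A \<C>"
    then show "\<Union>\<C> \<in> ?A" using compatible_Union_chain[of \<C>] by (auto simp: subset_chain_def)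
  qed
  then obtain R where R: "R \<in> ?A" "\<forall>X\<in>?A. R \<subseteq> X \<longrightarrow> X = R" by (rule bexE)
  then have "R' = R" if "compatible R'" "R \<subseteq> R'" for R'
    using that by (auto dest: order_trans)
  then show ?thesis using R(1) by (intro exI[of _ R]) simp
qed

lemma compatible_catalysis_g_imp_le:
  assumes R: "compatible R" and X: "X \<in> resources"
    and cat: "(replicate_mset p g + X, replicate_mset q g + X) \<in> R"
  shows "q \<le> p"
proof (rule ccontr)
  assume "\<not> q \<le> p"
  obtain b where b: "(replicate_mset b g, X) \<in> R" using compatible_from_g R X by blast
  let ?m = "b + 1"
  have "(replicate_mset b g + replicate_mset (?m * p) g, X + replicate_mset (?m * p) g) \<in> R"
    using b R by (intro compatible_add_right) auto
  moreover have "(replicate_mset (?m * p) g + X, replicate_mset (?m * q) g + X) \<in> R"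
    using compatible_catalysis_repeat_mset[OF R _ _ X cat, of ?m] by (simp del: repeat_mset_Suc add_Suc_right)
  moreover have "(replicate_mset (?m * q) g + X, replicate_mset (?m * q) g) \<in> R"
    using R X by (intro compatible_subset) auto
  ultimately have "(replicate_mset (b + ?m * p) g, replicate_mset (?m * q) g) \<in> R"
    unfolding replicate_mset_add using compatible_trans[OF R] by (metis add.commute)
  then have "?m * q \<le> b + ?m * p" by (rule compatible_replicate_g_imp_le[OF R])
  moreover have "?m * p + ?m \<le> ?m * q" using mult_le_mono2[of "p + 1" q ?m] \<open>\<not> q \<le> p\<close> by simp
  ultimately show False by linarith
qed

lemma maximal_compatible_obstruction:
  assumes R: "compatible R" and maximal: "\<And>R'. compatible R' \<Longrightarrow> R \<subseteq> R' \<Longrightarrow> R' = R"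
    and st: "s \<in> resources" "t \<in> resources" "(s, t) \<notin> R"
  shows "\<exists>n i j. n > 0 \<and> i < j \<and>
    (replicate_mset i g + repeat_mset n t, replicate_mset j g + repeat_mset n s) \<in> R"
proof (rule ccontr)
  assume none: "\<not> ?thesis"
  have nondegenerate: "j \<le> i"
    if "(replicate_mset i g + repeat_mset n t, replicate_mset j g + repeat_mset n s) \<in> R" for n i j
  proof (cases "n = 0")
    case True then show ?thesis using that R by (auto intro: compatible_replicate_g_imp_le)
  next
    case False then show ?thesis using that none by (meson not_gr_zero not_le)
  qed
  have "compatible (adjoin R s t)" "R \<subseteq> adjoin R s t" "(s, t) \<in> adjoin R s t"
    by (rule compatible_adjoin[OF R st(1,2)]; erule nondegenerate)+
  then show False using maximal st(3) by blast
qed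

lemma maximal_compatible_total:
  assumes R: "compatible R" and maximal: "\<And>R'. compatible R' \<Longrightarrow> R \<subseteq> R' \<Longrightarrow> R' = R"
    and st: "s \<in> resources" "t \<in> resources"
  shows "(s, t) \<in> R \<or> (t, s) \<in> R"
proof (rule ccontr)
  assume "\<not> ?thesis"
  then have incomparable: "(s, t) \<notin> R" "(t, s) \<notin> R" by auto
  obtain n i j where "n > 0" "i < j"
    and ts: "(replicate_mset i g + repeat_mset n t, replicate_mset j g + repeat_mset n s) \<in> R"
    using maximal_compatible_obstruction[OF R maximal st incomparable(1)] by blast
  obtain n' i' j' where "n' > 0" "i' < j'"
    and st': "(replicate_mset i' g + repeat_mset n' s, replicate_mset j' g + repeat_mset n' t) \<in> R"
    using maximal_compatible_obstruction[OF R maximal st(2,1) incomparable(2)] by blast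
  have "(repeat_mset n' (replicate_mset i g + repeat_mset n t)
      + repeat_mset n (replicate_mset i' g + repeat_mset n' s),
      repeat_mset n' (replicate_mset j g + repeat_mset n s)
      + repeat_mset n (replicate_mset j' g + repeat_mset n' t)) \<in> R"
    by (intro compatible_add[OF R] compatible_repeat_mset[OF R] ts st')
  then have "(replicate_mset (n' * i + n * i') g + repeat_mset (n * n') (s + t),
      replicate_mset (n' * j + n * j') g + repeat_mset (n * n') (s + t)) \<in> R"
    by (simp add: ac_simps replicate_mset_add)
  then have "n' * j + n * j' \<le> n' * i + n * i'" using st by (intro compatible_catalysis_g_imp_le[OF R]) auto
  moreover have "n' * i + n * i' < n' * j + n * j'"
    using \<open>n > 0\<close> \<open>i < j\<close> \<open>n' > 0\<close> \<open>i' < j'\<close> by (intro add_strict_mono) auto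
  ultimately show False by simp
qed

definition rates :: "('a multiset \<times> 'a multiset) set \<Rightarrow> 'a multiset \<Rightarrow> real set" where
  "rates R M = {real u / real n | u n. n > 0 \<and> (repeat_mset n M, replicate_mset u g) \<in> R}"

definition yield :: "('a multiset \<times> 'a multiset) set \<Rightarrow> 'a multiset \<Rightarrow> real" where
  "yield R M = Sup (rates R M)"

lemma rates_bdd_above:
  assumes R: "compatible R" and M: "M \<in> resources"
  shows "bdd_above (rates R M)"
proof -
  obtain b where b: "(replicate_mset b g, M) \<in> R" using compatible_from_g R M by blast
  have "real u / real n \<le> real b" if "n > 0" "(repeat_mset n M, replicate_mset u g) \<in> R" for u n
  proof -
    have "(replicate_mset (n * b) g, replicate_mset u g) \<in> R"
      using compatible_trans[OF R compatible_repeat_mset[OF R b, of n] that(2)] by simp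
    then have "real u \<le> real n * real b"
      using compatible_replicate_g_imp_le[OF R] by (metis of_nat_le_iff of_nat_mult)
    then show ?thesis using that(1) by (simp add: divide_le_eq mult.commute)
  qed
  then show ?thesis by (auto simp: bdd_above_def rates_def)
qed

lemma rates_nonempty:
  assumes "compatible R" "M \<in> resources"
  shows "rates R M \<noteq> {}"
proof -
  have "(repeat_mset 1 M, replicate_mset 0 g) \<in> R" using compatible_subset[of R M "{#}"] assms by simp
  then show ?thesis using zero_less_Suc[of 0] unfolding rates_def One_nat_def by blast
qed

lemma rate_le_yield:
  assumes "compatible R" "M \<in> resources" "n > 0" "(repeat_mset n M, replicate_mset u g) \<in> R"
  shows "real u / real n \<le> yield R M"
  unfolding yield_def using assms rates_bdd_above by (intro cSup_upper) (auto simp: rates_def)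

lemma yield_le:
  assumes "compatible R" "M \<in> resources"
    and "\<And>n u. n > 0 \<Longrightarrow> (repeat_mset n M, replicate_mset u g) \<in> R \<Longrightarrow> real u / real n \<le> y"
  shows "yield R M \<le> y"
  unfolding yield_def using assms rates_nonempty by (intro cSup_least) (auto simp: rates_def)

lemma rate_near_yield:
  assumes "compatible R" "M \<in> resources" "0 < \<epsilon>"
  obtains n u where "n > 0" "(repeat_mset n M, replicate_mset u g) \<in> R" "yield R M - \<epsilon> < real u / real n"
proof -
  have "yield R M - \<epsilon> < Sup (rates R M)" using assms(3) by (simp add: yield_def)
  then obtain x where "x \<in> rates R M" "yield R M - \<epsilon> < x"
    using less_cSup_iff[OF rates_nonempty rates_bdd_above] assms(1,2) by metis
  then show ?thesis using that by (auto simp: rates_def)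
qed

lemma yield_mono:
  assumes R: "compatible R" and MN: "(M, N) \<in> R"
  shows "yield R N \<le> yield R M"
proof (rule yield_le[OF R])
  fix n u assume "n > 0" "(repeat_mset n N, replicate_mset u g) \<in> R"
  then show "real u / real n \<le> yield R M"
    using compatible_trans[OF R compatible_repeat_mset[OF R MN]] rate_le_yield[OF R]
      compatible_in_resources[OF R MN] by blast
qed (use compatible_in_resources[OF R MN] in simp)

lemma yield_g:
  assumes R: "compatible R"
  shows "yield R {#g#} = 1"
proof (rule antisym)
  have g: "{#g#} \<in> resources" using resources_g[of 1] by simp
  show "yield R {#g#} \<le> 1"
    using compatible_replicate_g_imp_le[OF R] by (intro yield_le[OF R g]) auto
  show "1 \<le> yield R {#g#}"
    using rate_le_yield[OF R g, of 1 1] compatible_subset[OF R g, of "{#g#}"] by simp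
qed

lemma total_replicate_g_bracket:
  assumes R: "compatible R" and total: "\<And>s t. s \<in> resources \<Longrightarrow> t \<in> resources \<Longrightarrow> (s, t) \<in> R \<or> (t, s) \<in> R"
    and M: "M \<in> resources"
  obtains u where "(M, replicate_mset u g) \<in> R" "(replicate_mset (u + 1) g, M) \<in> R"
proof -
  let ?P = "\<lambda>u. (M, replicate_mset u g) \<in> R"
  have "?P 0" using compatible_subset[OF R M, of "{#}"] by simp
  obtain b where b: "(replicate_mset b g, M) \<in> R" using compatible_from_g R M by blast
  have bounded: "u \<le> b" if "?P u" for u
    using compatible_replicate_g_imp_le[OF R] compatible_trans[OF R b that] by blast
  define u where "u = (GREATEST u. ?P u)"
  have "?P u" unfolding u_def using GreatestI_nat[of ?P 0 b] \<open>?P 0\<close> bounded by blast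
  moreover have "\<not> ?P (u + 1)" using Greatest_le_nat[of ?P "u + 1" b] bounded unfolding u_def by auto
  then have "(replicate_mset (u + 1) g, M) \<in> R" using total M resources_g by blast
  ultimately show ?thesis using that by blast
qed

lemma yield_add_ge:
  assumes R: "compatible R" and M: "M \<in> resources" and N: "N \<in> resources"
  shows "yield R M + yield R N \<le> yield R (M + N)"
proof (rule field_le_epsilon)
  fix \<epsilon> :: real assume "\<epsilon> > 0"
  then have half: "0 < \<epsilon> / 2" by simp
  obtain n u where u: "n > 0" "(repeat_mset n M, replicate_mset u g) \<in> R" "yield R M - \<epsilon> / 2 < real u / real n"
    using rate_near_yield[OF R M half] by blast
  obtain m v where v: "m > 0" "(repeat_mset m N, replicate_mset v g) \<in> R" "yield R N - \<epsilon> / 2 < real v / real m"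
    using rate_near_yield[OF R N half] by blast
  have "(repeat_mset m (repeat_mset n M) + repeat_mset n (repeat_mset m N),
      repeat_mset m (replicate_mset u g) + repeat_mset n (replicate_mset v g)) \<in> R"
    by (intro compatible_add[OF R] compatible_repeat_mset[OF R] u v)
  then have "(repeat_mset (m * n) (M + N), replicate_mset (m * u + n * v) g) \<in> R"
    by (simp add: mult.commute replicate_mset_add)
  then have "real (m * u + n * v) / real (m * n) \<le> yield R (M + N)"
    by (intro rate_le_yield[OF R]) (use M N u v in simp_all)
  moreover have "real (m * u + n * v) / real (m * n) = real u / real n + real v / real m"
    using u(1) v(1) by (simp add: field_simps)
  ultimately show "yield R M + yield R N \<le> yield R (M + N) + \<epsilon>" using u(3) v(3) by linarith
qed

lemma total_rate_add_le:
  assumes R: "compatible R" and total: "\<And>s t. s \<in> resources \<Longrightarrow> t \<in> resources \<Longrightarrow> (s, t) \<in> R \<or> (t, s) \<in> R"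
    and M: "M \<in> resources" and N: "N \<in> resources" and u: "(repeat_mset n (M + N), replicate_mset u g) \<in> R"
    and "n > 0" "K > 0"
  shows "real u / real n \<le> yield R M + yield R N + 2 / real K"
proof -
  obtain a where a: "(repeat_mset (K * n) M, replicate_mset a g) \<in> R"
    "(replicate_mset (a + 1) g, repeat_mset (K * n) M) \<in> R"
    using total_replicate_g_bracket[OF R total] M by (metis resources_repeat)
  obtain b where b: "(repeat_mset (K * n) N, replicate_mset b g) \<in> R"
    "(replicate_mset (b + 1) g, repeat_mset (K * n) N) \<in> R"
    using total_replicate_g_bracket[OF R total] N by (metis resources_repeat)
  have "(replicate_mset (a + 1) g + replicate_mset (b + 1) g,
      repeat_mset (K * n) M + repeat_mset (K * n) N) \<in> R"
    by (rule compatible_add[OF R a(2) b(2)])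
  moreover have "(repeat_mset (K * n) M + repeat_mset (K * n) N, replicate_mset (K * u) g) \<in> R"
    using compatible_repeat_mset[OF R u, of K] by simp
  ultimately have "(replicate_mset ((a + 1) + (b + 1)) g, replicate_mset (K * u) g) \<in> R"
    unfolding replicate_mset_add[of "a + 1" "b + 1"] by (rule compatible_trans[OF R])
  then have "K * u \<le> a + b + 2" using compatible_replicate_g_imp_le[OF R] by force
  then have "real K * real u \<le> real a + real b + 2"
    by (metis of_nat_add of_nat_le_iff of_nat_mult of_nat_numeral)
  then have "real u / real n \<le> (real a + real b + 2) / (real K * real n)"
    using \<open>K > 0\<close> \<open>n > 0\<close> by (simp add: field_simps)
  also have "\<dots> = real a / real (K * n) + real b / real (K * n) + 2 / (real K * real n)"
    by (simp add: add_divide_distrib)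
  also have "\<dots> \<le> yield R M + yield R N + 2 / real K"
  proof (intro add_mono)
    show "real a / real (K * n) \<le> yield R M" "real b / real (K * n) \<le> yield R N"
      using \<open>K > 0\<close> \<open>n > 0\<close> M N a(1) b(1) by (auto intro!: rate_le_yield[OF R] simp del: of_nat_mult)
    show "2 / (real K * real n) \<le> 2 / real K"
      using \<open>K > 0\<close> \<open>n > 0\<close> by (intro divide_left_mono) (auto simp: mult_le_cancel_left1)
  qed
  finally show ?thesis .
qed

lemma yield_add:
  assumes R: "compatible R" and total: "\<And>s t. s \<in> resources \<Longrightarrow> t \<in> resources \<Longrightarrow> (s, t) \<in> R \<or> (t, s) \<in> R"
    and M: "M \<in> resources" and N: "N \<in> resources"
  shows "yield R (M + N) = yield R M + yield R N"
proof (rule antisym)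
  show "yield R (M + N) \<le> yield R M + yield R N"
  proof (rule yield_le[OF R], goal_cases)
    case (2 n u)
    have "\<forall>\<^sub>F K in sequentially. real u / real n \<le> yield R M + yield R N + 2 / real K"
      using total_rate_add_le[OF R total M N] 2 by (auto intro: eventually_sequentiallyI[of 1])
    moreover have "(\<lambda>K. yield R M + yield R N + 2 / real K) \<longlonglongrightarrow> yield R M + yield R N + 0"
      by (intro tendsto_intros lim_const_over_n)
    ultimately show ?case using tendsto_lowerbound by fastforce
  qed (use M N in simp)
qed (rule yield_add_ge[OF R M N])

lemma not_dominates_imp_nondegenerate:
  assumes st: "s \<in> resources" "t \<in> resources" and "\<not> dominates t s"
    and dom: "dominates (replicate_mset i g + repeat_mset n t) (replicate_mset j g + repeat_mset n s)"
  shows "j \<le> i"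
proof (rule ccontr)
  assume "\<not> j \<le> i"
  then have "n > 0" using dom dominates_replicate_g_imp_le by (cases "n = 0") auto
  have "dominates (replicate_mset j g + repeat_mset n s) (replicate_mset i g + repeat_mset n s)"
    using \<open>\<not> j \<le> i\<close> st by (intro dominates_subset) (auto intro: replicate_mset_subset)
  then have "dominates (repeat_mset n t + replicate_mset i g) (repeat_mset n s + replicate_mset i g)"
    using dominates_trans[OF dom] by (simp add: add.commute)
  then have "dominates (repeat_mset n t) (repeat_mset n s)"
    using dominates_cancel[of "repeat_mset n t" "repeat_mset n s" "replicate_mset i g"] st by simp
  then show False using dominates_of_repeat_mset \<open>n > 0\<close> assms by blast
qed

theorem separating_functional_exists:
  assumes AB: "A \<in> resources" "B \<in> resources" and "\<not> dominates A B"
  shows "\<exists>E. (\<forall>M\<in>resources. \<forall>N\<in>resources. E (M + N) = E M + E N) \<and> E {#g#} = (1::real) \<and>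
    (\<forall>M N. dominates M N \<longrightarrow> E N \<le> E M) \<and> E A < E B"
proof -
  obtain c where c: "\<not> dominates (repeat_mset c A + {#g#}) (repeat_mset c B)"
    using dominates_limit[OF AB, of 1] assms(3) by auto
  let ?s = "repeat_mset c B" and ?t = "repeat_mset c A + {#g#}" and ?G = "{(M, N). dominates M N}"
  have st: "?s \<in> resources" "?t \<in> resources" using AB g_in by auto
  have nondegenerate: "j \<le> i"
    if "(replicate_mset i g + repeat_mset n ?t, replicate_mset j g + repeat_mset n ?s) \<in> ?G" for n i j
    using not_dominates_imp_nondegenerate[OF st c] that by blast
  have adjoin: "compatible (adjoin ?G ?s ?t)" "(?s, ?t) \<in> adjoin ?G ?s ?t"
    by (rule compatible_adjoin(1,3)[OF compatible_dominates st], erule nondegenerate)+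
  obtain R where R: "compatible R" and extends: "adjoin ?G ?s ?t \<subseteq> R"
    and maximal: "\<And>R'. compatible R' \<Longrightarrow> R \<subseteq> R' \<Longrightarrow> R' = R"
    using compatible_maximal_exists[OF adjoin(1)] by metis
  have add: "yield R (M + N) = yield R M + yield R N" if "M \<in> resources" "N \<in> resources" for M N
    using yield_add[OF R maximal_compatible_total[OF R maximal] that] by blast
  have zero: "yield R {#} = 0" using add[of "{#}" "{#}"] by simp
  have repeat: "yield R (repeat_mset n M) = real n * yield R M" if "M \<in> resources" for n M
    using that by (induction n) (auto simp: add zero algebra_simps)
  have "yield R ?t \<le> yield R ?s" using yield_mono[OF R] extends adjoin(2) by blast
  then have "real c * yield R A + 1 \<le> real c * yield R B"
    using add[of "repeat_mset c A" "{#g#}"] repeat AB g_in yield_g[OF R] by simp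
  then have "yield R A < yield R B" by (smt (verit) mult_left_mono of_nat_0_le_iff)
  moreover have "yield R N \<le> yield R M" if "dominates M N" for M N
    using yield_mono[OF R] R that by (auto simp: compatible_def)
  ultimately show ?thesis using add yield_g[OF R] by (intro exI[of _ "yield R"]) simp
qed

end

section \<open>Payoffs of LOCC protocols\<close>

type_synonym amp = "nat list \<Rightarrow> complex"

definition ibox :: "nat list \<Rightarrow> nat list set" where
  "ibox d = {xs. length xs = length d \<and> (\<forall>i<length d. xs ! i < d ! i)}"

lemma ibox_Nil [simp]: "ibox [] = {[]}" by (auto simp: ibox_def)

lemma Cons_in_ibox [simp]: "x # xs \<in> ibox (a # d) \<longleftrightarrow> x < a \<and> xs \<in> ibox d"
  by (auto simp: ibox_def less_Suc_eq_0_disj)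

lemma ibox_Cons: "ibox (a # d) = (\<lambda>(x, xs). x # xs) ` ({..<a} \<times> ibox d)"
proof (intro Set.set_eqI iffI)
  fix ys assume ys: "ys \<in> ibox (a # d)"
  then obtain x xs where "ys = x # xs" by (cases ys) (auto simp: ibox_def)
  then show "ys \<in> (\<lambda>(x, xs). x # xs) ` ({..<a} \<times> ibox d)" using ys by auto
qed auto

lemma finite_ibox [simp]: "finite (ibox d)"
  by (induction d) (auto simp: ibox_Cons)

lemma ibox_ones: "ibox (replicate n (1::nat)) = {replicate n 0}"
  by (induction n) (auto simp: ibox_Cons)

lemma ibox_ones_Suc: "ibox (replicate n (Suc 0)) = {replicate n 0}"
  using ibox_ones by simp

lemma length_ibox: "xs \<in> ibox d \<Longrightarrow> length xs = length d" by (simp add: ibox_def)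

lemma nth_ibox: "xs \<in> ibox d \<Longrightarrow> i < length d \<Longrightarrow> xs ! i < d ! i" by (simp add: ibox_def)

lemma sum_ibox_Cons: "sum f (ibox (a # d)) = (\<Sum>x<a. \<Sum>xs\<in>ibox d. f (x # xs))"
  unfolding ibox_Cons
  by (subst sum.reindex) (auto simp: inj_on_def sum.cartesian_product case_prod_unfold)

lemma sum_ibox_split:
  "j < length d \<Longrightarrow> sum f (ibox d) = (\<Sum>xs\<in>ibox (d[j := 1]). \<Sum>z<d ! j. f (xs[j := z]))"
proof (induction d arbitrary: j f)
  case (Cons a d)
  show ?case
  proof (cases j)
    case 0
    then show ?thesis by (simp add: sum_ibox_Cons sum.swap[of _ "{..<a}"])
  next
    case (Suc i)
    then show ?thesis using Cons by (simp add: sum_ibox_Cons)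
  qed
qed simp

lemma list_update_in_ibox_list_update: "xs \<in> ibox (d[j := e']) \<Longrightarrow> z < e \<Longrightarrow> xs[j := z] \<in> ibox (d[j := e])"
proof -
  assume xs: "xs \<in> ibox (d[j := e'])" and z: "z < e"
  have "xs[j := z] ! i < d[j := e] ! i" if "i < length d" for i
    using xs z that by (cases "i = j") (auto simp: ibox_def dest!: spec[of _ i])
  then show ?thesis using xs by (simp add: ibox_def)
qed

lemma list_update_in_ibox: "xs \<in> ibox d \<Longrightarrow> z < e \<Longrightarrow> xs[j := z] \<in> ibox (d[j := e])"
  using list_update_in_ibox_list_update[of xs d j "d ! j" z e] by simp

definition supported :: "nat list \<Rightarrow> amp \<Rightarrow> bool" where
  "supported d a \<longleftrightarrow> (\<forall>xs. xs \<notin> ibox d \<longrightarrow> a xs = 0)"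

lemma supported_eqI: "supported d a \<Longrightarrow> supported d b \<Longrightarrow> (\<And>xs. xs \<in> ibox d \<Longrightarrow> a xs = b xs) \<Longrightarrow> a = b"
  unfolding supported_def by (intro ext) metis

definition iprod :: "nat list \<Rightarrow> amp \<Rightarrow> amp \<Rightarrow> complex" where
  "iprod d a b = (\<Sum>x\<in>ibox d. cnj (a x) * b x)"

definition sqnorm :: "nat list \<Rightarrow> amp \<Rightarrow> real" where
  "sqnorm d a = (\<Sum>x\<in>ibox d. (cmod (a x))\<^sup>2)"

definition local_act :: "nat list \<Rightarrow> nat \<Rightarrow> complex mat \<Rightarrow> amp \<Rightarrow> amp" where
  "local_act d j L a = (\<lambda>zs. if zs \<in> ibox (d[j := dim_row L])
     then \<Sum>y<d ! j. L $$ (zs ! j, y) * a (zs[j := y]) else 0)"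

definition instrument :: "nat \<Rightarrow> nat \<Rightarrow> (nat \<Rightarrow> complex mat) \<Rightarrow> bool" where
  "instrument D m L \<longleftrightarrow> (\<forall>i<m. 0 < dim_row (L i) \<and> dim_col (L i) = D) \<and>
     (\<forall>y<D. \<forall>y'<D. (\<Sum>i<m. \<Sum>z<dim_row (L i). cnj (L i $$ (z, y)) * L i $$ (z, y')) = (if y = y' then 1 else 0))"

lemma supported_local_act: "supported (d[j := dim_row L]) (local_act d j L a)"
  by (simp add: supported_def local_act_def)

lemma sqnorm_nonneg: "0 \<le> sqnorm d a" by (simp add: sqnorm_def sum_nonneg)

lemma sum_sqnorm_instrument:
  fixes M :: "'i \<Rightarrow> nat \<Rightarrow> complex"
  assumes c: "\<And>y y'. y < D \<Longrightarrow> y' < D \<Longrightarrow> (\<Sum>i\<in>I. cnj (M i y) * M i y') = (if y = y' then 1 else 0)"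
  shows "(\<Sum>i\<in>I. (cmod (\<Sum>y<D. M i y * \<alpha> y))\<^sup>2) = (\<Sum>y<D. (cmod (\<alpha> y))\<^sup>2)"
proof -
  have "complex_of_real (\<Sum>i\<in>I. (cmod (\<Sum>y<D. M i y * \<alpha> y))\<^sup>2)
      = (\<Sum>i\<in>I. (\<Sum>y<D. cnj (M i y * \<alpha> y)) * (\<Sum>y<D. M i y * \<alpha> y))"
    unfolding of_real_sum complex_norm_square
    by (intro sum.cong refl) (simp add: mult.commute)
  also have "\<dots> = (\<Sum>i\<in>I. \<Sum>y<D. \<Sum>y'<D. cnj (\<alpha> y) * \<alpha> y' * (cnj (M i y) * M i y'))"
    unfolding sum_product by (intro sum.cong refl) simp
  also have "\<dots> = (\<Sum>y<D. \<Sum>i\<in>I. \<Sum>y'<D. cnj (\<alpha> y) * \<alpha> y' * (cnj (M i y) * M i y'))"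
    by (rule sum.swap)
  also have "\<dots> = (\<Sum>y<D. \<Sum>y'<D. \<Sum>i\<in>I. cnj (\<alpha> y) * \<alpha> y' * (cnj (M i y) * M i y'))"
    by (intro sum.cong refl sum.swap)
  also have "\<dots> = (\<Sum>y<D. \<Sum>y'<D. if y = y' then cnj (\<alpha> y) * \<alpha> y' else 0)"
    by (intro sum.cong refl) (simp add: sum_distrib_left[symmetric] c)
  also have "\<dots> = (\<Sum>y<D. cnj (\<alpha> y) * \<alpha> y)" by simp
  also have "\<dots> = complex_of_real (\<Sum>y<D. (cmod (\<alpha> y))\<^sup>2)"
    unfolding of_real_sum complex_norm_square by (simp add: mult.commute)
  finally show ?thesis using of_real_eq_iff by blast
qed

lemma sum_sqnorm_local_act:
  assumes j: "j < length d" and L: "instrument (d ! j) m L"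
  shows "(\<Sum>i<m. sqnorm (d[j := dim_row (L i)]) (local_act d j (L i) a)) = sqnorm d a"
proof -
  have "sqnorm (d[j := dim_row (L i)]) (local_act d j (L i) a) =
      (\<Sum>xs\<in>ibox (d[j := 1]). \<Sum>z<dim_row (L i). (cmod (\<Sum>y<d ! j. L i $$ (z, y) * a (xs[j := y])))\<^sup>2)" for i
    unfolding sqnorm_def local_act_def
    using j by (subst sum_ibox_split[of j])
      (auto intro!: sum.cong simp: list_update_in_ibox_list_update length_ibox)
  then have "(\<Sum>i<m. sqnorm (d[j := dim_row (L i)]) (local_act d j (L i) a)) =
     (\<Sum>xs\<in>ibox (d[j := 1]). \<Sum>i<m. \<Sum>z<dim_row (L i). (cmod (\<Sum>y<d ! j. L i $$ (z, y) * a (xs[j := y])))\<^sup>2)"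
    by (simp add: sum.swap[of _ "{..<m}"])
  also have "\<dots> = (\<Sum>xs\<in>ibox (d[j := 1]). \<Sum>y<d ! j. (cmod (a (xs[j := y])))\<^sup>2)"
  proof (rule sum.cong[OF refl])
    fix xs
    show "(\<Sum>i<m. \<Sum>z<dim_row (L i). (cmod (\<Sum>y<d ! j. L i $$ (z, y) * a (xs[j := y])))\<^sup>2)
       = (\<Sum>y<d ! j. (cmod (a (xs[j := y])))\<^sup>2)" (is "?lhs = ?rhs")
    proof -
      let ?I = "Sigma {..<m} (\<lambda>i. {..<dim_row (L i)})"
      have flatten: "(\<Sum>i<m. \<Sum>z<dim_row (L i). f i z) = (\<Sum>k\<in>?I. f (fst k) (snd k))"
        for f :: "nat \<Rightarrow> nat \<Rightarrow> 'b::comm_monoid_add"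
        by (subst sum.Sigma) (auto simp: case_prod_unfold)
      show "?lhs = ?rhs"
        unfolding flatten
        by (rule sum_sqnorm_instrument) (use L in \<open>simp add: instrument_def flatten\<close>)
    qed
  qed
  also have "\<dots> = sqnorm d a" unfolding sqnorm_def using j by (rule sum_ibox_split[symmetric])
  finally show ?thesis .
qed

text \<open>\<open>pays H d a p\<close>: starting from the vector \<open>a\<close>, some finite-round LOCC protocol ends, in each
  branch, at an unnormalised vector \<open>v\<close> with local dimensions \<open>d'\<close> and a payoff \<open>q\<close> such that
  \<open>H d' v q\<close>, and these payoffs sum up to at least \<open>p\<close>. Since the norm of \<open>v\<close> carries the
  probability of the branch, sums of payoffs are averages.\<close>

inductive pays :: "(nat list \<Rightarrow> amp \<Rightarrow> real \<Rightarrow> bool) \<Rightarrow> nat list \<Rightarrow> amp \<Rightarrow> real \<Rightarrow> bool" for H where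
  leaf: "H d a p \<Longrightarrow> pays H d a p"
| round: "\<lbrakk>j < length d; instrument (d ! j) m L;
     \<forall>i<m. pays H (d[j := dim_row (L i)]) (local_act d j (L i) a) (q i); p \<le> (\<Sum>i<m. q i)\<rbrakk> \<Longrightarrow> pays H d a p"

lemma pays_bind:
  assumes "pays H d a p" "\<And>d' v q. H d' v q \<Longrightarrow> pays H' d' v q"
  shows "pays H' d a p"
  using assms by (induction rule: pays.induct) (auto intro: pays.intros)

lemma pays_antimono:
  assumes "pays H d a p" "q \<le> p" "\<And>d' v q q'. H d' v q \<Longrightarrow> q' \<le> q \<Longrightarrow> H d' v q'"
  shows "pays H d a q"
  using assms(1)
proof cases
  case leaf then show ?thesis using assms by (auto intro: pays.leaf)
next
  case (round j m L q')
  then show ?thesis using assms(2) by (intro pays.round[where q = q']) auto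
qed

definition relabel :: "(nat \<Rightarrow> nat \<Rightarrow> nat) \<Rightarrow> nat list \<Rightarrow> nat list" where
  "relabel \<pi> xs = map (\<lambda>j. \<pi> j (xs ! j)) [0..<length xs]"

lemma length_relabel [simp]: "length (relabel \<pi> xs) = length xs" by (simp add: relabel_def)

lemma nth_relabel [simp]: "j < length xs \<Longrightarrow> relabel \<pi> xs ! j = \<pi> j (xs ! j)" by (simp add: relabel_def)

lemma relabel_eq_iff: "length zs = length xs \<Longrightarrow> relabel \<pi> xs = zs \<longleftrightarrow> (\<forall>j<length xs. \<pi> j (xs ! j) = zs ! j)"
  by (auto simp: list_eq_iff_nth_eq)

definition monomial_act :: "nat list \<Rightarrow> nat list \<Rightarrow> (nat \<Rightarrow> nat \<Rightarrow> nat) \<Rightarrow> (nat \<Rightarrow> nat \<Rightarrow> complex) \<Rightarrow> amp \<Rightarrow> amp" where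
  "monomial_act d e \<pi> c a = (\<lambda>zs. if zs \<in> ibox e then
     \<Sum>xs\<in>ibox d. if relabel \<pi> xs = zs then (\<Prod>j<length d. c j (xs ! j)) * a xs else 0 else 0)"

lemma supported_monomial_act: "supported e (monomial_act d e \<pi> c a)"
  by (simp add: supported_def monomial_act_def)

lemma monomial_act_id: "supported d a \<Longrightarrow> monomial_act d d (\<lambda>j x. x) (\<lambda>j x. 1) a = a"
proof (rule supported_eqI[of d])
  fix xs assume xs: "xs \<in> ibox d"
  have "relabel (\<lambda>j x. x) ys = ys" for ys by (simp add: relabel_def map_nth)
  then show "monomial_act d d (\<lambda>j x. x) (\<lambda>j x. 1) a xs = a xs"
    using xs by (simp add: monomial_act_def)
qed (auto simp: supported_monomial_act)

definition monomial_kraus :: "nat \<Rightarrow> nat \<Rightarrow> (nat \<Rightarrow> nat) \<Rightarrow> (nat \<Rightarrow> complex) \<Rightarrow> complex mat" where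
  "monomial_kraus D e f \<mu> = mat e D (\<lambda>(z, x). if z = f x then \<mu> x else 0)"

lemma dim_row_monomial_kraus [simp]: "dim_row (monomial_kraus D e f \<mu>) = e"
  by (simp add: monomial_kraus_def)

lemma instrument_monomial_kraus:
  assumes "0 < e" and f: "\<And>x. x < D \<Longrightarrow> f x < e"
    and complete: "\<And>x x'. \<lbrakk>x < D; x' < D; f x = f x'\<rbrakk>
        \<Longrightarrow> (\<Sum>t<m. cnj (\<mu> t x) * \<mu> t x') = (if x = x' then 1 else 0)"
  shows "instrument D m (\<lambda>t. monomial_kraus D e f (\<mu> t))"
  unfolding instrument_def
proof (intro conjI allI impI)
  fix x x' assume x: "x < D" "x' < D"
  let ?L = "\<lambda>t. monomial_kraus D e f (\<mu> t)"
  have "(\<Sum>t<m. \<Sum>z<dim_row (?L t). cnj (?L t $$ (z, x)) * ?L t $$ (z, x'))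
      = (\<Sum>t<m. \<Sum>z<e. if z = f x then if f x = f x' then cnj (\<mu> t x) * \<mu> t x' else 0 else 0)"
    using x by (intro sum.cong) (auto simp: monomial_kraus_def)
  also have "\<dots> = (\<Sum>t<m. if f x = f x' then cnj (\<mu> t x) * \<mu> t x' else 0)" using f x by simp
  also have "\<dots> = (if x = x' then 1 else 0)" using complete x by (cases "f x = f x'") auto
  finally show "(\<Sum>t<m. \<Sum>z<dim_row (?L t). cnj (?L t $$ (z, x)) * ?L t $$ (z, x')) = (if x = x' then 1 else 0)" .
qed (use assms(1) in \<open>auto simp: monomial_kraus_def\<close>)

text \<open>In the situation of these definitions the parties \<open>0, \<dots>, l - 1\<close> have already acted.\<close>

definition partial_dims :: "nat \<Rightarrow> nat list \<Rightarrow> nat list \<Rightarrow> nat list" where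
  "partial_dims l d e = take l e @ drop l d"

definition partial_map :: "nat \<Rightarrow> (nat \<Rightarrow> nat \<Rightarrow> nat) \<Rightarrow> nat \<Rightarrow> nat \<Rightarrow> nat" where
  "partial_map l \<pi> j = (if j < l then \<pi> j else (\<lambda>x. x))"

definition partial_weight :: "nat \<Rightarrow> (nat \<Rightarrow> nat \<Rightarrow> nat \<Rightarrow> complex) \<Rightarrow> nat list \<Rightarrow> nat \<Rightarrow> nat \<Rightarrow> complex" where
  "partial_weight l \<mu> y j = (if j < l then \<mu> j (y ! j) else (\<lambda>x. 1))"

lemma length_partial_dims [simp]: "length e = length d \<Longrightarrow> length (partial_dims l d e) = length d"
  by (simp add: partial_dims_def)

lemma nth_partial_dims:
  "length e = length d \<Longrightarrow> j < length d \<Longrightarrow> partial_dims l d e ! j = (if j < l then e ! j else d ! j)"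
  by (auto simp: partial_dims_def nth_append)

lemma partial_dims_Suc:
  "length e = length d \<Longrightarrow> l < length d \<Longrightarrow> partial_dims (Suc l) d e = (partial_dims l d e)[l := e ! l]"
  by (intro nth_equalityI) (auto simp: nth_partial_dims nth_list_update)

lemma relabel_partial_map_Suc_iff:
  assumes "l < length xs" "length zs = length xs"
  shows "zs ! l = \<pi> l x \<and> relabel (partial_map l \<pi>) xs = zs[l := x] \<longleftrightarrow>
    x = xs ! l \<and> relabel (partial_map (Suc l) \<pi>) xs = zs"
proof -
  have "relabel (partial_map l \<pi>) xs = zs[l := x] \<longleftrightarrow>
      xs ! l = x \<and> (\<forall>j<length xs. j \<noteq> l \<longrightarrow> partial_map l \<pi> j (xs ! j) = zs ! j)"
    using assms by (auto simp: relabel_eq_iff nth_list_update partial_map_def)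
  moreover have "relabel (partial_map (Suc l) \<pi>) xs = zs \<longleftrightarrow>
      \<pi> l (xs ! l) = zs ! l \<and> (\<forall>j<length xs. j \<noteq> l \<longrightarrow> partial_map l \<pi> j (xs ! j) = zs ! j)"
    using assms by (auto simp: relabel_eq_iff partial_map_def less_Suc_eq)
  ultimately show ?thesis by auto
qed

lemma prod_partial_weight_Suc:
  assumes "l < length d" "length y = length d"
  shows "(\<Prod>j<length d. partial_weight (Suc l) \<mu> (y[l := t]) j (xs ! j)) =
    \<mu> l t (xs ! l) * (\<Prod>j<length d. partial_weight l \<mu> y j (xs ! j))"
proof -
  have "(\<Prod>j<length d. partial_weight (Suc l) \<mu> (y[l := t]) j (xs ! j)) =
      (\<Prod>j<length d. (if j = l then \<mu> l t (xs ! l) else 1) * partial_weight l \<mu> y j (xs ! j))"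
    using assms by (intro prod.cong refl) (auto simp: partial_weight_def nth_list_update less_Suc_eq)
  then show ?thesis using assms(1) by (simp add: prod.distrib)
qed

lemma local_act_monomial_act:
  assumes l: "l < length d" and e: "length e = length d" and y: "length y = length d"
  shows "local_act (partial_dims l d e) l (monomial_kraus (d ! l) (e ! l) (\<pi> l) (\<mu> l t))
      (monomial_act d (partial_dims l d e) (partial_map l \<pi>) (partial_weight l \<mu> y) a)
    = monomial_act d (partial_dims (Suc l) d e) (partial_map (Suc l) \<pi>) (partial_weight (Suc l) \<mu> (y[l := t])) a"
    (is "local_act _ _ ?L ?a = ?b")
proof (rule supported_eqI)
  show "supported (partial_dims (Suc l) d e) (local_act (partial_dims l d e) l ?L ?a)"
    using supported_local_act[of "partial_dims l d e" l ?L] by (simp add: partial_dims_Suc[OF e l])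
  fix zs assume zs: "zs \<in> ibox (partial_dims (Suc l) d e)"
  then have len: "length zs = length d" and digit_less: "zs ! l < e ! l"
    using nth_ibox[OF zs, of l] l e by (auto simp: length_ibox nth_partial_dims)
  have update: "zs[l := x] \<in> ibox (partial_dims l d e)" if "x < d ! l" for x
    using list_update_in_ibox[OF zs that, of l] l e
    by (simp add: partial_dims_Suc) (metis less_irrefl list_update_id nth_partial_dims)
  let ?w = "\<lambda>xs. (\<Prod>j<length d. partial_weight l \<mu> y j (xs ! j)) * a xs"
  have collapse: "(\<Sum>x<d ! l. (if zs ! l = \<pi> l x then \<mu> l t x else 0) *
        (if relabel (partial_map l \<pi>) xs = zs[l := x] then ?w xs else 0))
      = (if relabel (partial_map (Suc l) \<pi>) xs = zs then \<mu> l t (xs ! l) * ?w xs else 0)"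
    if xs: "xs \<in> ibox d" for xs
  proof -
    have "(if zs ! l = \<pi> l x then \<mu> l t x else 0) *
          (if relabel (partial_map l \<pi>) xs = zs[l := x] then ?w xs else 0)
        = (if zs ! l = \<pi> l x \<and> relabel (partial_map l \<pi>) xs = zs[l := x] then \<mu> l t x * ?w xs else 0)" for x
      by simp
    also have "\<dots> x = (if x = xs ! l then
        if relabel (partial_map (Suc l) \<pi>) xs = zs then \<mu> l t x * ?w xs else 0 else 0)" for x
      using l len xs by (subst relabel_partial_map_Suc_iff) (auto simp: length_ibox)
    finally show ?thesis using nth_ibox[OF xs l] by simp
  qed
  have "local_act (partial_dims l d e) l ?L ?a zs = (\<Sum>x<d ! l. ?L $$ (zs ! l, x) * ?a (zs[l := x]))"
    using zs l e by (simp add: local_act_def partial_dims_Suc nth_partial_dims)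
  also have "\<dots> = (\<Sum>x<d ! l. \<Sum>xs\<in>ibox d. (if zs ! l = \<pi> l x then \<mu> l t x else 0) *
       (if relabel (partial_map l \<pi>) xs = zs[l := x] then ?w xs else 0))"
    using digit_less update by (intro sum.cong refl)
      (simp add: monomial_act_def monomial_kraus_def sum_distrib_left)
  also have "\<dots> = (\<Sum>xs\<in>ibox d. if relabel (partial_map (Suc l) \<pi>) xs = zs then \<mu> l t (xs ! l) * ?w xs else 0)"
    by (subst sum.swap) (simp add: collapse)
  also have "\<dots> = ?b zs"
    using zs l y by (simp add: monomial_act_def prod_partial_weight_Suc mult.assoc cong: if_cong)
  finally show "local_act (partial_dims l d e) l ?L ?a zs = ?b zs" .
qed (rule supported_monomial_act)

definition completions :: "nat list \<Rightarrow> nat \<Rightarrow> nat list \<Rightarrow> nat list set" where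
  "completions m l y = {y' \<in> ibox m. take l y' = take l y}"

lemma completions_0: "completions m 0 y = ibox m" by (simp add: completions_def)

lemma completions_length: "y \<in> ibox m \<Longrightarrow> completions m (length m) y = {y}"
  by (auto simp: completions_def length_ibox)

lemma completions_Suc:
  assumes l: "l < length m" and y: "length y = length m"
  shows "completions m l y = (\<Union>t<m ! l. completions m (Suc l) (y[l := t]))"
proof (intro Set.set_eqI iffI)
  fix y' assume "y' \<in> completions m l y"
  then have y': "y' \<in> ibox m" "take l y' = take l y" by (auto simp: completions_def)
  then have "take (Suc l) y' = take (Suc l) (y[l := y' ! l])"
    using y l by (simp add: take_Suc_conv_app_nth length_ibox)
  then show "y' \<in> (\<Union>t<m ! l. completions m (Suc l) (y[l := t]))"
    using y' nth_ibox[OF y'(1) l] by (auto simp: completions_def)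
next
  fix y' assume "y' \<in> (\<Union>t<m ! l. completions m (Suc l) (y[l := t]))"
  then obtain t where y': "y' \<in> ibox m" "take (Suc l) y' = take (Suc l) (y[l := t])"
    by (auto simp: completions_def)
  from arg_cong[OF this(2), of "take l"] show "y' \<in> completions m l y"
    using y'(1) by (simp add: min_def completions_def)
qed

lemma sum_completions_Suc:
  assumes l: "l < length m" and y: "length y = length m"
  shows "sum q (completions m l y) = (\<Sum>t<m ! l. sum q (completions m (Suc l) (y[l := t])))"
  unfolding completions_Suc[OF assms]
proof (rule sum.UNION_disjoint)
  show "\<forall>t\<in>{..<m ! l}. finite (completions m (Suc l) (y[l := t]))"
    by (auto simp: completions_def intro: finite_subset[OF _ finite_ibox[of m]])
  have "take (Suc l) (y[l := s]) \<noteq> take (Suc l) (y[l := t])" if "s \<noteq> t" for s t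
    using that assms by (simp add: take_Suc_conv_app_nth)
  then show "\<forall>s\<in>{..<m ! l}. \<forall>t\<in>{..<m ! l}. s \<noteq> t \<longrightarrow>
      completions m (Suc l) (y[l := s]) \<inter> completions m (Suc l) (y[l := t]) = {}"
    by (auto simp: completions_def)
qed simp

lemma pays_partial_monomial:
  assumes len: "length e = length d" "length m = length d"
    and epos: "\<And>j. j < length d \<Longrightarrow> 0 < e ! j"
    and \<pi>: "\<And>j x. j < length d \<Longrightarrow> x < d ! j \<Longrightarrow> \<pi> j x < e ! j"
    and complete: "\<And>j x x'. \<lbrakk>j < length d; x < d ! j; x' < d ! j; \<pi> j x = \<pi> j x'\<rbrakk>
        \<Longrightarrow> (\<Sum>t<m ! j. cnj (\<mu> j t x) * \<mu> j t x') = (if x = x' then 1 else 0)"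
    and final: "\<And>y. y \<in> ibox m \<Longrightarrow> pays H e (monomial_act d e \<pi> (\<lambda>j. \<mu> j (y ! j)) a) (q y)"
    and "l \<le> length d" "y \<in> ibox m"
  shows "pays H (partial_dims l d e)
    (monomial_act d (partial_dims l d e) (partial_map l \<pi>) (partial_weight l \<mu> y) a)
    (sum q (completions m l y))"
  using assms(7,8)
proof (induction l arbitrary: y rule: inc_induct)
  case base
  have "relabel (partial_map (length d) \<pi>) xs = relabel \<pi> xs" if "xs \<in> ibox d" for xs
    using that by (intro nth_equalityI) (auto simp: partial_map_def length_ibox)
  then have "monomial_act d e (partial_map (length d) \<pi>) (partial_weight (length d) \<mu> y) a
      = monomial_act d e \<pi> (\<lambda>j. \<mu> j (y ! j)) a"
    unfolding monomial_act_def by (intro ext if_cong refl sum.cong) (auto simp: partial_weight_def)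
  then show ?case using final[OF base] completions_length[OF base] len by (simp add: partial_dims_def)
next
  case (step l)
  have y: "length y = length d" using step.prems len by (simp add: length_ibox)
  show ?case
  proof (rule pays.round)
    show "l < length (partial_dims l d e)" using step.hyps len by simp
    show "instrument (partial_dims l d e ! l) (m ! l) (\<lambda>t. monomial_kraus (d ! l) (e ! l) (\<pi> l) (\<mu> l t))"
      using step.hyps len epos \<pi> complete by (auto simp: nth_partial_dims intro!: instrument_monomial_kraus)
    show "\<forall>t<m ! l. pays H ((partial_dims l d e)[l := dim_row (monomial_kraus (d ! l) (e ! l) (\<pi> l) (\<mu> l t))])
        (local_act (partial_dims l d e) l (monomial_kraus (d ! l) (e ! l) (\<pi> l) (\<mu> l t))
          (monomial_act d (partial_dims l d e) (partial_map l \<pi>) (partial_weight l \<mu> y) a))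
        (sum q (completions m (Suc l) (y[l := t])))"
      using step.IH list_update_in_ibox[OF step.prems, of _ _ l] step.hyps len y
      by (simp add: local_act_monomial_act partial_dims_Suc) (metis list_update_id)
    show "sum q (completions m l y) \<le> (\<Sum>t<m ! l. sum q (completions m (Suc l) (y[l := t])))"
      using sum_completions_Suc[of l m y q] step.hyps len y by simp
  qed
qed

text \<open>All parties measure, party \<open>j\<close> with the monomial Kraus operators
  \<open>|x\<rangle> \<mapsto> \<mu>\<^sub>j(y,x) |\<pi>\<^sub>j(x)\<rangle>\<close> for the outcomes \<open>y\<close>. Every protocol below is a composition of such rounds.\<close>

lemma pays_monomial:
  assumes len: "length e = length d" "length m = length d" and a: "supported d a"
    and epos: "\<And>j. j < length d \<Longrightarrow> 0 < e ! j"
    and \<pi>: "\<And>j x. j < length d \<Longrightarrow> x < d ! j \<Longrightarrow> \<pi> j x < e ! j"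
    and complete: "\<And>j x x'. \<lbrakk>j < length d; x < d ! j; x' < d ! j; \<pi> j x = \<pi> j x'\<rbrakk>
        \<Longrightarrow> (\<Sum>t<m ! j. cnj (\<mu> j t x) * \<mu> j t x') = (if x = x' then 1 else 0)"
    and final: "\<And>y. y \<in> ibox m \<Longrightarrow> pays H e (monomial_act d e \<pi> (\<lambda>j. \<mu> j (y ! j)) a) (q y)"
    and p: "p \<le> (\<Sum>y\<in>ibox m. q y)"
    and anti: "\<And>d' v q q'. H d' v q \<Longrightarrow> q' \<le> q \<Longrightarrow> H d' v q'"
  shows "pays H d a p"
proof -
  have "pays H d a (\<Sum>y\<in>ibox m. q y)"
  proof (cases "ibox m = {}")
    case True
    then obtain j where j: "j < length m" "m ! j = 0"
      using len by (auto simp: ibox_def) (metis length_replicate not_gr_zero nth_replicate)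
    then have "d ! j = 0" using complete[of j 0 0] len by (cases "d ! j") auto
    show ?thesis
    proof (rule pays.round)
      show "j < length d" using j len by simp
      show "instrument (d ! j) 0 undefined" using \<open>d ! j = 0\<close> by (simp add: instrument_def)
    qed (use True in auto)
  next
    case False
    then obtain y where y: "y \<in> ibox m" by blast
    have "monomial_act d d (partial_map 0 \<pi>) (partial_weight 0 \<mu> y) a = a"
      using monomial_act_id[OF a] by (simp add: partial_map_def[abs_def] partial_weight_def[abs_def])
    moreover have "pays H (partial_dims 0 d e)
        (monomial_act d (partial_dims 0 d e) (partial_map 0 \<pi>) (partial_weight 0 \<mu> y) a)
        (sum q (completions m 0 y))"
      by (rule pays_partial_monomial[OF len epos \<pi> complete final _ y]) auto
    ultimately show ?thesis by (simp add: completions_0 partial_dims_def)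
  qed
  then show ?thesis using p anti by (rule pays_antimono)
qed

section \<open>Tensor products and composition of conversions\<close>

definition dmul :: "nat list \<Rightarrow> nat list \<Rightarrow> nat list" where "dmul d f = map2 (*) d f"

definition join :: "nat list \<Rightarrow> nat list \<Rightarrow> nat list \<Rightarrow> nat list" where
  "join f xs ys = map (\<lambda>j. xs ! j * f ! j + ys ! j) [0..<length f]"

definition tensor :: "nat list \<Rightarrow> amp \<Rightarrow> nat list \<Rightarrow> amp \<Rightarrow> amp" where
  "tensor d a f b = (\<lambda>zs. if zs \<in> ibox (dmul d f) then a (map2 (div) zs f) * b (map2 (mod) zs f) else 0)"

lemma length_dmul [simp]: "length (dmul d f) = min (length d) (length f)" by (simp add: dmul_def)

lemma nth_dmul [simp]: "j < length d \<Longrightarrow> j < length f \<Longrightarrow> dmul d f ! j = d ! j * f ! j" by (simp add: dmul_def)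

lemma length_join [simp]: "length (join f xs ys) = length f" by (simp add: join_def)

lemma nth_join [simp]: "j < length f \<Longrightarrow> join f xs ys ! j = xs ! j * f ! j + ys ! j" by (simp add: join_def)

lemma mult_add_less_mult: "x < a \<Longrightarrow> y < b \<Longrightarrow> x * b + y < a * (b::nat)"
proof -
  assume "x < a" "y < b"
  then have "x * b + y < x * b + b" by simp
  also have "\<dots> = Suc x * b" by simp
  also have "\<dots> \<le> a * b" using \<open>x < a\<close> by (intro mult_le_mono1) simp
  finally show ?thesis .
qed

lemma less_mult_imp_pos: "x < a * b \<Longrightarrow> 0 < (b::nat)"
  by (cases b) auto

lemma join_in_ibox:
  "length d = length f \<Longrightarrow> xs \<in> ibox d \<Longrightarrow> ys \<in> ibox f \<Longrightarrow> join f xs ys \<in> ibox (dmul d f)"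
  by (auto simp: ibox_def mult_add_less_mult)

lemma div_join:
  "length d = length f \<Longrightarrow> xs \<in> ibox d \<Longrightarrow> ys \<in> ibox f \<Longrightarrow> map2 (div) (join f xs ys) f = xs"
  by (rule nth_equalityI) (auto simp: ibox_def)

lemma mod_join:
  "length d = length f \<Longrightarrow> xs \<in> ibox d \<Longrightarrow> ys \<in> ibox f \<Longrightarrow> map2 (mod) (join f xs ys) f = ys"
  by (rule nth_equalityI) (auto simp: ibox_def)

lemma div_in_ibox: "length d = length f \<Longrightarrow> zs \<in> ibox (dmul d f) \<Longrightarrow> map2 (div) zs f \<in> ibox d"
  by (auto simp: ibox_def less_mult_imp_div_less)

lemma mod_in_ibox: "length d = length f \<Longrightarrow> zs \<in> ibox (dmul d f) \<Longrightarrow> map2 (mod) zs f \<in> ibox f"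
proof -
  assume a: "length d = length f" "zs \<in> ibox (dmul d f)"
  then have "f ! i > 0" if "i < length f" for i using that nth_ibox[OF a(2), of i]
    by (auto dest: less_mult_imp_pos)
  then show ?thesis using a by (auto simp: ibox_def)
qed

lemma join_div_mod:
  "length d = length f \<Longrightarrow> zs \<in> ibox (dmul d f) \<Longrightarrow> join f (map2 (div) zs f) (map2 (mod) zs f) = zs"
  by (rule nth_equalityI) (auto simp: ibox_def div_mult_mod_eq)

lemma sum_ibox_dmul:
  assumes "length d = length f"
  shows "sum h (ibox (dmul d f)) = (\<Sum>xs\<in>ibox d. \<Sum>ys\<in>ibox f. h (join f xs ys))"
  unfolding sum.cartesian_product
  by (rule sum.reindex_bij_witness[of _ "\<lambda>(xs, ys). join f xs ys" "\<lambda>zs. (map2 (div) zs f, map2 (mod) zs f)"])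
     (use assms in \<open>auto simp: join_in_ibox div_join mod_join div_in_ibox mod_in_ibox join_div_mod\<close>)

lemma tensor_join:
  "length d = length f \<Longrightarrow> xs \<in> ibox d \<Longrightarrow> ys \<in> ibox f \<Longrightarrow> tensor d a f b (join f xs ys) = a xs * b ys"
  by (simp add: tensor_def join_in_ibox div_join mod_join)

lemma supported_tensor: "supported (dmul d f) (tensor d a f b)" by (simp add: supported_def tensor_def)

lemma ibox_dmul_cases:
  assumes "length d = length f" "zs \<in> ibox (dmul d f)"
  obtains xs ys where "xs \<in> ibox d" "ys \<in> ibox f" "zs = join f xs ys"
  using that[OF div_in_ibox[OF assms] mod_in_ibox[OF assms]] join_div_mod[OF assms] by simp

lemma tensor_eqI:
  assumes "length d = length f" "supported (dmul d f) c"
    "\<And>xs ys. xs \<in> ibox d \<Longrightarrow> ys \<in> ibox f \<Longrightarrow> c (join f xs ys) = a xs * b ys"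
  shows "c = tensor d a f b"
proof (rule supported_eqI[OF assms(2) supported_tensor])
  fix zs assume "zs \<in> ibox (dmul d f)"
  then obtain xs ys where "xs \<in> ibox d" "ys \<in> ibox f" "zs = join f xs ys"
    using ibox_dmul_cases[OF assms(1)] by blast
  then show "c zs = tensor d a f b zs" using assms(3) tensor_join[OF assms(1)] by simp
qed

lemma iprod_tensor:
  "length d = length f \<Longrightarrow> iprod (dmul d f) (tensor d a f b) (tensor d a' f b') = iprod d a a' * iprod f b b'"
  unfolding iprod_def sum_product by (simp add: sum_ibox_dmul tensor_join ac_simps)

lemma sqnorm_tensor: "length d = length f \<Longrightarrow> sqnorm (dmul d f) (tensor d a f b) = sqnorm d a * sqnorm f b"
  unfolding sqnorm_def sum_product by (simp add: sum_ibox_dmul tensor_join norm_mult power_mult_distrib)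

lemma sum_lessThan_mult:
  fixes h :: "nat \<Rightarrow> 'b::comm_monoid_add"
  shows "sum h {..<e * F} = (\<Sum>z<e. \<Sum>t<F. h (z * F + t))"
  unfolding sum.cartesian_product
proof (rule sum.reindex_bij_witness[of _ "\<lambda>(z, t). z * F + t" "\<lambda>x. (x div F, x mod F)"])
  fix x assume "x \<in> {..<e * F}"
  then have "x < e * F" by simp
  then have "F > 0" by (rule less_mult_imp_pos)
  then show "(x div F, x mod F) \<in> {..<e} \<times> {..<F}" using \<open>x < e * F\<close> by (simp add: less_mult_imp_div_less)
qed (auto simp: mult_add_less_mult)

definition ampliate :: "nat \<Rightarrow> nat \<Rightarrow> complex mat \<Rightarrow> complex mat" where
  "ampliate D F L = mat (dim_row L * F) (D * F)
     (\<lambda>(z, x). if z mod F = x mod F then L $$ (z div F, x div F) else 0)"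

lemma dim_row_ampliate [simp]: "dim_row (ampliate D F L) = dim_row L * F" by (simp add: ampliate_def)

lemma ampliate_entry:
  "\<lbrakk>z < dim_row L; x < D; t < F; s < F\<rbrakk>
    \<Longrightarrow> ampliate D F L $$ (z * F + t, x * F + s) = (if t = s then L $$ (z, x) else 0)"
  by (simp add: ampliate_def mult_add_less_mult)

lemma instrument_ampliate:
  assumes L: "instrument D m L" and F: "0 < F"
  shows "instrument (D * F) m (\<lambda>i. ampliate D F (L i))"
  unfolding instrument_def
proof (intro conjI allI impI)
  fix y y' assume "y < D * F" "y' < D * F"
  then have y: "y div F < D" "y' div F < D" "y mod F < F" "y' mod F < F"
    using F by (auto simp: less_mult_imp_div_less)
  let ?L = "\<lambda>i. ampliate D F (L i)"
  have entry: "?L i $$ (z * F + t, y) = (if t = y mod F then L i $$ (z, y div F) else 0)"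
    "?L i $$ (z * F + t, y') = (if t = y' mod F then L i $$ (z, y' div F) else 0)"
    if "z < dim_row (L i)" "t < F" for i z t
    using ampliate_entry[of z "L i" "y div F" D t F "y mod F"]
      ampliate_entry[of z "L i" "y' div F" D t F "y' mod F"] that y
    by simp_all
  have "(\<Sum>i<m. \<Sum>z<dim_row (?L i). cnj (?L i $$ (z, y)) * ?L i $$ (z, y'))
     = (\<Sum>i<m. \<Sum>z<dim_row (L i). \<Sum>t<F. if t = y mod F then
         (if y mod F = y' mod F then cnj (L i $$ (z, y div F)) * L i $$ (z, y' div F) else 0) else 0)"
    unfolding dim_row_ampliate sum_lessThan_mult by (intro sum.cong refl) (use entry in auto)
  also have "\<dots> = (if y mod F = y' mod F then
      (\<Sum>i<m. \<Sum>z<dim_row (L i). cnj (L i $$ (z, y div F)) * L i $$ (z, y' div F)) else 0)"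
    using y by simp
  also have "\<dots> = (if y mod F = y' mod F then (if y div F = y' div F then 1 else 0) else 0)"
    using L y by (simp add: instrument_def)
  also have "\<dots> = (if y = y' then 1 else 0)" by (metis div_mult_mod_eq)
  finally show "(\<Sum>i<m. \<Sum>z<dim_row (?L i). cnj (?L i $$ (z, y)) * ?L i $$ (z, y')) = (if y = y' then 1 else 0)" .
qed (use assms in \<open>auto simp: instrument_def ampliate_def\<close>)

lemma dmul_list_update:
  "j < length d \<Longrightarrow> length d = length f \<Longrightarrow> (dmul d f)[j := e * f ! j] = dmul (d[j := e]) f"
  by (intro nth_equalityI) (auto simp: nth_list_update)

lemma local_act_ampliate:
  assumes j: "j < length d" and len: "length d = length f"
  shows "local_act (dmul d f) j (ampliate (d ! j) (f ! j) L) (tensor d a f b)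
      = tensor (d[j := dim_row L]) (local_act d j L a) f b"
    (is "?lhs = tensor ?d _ _ _")
proof (rule tensor_eqI)
  let ?F = "f ! j" and ?L = "ampliate (d ! j) (f ! j) L"
  show len': "length ?d = length f" using len by simp
  have dims: "(dmul d f)[j := dim_row ?L] = dmul ?d f" using dmul_list_update[OF j len] by simp
  show "supported (dmul ?d f) ?lhs" using supported_local_act[of "dmul d f" j ?L] by (simp only: dims)
  fix xs ys assume xs: "xs \<in> ibox ?d" and ys: "ys \<in> ibox f"
  have lens: "length xs = length d" "length ys = length f" using xs ys by (auto simp: length_ibox)
  have entries: "xs ! j < dim_row L" "ys ! j < ?F" using nth_ibox[OF xs, of j] nth_ibox[OF ys, of j] j len
    by auto
  have join_update: "(join f xs ys)[j := x * ?F + ys ! j] = join f (xs[j := x]) ys" for x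
    using j lens len by (intro nth_equalityI) (auto simp: nth_list_update)
  have update: "xs[j := x] \<in> ibox d" if "x < d ! j" for x using list_update_in_ibox[OF xs that, of j] j by simp
  have "?lhs (join f xs ys) = (\<Sum>y<d ! j * ?F. ?L $$ (xs ! j * ?F + ys ! j, y)
      * tensor d a f b ((join f xs ys)[j := y]))"
    using join_in_ibox[OF len' xs ys] j len by (simp add: local_act_def dims del: dim_row_ampliate)
  also have "\<dots> = (\<Sum>x<d ! j. \<Sum>t<?F. ?L $$ (xs ! j * ?F + ys ! j, x * ?F + t)
      * tensor d a f b ((join f xs ys)[j := x * ?F + t]))"
    by (rule sum_lessThan_mult)
  also have "\<dots> = (\<Sum>x<d ! j. \<Sum>t<?F. if t = ys ! j
      then L $$ (xs ! j, x) * tensor d a f b ((join f xs ys)[j := x * ?F + ys ! j]) else 0)"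
    using entries by (intro sum.cong refl) (auto simp: ampliate_entry)
  also have "\<dots> = (\<Sum>x<d ! j. L $$ (xs ! j, x) * (a (xs[j := x]) * b ys))"
    using entries update ys len by (simp add: join_update tensor_join)
  also have "\<dots> = local_act d j L a xs * b ys"
    using xs by (simp add: local_act_def sum_distrib_right mult.assoc)
  finally show "?lhs (join f xs ys) = local_act d j L a xs * b ys" .
qed

lemma pays_tensor:
  assumes "pays H d a p" "length d = length f" "\<forall>x\<in>set f. 0 < x"
  shows "pays (\<lambda>D w q. \<exists>d' v. length d' = length f \<and> D = dmul d' f \<and> w = tensor d' v f b \<and> H d' v q)
    (dmul d f) (tensor d a f b) p"
  using assms
proof (induction rule: pays.induct)
  case (leaf d a p)
  then show ?case by (intro pays.leaf) auto
next
  case (round j d m L a q p)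
  then have j: "j < length d" "j < length f" by auto
  show ?case
  proof (rule pays.round)
    show "j < length (dmul d f)" using j by simp
    show "instrument (dmul d f ! j) m (\<lambda>i. ampliate (d ! j) (f ! j) (L i))"
      using instrument_ampliate[OF round(2), of "f ! j"] round.prems j by simp
    show "p \<le> sum q {..<m}" by (rule round)
  qed (use round j in \<open>simp add: local_act_ampliate dmul_list_update\<close>)
qed

type_synonym statevec = "nat list \<times> amp"

definition states :: "nat \<Rightarrow> statevec set" where
  "states k = {s. valid_dims k (fst s) \<and> supported (fst s) (snd s) \<and> sqnorm (fst s) (snd s) = 1}"

definition state_tensor :: "statevec \<Rightarrow> statevec \<Rightarrow> statevec" where
  "state_tensor s t = (dmul (fst s) (fst t), tensor (fst s) (snd s) (fst t) (snd t))"

definition target :: "statevec \<Rightarrow> nat list \<Rightarrow> amp \<Rightarrow> real \<Rightarrow> bool" where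
  "target t d v q \<longleftrightarrow> d = fst t \<and> q \<le> (cmod (iprod d (snd t) v))\<^sup>2"

definition converts :: "statevec \<Rightarrow> statevec \<Rightarrow> real \<Rightarrow> bool" where
  "converts s t p \<longleftrightarrow> pays (target t) (fst s) (snd s) p"

lemma target_antimono: "target t d v q \<Longrightarrow> q' \<le> q \<Longrightarrow> target t d v q'" by (auto simp: target_def)

lemma converts_antimono: "converts s t p \<Longrightarrow> q \<le> p \<Longrightarrow> converts s t q"
  unfolding converts_def by (erule pays_antimono) (auto intro: target_antimono)

lemma iprod_self: "iprod d a a = complex_of_real (sqnorm d a)"
  unfolding iprod_def sqnorm_def of_real_sum complex_norm_square by (simp add: mult.commute)

lemma states_length: "s \<in> states k \<Longrightarrow> length (fst s) = k" by (simp add: states_def valid_dims_def)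

lemma states_pos: "s \<in> states k \<Longrightarrow> x \<in> set (fst s) \<Longrightarrow> 0 < x" by (simp add: states_def valid_dims_def)

lemma states_nth_pos: "s \<in> states k \<Longrightarrow> j < k \<Longrightarrow> 0 < fst s ! j" by (simp add: states_def valid_dims_def)

lemma valid_dims_dmul: "valid_dims k d \<Longrightarrow> valid_dims k f \<Longrightarrow> valid_dims k (dmul d f)"
  unfolding valid_dims_def all_set_conv_all_nth by auto

lemma state_tensor_in_states: "s \<in> states k \<Longrightarrow> t \<in> states k \<Longrightarrow> state_tensor s t \<in> states k"
  using states_length[of s k] states_length[of t k]
  by (simp add: states_def state_tensor_def supported_tensor sqnorm_tensor valid_dims_dmul)

lemma converts_state_tensor:
  assumes "converts s t p" "s \<in> states k" "t \<in> states k" "u \<in> states k"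
  shows "converts (state_tensor s u) (state_tensor t u) p"
proof -
  have len: "length (fst s) = k" "length (fst t) = k" "length (fst u) = k" using assms states_length by auto
  have u: "iprod (fst u) (snd u) (snd u) = 1" using assms(4) by (simp add: iprod_self states_def)
  have "pays (\<lambda>D w q. \<exists>d' v. length d' = length (fst u) \<and> D = dmul d' (fst u)
        \<and> w = tensor d' v (fst u) (snd u) \<and> target t d' v q)
      (dmul (fst s) (fst u)) (tensor (fst s) (snd s) (fst u) (snd u)) p"
    using assms(1) len states_pos[OF assms(4)] unfolding converts_def by (intro pays_tensor) auto
  then show ?thesis
    unfolding converts_def state_tensor_def fst_conv snd_conv
  proof (rule pays_bind, elim exE conjE)
    fix d' v q D w
    assume "length d' = length (fst u)" "D = dmul d' (fst u)" "w = tensor d' v (fst u) (snd u)"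
      "target t d' v q"
    then show "pays (target (dmul (fst t) (fst u), tensor (fst t) (snd t) (fst u) (snd u))) D w q"
      using u by (intro pays.leaf) (auto simp: target_def iprod_tensor)
  qed
qed

lemma Cauchy_Schwarz_iprod: "(cmod (iprod d a b))\<^sup>2 \<le> sqnorm d a * sqnorm d b"
proof -
  have "cmod (iprod d a b) \<le> (\<Sum>x\<in>ibox d. cmod (a x) * cmod (b x))"
    unfolding iprod_def by (rule order_trans[OF norm_sum]) (simp add: norm_mult)
  then have "(cmod (iprod d a b))\<^sup>2 \<le> (\<Sum>x\<in>ibox d. cmod (a x) * cmod (b x))\<^sup>2"
    by (intro power_mono) auto
  also have "\<dots> \<le> sqnorm d a * sqnorm d b" unfolding sqnorm_def by (rule Cauchy_Schwarz_ineq_sum)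
  finally show ?thesis .
qed

lemma norm_add_sq_ge:
  fixes x y :: complex
  assumes "0 < \<eta>" "\<eta> < 1"
  shows "(1 - \<eta>) * (cmod x)\<^sup>2 - (cmod y)\<^sup>2 / \<eta> \<le> (cmod (x + y))\<^sup>2"
proof -
  have "cmod x \<le> cmod (x + y) + cmod y" by (metis add_diff_cancel_right' norm_triangle_ineq4)
  moreover have "cmod y \<le> cmod (x + y) + cmod x" by (metis add_diff_cancel_left' norm_triangle_ineq4)
  ultimately have "\<bar>cmod x - cmod y\<bar> \<le> cmod (x + y)" by linarith
  then have "(cmod x - cmod y)\<^sup>2 \<le> (cmod (x + y))\<^sup>2" by (metis abs_ge_zero power2_abs power_mono)
  moreover have "0 \<le> (sqrt \<eta> * cmod x - cmod y / sqrt \<eta>)\<^sup>2" by simp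
  then have "2 * cmod x * cmod y \<le> \<eta> * (cmod x)\<^sup>2 + (cmod y)\<^sup>2 / \<eta>"
    using assms by (simp add: power2_diff power_mult_distrib power_divide)
  ultimately show ?thesis by (simp add: power2_diff algebra_simps) (smt (verit) zero_le_power2)
qed

lemma iprod_add: "iprod d a (\<lambda>x. v x + w x) = iprod d a v + iprod d a w"
  by (simp add: iprod_def distrib_left sum.distrib)

lemma iprod_scale: "iprod d a (\<lambda>x. c * v x) = c * iprod d a v"
  by (simp add: iprod_def sum_distrib_left ac_simps)

lemma sqnorm_scale: "sqnorm d (\<lambda>x. c * v x) = (cmod c)\<^sup>2 * sqnorm d v"
  by (simp add: sqnorm_def sum_distrib_left norm_mult power_mult_distrib)

lemma local_act_add: "local_act d j L (\<lambda>x. v x + w x) = (\<lambda>x. local_act d j L v x + local_act d j L w x)"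
  by (auto simp: local_act_def distrib_left sum.distrib)

lemma local_act_scale: "local_act d j L (\<lambda>x. c * v x) = (\<lambda>x. c * local_act d j L v x)"
  by (auto simp: local_act_def sum_distrib_left ac_simps intro!: ext sum.cong)

text \<open>The expected payoff of a fixed protocol is a quadratic form in the input vector, hence stable under
  perturbations; this is what makes conversions with errors compose.\<close>

definition gain :: "statevec \<Rightarrow> nat list \<Rightarrow> (amp \<Rightarrow> real) \<Rightarrow> bool" where
  "gain t d G \<longleftrightarrow> (\<forall>v. pays (target t) d v (G v)) \<and>
     (\<forall>v w \<eta>. 0 < \<eta> \<longrightarrow> \<eta> < 1 \<longrightarrow> (1 - \<eta>) * G v - sqnorm d w / \<eta> \<le> G (\<lambda>x. v x + w x)) \<and>
     (\<forall>c v. G (\<lambda>x. c * v x) = (cmod c)\<^sup>2 * G v)"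

lemma gain_pays: "gain t d G \<Longrightarrow> pays (target t) d v (G v)"
  and gain_perturb: "gain t d G \<Longrightarrow> 0 < \<eta> \<Longrightarrow> \<eta> < 1 \<Longrightarrow> (1 - \<eta>) * G v - sqnorm d w / \<eta> \<le> G (\<lambda>x. v x + w x)"
  and gain_scale: "gain t d G \<Longrightarrow> G (\<lambda>x. c * v x) = (cmod c)\<^sup>2 * G v"
  by (simp_all add: gain_def)

lemma gain_overlap:
  assumes "sqnorm (fst t) (snd t) \<le> 1"
  shows "gain t (fst t) (\<lambda>v. (cmod (iprod (fst t) (snd t) v))\<^sup>2)"
  unfolding gain_def
proof (intro conjI allI impI)
  fix v show "pays (target t) (fst t) v ((cmod (iprod (fst t) (snd t) v))\<^sup>2)"
    by (intro pays.leaf) (auto simp: target_def)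
next
  fix v w and \<eta> :: real assume \<eta>: "0 < \<eta>" "\<eta> < 1"
  have "(cmod (iprod (fst t) (snd t) w))\<^sup>2 \<le> sqnorm (fst t) (snd t) * sqnorm (fst t) w"
    by (rule Cauchy_Schwarz_iprod)
  also have "\<dots> \<le> 1 * sqnorm (fst t) w" using assms by (intro mult_right_mono sqnorm_nonneg)
  finally have "(cmod (iprod (fst t) (snd t) w))\<^sup>2 / \<eta> \<le> sqnorm (fst t) w / \<eta>"
    using \<eta> by (simp add: divide_right_mono)
  then show "(1 - \<eta>) * (cmod (iprod (fst t) (snd t) v))\<^sup>2 - sqnorm (fst t) w / \<eta>
      \<le> (cmod (iprod (fst t) (snd t) (\<lambda>x. v x + w x)))\<^sup>2"
    using norm_add_sq_ge[of \<eta> "iprod (fst t) (snd t) v" "iprod (fst t) (snd t) w"] \<eta>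
    unfolding iprod_add by linarith
next
  fix c v show "(cmod (iprod (fst t) (snd t) (\<lambda>x. c * v x)))\<^sup>2
      = (cmod c)\<^sup>2 * (cmod (iprod (fst t) (snd t) v))\<^sup>2"
    by (simp add: iprod_scale norm_mult power_mult_distrib)
qed

lemma gain_round:
  assumes j: "j < length d" and L: "instrument (d ! j) m L"
    and G: "\<And>i. i < m \<Longrightarrow> gain t (d[j := dim_row (L i)]) (G i)"
  shows "gain t d (\<lambda>v. \<Sum>i<m. G i (local_act d j (L i) v))" (is "gain t d ?K")
  unfolding gain_def
proof (intro conjI allI impI)
  fix v show "pays (target t) d v (?K v)"
    using G gain_pays by (intro pays.round[OF j L, where q = "\<lambda>i. G i (local_act d j (L i) v)"]) auto
next
  fix v w and \<eta> :: real assume \<eta>: "0 < \<eta>" "\<eta> < 1"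
  have "(1 - \<eta>) * ?K v - sqnorm d w / \<eta>
    = (\<Sum>i<m. (1 - \<eta>) * G i (local_act d j (L i) v)
        - sqnorm (d[j := dim_row (L i)]) (local_act d j (L i) w) / \<eta>)"
    using sum_sqnorm_local_act[OF j L, of w]
    by (simp add: sum_subtractf sum_distrib_left sum_divide_distrib[symmetric])
  also have "\<dots> \<le> ?K (\<lambda>x. v x + w x)"
    unfolding local_act_add using G gain_perturb \<eta> by (intro sum_mono) blast
  finally show "(1 - \<eta>) * ?K v - sqnorm d w / \<eta> \<le> ?K (\<lambda>x. v x + w x)" .
next
  fix c v show "?K (\<lambda>x. c * v x) = (cmod c)\<^sup>2 * ?K v"
    unfolding local_act_scale sum_distrib_left using G gain_scale by (intro sum.cong refl) blast
qed

lemma pays_imp_gain: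
  assumes "pays (target t) d a p" "sqnorm (fst t) (snd t) \<le> 1"
  shows "\<exists>G. p \<le> G a \<and> gain t d G"
  using assms
proof (induction rule: pays.induct)
  case (leaf d a p)
  then show ?case
    using gain_overlap[of t] by (intro exI[of _ "\<lambda>v. (cmod (iprod d (snd t) v))\<^sup>2"]) (auto simp: target_def)
next
  case (round j d m L a q p)
  then have "\<exists>G. \<forall>i<m. q i \<le> G i (local_act d j (L i) a) \<and> gain t (d[j := dim_row (L i)]) (G i)" by metis
  then obtain G where G: "\<And>i. i < m \<Longrightarrow> q i \<le> G i (local_act d j (L i) a) \<and> gain t (d[j := dim_row (L i)]) (G i)"
    by blast
  have "p \<le> (\<Sum>i<m. q i)" by (rule round)
  also have "\<dots> \<le> (\<Sum>i<m. G i (local_act d j (L i) a))" using G by (intro sum_mono) auto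
  finally have "p \<le> (\<Sum>i<m. G i (local_act d j (L i) a))" .
  moreover have "gain t d (\<lambda>v. \<Sum>i<m. G i (local_act d j (L i) v))"
    using G by (intro gain_round[OF round(1,2)]) blast
  ultimately show ?case by (intro exI[of _ "\<lambda>v. \<Sum>i<m. G i (local_act d j (L i) v)"]) simp
qed

lemma pays_scale:
  assumes "pays (target t) d a p" "sqnorm (fst t) (snd t) \<le> 1"
  shows "pays (target t) d (\<lambda>x. c * a x) ((cmod c)\<^sup>2 * p)"
proof -
  obtain G where G: "p \<le> G a" "gain t d G" using pays_imp_gain[OF assms] by blast
  have "pays (target t) d (\<lambda>x. c * a x) ((cmod c)\<^sup>2 * G a)"
    using gain_pays[OF G(2), of "\<lambda>x. c * a x"] unfolding gain_scale[OF G(2)] .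
  moreover have "(cmod c)\<^sup>2 * p \<le> (cmod c)\<^sup>2 * G a" using G(1) by (simp add: mult_left_mono)
  ultimately show ?thesis by (rule pays_antimono) (rule target_antimono)
qed

lemma sqnorm_orthogonal_part:
  assumes "sqnorm d e = 1"
  shows "sqnorm d (\<lambda>x. v x - iprod d e v * e x) = sqnorm d v - (cmod (iprod d e v))\<^sup>2"
proof -
  define \<alpha> where "\<alpha> = iprod d e v"
  let ?w = "\<lambda>x. v x - \<alpha> * e x"
  have "complex_of_real (sqnorm d ?w) = iprod d ?w ?w" by (simp add: iprod_self)
  also have "\<dots> = (\<Sum>x\<in>ibox d. cnj (v x) * v x - \<alpha> * cnj (v x) * e x - cnj \<alpha> * (cnj (e x) * v x)
      + cnj \<alpha> * \<alpha> * (cnj (e x) * e x))"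
    unfolding iprod_def by (intro sum.cong refl) (simp add: algebra_simps)
  also have "\<dots> = iprod d v v - \<alpha> * cnj \<alpha> - cnj \<alpha> * \<alpha> + cnj \<alpha> * \<alpha> * iprod d e e"
    unfolding sum_subtractf sum.distrib sum_distrib_left[symmetric] mult.assoc \<alpha>_def iprod_def
    by (simp add: cnj_sum ac_simps)
  also have "\<dots> = complex_of_real (sqnorm d v - (cmod \<alpha>)\<^sup>2)"
    using assms by (simp add: iprod_self complex_norm_square[symmetric] mult.commute[of "cnj \<alpha>"])
  finally show ?thesis unfolding \<alpha>_def using of_real_eq_iff by blast
qed

lemma gain_ge_overlap:
  assumes t: "sqnorm (fst t) (snd t) = 1" and G: "gain u (fst t) G" "p' \<le> G (snd t)"
    and q: "q \<le> (cmod (iprod (fst t) (snd t) v))\<^sup>2" and "0 \<le> p'" and \<eta>: "0 < \<eta>" "\<eta> < 1"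
  shows "(1 - \<eta>) * q * p' - (sqnorm (fst t) v - q) / \<eta> \<le> G v"
proof -
  define \<alpha> where "\<alpha> = iprod (fst t) (snd t) v"
  define w where "w = (\<lambda>x. v x - \<alpha> * snd t x)"
  have w: "sqnorm (fst t) w = sqnorm (fst t) v - (cmod \<alpha>)\<^sup>2"
    unfolding w_def \<alpha>_def by (rule sqnorm_orthogonal_part[OF t])
  have v: "v = (\<lambda>x. \<alpha> * snd t x + w x)" by (simp add: w_def)
  have "(1 - \<eta>) * ((cmod \<alpha>)\<^sup>2 * G (snd t)) - sqnorm (fst t) w / \<eta> \<le> G v"
    using gain_perturb[OF G(1) \<eta>, of "\<lambda>x. \<alpha> * snd t x" w] v unfolding gain_scale[OF G(1)] by simp
  moreover have "(1 - \<eta>) * (q * p') \<le> (1 - \<eta>) * ((cmod \<alpha>)\<^sup>2 * G (snd t))"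
    using q G(2) \<open>0 \<le> p'\<close> \<eta> by (intro mult_left_mono mult_mono) (auto simp: \<alpha>_def)
  moreover have "sqnorm (fst t) w / \<eta> \<le> (sqnorm (fst t) v - q) / \<eta>"
    using w q \<eta> by (intro divide_right_mono) (auto simp: \<alpha>_def)
  ultimately show ?thesis by (simp add: mult.assoc)
qed

lemma pays_compose:
  assumes "pays (target t) d a p"
    and t: "sqnorm (fst t) (snd t) = 1" and u: "sqnorm (fst u) (snd u) \<le> 1"
    and tu: "pays (target u) (fst t) (snd t) p'" and p': "0 \<le> p'" and \<eta>: "0 < \<eta>" "\<eta> < 1"
  shows "pays (target u) d a ((1 - \<eta>) * p * p' - (sqnorm d a - p) / \<eta>)"
proof -
  obtain G where G: "p' \<le> G (snd t)" "gain u (fst t) G" using pays_imp_gain[OF tu u] by blast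
  show ?thesis
    using assms(1)
  proof (induction rule: pays.induct)
    case (leaf d v q)
    then have d: "d = fst t" and q: "q \<le> (cmod (iprod (fst t) (snd t) v))\<^sup>2" by (auto simp: target_def)
    show ?case
      unfolding d
      by (rule pays_antimono[OF gain_pays[OF G(2)] gain_ge_overlap[OF t G(2,1) q p' \<eta>] target_antimono])
  next
    case (round j d m L a q p)
    show ?case
    proof (rule pays.round[OF round(1,2)])
      show "\<forall>i<m. pays (target u) (d[j := dim_row (L i)]) (local_act d j (L i) a)
         ((1 - \<eta>) * q i * p' - (sqnorm (d[j := dim_row (L i)]) (local_act d j (L i) a) - q i) / \<eta>)"
        using round by blast
      have "(\<Sum>i<m. (1 - \<eta>) * q i * p' - (sqnorm (d[j := dim_row (L i)]) (local_act d j (L i) a) - q i) / \<eta>)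
         = (1 - \<eta>) * sum q {..<m} * p' - (sqnorm d a - sum q {..<m}) / \<eta>"
        using sum_sqnorm_local_act[OF round(1,2), of a]
        by (simp add: sum_subtractf sum_distrib_left sum_distrib_right sum_divide_distrib[symmetric])
      moreover have "(1 - \<eta>) * p * p' \<le> (1 - \<eta>) * sum q {..<m} * p'"
        using round(3) \<eta> p' by (intro mult_right_mono mult_left_mono) auto
      moreover have "(sqnorm d a - sum q {..<m}) / \<eta> \<le> (sqnorm d a - p) / \<eta>"
        using round(3) \<eta> by (intro divide_right_mono) auto
      ultimately show "(1 - \<eta>) * p * p' - (sqnorm d a - p) / \<eta> \<le>
        (\<Sum>i<m. (1 - \<eta>) * q i * p' - (sqnorm (d[j := dim_row (L i)]) (local_act d j (L i) a) - q i) / \<eta>)"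
        by linarith
    qed
  qed
qed

lemma converts_compose:
  assumes "converts s t p" "converts t u p'" "s \<in> states k" "t \<in> states k" "u \<in> states k"
    and "0 \<le> p'" "0 < \<eta>" "\<eta> < 1"
  shows "converts s u ((1 - \<eta>) * p * p' - (1 - p) / \<eta>)"
  using pays_compose[of t "fst s" "snd s" p u p' \<eta>] assms by (auto simp: converts_def states_def)

section \<open>Relabellings and multisets of states\<close>

definition relabelling :: "nat list \<Rightarrow> nat list \<Rightarrow> (nat \<Rightarrow> nat \<Rightarrow> nat) \<Rightarrow> (nat \<Rightarrow> nat \<Rightarrow> complex) \<Rightarrow> bool" where
  "relabelling d e \<pi> c \<longleftrightarrow> length e = length d \<and>
     (\<forall>j<length d. (\<forall>x<d ! j. \<pi> j x < e ! j \<and> cmod (c j x) = 1) \<and> inj_on (\<pi> j) {..<d ! j})"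

lemma mult_add_div [simp]: "y < b \<Longrightarrow> (x * b + y) div b = (x::nat)" by simp

lemma cnj_mult_self: "cmod z = 1 \<Longrightarrow> cnj z * z = 1"
  by (metis complex_norm_square mult.commute of_real_1 one_power2)

lemma relabel_in_ibox: "relabelling d e \<pi> c \<Longrightarrow> xs \<in> ibox d \<Longrightarrow> relabel \<pi> xs \<in> ibox e"
  by (auto simp: relabelling_def ibox_def)

lemma inj_on_relabel:
  assumes r: "relabelling d e \<pi> c" and xs: "xs \<in> ibox d" and ys: "ys \<in> ibox d"
    and same: "relabel \<pi> xs = relabel \<pi> ys"
  shows "xs = ys"
proof (rule nth_equalityI)
  show "length xs = length ys" using xs ys by (simp add: length_ibox)
  fix j assume j: "j < length xs"
  then have j_less: "j < length d" using xs by (simp add: length_ibox)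
  have "relabel \<pi> xs ! j = relabel \<pi> ys ! j" using same by simp
  then have "\<pi> j (xs ! j) = \<pi> j (ys ! j)" using j j_less ys by (simp add: length_ibox)
  then show "xs ! j = ys ! j"
    using r j_less nth_ibox[OF xs j_less] nth_ibox[OF ys j_less] by (auto simp: relabelling_def inj_on_def)
qed

lemma monomial_act_relabel:
  assumes r: "relabelling d e \<pi> c" and xs: "xs \<in> ibox d"
  shows "monomial_act d e \<pi> c a (relabel \<pi> xs) = (\<Prod>j<length d. c j (xs ! j)) * a xs"
proof -
  have "monomial_act d e \<pi> c a (relabel \<pi> xs)
      = (\<Sum>ys\<in>ibox d. if ys = xs then (\<Prod>j<length d. c j (ys ! j)) * a ys else 0)"
    unfolding monomial_act_def if_P[OF relabel_in_ibox[OF r xs]]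
    by (intro sum.cong refl if_cong iffI) (auto intro: inj_on_relabel[OF r _ xs])
  then show ?thesis using xs by simp
qed

lemma monomial_act_outside_range: "zs \<notin> relabel \<pi> ` ibox d \<Longrightarrow> monomial_act d e \<pi> c a zs = 0"
  by (auto simp: monomial_act_def intro!: sum.neutral)

lemma monomial_act_eqI:
  assumes r: "relabelling d e \<pi> c" and b: "supported e b"
    and range: "\<And>xs. xs \<in> ibox d \<Longrightarrow> b (relabel \<pi> xs) = (\<Prod>j<length d. c j (xs ! j)) * a xs"
    and outside: "\<And>zs. zs \<in> ibox e \<Longrightarrow> zs \<notin> relabel \<pi> ` ibox d \<Longrightarrow> b zs = 0"
  shows "monomial_act d e \<pi> c a = b"
proof (rule supported_eqI[OF supported_monomial_act b])
  fix zs assume zs: "zs \<in> ibox e"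
  show "monomial_act d e \<pi> c a zs = b zs"
  proof (cases "zs \<in> relabel \<pi> ` ibox d")
    case True
    then obtain xs where "zs = relabel \<pi> xs" "xs \<in> ibox d" by blast
    then show ?thesis using monomial_act_relabel[OF r] range by simp
  next
    case False then show ?thesis using monomial_act_outside_range outside[OF zs] by simp
  qed
qed

lemma monomial_act_sum:
  "monomial_act d e \<pi> c (\<lambda>x. \<Sum>i\<in>I. w i * a i x) = (\<lambda>x. \<Sum>i\<in>I. w i * monomial_act d e \<pi> c (a i) x)"
proof
  fix zs
  have "(\<Sum>xs\<in>ibox d. if relabel \<pi> xs = zs then (\<Prod>j<length d. c j (xs ! j)) * (\<Sum>i\<in>I. w i * a i xs) else 0)
    = (\<Sum>xs\<in>ibox d. \<Sum>i\<in>I. w i * (if relabel \<pi> xs = zs then (\<Prod>j<length d. c j (xs ! j)) * a i xs else 0))"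
    by (intro sum.cong refl) (simp add: sum_distrib_left mult.left_commute)
  also have "\<dots> = (\<Sum>i\<in>I. w i *
      (\<Sum>xs\<in>ibox d. if relabel \<pi> xs = zs then (\<Prod>j<length d. c j (xs ! j)) * a i xs else 0))"
    by (subst sum.swap) (simp add: sum_distrib_left)
  finally show "monomial_act d e \<pi> c (\<lambda>x. \<Sum>i\<in>I. w i * a i x) zs = (\<Sum>i\<in>I. w i * monomial_act d e \<pi> c (a i) zs)"
    by (simp add: monomial_act_def)
qed

definition relabel_map :: "nat list \<Rightarrow> nat list \<Rightarrow> (amp \<Rightarrow> amp) \<Rightarrow> bool" where
  "relabel_map d e T \<longleftrightarrow> (\<exists>\<pi> c. relabelling d e \<pi> c \<and> T = monomial_act d e \<pi> c)"

lemma relabel_map_length: "relabel_map d e T \<Longrightarrow> length e = length d"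
  by (auto simp: relabel_map_def relabelling_def)

lemma relabel_map_sum: "relabel_map d e T \<Longrightarrow> T (\<lambda>x. \<Sum>i\<in>I. w i * a i x) = (\<lambda>x. \<Sum>i\<in>I. w i * T (a i) x)"
  by (auto simp: relabel_map_def monomial_act_sum)

lemma relabel_map_iprod:
  assumes "relabel_map d e T"
  shows "iprod e (T a) (T b) = iprod d a b"
proof -
  obtain \<pi> c where r: "relabelling d e \<pi> c" and T: "T = monomial_act d e \<pi> c"
    using assms by (auto simp: relabel_map_def)
  have inj: "inj_on (relabel \<pi>) (ibox d)" using inj_on_relabel[OF r] by (auto simp: inj_on_def)
  have "iprod e (T a) (T b) = (\<Sum>zs\<in>relabel \<pi> ` ibox d. cnj (T a zs) * T b zs)"
    unfolding iprod_def
  proof (rule sum.mono_neutral_right)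
    show "relabel \<pi> ` ibox d \<subseteq> ibox e" using relabel_in_ibox[OF r] by blast
    show "\<forall>i\<in>ibox e - relabel \<pi> ` ibox d. cnj (T a i) * T b i = 0" using monomial_act_outside_range T by auto
  qed simp
  also have "\<dots> = (\<Sum>xs\<in>ibox d. cnj (T a (relabel \<pi> xs)) * T b (relabel \<pi> xs))"
    by (simp add: sum.reindex[OF inj])
  also have "\<dots> = (\<Sum>xs\<in>ibox d. cnj (a xs) * b xs)"
  proof (rule sum.cong[OF refl])
    fix xs assume xs: "xs \<in> ibox d"
    let ?C = "\<Prod>j<length d. c j (xs ! j)"
    have "cmod ?C = 1" unfolding prod_norm[symmetric]
      using r nth_ibox[OF xs] by (intro prod.neutral) (auto simp: relabelling_def)
    then have "cnj ?C * ?C = 1" by (rule cnj_mult_self)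
    then show "cnj (T a (relabel \<pi> xs)) * T b (relabel \<pi> xs) = cnj (a xs) * b xs"
      unfolding T monomial_act_relabel[OF r xs] complex_cnj_mult
      by (metis (no_types, lifting) mult.assoc mult.left_commute mult_1)
  qed
  finally show ?thesis by (simp add: iprod_def)
qed

lemma pays_relabel_map:
  assumes T: "relabel_map d e T" and a: "supported d a" and e: "\<forall>x\<in>set e. 0 < x" and p: "pays H e (T a) q"
    and anti: "\<And>d' v q q'. H d' v q \<Longrightarrow> q' \<le> q \<Longrightarrow> H d' v q'"
  shows "pays H d a q"
proof -
  obtain \<pi> c where r: "relabelling d e \<pi> c" and T: "T = monomial_act d e \<pi> c"
    using T by (auto simp: relabel_map_def)
  show ?thesis
  proof (rule pays_monomial[where e = e and m = "replicate (length d) 1" and \<pi> = \<pi> and \<mu> = "\<lambda>j t. c j"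
    and q = "\<lambda>_. q"])
    show "length e = length d" using r by (simp add: relabelling_def)
    show "0 < e ! j" if "j < length d" for j using e r that by (simp add: relabelling_def)
    show "\<pi> j x < e ! j" if "j < length d" "x < d ! j" for j x using r that by (simp add: relabelling_def)
    show "(\<Sum>t<replicate (length d) (1::nat) ! j. cnj (c j x) * c j x') = (if x = x' then 1 else 0)"
      if "j < length d" "x < d ! j" "x' < d ! j" "\<pi> j x = \<pi> j x'" for j x x'
    proof -
      have "x = x'" using r that by (auto simp: relabelling_def inj_on_def)
      moreover have "cmod (c j x) = 1" using r that by (simp add: relabelling_def)
      ultimately show ?thesis using that by (simp add: cnj_mult_self)
    qed
    show "pays H e (monomial_act d e \<pi> (\<lambda>j. c j) a) q" using p T by simp
    show "q \<le> (\<Sum>y\<in>ibox (replicate (length d) 1). q)" unfolding ibox_ones by simp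
  qed (use a anti in auto)
qed

lemma relabel_map_comp:
  assumes T: "relabel_map d e T" and T': "relabel_map e f T'"
  shows "\<exists>U. relabel_map d f U \<and> (\<forall>a. U a = T' (T a))"
proof -
  obtain \<pi> c where r: "relabelling d e \<pi> c" and T: "T = monomial_act d e \<pi> c"
    using T by (auto simp: relabel_map_def)
  obtain \<pi>' c' where r': "relabelling e f \<pi>' c'" and T': "T' = monomial_act e f \<pi>' c'"
    using T' by (auto simp: relabel_map_def)
  define \<rho> where "\<rho> = (\<lambda>j x. \<pi>' j (\<pi> j x))"
  define b where "b = (\<lambda>j x. c j x * c' j (\<pi> j x))"
  have composite: "relabelling d f \<rho> b"
    using r r' by (auto simp: relabelling_def \<rho>_def b_def norm_mult inj_on_def)
  have compose: "relabel \<rho> xs = relabel \<pi>' (relabel \<pi> xs)" for xs by (rule nth_equalityI) (auto simp: \<rho>_def)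
  have "monomial_act d f \<rho> b a = T' (T a)" for a
  proof (rule monomial_act_eqI[OF composite])
    show "supported f (T' (T a))" by (simp add: T' supported_monomial_act)
    fix xs assume xs: "xs \<in> ibox d"
    have "T' (T a) (relabel \<rho> xs) = (\<Prod>j<length e. c' j (relabel \<pi> xs ! j)) * T a (relabel \<pi> xs)"
      unfolding compose T' by (rule monomial_act_relabel[OF r' relabel_in_ibox[OF r xs]])
    also have "\<dots> = (\<Prod>j<length e. c' j (relabel \<pi> xs ! j)) * ((\<Prod>j<length d. c j (xs ! j)) * a xs)"
      unfolding T monomial_act_relabel[OF r xs] ..
    also have "(\<Prod>j<length e. c' j (relabel \<pi> xs ! j)) = (\<Prod>j<length d. c' j (\<pi> j (xs ! j)))"
      using r xs by (intro prod.cong) (auto simp: relabelling_def length_ibox)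
    finally show "T' (T a) (relabel \<rho> xs) = (\<Prod>j<length d. b j (xs ! j)) * a xs"
      by (simp add: b_def prod.distrib)
  next
    fix zs assume zs: "zs \<notin> relabel \<rho> ` ibox d"
    show "T' (T a) zs = 0"
    proof (cases "zs \<in> relabel \<pi>' ` ibox e")
      case False then show ?thesis unfolding T' by (rule monomial_act_outside_range)
    next
      case True
      then obtain ys where ys: "zs = relabel \<pi>' ys" "ys \<in> ibox e" by blast
      then have "ys \<notin> relabel \<pi> ` ibox d" using zs compose by auto
      then have "T a ys = 0" unfolding T by (rule monomial_act_outside_range)
      then show ?thesis unfolding ys(1) T' monomial_act_relabel[OF r' ys(2)] by simp
    qed
  qed
  then show ?thesis using composite by (auto simp: relabel_map_def)
qed

lemma relabelling_swap:
  assumes "length d = length f"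
  shows "relabelling (dmul d f) (dmul f d) (\<lambda>j x. (x mod f ! j) * d ! j + x div f ! j) (\<lambda>_ _. 1)"
  unfolding relabelling_def
proof (intro conjI allI impI)
  fix j assume "j < length (dmul d f)"
  then have j: "j < length d" "j < length f" by auto
  let ?\<pi> = "\<lambda>x. (x mod f ! j) * d ! j + x div f ! j"
  show "?\<pi> x < dmul f d ! j" if "x < dmul d f ! j" for x
    using that j by (auto intro!: mult_add_less_mult dest: less_mult_imp_pos simp: less_mult_imp_div_less)
  show "inj_on ?\<pi> {..<dmul d f ! j}"
  proof (rule inj_onI)
    fix x y assume "x \<in> {..<dmul d f ! j}" "y \<in> {..<dmul d f ! j}" and same: "?\<pi> x = ?\<pi> y"
    then have "x div f ! j < d ! j" "y div f ! j < d ! j" using j by (auto simp: less_mult_imp_div_less)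
    then have "?\<pi> x div d ! j = x mod f ! j" "?\<pi> y div d ! j = y mod f ! j"
      "?\<pi> x mod d ! j = x div f ! j" "?\<pi> y mod d ! j = y div f ! j" by auto
    then show "x = y" using same by (metis div_mult_mod_eq)
  qed
qed (use assms in auto)

lemma relabel_map_swap:
  assumes len: "length d = length f"
  shows "\<exists>T. relabel_map (dmul d f) (dmul f d) T \<and> (\<forall>a b. T (tensor d a f b) = tensor f b d a)"
proof -
  let ?\<pi> = "\<lambda>j x. (x mod f ! j) * d ! j + x div f ! j"
  have swap: "relabel ?\<pi> (join f xs ys) = join d ys xs" if "ys \<in> ibox f" for xs ys
    using nth_ibox[OF that] len by (intro nth_equalityI) auto
  have "monomial_act (dmul d f) (dmul f d) ?\<pi> (\<lambda>_ _. 1) (tensor d a f b) = tensor f b d a" for a b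
  proof (rule monomial_act_eqI[OF relabelling_swap[OF len] supported_tensor])
    fix zs assume "zs \<in> ibox (dmul d f)"
    then obtain xs ys where "xs \<in> ibox d" "ys \<in> ibox f" "zs = join f xs ys" using ibox_dmul_cases[OF len]
      by blast
    then show "tensor f b d a (relabel ?\<pi> zs) = (\<Prod>j<length (dmul d f). 1) * tensor d a f b zs"
      using swap len by (simp add: tensor_join)
  next
    fix zs assume "zs \<in> ibox (dmul f d)" and outside: "zs \<notin> relabel ?\<pi> ` ibox (dmul d f)"
    then obtain ys xs where z: "ys \<in> ibox f" "xs \<in> ibox d" "zs = join d ys xs"
      using ibox_dmul_cases[OF len[symmetric]] by blast
    then have "zs = relabel ?\<pi> (join f xs ys)" using swap by simp
    then show "tensor f b d a zs = 0" using outside join_in_ibox[OF len z(2,1)] by blast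
  qed
  then show ?thesis using relabelling_swap[OF len] by (auto simp: relabel_map_def)
qed

lemma relabelling_ampliate:
  assumes r: "relabelling d e \<pi> c" and len: "length d = length f"
  shows "relabelling (dmul d f) (dmul e f) (\<lambda>j x. \<pi> j (x div f ! j) * f ! j + x mod f ! j)
      (\<lambda>j x. c j (x div f ! j))"
  unfolding relabelling_def
proof (intro conjI allI impI)
  show "length (dmul e f) = length (dmul d f)" using r len by (simp add: relabelling_def)
  fix j assume "j < length (dmul d f)"
  then have j: "j < length d" "j < length f" "j < length e" using r by (auto simp: relabelling_def)
  let ?\<rho> = "\<lambda>x. \<pi> j (x div f ! j) * f ! j + x mod f ! j"
  have div: "x div f ! j < d ! j" if "x < dmul d f ! j" for x using that j by (simp add: less_mult_imp_div_less)
  then show "?\<rho> x < dmul e f ! j" "cmod (c j (x div f ! j)) = 1" if "x < dmul d f ! j" for x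
    using that r j by (auto simp: relabelling_def intro!: mult_add_less_mult dest: less_mult_imp_pos)
  show "inj_on ?\<rho> {..<dmul d f ! j}"
  proof (rule inj_onI)
    fix x y assume xy: "x \<in> {..<dmul d f ! j}" "y \<in> {..<dmul d f ! j}" and same: "?\<rho> x = ?\<rho> y"
    then have f: "0 < f ! j" using j by (auto dest: less_mult_imp_pos)
    have mod: "x mod f ! j = y mod f ! j" using arg_cong[OF same, of "\<lambda>z. z mod f ! j"] by simp
    then have "\<pi> j (x div f ! j) = \<pi> j (y div f ! j)" using same f by simp
    then have "x div f ! j = y div f ! j" using div xy r j by (auto simp: relabelling_def inj_on_def)
    then show "x = y" using mod by (metis div_mult_mod_eq)
  qed
qed

lemma relabel_map_tensor_right:
  assumes T: "relabel_map d e T" and len: "length d = length f"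
  shows "\<exists>U. relabel_map (dmul d f) (dmul e f) U \<and> (\<forall>a b. U (tensor d a f b) = tensor e (T a) f b)"
proof -
  obtain \<pi> c where r: "relabelling d e \<pi> c" and T: "T = monomial_act d e \<pi> c"
    using T by (auto simp: relabel_map_def)
  have len': "length e = length f" using r len by (simp add: relabelling_def)
  let ?\<rho> = "\<lambda>j x. \<pi> j (x div f ! j) * f ! j + x mod f ! j" and ?c = "\<lambda>j x. c j (x div f ! j)"
  have ampliated: "relabelling (dmul d f) (dmul e f) ?\<rho> ?c" by (rule relabelling_ampliate[OF r len])
  have join: "relabel ?\<rho> (join f xs ys) = join f (relabel \<pi> xs) ys" if "xs \<in> ibox d" "ys \<in> ibox f" for xs ys
    using nth_ibox[OF that(2)] length_ibox[OF that(1)] len by (intro nth_equalityI) auto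
  have "monomial_act (dmul d f) (dmul e f) ?\<rho> ?c (tensor d a f b) = tensor e (T a) f b" for a b
  proof (rule monomial_act_eqI[OF ampliated supported_tensor])
    fix zs assume "zs \<in> ibox (dmul d f)"
    then obtain xs ys where z: "xs \<in> ibox d" "ys \<in> ibox f" "zs = join f xs ys" using ibox_dmul_cases[OF len]
      by blast
    have "(\<Prod>j<length (dmul d f). ?c j (zs ! j)) = (\<Prod>j<length d. c j (xs ! j))"
      using z len nth_ibox[OF z(2)] by (intro prod.cong) auto
    then show "tensor e (T a) f b (relabel ?\<rho> zs) = (\<Prod>j<length (dmul d f). ?c j (zs ! j)) * tensor d a f b zs"
      using z join relabel_in_ibox[OF r] len len' by (simp add: tensor_join T monomial_act_relabel[OF r])
  next
    fix zs assume "zs \<in> ibox (dmul e f)" and outside: "zs \<notin> relabel ?\<rho> ` ibox (dmul d f)"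
    then obtain us ys where z: "us \<in> ibox e" "ys \<in> ibox f" "zs = join f us ys" using ibox_dmul_cases[OF len']
      by blast
    have "us \<notin> relabel \<pi> ` ibox d"
    proof
      assume "us \<in> relabel \<pi> ` ibox d"
      then obtain xs where xs: "us = relabel \<pi> xs" "xs \<in> ibox d" by blast
      then have "zs = relabel ?\<rho> (join f xs ys)" using z join by simp
      then show False using outside join_in_ibox[OF len xs(2) z(2)] by blast
    qed
    then have "T a us = 0" unfolding T by (rule monomial_act_outside_range)
    then show "tensor e (T a) f b zs = 0" using z len' by (simp add: tensor_join)
  qed
  then show ?thesis using ampliated by (auto simp: relabel_map_def)
qed

lemma relabel_map_tensor_left:
  assumes T: "relabel_map d e T" and len: "length d = length f"
  shows "\<exists>U. relabel_map (dmul f d) (dmul f e) U \<and> (\<forall>a b. U (tensor f b d a) = tensor f b e (T a))"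
proof -
  have len': "length e = length f" using relabel_map_length[OF T] len by simp
  obtain U1 where U1: "relabel_map (dmul f d) (dmul d f) U1" "\<forall>a b. U1 (tensor f a d b) = tensor d b f a"
    using relabel_map_swap[OF len[symmetric]] by blast
  obtain U2 where U2: "relabel_map (dmul d f) (dmul e f) U2" "\<forall>a b. U2 (tensor d a f b) = tensor e (T a) f b"
    using relabel_map_tensor_right[OF T len] by blast
  obtain U3 where U3: "relabel_map (dmul e f) (dmul f e) U3" "\<forall>a b. U3 (tensor e a f b) = tensor f b e a"
    using relabel_map_swap[OF len'] by blast
  obtain V where V: "relabel_map (dmul f d) (dmul e f) V" "\<forall>a. V a = U2 (U1 a)"
    using relabel_map_comp[OF U1(1) U2(1)] by blast
  obtain W where W: "relabel_map (dmul f d) (dmul f e) W" "\<forall>a. W a = U3 (V a)"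
    using relabel_map_comp[OF V(1) U3(1)] by blast
  show ?thesis using W V(2) U1(2) U2(2) U3(2) by (intro exI[of _ W]) simp
qed

definition relabels :: "statevec \<Rightarrow> statevec \<Rightarrow> bool" where
  "relabels s t \<longleftrightarrow> (\<exists>T. relabel_map (fst s) (fst t) T \<and> snd t = T (snd s))"

lemma relabels_refl: "s \<in> states k \<Longrightarrow> relabels s s"
  unfolding relabels_def relabel_map_def
  by (intro exI[of _ "monomial_act (fst s) (fst s) (\<lambda>j x. x) (\<lambda>j x. 1)"] conjI exI[of _ "\<lambda>j x. x"]
      exI[of _ "\<lambda>j x. 1"])
     (auto simp: relabelling_def monomial_act_id states_def)

lemma relabels_trans: "relabels s t \<Longrightarrow> relabels t u \<Longrightarrow> relabels s u"
  unfolding relabels_def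
proof (elim exE conjE)
  fix T T' assume T: "relabel_map (fst s) (fst t) T" "snd t = T (snd s)" "relabel_map (fst t) (fst u) T'"
    "snd u = T' (snd t)"
  obtain U where "relabel_map (fst s) (fst u) U" "\<forall>a. U a = T' (T a)" using relabel_map_comp[OF T(1,3)] by blast
  then show "\<exists>T. relabel_map (fst s) (fst u) T \<and> snd u = T (snd s)" using T by auto
qed

lemma relabels_swap: "s \<in> states k \<Longrightarrow> t \<in> states k \<Longrightarrow> relabels (state_tensor s t) (state_tensor t s)"
  using relabel_map_swap[of "fst s" "fst t"] states_length[of s k] states_length[of t k]
  by (auto simp: relabels_def state_tensor_def)

lemma relabels_tensor_right:
  assumes "relabels s t" "s \<in> states k" "u \<in> states k"
  shows "relabels (state_tensor s u) (state_tensor t u)"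
proof -
  obtain T where T: "relabel_map (fst s) (fst t) T" "snd t = T (snd s)" using assms by (auto simp: relabels_def)
  show ?thesis
    using relabel_map_tensor_right[OF T(1), of "fst u"] T(2) states_length[OF assms(2)] states_length[OF assms(3)]
    by (auto simp: relabels_def state_tensor_def)
qed

lemma relabels_tensor_left:
  assumes "relabels s t" "s \<in> states k" "u \<in> states k"
  shows "relabels (state_tensor u s) (state_tensor u t)"
proof -
  obtain T where T: "relabel_map (fst s) (fst t) T" "snd t = T (snd s)" using assms by (auto simp: relabels_def)
  show ?thesis
    using relabel_map_tensor_left[OF T(1), of "fst u"] T(2) states_length[OF assms(2)] states_length[OF assms(3)]
    by (auto simp: relabels_def state_tensor_def)
qed

lemma converts_of_relabels:
  assumes "relabels s t" "s \<in> states k" "t \<in> states k" "converts t u p"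
  shows "converts s u p"
proof -
  obtain T where T: "relabel_map (fst s) (fst t) T" "snd t = T (snd s)" using assms by (auto simp: relabels_def)
  show ?thesis
    unfolding converts_def
  proof (rule pays_relabel_map[OF T(1)])
    show "supported (fst s) (snd s)" using assms by (simp add: states_def)
    show "\<forall>x\<in>set (fst t). 0 < x" using states_pos[OF assms(3)] by blast
    show "pays (target u) (fst t) (T (snd s)) p" using assms(4) T(2) by (simp add: converts_def)
  qed (rule target_antimono)
qed

lemma pays_supported:
  "pays H d a p \<Longrightarrow> supported d a \<Longrightarrow> pays (\<lambda>d v q. supported d v \<and> H d v q) d a p"
proof (induction rule: pays.induct)
  case (leaf d a p) then show ?case by (intro pays.leaf) auto
next
  case (round j d m L a q p)
  then show ?case by (intro pays.round[OF round(1,2) _ round(3)]) (auto simp: supported_local_act)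
qed

lemma converts_relabels_cong:
  assumes "converts s t p" "relabels t u" "s \<in> states k" "u \<in> states k"
  shows "converts s u p"
proof -
  obtain T where T: "relabel_map (fst t) (fst u) T" "snd u = T (snd t)" using assms by (auto simp: relabels_def)
  have "pays (\<lambda>d v q. supported d v \<and> target t d v q) (fst s) (snd s) p"
    using assms pays_supported by (auto simp: converts_def states_def)
  then show ?thesis
    unfolding converts_def
  proof (rule pays_bind)
    fix d v q assume h: "supported d v \<and> target t d v q"
    then have d: "d = fst t" by (simp add: target_def)
    show "pays (target u) d v q"
      unfolding d
    proof (rule pays_relabel_map[OF T(1)])
      show "supported (fst t) v" using h d by simp
      show "\<forall>x\<in>set (fst u). 0 < x" using states_pos[OF assms(4)] by blast
      have "iprod (fst u) (snd u) (T v) = iprod (fst t) (snd t) v"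
        unfolding T(2) by (rule relabel_map_iprod[OF T(1)])
      then show "pays (target u) (fst u) (T v) q" using h by (intro pays.leaf) (auto simp: target_def)
    qed (rule target_antimono)
  qed
qed

lemma dmul_assoc: "dmul (dmul d f) h = dmul d (dmul f h)"
  by (rule nth_equalityI) (auto simp: mult.assoc)

lemma tensor_assoc:
  assumes len: "length d = length f" "length f = length h"
  shows "tensor (dmul d f) (tensor d a f b) h c = tensor d a (dmul f h) (tensor f b h c)"
proof (rule tensor_eqI)
  show "length d = length (dmul f h)" using len by simp
  show "supported (dmul d (dmul f h)) (tensor (dmul d f) (tensor d a f b) h c)"
    using supported_tensor[of "dmul d f" h] by (simp add: dmul_assoc)
  fix xs ws assume xs: "xs \<in> ibox d" and "ws \<in> ibox (dmul f h)"
  then obtain ys zs where z: "ys \<in> ibox f" "zs \<in> ibox h" "ws = join h ys zs" using ibox_dmul_cases[OF len(2)]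
    by blast
  have "join (dmul f h) xs ws = join h (join f xs ys) zs"
    using len z by (intro nth_equalityI) (auto simp: algebra_simps)
  then show "tensor (dmul d f) (tensor d a f b) h c (join (dmul f h) xs ws) = a xs * tensor f b h c ws"
    using z xs len join_in_ibox[OF len(1)] by (simp add: tensor_join)
qed

lemma state_tensor_assoc: "s \<in> states k \<Longrightarrow> t \<in> states k \<Longrightarrow> u \<in> states k \<Longrightarrow> state_tensor (state_tensor s t) u
    = state_tensor s (state_tensor t u)"
  using tensor_assoc[of "fst s" "fst t" "fst u"] states_length[of s k] states_length[of t k]
    states_length[of u k]
  by (simp add: state_tensor_def dmul_assoc)

definition unit_state :: "nat \<Rightarrow> statevec" where
  "unit_state k = (replicate k 1, \<lambda>xs. if xs = replicate k 0 then 1 else 0)"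

lemma unit_in_states: "unit_state k \<in> states k"
  by (auto simp: states_def unit_state_def valid_dims_def supported_def ibox_ones_Suc ibox_ones sqnorm_def)

lemma unit_state_tensor: "s \<in> states k \<Longrightarrow> state_tensor (unit_state k) s = s"
proof -
  assume s: "s \<in> states k"
  then have len: "length (fst s) = k" by (rule states_length)
  have d: "dmul (replicate k 1) (fst s) = fst s" using len by (intro nth_equalityI) auto
  have "snd s = tensor (replicate k 1) (snd (unit_state k)) (fst s) (snd s)"
  proof (rule tensor_eqI)
    show "supported (dmul (replicate k 1) (fst s)) (snd s)" using s unfolding d by (simp add: states_def)
    fix xs ys assume "xs \<in> ibox (replicate k 1)" "ys \<in> ibox (fst s)"
    then have xs: "xs = replicate k 0" and len_ys: "length ys = k"
      using len by (auto simp: ibox_ones_Suc length_ibox)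
    have "join (fst s) xs ys = ys" unfolding xs using len len_ys by (intro nth_equalityI) auto
    then show "snd s (join (fst s) xs ys) = snd (unit_state k) xs * snd s ys" by (simp add: xs unit_state_def)
  qed (use len in simp)
  then show ?thesis using d by (simp add: state_tensor_def unit_state_def prod_eq_iff)
qed

lemma state_tensor_unit: "s \<in> states k \<Longrightarrow> state_tensor s (unit_state k) = s"
proof -
  assume s: "s \<in> states k"
  then have len: "length (fst s) = k" by (rule states_length)
  have d: "dmul (fst s) (replicate k 1) = fst s" using len by (intro nth_equalityI) auto
  have "snd s = tensor (fst s) (snd s) (replicate k 1) (snd (unit_state k))"
  proof (rule tensor_eqI)
    show "supported (dmul (fst s) (replicate k 1)) (snd s)" using s unfolding d by (simp add: states_def)
    fix ys xs assume "xs \<in> ibox (replicate k 1)" "ys \<in> ibox (fst s)"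
    then have xs: "xs = replicate k 0" and len_ys: "length ys = k"
      using len by (auto simp: ibox_ones_Suc length_ibox)
    have "join (replicate k 1) ys xs = ys" unfolding xs using len len_ys by (intro nth_equalityI) auto
    then show "snd s (join (replicate k 1) ys xs) = snd s ys * snd (unit_state k) xs"
      by (simp add: xs unit_state_def)
  qed (use len in simp)
  then show ?thesis using d by (simp add: state_tensor_def unit_state_def prod_eq_iff)
qed

definition tensor_list :: "nat \<Rightarrow> statevec list \<Rightarrow> statevec"
  where "tensor_list k xs = foldr state_tensor xs (unit_state k)"

lemma tensor_list_Nil [simp]: "tensor_list k [] = unit_state k" by (simp add: tensor_list_def)

lemma tensor_list_Cons [simp]: "tensor_list k (x # xs) = state_tensor x (tensor_list k xs)"
  by (simp add: tensor_list_def)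

lemma tensor_list_in_states: "set xs \<subseteq> states k \<Longrightarrow> tensor_list k xs \<in> states k"
  by (induction xs) (auto simp: unit_in_states state_tensor_in_states)

lemma tensor_list_append: "set xs \<subseteq> states k \<Longrightarrow> set ys \<subseteq> states k
    \<Longrightarrow> tensor_list k (xs @ ys) = state_tensor (tensor_list k xs) (tensor_list k ys)"
  by (induction xs) (auto simp: unit_state_tensor tensor_list_in_states state_tensor_assoc[of _ k])

lemma relabels_tensor_list_permute:
  "mset xs = mset ys \<Longrightarrow> set xs \<subseteq> states k \<Longrightarrow> relabels (tensor_list k xs) (tensor_list k ys)"
proof (induction xs arbitrary: ys)
  case Nil then show ?case by (simp add: relabels_refl[OF unit_in_states])
next
  case (Cons x xs)
  have "x \<in> set ys" using Cons.prems by (metis list.set_intros(1) set_mset_mset)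
  then obtain ys1 ys2 where ys: "ys = ys1 @ x # ys2" by (meson split_list)
  have rest_mset: "mset xs = mset (ys1 @ ys2)" using Cons.prems ys by simp
  have "set xs = set ys1 \<union> set ys2" using arg_cong[OF rest_mset, of set_mset] by simp
  then have mem: "x \<in> states k" "set xs \<subseteq> states k" "set ys1 \<subseteq> states k" "set ys2 \<subseteq> states k"
    using Cons.prems(2) by auto
  have parts: "tensor_list k ys1 \<in> states k" "tensor_list k ys2 \<in> states k" using mem tensor_list_in_states
    by auto
  have "relabels (state_tensor x (tensor_list k xs)) (state_tensor x (tensor_list k (ys1 @ ys2)))"
    using Cons.IH[OF rest_mset mem(2)] mem tensor_list_in_states by (intro relabels_tensor_left) auto
  also have "state_tensor x (tensor_list k (ys1 @ ys2)) = state_tensor (state_tensor x (tensor_list k ys1))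
      (tensor_list k ys2)"
    using tensor_list_append[OF mem(3,4)] state_tensor_assoc[OF mem(1) parts] by simp
  finally have insert: "relabels (state_tensor x (tensor_list k xs))
      (state_tensor (state_tensor x (tensor_list k ys1)) (tensor_list k ys2))" .
  have "relabels (state_tensor (state_tensor x (tensor_list k ys1)) (tensor_list k ys2))
      (state_tensor (state_tensor (tensor_list k ys1) x) (tensor_list k ys2))"
    using mem parts by (intro relabels_tensor_right relabels_swap) (auto intro: state_tensor_in_states)
  also have "state_tensor (state_tensor (tensor_list k ys1) x) (tensor_list k ys2) = tensor_list k ys"
    using tensor_list_append[OF mem(3), of "x # ys2"] state_tensor_assoc[OF parts(1) mem(1) parts(2)] mem
    by (simp add: ys)
  finally show ?case using insert relabels_trans by simp
qed

definition tensor_mset :: "nat \<Rightarrow> statevec multiset \<Rightarrow> statevec"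
  where "tensor_mset k M = tensor_list k (SOME xs. mset xs = M)"

definition mconverts :: "nat \<Rightarrow> statevec multiset \<Rightarrow> statevec multiset \<Rightarrow> real \<Rightarrow> bool" where
  "mconverts k M N p \<longleftrightarrow> converts (tensor_mset k M) (tensor_mset k N) p"

lemma mset_some_enumeration: "mset (SOME xs. mset xs = M) = M" by (metis (mono_tags) ex_mset someI)

lemma set_some_enumeration: "set (SOME xs. mset xs = M) = set_mset M"
  by (metis mset_some_enumeration set_mset_mset)

lemma tensor_mset_in_states: "set_mset M \<subseteq> states k \<Longrightarrow> tensor_mset k M \<in> states k"
  unfolding tensor_mset_def by (rule tensor_list_in_states) (simp add: set_some_enumeration)

lemma relabels_tensor_mset:
  assumes "set xs \<subseteq> states k"
  shows "relabels (tensor_list k xs) (tensor_mset k (mset xs))"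
    "relabels (tensor_mset k (mset xs)) (tensor_list k xs)"
  unfolding tensor_mset_def using assms by (auto intro!: relabels_tensor_list_permute
    simp: mset_some_enumeration set_some_enumeration)

lemma mconverts_tensor_list:
  assumes "set xs \<subseteq> states k" "set ys \<subseteq> states k"
  shows "mconverts k (mset xs) (mset ys) p \<longleftrightarrow> converts (tensor_list k xs) (tensor_list k ys) p"
proof -
  have mem: "tensor_list k xs \<in> states k" "tensor_list k ys \<in> states k" "tensor_mset k (mset xs) \<in> states k"
    "tensor_mset k (mset ys) \<in> states k"
    using assms by (auto intro: tensor_list_in_states intro!: tensor_mset_in_states)
  show ?thesis
    unfolding mconverts_def
    using converts_of_relabels[OF relabels_tensor_mset(1)[OF assms(1)] mem(1,3)]
      converts_of_relabels[OF
      relabels_tensor_mset(2)[OF assms(1)] mem(3,1)]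
      converts_relabels_cong[OF _ relabels_tensor_mset(1)[OF assms(2)] _ mem(4)] converts_relabels_cong[OF _
        relabels_tensor_mset(2)[OF assms(2)] _ mem(2)] mem
    by blast
qed

lemma mconverts_add:
  assumes "set_mset M \<subseteq> states k" "set_mset N \<subseteq> states k" "set_mset K \<subseteq> states k" "mconverts k M N p"
  shows "mconverts k (M + K) (N + K) p"
proof -
  obtain xs ys zs where lists: "M = mset xs" "N = mset ys" "K = mset zs" by (metis ex_mset)
  have s: "set xs \<subseteq> states k" "set ys \<subseteq> states k" "set zs \<subseteq> states k" using assms lists by auto
  have "converts (tensor_list k xs) (tensor_list k ys) p" using assms(4) lists mconverts_tensor_list s by simp
  then have "converts (tensor_list k (xs @ zs)) (tensor_list k (ys @ zs)) p"
    unfolding tensor_list_append[OF s(1,3)] tensor_list_append[OF s(2,3)]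
    by (intro converts_state_tensor[of _ _ _ k] tensor_list_in_states s)
  then have "mconverts k (mset (xs @ zs)) (mset (ys @ zs)) p" by (subst mconverts_tensor_list) (use s in auto)
  then show ?thesis using lists by simp
qed

lemma prod_indicator: "(\<Prod>j<(n::nat). if P j then (1::complex) else 0) = (if \<forall>j<n. P j then 1 else 0)"
  by (induction n) (auto simp: less_Suc_eq)

lemma monomial_act_discard:
  assumes len: "length d = length f" and a: "supported d a" and y: "y \<in> ibox f"
  shows "monomial_act (dmul d f) d (\<lambda>j x. x div f ! j) (\<lambda>j x. if x mod f ! j = y ! j then 1 else 0)
      (tensor d a f b)
    = (\<lambda>xs. b y * a xs)" (is "monomial_act _ _ ?\<pi> ?\<mu> _ = _")
proof (rule supported_eqI[OF supported_monomial_act])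
  show "supported d (\<lambda>xs. b y * a xs)" using a by (simp add: supported_def)
  fix zs assume zs: "zs \<in> ibox d"
  have div: "relabel ?\<pi> (join f xs ys) = xs" if "xs \<in> ibox d" "ys \<in> ibox f" for xs ys
    using that len nth_ibox[OF that(2)] by (intro nth_equalityI) (auto simp: length_ibox)
  have mod: "(\<Prod>j<length f. ?\<mu> j (join f xs ys ! j)) = (if ys = y then 1 else 0)" if "ys \<in> ibox f" for xs ys
  proof -
    have "(\<Prod>j<length f. ?\<mu> j (join f xs ys ! j)) = (\<Prod>j<length f. if ys ! j = y ! j then 1 else 0)"
      using len nth_ibox[OF that] by (intro prod.cong) auto
    also have "\<dots> = (if \<forall>j<length f. ys ! j = y ! j then 1 else 0)" by (rule prod_indicator)
    also have "(\<forall>j<length f. ys ! j = y ! j) \<longleftrightarrow> ys = y"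
      using that y by (auto simp: list_eq_iff_nth_eq length_ibox)
    finally show ?thesis .
  qed
  have len': "length (dmul d f) = length f" using len by simp
  have "monomial_act (dmul d f) d ?\<pi> ?\<mu> (tensor d a f b) zs
    = (\<Sum>xs\<in>ibox d. \<Sum>ys\<in>ibox f. if relabel ?\<pi> (join f xs ys) = zs then
         (\<Prod>j<length f. ?\<mu> j (join f xs ys ! j)) * tensor d a f b (join f xs ys) else 0)"
    unfolding monomial_act_def len' using zs by (simp add: sum_ibox_dmul[OF len] del: nth_join)
  also have "\<dots> = (\<Sum>xs\<in>ibox d. \<Sum>ys\<in>ibox f. if xs = zs then (if ys = y then a zs * b y else 0) else 0)"
    by (intro sum.cong refl) (simp add: div mod tensor_join[OF len zs y] del: nth_join)
  also have "\<dots> = b y * a zs" using zs y by (simp add: sum.swap[of _ "ibox f"])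
  finally show "monomial_act (dmul d f) d ?\<pi> ?\<mu> (tensor d a f b) zs = b y * a zs" .
qed

lemma converts_discard:
  assumes s: "s \<in> states k" and t: "t \<in> states k"
  shows "converts (state_tensor s t) s 1"
proof -
  define d a f b where "d = fst s" and "a = snd s" and "f = fst t" and "b = snd t"
  have len: "length d = k" "length f = k" using s t states_length by (auto simp: d_def f_def)
  have pos: "0 < d ! j" "0 < f ! j" if "j < k" for j using states_nth_pos s t that by (auto simp: d_def f_def)
  have unit: "sqnorm f b = 1" "sqnorm d a = 1" "supported d a"
    using s t by (auto simp: states_def b_def f_def a_def d_def)
  let ?\<pi> = "\<lambda>j x. x div f ! j" and ?\<mu> = "\<lambda>j t x. if x mod f ! j = t then (1::complex) else 0"
  have "pays (target s) (dmul d f) (tensor d a f b) 1"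
  proof (rule pays_monomial[where e = d and m = f and \<pi> = ?\<pi> and \<mu> = ?\<mu> and q = "\<lambda>y. (cmod (b y))\<^sup>2"])
    show "?\<pi> j x < d ! j" if "j < length (dmul d f)" "x < dmul d f ! j" for j x
      using that len by (simp add: less_mult_imp_div_less)
    show "(\<Sum>t<f ! j. cnj (?\<mu> j t x) * ?\<mu> j t x') = (if x = x' then 1 else 0)"
      if "j < length (dmul d f)" "x < dmul d f ! j" "x' < dmul d f ! j" "?\<pi> j x = ?\<pi> j x'" for j x x'
    proof -
      have "(\<Sum>t<f ! j. cnj (?\<mu> j t x) * ?\<mu> j t x')
          = (\<Sum>t<f ! j. if t = x mod f ! j then (if x mod f ! j = x' mod f ! j then 1 else 0) else 0)"
        by (intro sum.cong refl) auto
      also have "\<dots> = (if x mod f ! j = x' mod f ! j then 1 else 0)" using pos(2)[of j] that len by simp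
      also have "\<dots> = (if x = x' then 1 else 0)" using that(4) by (metis div_mult_mod_eq)
      finally show ?thesis .
    qed
    show "pays (target s) d (monomial_act (dmul d f) d ?\<pi> (\<lambda>j. ?\<mu> j (y ! j)) (tensor d a f b)) ((cmod (b y))\<^sup>2)"
      if "y \<in> ibox f" for y
      unfolding monomial_act_discard[OF trans[OF len(1) len(2)[symmetric]] unit(3) that]
      by (rule pays.leaf) (use unit in \<open>simp add: target_def iprod_scale iprod_self norm_mult flip: a_def d_def\<close>)
    show "1 \<le> (\<Sum>y\<in>ibox f. (cmod (b y))\<^sup>2)" using unit by (simp add: sqnorm_def)
  qed (use len pos supported_tensor target_antimono in auto)
  then show ?thesis by (simp add: converts_def state_tensor_def d_def f_def a_def b_def)
qed

lemma converts_zero: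
  assumes s: "s \<in> states k" and t: "t \<in> states k"
  shows "converts s t 0"
  unfolding converts_def
proof (rule pays_monomial[where e = "fst t" and m = "fst s" and \<pi> = "\<lambda>j x. 0" and
      \<mu> = "\<lambda>j t x. if x = t then 1 else 0" and q = "\<lambda>y. 0"])
  have len: "length (fst s) = k" "length (fst t) = k" using s t states_length by auto
  show "length (fst t) = length (fst s)" using len by simp
  show "supported (fst s) (snd s)" using s by (simp add: states_def)
  show "0 < fst t ! j" "0 < fst t ! j" if "j < length (fst s)" for j using states_nth_pos[OF t] that len by auto
  show "(\<Sum>t<fst s ! j. cnj (if x = t then 1 else 0) * (if x' = t then 1 else (0::complex)))
      = (if x = x' then 1 else 0)"
    if "x < fst s ! j" for j x x'
  proof -
    have "(\<Sum>t<fst s ! j. cnj (if x = t then 1 else 0) * (if x' = t then 1 else (0::complex)))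
      = (\<Sum>t<fst s ! j. if t = x then (if x = x' then 1 else 0) else 0)" by (intro sum.cong refl) auto
    then show ?thesis using that by simp
  qed
qed (auto simp: target_def intro!: pays.leaf)

lemma mconverts_discard:
  assumes "set_mset M \<subseteq> states k" "set_mset N \<subseteq> states k"
  shows "mconverts k (M + N) M 1"
proof -
  obtain xs ys where lists: "M = mset xs" "N = mset ys" by (metis ex_mset)
  have s: "set xs \<subseteq> states k" "set ys \<subseteq> states k" using assms lists by auto
  have "converts (tensor_list k (xs @ ys)) (tensor_list k xs) 1"
    unfolding tensor_list_append[OF s] by (intro converts_discard[of _ k] tensor_list_in_states s)
  then have "mconverts k (mset (xs @ ys)) (mset xs) 1" by (subst mconverts_tensor_list) (use s in auto)
  then show ?thesis using lists by simp
qed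


section \<open>GHZ states\<close>

definition ghz :: "nat \<Rightarrow> nat \<Rightarrow> statevec" where
  "ghz k r = (replicate k r, \<lambda>xs. if \<exists>i<r. xs = replicate k i then complex_of_real (1 / sqrt (real r)) else 0)"

lemma replicate_in_ibox [simp]: "i < r \<Longrightarrow> replicate k i \<in> ibox (replicate k r)" by (simp add: ibox_def)

lemma sum_constant_indices:
  fixes h :: "nat list \<Rightarrow> 'b::comm_monoid_add"
  assumes k: "0 < k"
  shows "(\<Sum>xs\<in>ibox (replicate k r). if \<exists>i<r. xs = replicate k i then h xs else 0) = (\<Sum>i<r. h (replicate k i))"
proof -
  have inj: "inj_on (replicate k) {..<r}" using k by (auto simp: inj_on_def)
  have "(\<Sum>xs\<in>ibox (replicate k r). if \<exists>i<r. xs = replicate k i then h xs else 0)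
      = (\<Sum>xs\<in>replicate k ` {..<r}. h xs)"
    by (rule sum.mono_neutral_cong_right) auto
  also have "\<dots> = (\<Sum>i<r. h (replicate k i))" by (simp add: sum.reindex[OF inj])
  finally show ?thesis .
qed

lemma ghz_in_states: "0 < k \<Longrightarrow> 0 < r \<Longrightarrow> ghz k r \<in> states k"
proof -
  assume k: "0 < k" and r: "0 < r"
  have "sqnorm (replicate k r) (snd (ghz k r))
      = (\<Sum>xs\<in>ibox (replicate k r). if \<exists>i<r. xs = replicate k i then 1 / real r else 0)"
    unfolding sqnorm_def ghz_def snd_conv by (intro sum.cong refl) (auto simp: norm_divide power_divide)
  also have "\<dots> = 1" using r by (simp add: sum_constant_indices[OF k])
  finally show ?thesis using k r by (auto simp: states_def ghz_def valid_dims_def supported_def)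
qed

lemma ghz_one: "ghz k 1 = unit_state k" by (auto simp: ghz_def unit_state_def)

lemma ghz_mult:
  assumes k: "0 < k"
  shows "state_tensor (ghz k r) (ghz k r') = ghz k (r * r')"
proof -
  have d: "dmul (replicate k r) (replicate k r') = replicate k (r * r')" by (rule nth_equalityI) auto
  have "snd (ghz k (r * r')) = tensor (replicate k r) (snd (ghz k r)) (replicate k r') (snd (ghz k r'))"
  proof (rule tensor_eqI)
    show "supported (dmul (replicate k r) (replicate k r')) (snd (ghz k (r * r')))"
      unfolding d by (auto simp: supported_def ghz_def)
    fix xs ys assume xs: "xs \<in> ibox (replicate k r)" and ys: "ys \<in> ibox (replicate k r')"
    have len: "length xs = k" "length ys = k" using xs ys by (auto simp: length_ibox)
    have "(\<exists>i<r * r'. join (replicate k r') xs ys = replicate k i) \<longleftrightarrow> (\<exists>i<r. xs = replicate k i)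
        \<and> (\<exists>i<r'. ys = replicate k i)"
    proof
      assume "\<exists>i<r * r'. join (replicate k r') xs ys = replicate k i"
      then obtain i where i: "i < r * r'" "join (replicate k r') xs ys = replicate k i" by blast
      have "xs ! j * r' + ys ! j = i" if "j < k" for j using arg_cong[OF i(2), of "\<lambda>l. l ! j"] that by simp
      moreover have yj: "ys ! j < r'" if "j < k" for j using nth_ibox[OF ys, of j] that by simp
      ultimately have parts: "xs ! j = i div r'" "ys ! j = i mod r'" if "j < k" for j
        using that by (metis mult_add_div, metis mod_mult_self3 mod_less)
      have "xs = replicate k (i div r')" "ys = replicate k (i mod r')"
        using parts len by (auto intro!: nth_equalityI)
      moreover have "i div r' < r" using i(1) by (simp add: less_mult_imp_div_less)
      moreover have "i mod r' < r'" using yj[OF k] by (intro mod_less_divisor) simp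
      ultimately show "(\<exists>i<r. xs = replicate k i) \<and> (\<exists>i<r'. ys = replicate k i)" by blast
    next
      assume "(\<exists>i<r. xs = replicate k i) \<and> (\<exists>i<r'. ys = replicate k i)"
      then obtain i i' where i: "i < r" "xs = replicate k i" "i' < r'" "ys = replicate k i'" by blast
      then have "join (replicate k r') xs ys = replicate k (i * r' + i')" by (intro nth_equalityI) auto
      then show "\<exists>i<r * r'. join (replicate k r') xs ys = replicate k i" using mult_add_less_mult[OF i(1,3)]
        by blast
    qed
    then show "snd (ghz k (r * r')) (join (replicate k r') xs ys) = snd (ghz k r) xs * snd (ghz k r') ys"
      unfolding ghz_def snd_conv by (auto simp: real_sqrt_mult)
  qed simp
  then show ?thesis using d by (simp add: state_tensor_def ghz_def prod_eq_iff)
qed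

lemma tensor_list_ghz: "0 < k \<Longrightarrow> tensor_list k (replicate n (ghz k r)) = ghz k (r ^ n)"
  by (induction n) (auto simp: ghz_one[unfolded One_nat_def] ghz_mult)

lemma digits_in_ibox: "i < prod_list d \<Longrightarrow> digits d i \<in> ibox d"
proof (induction d arbitrary: i)
  case (Cons a d)
  then have "prod_list d > 0" by (auto dest: less_mult_imp_pos)
  then show ?case using Cons by (simp add: less_mult_imp_div_less)
qed simp

lemma enc_digits: "i < prod_list d \<Longrightarrow> enc d (digits d i) = i"
proof (induction d arbitrary: i)
  case (Cons a d)
  then have "prod_list d > 0" by (auto dest: less_mult_imp_pos)
  then show ?case using Cons.IH[of "i mod prod_list d"] by (simp add: div_mult_mod_eq)
qed simp

lemma enc_less: "xs \<in> ibox d \<Longrightarrow> enc d xs < prod_list d"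
proof (induction d arbitrary: xs)
  case (Cons a d)
  then obtain y ys where "xs = y # ys" by (cases xs) (auto simp: ibox_def)
  then show ?case using Cons by (simp add: mult_add_less_mult)
qed simp

lemma digits_enc: "xs \<in> ibox d \<Longrightarrow> digits d (enc d xs) = xs"
proof (induction d arbitrary: xs)
  case (Cons a d)
  then obtain y ys where y: "xs = y # ys" by (cases xs) (auto simp: ibox_def)
  then show ?case using Cons enc_less[of ys d] by simp
qed simp

lemma enc_eq_sum: "length xs = length d \<Longrightarrow> enc d xs = (\<Sum>j<length d. xs ! j * prod_list (drop (Suc j) d))"
proof (induction d arbitrary: xs)
  case (Cons a d)
  then obtain y ys where y: "xs = y # ys" by (cases xs) auto
  then show ?case using Cons by (simp add: sum.lessThan_Suc_shift del: sum.lessThan_Suc)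
qed simp

lemma sum_ibox_digits: "sum h (ibox d) = (\<Sum>i<prod_list d. h (digits d i))"
  by (rule sum.reindex_bij_witness[of _ "digits d" "enc d"])
     (auto simp: digits_in_ibox enc_digits enc_less digits_enc)

lemma card_ibox: "card (ibox d) = prod_list d"
  using sum_ibox_digits[of "\<lambda>_. 1::nat" d] by simp

lemma inj_shift: "inj_on (\<lambda>i. (i + t) mod r) {..<r::nat}"
proof (rule inj_onI)
  fix i j assume ij: "i \<in> {..<r}" "j \<in> {..<r}" "(i + t) mod r = (j + t) mod r"
  then obtain p q where "(i + t) + r * p = (j + t) + r * q" by (metis nat_mod_eq_iff)
  then have "i + r * p = j + r * q" by linarith
  then have "i mod r = j mod r" by (metis nat_mod_eq_iff)
  then show "i = j" using ij by simp
qed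

lemma sum_shift:
  fixes h :: "nat \<Rightarrow> 'b::comm_monoid_add"
  shows "(\<Sum>i<r. h ((i + t) mod r)) = (\<Sum>i<r. h i)"
proof -
  have "(\<lambda>i. (i + t) mod r) ` {..<r} = {..<r}"
    by (rule endo_inj_surj[OF _ _ inj_shift]) (auto intro: mod_less_divisor)
  then show ?thesis using sum.reindex[OF inj_shift[of t r], of h] by (simp add: comp_def)
qed

lemma sum_cis_orthogonal:
  assumes i: "i < r" "j < r"
  shows "(\<Sum>z<r. cis (2 * pi * real z * (real j - real i) / real r)) = (if i = j then of_nat r else 0)"
proof (cases "i = j")
  case False
  define w where "w = cis (2 * pi * (real j - real i) / real r)"
  have r: "real r > 0" using i by simp
  have pw: "w ^ z = cis (2 * pi * real z * (real j - real i) / real r)" for z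
  proof -
    have "w ^ z = cis (real z * (2 * pi * (real j - real i) / real r))"
      unfolding w_def by (rule Complex.DeMoivre)
    also have "real z * (2 * pi * (real j - real i) / real r) = 2 * pi * real z * (real j - real i) / real r"
      by simp
    finally show ?thesis .
  qed
  have "w ^ r = cis (2 * pi * (real j - real i))" unfolding pw
    using r by (intro arg_cong[of _ _ cis]) simp
  also have "\<dots> = 1"
  proof -
    have "real j - real i = of_int (int j - int i)" by simp
    then show ?thesis by (metis cis_multiple_2pi Ints_of_int)
  qed
  finally have wr: "w ^ r = 1" .
  have "w \<noteq> 1"
  proof
    assume "w = 1"
    then have "cos (2 * pi * (real j - real i) / real r) = 1"
      unfolding w_def by (metis cis.simps(1) one_complex.simps(1))
    then obtain n :: int where "2 * pi * (real j - real i) / real r = of_int n * 2 * pi"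
      using cos_one_2pi_int by blast
    then have "2 * pi * (real j - real i) = 2 * pi * (of_int n * real r)"
      using r by (simp add: divide_eq_eq ac_simps)
    then have "real j - real i = of_int n * real r" by (rule iffD1[OF mult_left_cancel, rotated]) simp
    then have "real_of_int (int j - int i) = real_of_int (n * int r)" by simp
    then have "int j - int i = n * int r" by (simp only: of_int_eq_iff)
    moreover have "\<bar>int j - int i\<bar> < int r" using i by linarith
    ultimately have "\<bar>n\<bar> * int r < 1 * int r" by (simp add: abs_mult)
    then have "n = 0" by (simp only: mult_less_cancel_right) linarith
    then show False using \<open>int j - int i = n * int r\<close> False by simp
  qed
  then have "(\<Sum>z<r. w ^ z) = 0" using wr by (simp add: geometric_sum)
  then show ?thesis using False by (simp add: pw)
qed simp

lemma prod_cis: "finite A \<Longrightarrow> (\<Prod>j\<in>A. cis (f j)) = cis (\<Sum>j\<in>A. f j)"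
  by (induction A rule: finite_induct) (auto simp: cis_mult)

lemma monomial_act_diag:
  "monomial_act d d (\<lambda>j x. x) c a = (\<lambda>zs. if zs \<in> ibox d then (\<Prod>j<length d. c j (zs ! j)) * a zs else 0)"
proof -
  have "relabel (\<lambda>j x. x) ys = ys" for ys by (simp add: relabel_def map_nth)
  then show ?thesis by (auto simp: monomial_act_def)
qed

text \<open>Party \<open>0\<close> of a GHZ state imprints a cyclically shifted copy of the amplitudes on the diagonal; then all
  parties measure in the Fourier basis, and undo the phase that depends on the announced outcomes.\<close>

locale state_from_ghz =
  fixes k r :: nat and d :: "nat list" and a :: amp
  assumes k: "0 < k" and state: "(d, a) \<in> states k" and dim_le: "prod_list d \<le> r"
begin

lemma length_d: "length d = k" using states_length[OF state] by simp

lemma nth_d_pos: "j < k \<Longrightarrow> 0 < d ! j" using states_nth_pos[OF state] by simp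

lemma sqnorm_a: "sqnorm d a = 1" and supported_a: "supported d a" using state by (auto simp: states_def)

lemma r_pos: "0 < r"
proof -
  have "ibox d \<noteq> {}" using sqnorm_a by (auto simp: sqnorm_def)
  then have "0 < prod_list d" using card_ibox[of d] by (metis card_gt_0_iff finite_ibox)
  then show ?thesis using dim_le by simp
qed

definition padded :: "nat \<Rightarrow> complex" where
  "padded i = (if i < prod_list d then a (digits d i) else 0)"

lemma sum_padded: "(\<Sum>i<r. (cmod (padded i))\<^sup>2) = 1"
proof -
  have "(\<Sum>i<r. (cmod (padded i))\<^sup>2) = (\<Sum>i<prod_list d. (cmod (a (digits d i)))\<^sup>2)"
    using dim_le by (intro sum.mono_neutral_cong_right) (auto simp: padded_def)
  also have "\<dots> = 1" using sqnorm_a by (simp add: sqnorm_def sum_ibox_digits)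
  finally show ?thesis .
qed

lemma pays_phase_correction: "pays (target (d, a)) d (\<lambda>zs. \<kappa> * cis (\<theta> * real (enc d zs)) * a zs) ((cmod \<kappa>)\<^sup>2)"
proof (rule pays_relabel_map)
  let ?c = "\<lambda>j x. cis (- (\<theta> * real (x * prod_list (drop (Suc j) d))))"
  let ?T = "monomial_act d d (\<lambda>j x. x) ?c" and ?v = "\<lambda>zs. \<kappa> * cis (\<theta> * real (enc d zs)) * a zs"
  show "relabel_map d d ?T"
    by (auto simp: relabel_map_def relabelling_def intro!: exI[of _ "\<lambda>j x. x"] exI[of _ ?c])
  show "supported d ?v" using supported_a by (simp add: supported_def)
  show "\<forall>x\<in>set d. 0 < x" using states_pos[OF state] by simp
  have "?T ?v zs = \<kappa> * a zs" for zs
  proof (cases "zs \<in> ibox d")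
    case True
    then have "enc d zs = (\<Sum>j<length d. zs ! j * prod_list (drop (Suc j) d))" by (intro enc_eq_sum length_ibox)
    then have "(\<Prod>j<length d. ?c j (zs ! j)) = cis (- (\<theta> * real (enc d zs)))"
      by (simp add: prod_cis sum_negf sum_distrib_left[symmetric])
    then show ?thesis using True by (simp add: monomial_act_diag cis_mult[symmetric] mult.assoc[symmetric]
      cis_mult)
  next
    case False then show ?thesis using supported_a by (simp add: monomial_act_diag supported_def)
  qed
  then have "?T ?v = (\<lambda>zs. \<kappa> * a zs)" by blast
  then show "pays (target (d, a)) d (?T ?v) ((cmod \<kappa>)\<^sup>2)"
    using sqnorm_a by (auto intro!: pays.leaf simp: target_def iprod_scale iprod_self norm_mult)
qed (rule target_antimono)

definition fourier :: "nat \<Rightarrow> nat \<Rightarrow> nat \<Rightarrow> complex" where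
  "fourier t z x = complex_of_real (1 / sqrt (real r)) * cis (2 * pi * real z * real ((x + t) mod r) / real r)"

lemma fourier_complete:
  assumes "x < r" "x' < r"
  shows "(\<Sum>z<r. cnj (fourier t z x) * fourier t z x') = (if x = x' then 1 else 0)"
proof -
  have "cnj (fourier t z x) * fourier t z x' =
      complex_of_real (1 / real r) * cis (2 * pi * real z
      * (real ((x' + t) mod r) - real ((x + t) mod r)) / real r)" for z
  proof -
    have "cnj (fourier t z x) * fourier t z x' = complex_of_real (1 / sqrt (real r) * (1 / sqrt (real r))) *
       (cis (- (2 * pi * real z * real ((x + t) mod r) / real r))
       * cis (2 * pi * real z * real ((x' + t) mod r) / real r))"
      unfolding fourier_def
      by (simp only: complex_cnj_mult cis_cnj complex_cnj_complex_of_real of_real_mult ac_simps)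
    moreover have "1 / sqrt (real r) * (1 / sqrt (real r)) = 1 / real r" using r_pos by simp
    ultimately show ?thesis by (simp add: cis_mult right_diff_distrib diff_divide_distrib)
  qed
  then have "(\<Sum>z<r. cnj (fourier t z x) * fourier t z x') = complex_of_real (1 / real r) *
      (\<Sum>z<r. cis (2 * pi * real z * (real ((x' + t) mod r) - real ((x + t) mod r)) / real r))"
    by (simp only: sum_distrib_left)
  also have "\<dots> = complex_of_real (1 / real r) * (if (x + t) mod r = (x' + t) mod r then of_nat r else 0)"
    using r_pos by (subst sum_cis_orthogonal) auto
  also have "(x + t) mod r = (x' + t) mod r \<longleftrightarrow> x = x'" using inj_on_eq_iff[OF inj_shift[of t r], of x x'] assms
    by simp
  finally show ?thesis using r_pos by simp
qed

definition fourier_amp :: complex where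
  "fourier_amp = complex_of_real (1 / sqrt (real r)) ^ k * complex_of_real (1 / sqrt (real r))"

lemma cmod_fourier_amp: "(cmod fourier_amp)\<^sup>2 = (1 / real r) ^ k * (1 / real r)"
proof -
  have "cmod fourier_amp = (1 / sqrt (real r)) ^ k * (1 / sqrt (real r))"
    by (simp add: fourier_amp_def norm_mult norm_power norm_divide)
  then have "(cmod fourier_amp)\<^sup>2 = ((1 / sqrt (real r))\<^sup>2) ^ k * (1 / sqrt (real r))\<^sup>2"
    by (simp only: power_mult_distrib power_mult[symmetric] mult.commute)
  then show ?thesis using r_pos by (simp add: power_divide)
qed

lemma prod_fourier:
  "(\<Prod>j<k. fourier t (y ! j) i) =
     complex_of_real (1 / sqrt (real r)) ^ k *
     cis (2 * pi * (\<Sum>j<k. real (y ! j)) / real r * real ((i + t) mod r))"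
  unfolding fourier_def prod.distrib prod_cis[OF finite_lessThan]
  by (simp add: sum_divide_distrib[symmetric] sum_distrib_left[symmetric] sum_distrib_right[symmetric])

definition shifted_digit :: "nat \<Rightarrow> nat \<Rightarrow> nat \<Rightarrow> nat" where
  "shifted_digit t j x = (if (x + t) mod r < prod_list d then digits d ((x + t) mod r) ! j else 0)"

definition shifted_diag :: "nat \<Rightarrow> amp" where
  "shifted_diag t = (\<lambda>xs. if \<exists>i<r. xs = replicate k i
      then padded ((hd xs + t) mod r) * complex_of_real (1 / sqrt (real r)) else 0)"

lemma fourier_branch:
  assumes zs: "zs \<in> ibox d"
  shows "(if relabel (shifted_digit t) (replicate k i) = zs then (\<Prod>j<k. fourier t (y ! j) i) *
      (padded ((i + t) mod r) * complex_of_real (1 / sqrt (real r))) else 0)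
    = (if (i + t) mod r = enc d zs then fourier_amp
    * cis (2 * pi * (\<Sum>j<k. real (y ! j)) / real r * real (enc d zs)) * a zs else 0)"
proof (cases "(i + t) mod r < prod_list d")
  case True
  have "relabel (shifted_digit t) (replicate k i) = digits d ((i + t) mod r)"
    using True digits_in_ibox[OF True] length_d
    by (intro nth_equalityI) (auto simp: shifted_digit_def length_ibox)
  then have "relabel (shifted_digit t) (replicate k i) = zs \<longleftrightarrow> (i + t) mod r = enc d zs"
    using True zs enc_digits[OF True] digits_enc[OF zs] by auto
  moreover have "padded (enc d zs) = a zs" using enc_less[OF zs] digits_enc[OF zs] by (simp add: padded_def)
  ultimately show ?thesis unfolding prod_fourier by (auto simp: fourier_amp_def)
next
  case False
  then have "(i + t) mod r \<noteq> enc d zs" using enc_less[OF zs] by auto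
  then show ?thesis using False by (simp add: padded_def)
qed

lemma monomial_act_shifted_diag:
  "monomial_act (replicate k r) d (shifted_digit t) (\<lambda>j. fourier t (y ! j)) (shifted_diag t)
    = (\<lambda>zs. fourier_amp * cis (2 * pi * (\<Sum>j<k. real (y ! j)) / real r * real (enc d zs)) * a zs)" (is
      "?lhs = ?rhs")
proof (rule supported_eqI[OF supported_monomial_act])
  show "supported d ?rhs" using supported_a by (simp add: supported_def)
  fix zs assume zs: "zs \<in> ibox d"
  have "?lhs zs = (\<Sum>xs\<in>ibox (replicate k r). if \<exists>i<r. xs = replicate k i then
      (if relabel (shifted_digit t) xs = zs then (\<Prod>j<k. fourier t (y ! j) (xs ! j)) *
        (padded ((hd xs + t) mod r) * complex_of_real (1 / sqrt (real r))) else 0) else 0)"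
    unfolding monomial_act_def shifted_diag_def if_P[OF zs] length_replicate by (intro sum.cong refl) auto
  also have "\<dots> = (\<Sum>i<r. if relabel (shifted_digit t) (replicate k i) = zs then (\<Prod>j<k. fourier t (y ! j) i) *
      (padded ((i + t) mod r) * complex_of_real (1 / sqrt (real r))) else 0)"
    using k by (subst sum_constant_indices) (auto intro!: sum.cong prod.cong simp: hd_replicate)
  also have "\<dots> = (\<Sum>i<r. (\<lambda>i. if i = enc d zs then ?rhs zs else 0) ((i + t) mod r))"
    by (intro sum.cong refl) (simp only: fourier_branch[OF zs])
  also have "\<dots> = (\<Sum>i<r. if i = enc d zs then ?rhs zs else 0)" by (rule sum_shift)
  also have "\<dots> = ?rhs zs" using enc_less[OF zs] dim_le by simp
  finally show "?lhs zs = ?rhs zs" .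
qed

lemma pays_shifted_diag: "pays (target (d, a)) (replicate k r) (shifted_diag t) (1 / real r)"
proof (rule pays_monomial[where e = d and m = "replicate k r" and \<pi> = "shifted_digit t" and \<mu> = "\<lambda>j. fourier t"
      and q = "\<lambda>y. (cmod fourier_amp)\<^sup>2"])
  show "supported (replicate k r) (shifted_diag t)" by (auto simp: supported_def shifted_diag_def)
  show "shifted_digit t j x < d ! j" if "j < length (replicate k r)" for j x
    using that nth_d_pos nth_ibox[OF digits_in_ibox, of "(x + t) mod r" d j] length_d
    by (auto simp: shifted_digit_def)
  show "pays (target (d, a)) d (monomial_act (replicate k r) d (shifted_digit t) (\<lambda>j. fourier t (y ! j)) (shifted_diag t))
      ((cmod fourier_amp)\<^sup>2)" for y
    unfolding monomial_act_shifted_diag by (rule pays_phase_correction)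
  show "1 / real r \<le> (\<Sum>y\<in>ibox (replicate k r). (cmod fourier_amp)\<^sup>2)"
    using r_pos by (simp add: card_ibox cmod_fourier_amp prod_list_replicate power_divide)
qed (use length_d nth_d_pos target_antimono fourier_complete in auto)

lemma monomial_act_ghz:
  "monomial_act (replicate k r) (replicate k r) (\<lambda>j x. x) (\<lambda>j x. if j = 0 then padded ((x + t) mod r) else 1)
      (snd (ghz k r))
    = shifted_diag t" (is "?lhs = _")
proof
  fix xs
  show "?lhs xs = shifted_diag t xs"
  proof (cases "\<exists>i<r. xs = replicate k i")
    case True
    then obtain i where i: "i < r" "xs = replicate k i" by blast
    then have "xs ! 0 = i" "hd xs = i" using k by (auto simp: hd_replicate)
    moreover have "(\<Prod>j<k. if j = 0 then padded ((xs ! j + t) mod r) else 1) = padded ((xs ! 0 + t) mod r)"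
      using k by (simp add: prod.delta)
    ultimately show ?thesis using True i k by (simp add: monomial_act_diag ghz_def shifted_diag_def)
  next
    case False then show ?thesis by (auto simp: monomial_act_diag ghz_def shifted_diag_def)
  qed
qed

lemma converts_ghz: "converts (ghz k r) (d, a) 1"
proof -
  have complete: "(\<Sum>t<r. cnj (padded ((x + t) mod r)) * padded ((x + t) mod r)) = 1" for x
  proof -
    have "(\<Sum>t<r. cnj (padded ((x + t) mod r)) * padded ((x + t) mod r))
        = complex_of_real (\<Sum>t<r. (cmod (padded ((t + x) mod r)))\<^sup>2)"
      unfolding of_real_sum complex_norm_square by (intro sum.cong refl) (simp add: ac_simps)
    then show ?thesis unfolding sum_shift[of "\<lambda>i. (cmod (padded i))\<^sup>2"] sum_padded by simp
  qed
  have "pays (target (d, a)) (replicate k r) (snd (ghz k r)) 1"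
  proof (rule pays_monomial[where e = "replicate k r" and m = "r # replicate (k - 1) 1" and \<pi> = "\<lambda>j x. x" and
        \<mu> = "\<lambda>j t x. if j = 0 then padded ((x + t) mod r) else 1" and q = "\<lambda>y. 1 / real r"])
    show "length (r # replicate (k - 1) 1) = length (replicate k r)" using k by simp
    show "supported (replicate k r) (snd (ghz k r))" by (auto simp: supported_def ghz_def)
    show "(\<Sum>t<(r # replicate (k - 1) 1) ! j. cnj (if j = 0 then padded ((x + t) mod r) else 1) *
        (if j = 0 then padded ((x' + t) mod r) else 1)) = (if x = x' then 1 else 0)"
      if "j < length (replicate k r)" "x = x'" for j x x'
      using that complete by (cases j) auto
    show "pays (target (d, a)) (replicate k r) (monomial_act (replicate k r) (replicate k r) (\<lambda>j x. x)
        (\<lambda>j x. if j = 0 then padded ((x + y ! j) mod r) else 1) (snd (ghz k r))) (1 / real r)" for y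
      using pays_shifted_diag[of "y ! 0"] monomial_act_ghz[of "y ! 0"] by (simp cong: if_cong)
    show "1 \<le> (\<Sum>y\<in>ibox (r # replicate (k - 1) 1). 1 / real r)"
      using r_pos by (simp add: card_ibox prod_list_replicate)
  qed (use r_pos target_antimono in auto)
  then show ?thesis by (simp add: converts_def ghz_def)
qed

end

lemma converts_from_ghz:
  assumes "0 < k" "s \<in> states k" "prod_list (fst s) \<le> r"
  shows "converts (ghz k r) s 1"
  using state_from_ghz.converts_ghz[of k r "fst s" "snd s"] assms by (simp add: state_from_ghz_def)

definition schmidt_form :: "'i set \<Rightarrow> nat list \<Rightarrow> amp \<Rightarrow> ('i \<Rightarrow> amp) \<Rightarrow> ('i \<Rightarrow> amp) \<Rightarrow> bool" where
  "schmidt_form I d v \<alpha> \<beta> \<longleftrightarrow> (\<forall>x xs. x # xs \<in> ibox d \<longrightarrow> v (x # xs) = (\<Sum>i\<in>I. \<alpha> i [x] * \<beta> i xs))"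

lemma schmidt_form_local_act_0:
  assumes "schmidt_form I (D # ds) v \<alpha> \<beta>"
  shows "schmidt_form I (dim_row L # ds) (local_act (D # ds) 0 L v) (\<lambda>i. local_act [D] 0 L (\<alpha> i)) \<beta>"
  unfolding schmidt_form_def
proof (intro allI impI)
  fix x xs assume x: "x # xs \<in> ibox (dim_row L # ds)"
  then have "local_act (D # ds) 0 L v (x # xs) = (\<Sum>y<D. L $$ (x, y) * v (y # xs))" by (simp add: local_act_def)
  also have "\<dots> = (\<Sum>y<D. \<Sum>i\<in>I. L $$ (x, y) * (\<alpha> i [y] * \<beta> i xs))"
    using assms x by (intro sum.cong refl) (simp add: sum_distrib_left schmidt_form_def)
  also have "\<dots> = (\<Sum>i\<in>I. \<Sum>y<D. L $$ (x, y) * (\<alpha> i [y] * \<beta> i xs))" by (rule sum.swap)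
  also have "\<dots> = (\<Sum>i\<in>I. local_act [D] 0 L (\<alpha> i) [x] * \<beta> i xs)"
    using x by (intro sum.cong refl) (simp add: local_act_def sum_distrib_right mult.assoc)
  finally show "local_act (D # ds) 0 L v (x # xs) = (\<Sum>i\<in>I. local_act [D] 0 L (\<alpha> i) [x] * \<beta> i xs)" .
qed

lemma schmidt_form_local_act_Suc:
  assumes "schmidt_form I (D # ds) v \<alpha> \<beta>"
  shows "schmidt_form I (D # ds[j := dim_row L]) (local_act (D # ds) (Suc j) L v) \<alpha>
      (\<lambda>i. local_act ds j L (\<beta> i))"
  unfolding schmidt_form_def
proof (intro allI impI)
  fix x xs assume x: "x # xs \<in> ibox (D # ds[j := dim_row L])"
  have update: "xs[j := y] \<in> ibox ds" if "y < ds ! j" for y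
    using list_update_in_ibox[OF _ that, of xs "ds[j := dim_row L]" j] x by simp
  have "local_act (D # ds) (Suc j) L v (x # xs) = (\<Sum>y<ds ! j. L $$ (xs ! j, y) * v (x # xs[j := y]))"
    using x by (simp add: local_act_def)
  also have "\<dots> = (\<Sum>y<ds ! j. \<Sum>i\<in>I. L $$ (xs ! j, y) * (\<alpha> i [x] * \<beta> i (xs[j := y])))"
    using assms x update by (intro sum.cong refl) (simp add: sum_distrib_left schmidt_form_def)
  also have "\<dots> = (\<Sum>i\<in>I. \<Sum>y<ds ! j. L $$ (xs ! j, y) * (\<alpha> i [x] * \<beta> i (xs[j := y])))" by (rule sum.swap)
  also have "\<dots> = (\<Sum>i\<in>I. \<alpha> i [x] * local_act ds j L (\<beta> i) xs)"
    using x by (intro sum.cong refl) (simp add: local_act_def sum_distrib_left mult.left_commute)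
  finally show "local_act (D # ds) (Suc j) L v (x # xs) = (\<Sum>i\<in>I. \<alpha> i [x] * local_act ds j L (\<beta> i) xs)" .
qed

lemma iprod_ghz: "0 < k \<Longrightarrow> iprod (replicate k r) (snd (ghz k r)) v
    = complex_of_real (1 / sqrt (real r)) * (\<Sum>z<r. v (replicate k z))"
proof -
  assume k: "0 < k"
  have "iprod (replicate k r) (snd (ghz k r)) v
      = (\<Sum>xs\<in>ibox (replicate k r).
        if \<exists>i<r. xs = replicate k i then complex_of_real (1 / sqrt (real r)) * v xs else 0)"
    unfolding iprod_def ghz_def snd_conv by (intro sum.cong refl) auto
  then show ?thesis by (simp add: sum_constant_indices[OF k] sum_distrib_left)
qed

lemma ghz_overlap_schmidt_form:
  assumes v: "schmidt_form I (replicate (Suc k) r) v \<alpha> \<beta>" and "0 < k" "0 < r"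
  shows "real r * (cmod (iprod (replicate (Suc k) r) (snd (ghz (Suc k) r)) v))\<^sup>2
    \<le> (\<Sum>i\<in>I. sqnorm [r] (\<alpha> i)) * (\<Sum>i\<in>I. sqnorm (replicate k r) (\<beta> i))"
proof -
  let ?J = "{..<r} \<times> I" and ?a = "\<lambda>(z, i). cmod (\<alpha> i [z])" and ?b = "\<lambda>(z, i). cmod (\<beta> i (replicate k z))"
  have "v (replicate (Suc k) z) = (\<Sum>i\<in>I. \<alpha> i [z] * \<beta> i (replicate k z))" if "z < r" for z
    using v that by (simp add: schmidt_form_def)
  then have "(cmod (iprod (replicate (Suc k) r) (snd (ghz (Suc k) r)) v))\<^sup>2
      = 1 / real r * (cmod (\<Sum>z<r. \<Sum>i\<in>I. \<alpha> i [z] * \<beta> i (replicate k z)))\<^sup>2"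
    using \<open>0 < r\<close> by (simp add: iprod_ghz norm_mult norm_divide power_mult_distrib power_divide del:
      replicate_Suc)
  then have "real r * (cmod (iprod (replicate (Suc k) r) (snd (ghz (Suc k) r)) v))\<^sup>2
      = (cmod (\<Sum>z<r. \<Sum>i\<in>I. \<alpha> i [z] * \<beta> i (replicate k z)))\<^sup>2" using \<open>0 < r\<close> by simp
  also have "\<dots> \<le> (\<Sum>p\<in>?J. ?a p * ?b p)\<^sup>2"
    unfolding sum.cartesian_product
    by (intro power_mono order_trans[OF norm_sum]) (auto simp: norm_mult case_prod_unfold)
  also have "\<dots> \<le> (\<Sum>p\<in>?J. (?a p)\<^sup>2) * (\<Sum>p\<in>?J. (?b p)\<^sup>2)" by (rule Cauchy_Schwarz_ineq_sum)
  also have "(\<Sum>p\<in>?J. (?a p)\<^sup>2) = (\<Sum>z<r. \<Sum>i\<in>I. (cmod (\<alpha> i [z]))\<^sup>2)"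
    by (simp add: sum.cartesian_product case_prod_unfold)
  also have "\<dots> = (\<Sum>i\<in>I. sqnorm [r] (\<alpha> i))" by (simp add: sqnorm_def sum_ibox_Cons sum.swap[of _ I])
  also have "(\<Sum>p\<in>?J. (?b p)\<^sup>2) = (\<Sum>z<r. \<Sum>i\<in>I. (cmod (\<beta> i (replicate k z)))\<^sup>2)"
    by (simp add: sum.cartesian_product case_prod_unfold)
  also have "\<dots> = (\<Sum>i\<in>I. \<Sum>z<r. (cmod (\<beta> i (replicate k z)))\<^sup>2)" by (rule sum.swap)
  also have "\<dots> = (\<Sum>i\<in>I. \<Sum>xs\<in>ibox (replicate k r). if \<exists>z<r. xs = replicate k z then (cmod (\<beta> i xs))\<^sup>2 else 0)"
    using \<open>0 < k\<close> by (simp add: sum_constant_indices)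
  also have "\<dots> \<le> (\<Sum>i\<in>I. sqnorm (replicate k r) (\<beta> i))"
    unfolding sqnorm_def by (intro sum_mono) auto
  finally show ?thesis by (simp add: mult_left_mono sum_nonneg sqnorm_nonneg)
qed

lemma sum_sqnorm_local_act_family:
  assumes "j < length d" "instrument (d ! j) m L"
  shows "(\<Sum>i<m. \<Sum>i'\<in>I. sqnorm (d[j := dim_row (L i)]) (local_act d j (L i) (\<beta> i'))) = (\<Sum>i'\<in>I. sqnorm d (\<beta> i'))"
  by (subst sum.swap) (simp add: sum_sqnorm_local_act[OF assms])

text \<open>A vector of Schmidt rank at most \<open>card I\<close> between the first party and the others stays of that form along
  the protocol, and its overlap with a GHZ state is at most the product of the squared norms of its two factors.\<close>

lemma schmidt_rank_bound:
  assumes "pays (target (ghz (Suc k) r)) d v p" "length d = Suc k" "0 < k" "0 < r" "schmidt_form I d v \<alpha> \<beta>"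
  shows "p * real r \<le> (\<Sum>i\<in>I. sqnorm [hd d] (\<alpha> i)) * (\<Sum>i\<in>I. sqnorm (tl d) (\<beta> i))"
  using assms
proof (induction arbitrary: \<alpha> \<beta> rule: pays.induct)
  case (leaf d v p)
  then have d: "d = replicate (Suc k) r" and p: "p \<le> (cmod (iprod d (snd (ghz (Suc k) r)) v))\<^sup>2"
    by (auto simp: target_def ghz_def)
  have "p * real r \<le> real r * (cmod (iprod d (snd (ghz (Suc k) r)) v))\<^sup>2"
    using p \<open>0 < r\<close> by (simp add: mult.commute[of p] mult_left_mono)
  also have "\<dots> \<le> (\<Sum>i\<in>I. sqnorm [r] (\<alpha> i)) * (\<Sum>i\<in>I. sqnorm (replicate k r) (\<beta> i))"
    unfolding d using leaf.prems by (intro ghz_overlap_schmidt_form) (auto simp: d)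
  finally show ?case by (simp add: d)
next
  case (round j d m L v q p)
  obtain D ds where d: "d = D # ds" using round.prems by (cases d) auto
  have IH: "q i * real r \<le> (\<Sum>i'\<in>I. sqnorm [hd (d[j := dim_row (L i)])] (\<alpha>' i')) *
      (\<Sum>i'\<in>I. sqnorm (tl (d[j := dim_row (L i)])) (\<beta>' i'))"
    if "i < m" "schmidt_form I (d[j := dim_row (L i)]) (local_act d j (L i) v) \<alpha>' \<beta>'" for i \<alpha>' \<beta>'
    using round(4) that round.prems by simp
  have p: "p * real r \<le> (\<Sum>i<m. q i * real r)"
    using round(3) by (simp add: sum_distrib_right[symmetric] mult_right_mono)
  show ?case
  proof (cases j)
    case 0
    have "(\<Sum>i<m. q i * real r)
        \<le> (\<Sum>i<m. (\<Sum>i'\<in>I. sqnorm [dim_row (L i)] (local_act [D] 0 (L i) (\<alpha> i'))) * (\<Sum>i'\<in>I. sqnorm ds (\<beta> i')))"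
      using IH schmidt_form_local_act_0[of I D ds v \<alpha> \<beta>] round.prems d 0 by (intro sum_mono) fastforce
    also have "\<dots> = (\<Sum>i'\<in>I. sqnorm [D] (\<alpha> i')) * (\<Sum>i'\<in>I. sqnorm ds (\<beta> i'))"
      using sum_sqnorm_local_act_family[of 0 "[D]" m L \<alpha> I] round(2) d 0
      by (simp add: sum_distrib_right[symmetric])
    finally show ?thesis using p d by simp
  next
    case (Suc j')
    then have j': "j' < length ds" "instrument (ds ! j') m L" using round(1,2) d by simp_all
    have "(\<Sum>i<m. q i * real r)
        \<le> (\<Sum>i<m. (\<Sum>i'\<in>I. sqnorm [D] (\<alpha> i')) * (\<Sum>i'\<in>I. sqnorm (ds[j' := dim_row (L i)]) (local_act ds j' (L i) (\<beta> i'))))"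
      using IH schmidt_form_local_act_Suc[of I D ds v \<alpha> \<beta> j'] round.prems d Suc by (intro sum_mono) fastforce
    also have "\<dots> = (\<Sum>i'\<in>I. sqnorm [D] (\<alpha> i')) * (\<Sum>i'\<in>I. sqnorm ds (\<beta> i'))"
      using sum_sqnorm_local_act_family[OF j', of \<beta> I] by (simp add: sum_distrib_left[symmetric])
    finally show ?thesis using p d by simp
  qed
qed

lemma ghz_converts_bound:
  assumes "converts (ghz k r) (ghz k r') p" "2 \<le> k" "0 < r" "0 < r'"
  shows "p * real r' \<le> real r"
proof -
  obtain k' where k': "k = Suc k'" "0 < k'" using assms by (cases k) auto
  define \<alpha> where "\<alpha> = (\<lambda>(i::nat) xs. if xs = [i] then (1::complex) else 0)"
  define \<beta> where "\<beta> = (\<lambda>(i::nat) xs. if xs = replicate k' i then complex_of_real (1 / sqrt (real r)) else 0)"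
  have "p * real r' \<le> (\<Sum>i<r. sqnorm [hd (replicate k r)] (\<alpha> i)) * (\<Sum>i<r. sqnorm (tl (replicate k r)) (\<beta> i))"
  proof (rule schmidt_rank_bound)
    show "pays (target (ghz (Suc k') r')) (replicate k r) (snd (ghz k r)) p"
      using assms(1) k' by (simp add: converts_def ghz_def)
    show "schmidt_form {..<r} (replicate k r) (snd (ghz k r)) \<alpha> \<beta>"
      unfolding schmidt_form_def
    proof (intro allI impI)
      fix x xs assume x: "x # xs \<in> ibox (replicate k r)"
      have "(\<Sum>i<r. \<alpha> i [x] * \<beta> i xs) = (\<Sum>i<r. if i = x then \<beta> x xs else 0)"
        by (intro sum.cong refl) (auto simp: \<alpha>_def)
      also have "\<dots> = snd (ghz k r) (x # xs)" using x k' by (auto simp: \<beta>_def ghz_def)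
      finally show "snd (ghz k r) (x # xs) = (\<Sum>i<r. \<alpha> i [x] * \<beta> i xs)" by simp
    qed
  qed (use assms k' in auto)
  also have "(\<Sum>i<r. sqnorm [hd (replicate k r)] (\<alpha> i)) = real r"
  proof -
    have "sqnorm [hd (replicate k r)] (\<alpha> i) = 1" if "i < r" for i
      using that k' by (simp add: sqnorm_def sum_ibox_Cons \<alpha>_def if_distrib[of cmod]
        if_distrib[of "\<lambda>x. x ^ 2"] cong: if_cong)
    then show ?thesis by simp
  qed
  also have "(\<Sum>i<r. sqnorm (tl (replicate k r)) (\<beta> i)) = 1"
  proof -
    have "sqnorm (tl (replicate k r)) (\<beta> i) = 1 / real r" if "i < r" for i
    proof -
      have "sqnorm (tl (replicate k r)) (\<beta> i)
          = (\<Sum>xs\<in>ibox (replicate k' r). if xs = replicate k' i then 1 / real r else 0)"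
        unfolding sqnorm_def k'(1) replicate_Suc list.sel
        by (intro sum.cong refl) (auto simp: \<beta>_def norm_divide power_divide)
      then show ?thesis using that by simp
    qed
    then show ?thesis using assms by simp
  qed
  finally show ?thesis by simp
qed

lemma mconverts_from_ghz:
  assumes k: "0 < k" and s: "s \<in> states k" and n: "prod_list (fst s) \<le> 2 ^ n"
  shows "mconverts k (replicate_mset n (ghz k 2)) {#s#} 1"
proof -
  have "converts (tensor_list k (replicate n (ghz k 2))) (tensor_list k [s]) 1"
    using converts_from_ghz[OF k s n] k s by (simp add: tensor_list_ghz state_tensor_unit)
  then have "mconverts k (mset (replicate n (ghz k 2))) (mset [s]) 1"
    by (subst mconverts_tensor_list) (use ghz_in_states k s in auto)
  then show ?thesis by simp
qed

lemma entanglement_resource_theory: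
  assumes k: "2 \<le> k"
  shows "resource_theory (states k) (mconverts k) (ghz k 2)"
proof
  have k_pos: "0 < k" using k by simp
  show ghz: "ghz k 2 \<in> states k" by (rule ghz_in_states[OF k_pos]) simp
  show "mconverts k M N q" if "mconverts k M N p" "q \<le> p" for M N p q
    using that by (auto simp: mconverts_def intro: converts_antimono)
  show "mconverts k M K ((1 - \<eta>) * p * p' - (1 - p) / \<eta>)"
    if "set_mset M \<subseteq> states k" "set_mset N \<subseteq> states k" "set_mset K \<subseteq> states k" "mconverts k M N p"
      "mconverts k N K p'" "0 \<le> p'" "0 < \<eta>" "\<eta> < 1"
    for M N K p p' \<eta>
    using that unfolding mconverts_def by (intro converts_compose[where t = "tensor_mset k N"
      and k = k] tensor_mset_in_states) auto
  show "mconverts k (M + K) (N + K) p" if "set_mset M \<subseteq> states k" "set_mset N \<subseteq> states k"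
    "set_mset K \<subseteq> states k" "mconverts k M N p" for M N K p
    using that by (rule mconverts_add)
  show "mconverts k (M + N) M 1" if "set_mset M \<subseteq> states k" "set_mset N \<subseteq> states k" for M N
    using that by (rule mconverts_discard)
  show "\<exists>n. mconverts k (replicate_mset n (ghz k 2)) {#s#} 1" if "s \<in> states k" for s
    using mconverts_from_ghz[OF k_pos that, of "prod_list (fst s)"] less_imp_le[OF less_exp] by blast
  show "p * 2 ^ j \<le> 2 ^ i" if "mconverts k (replicate_mset i (ghz k 2)) (replicate_mset j (ghz k 2)) p"
    for i j p
  proof -
    have "mconverts k (mset (replicate i (ghz k 2))) (mset (replicate j (ghz k 2))) p" using that by simp
    then have "converts (ghz k (2 ^ i)) (ghz k (2 ^ j)) p"
      by (subst (asm) mconverts_tensor_list) (use ghz in \<open>auto simp: tensor_list_ghz[OF k_pos]\<close>)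
    then show ?thesis using ghz_converts_bound[OF _ k, of "2 ^ i" "2 ^ j" p] by simp
  qed
qed

section \<open>Monotonicity on average\<close>

lemma converts_refl: "s \<in> states k \<Longrightarrow> converts s s 1"
  unfolding converts_def by (rule pays.leaf) (simp add: target_def iprod_self states_def)

lemma tensor_scale: "tensor d (\<lambda>x. c * a x) f b = (\<lambda>x. c * tensor d a f b x)"
  by (auto simp: tensor_def)

text \<open>A protocol turns \<open>s\<close> into the ensemble of states \<open>T i\<close> with probabilities \<open>\<bar>c i\<bar>\<^sup>2\<close>.\<close>

definition ensemble :: "statevec \<Rightarrow> 'i set \<Rightarrow> ('i \<Rightarrow> complex) \<Rightarrow> ('i \<Rightarrow> statevec) \<Rightarrow> bool" where
  "ensemble s I c T \<longleftrightarrow> (\<forall>q. pays (\<lambda>d v p. \<exists>i\<in>I. d = fst (T i) \<and> v = (\<lambda>x. c i * snd (T i) x) \<and> p \<le> q i)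
     (fst s) (snd s) (\<Sum>i\<in>I. q i))"

lemma ensemble_mconverts:
  assumes ens: "ensemble s I c T" and s: "s \<in> states k" and T: "\<And>i. i \<in> I \<Longrightarrow> T i \<in> states k"
    and M: "set_mset M \<subseteq> states k" and N: "set_mset N \<subseteq> states k"
    and r: "\<And>i. i \<in> I \<Longrightarrow> mconverts k (add_mset (T i) M) N (r i)"
  shows "mconverts k (add_mset s M) N (\<Sum>i\<in>I. (cmod (c i))\<^sup>2 * r i)"
proof -
  obtain xs ys where lists: "M = mset xs" "N = mset ys" by (metis ex_mset)
  have members: "set xs \<subseteq> states k" "set ys \<subseteq> states k" using M N lists by auto
  define u where "u = tensor_list k xs"
  define t where "t = tensor_list k ys"
  have u: "u \<in> states k" and t: "t \<in> states k" using tensor_list_in_states members by (auto simp: u_def t_def)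
  have branch: "converts (state_tensor (T i) u) t (r i)" if "i \<in> I" for i
  proof -
    have "mconverts k (mset (T i # xs)) (mset ys) (r i)" using r[OF that] lists by simp
    then show ?thesis by (subst (asm) mconverts_tensor_list)
      (use members T[OF that] in \<open>auto simp: u_def t_def\<close>)
  qed
  have "pays (\<lambda>d v p. \<exists>i\<in>I. d = fst (T i) \<and> v = (\<lambda>x. c i * snd (T i) x) \<and> p \<le> (cmod (c i))\<^sup>2 * r i)
     (fst s) (snd s) (\<Sum>i\<in>I. (cmod (c i))\<^sup>2 * r i)" using ens by (simp add: ensemble_def)
  from pays_tensor[OF this, of "fst u" "snd u"] states_length[OF s] states_length[OF u] states_pos[OF u]
  have "pays (\<lambda>D w q. \<exists>d' v. length d' = length (fst u) \<and> D = dmul d' (fst u)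
      \<and> w = tensor d' v (fst u) (snd u) \<and>
     (\<exists>i\<in>I. d' = fst (T i) \<and> v = (\<lambda>x. c i * snd (T i) x) \<and> q \<le> (cmod (c i))\<^sup>2 * r i))
     (dmul (fst s) (fst u)) (tensor (fst s) (snd s) (fst u) (snd u)) (\<Sum>i\<in>I. (cmod (c i))\<^sup>2 * r i)" by simp
  then have "converts (state_tensor s u) t (\<Sum>i\<in>I. (cmod (c i))\<^sup>2 * r i)"
    unfolding converts_def state_tensor_def fst_conv snd_conv
  proof (rule pays_bind)
    fix D w q
    assume "\<exists>d' v. length d' = length (fst u) \<and> D = dmul d' (fst u) \<and> w = tensor d' v (fst u) (snd u) \<and>
     (\<exists>i\<in>I. d' = fst (T i) \<and> v = (\<lambda>x. c i * snd (T i) x) \<and> q \<le> (cmod (c i))\<^sup>2 * r i)"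
    then obtain i where i: "i \<in> I" "D = dmul (fst (T i)) (fst u)"
      "w = tensor (fst (T i)) (\<lambda>x. c i * snd (T i) x) (fst u) (snd u)" "q \<le> (cmod (c i))\<^sup>2 * r i" by blast
    have "pays (target t) D (tensor (fst (T i)) (snd (T i)) (fst u) (snd u)) (r i)"
      using branch[OF i(1)] i(2) by (simp add: converts_def state_tensor_def)
    then have "pays (target t) D w ((cmod (c i))\<^sup>2 * r i)"
      unfolding i(3) tensor_scale using t by (intro pays_scale) (auto simp: states_def)
    then show "pays (target t) D w q" using i(4) by (rule pays_antimono) (rule target_antimono)
  qed
  then have "converts (tensor_list k (s # xs)) (tensor_list k ys) (\<Sum>i\<in>I. (cmod (c i))\<^sup>2 * r i)"
    by (simp add: u_def t_def)
  then have "mconverts k (mset (s # xs)) (mset ys) (\<Sum>i\<in>I. (cmod (c i))\<^sup>2 * r i)"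
    by (subst mconverts_tensor_list) (use members s in auto)
  then show ?thesis using lists by simp
qed

definition words :: "'i set \<Rightarrow> nat \<Rightarrow> 'i list set" where "words I n = {w. set w \<subseteq> I \<and> length w = n}"

lemma words_0 [simp]: "words I 0 = {[]}" by (auto simp: words_def)

lemma finite_words [simp]: "finite I \<Longrightarrow> finite (words I n)"
  unfolding words_def by (rule finite_lists_length_eq)

lemma sum_words_Suc: "sum h (words I (Suc n)) = (\<Sum>i\<in>I. \<Sum>w\<in>words I n. h (i # w))"
proof -
  have W: "words I (Suc n) = (\<lambda>(i, w). i # w) ` (I \<times> words I n)"
  proof (intro Set.set_eqI iffI)
    fix v assume v: "v \<in> words I (Suc n)"
    then obtain i w where "v = i # w" by (cases v) (auto simp: words_def)
    then show "v \<in> (\<lambda>(i, w). i # w) ` (I \<times> words I n)" using v by (auto simp: words_def)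
  qed (auto simp: words_def)
  show ?thesis unfolding W
    by (subst sum.reindex) (auto simp: inj_on_def sum.cartesian_product case_prod_unfold)
qed

lemma sum_words_prob:
  assumes "sum P I = (1::real)"
  shows "(\<Sum>w\<in>words I n. prod_list (map P w)) = 1"
  by (induction n) (use assms in \<open>auto simp: sum_words_Suc sum_distrib_left[symmetric]\<close>)

lemma words_mean:
  assumes P: "sum P I = (1::real)" and f: "(\<Sum>i\<in>I. P i * f i) = 0"
  shows "(\<Sum>w\<in>words I n. prod_list (map P w) * sum_list (map f w)) = 0"
proof (induction n)
  case (Suc n)
  have "(\<Sum>w\<in>words I (Suc n). prod_list (map P w) * sum_list (map f w))
    = (\<Sum>i\<in>I. \<Sum>w\<in>words I n. P i * f i * prod_list (map P w) + P i * (prod_list (map P w) * sum_list (map f w)))"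
    unfolding sum_words_Suc by (intro sum.cong refl) (simp add: algebra_simps)
  also have "\<dots> = 0"
    unfolding sum.distrib sum_distrib_left[symmetric] sum_words_prob[OF P] Suc using f by simp
  finally show ?case .
qed simp

lemma words_variance:
  assumes P: "sum P I = (1::real)" and f: "(\<Sum>i\<in>I. P i * f i) = 0"
  shows "(\<Sum>w\<in>words I n. prod_list (map P w) * (sum_list (map f w))\<^sup>2) = real n * (\<Sum>i\<in>I. P i * (f i)\<^sup>2)"
proof (induction n)
  case (Suc n)
  have "(\<Sum>w\<in>words I (Suc n). prod_list (map P w) * (sum_list (map f w))\<^sup>2)
    = (\<Sum>i\<in>I. \<Sum>w\<in>words I n. P i * (f i)\<^sup>2 * prod_list (map P w) +
        2 * (P i * f i) * (prod_list (map P w) * sum_list (map f w)) +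
        P i * (prod_list (map P w) * (sum_list (map f w))\<^sup>2))"
    unfolding sum_words_Suc by (intro sum.cong refl) (simp add: algebra_simps power2_eq_square)
  also have "\<dots> = (\<Sum>i\<in>I. P i * (f i)\<^sup>2) + sum P I * (real n * (\<Sum>i\<in>I. P i * (f i)\<^sup>2))"
    unfolding sum.distrib sum_distrib_left[symmetric] sum_words_prob[OF P] words_mean[OF P f] Suc
    by (simp add: sum_distrib_right)
  finally show ?case using P by (simp add: algebra_simps)
qed simp

lemma words_Chebyshev:
  assumes I: "finite I" and P: "sum P I = (1::real)" "\<And>i. i \<in> I \<Longrightarrow> 0 \<le> P i" and b: "b \<in> I" and a: "0 < a"
  shows "(\<Sum>w | w \<in> words I n \<and> a \<le> real n * P b - real (count_list w b). prod_list (map P w)) \<le> real n / a\<^sup>2"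
proof -
  define f where "f = (\<lambda>i. (if i = b then 1 else 0) - P b)"
  have centered: "(\<Sum>i\<in>I. P i * f i) = 0"
  proof -
    have "(\<Sum>i\<in>I. P i * f i) = (\<Sum>i\<in>I. (if i = b then P b else 0) - P b * P i)"
      by (intro sum.cong refl) (auto simp: f_def algebra_simps)
    also have "\<dots> = P b - P b * sum P I" using I b by (simp add: sum_subtractf sum_distrib_left)
    finally show ?thesis using P by simp
  qed
  have Pb: "P b \<le> 1" using member_le_sum[of b I P] I b P by auto
  have bounded: "(f i)\<^sup>2 \<le> 1" for i
  proof -
    have "\<bar>f i\<bar> \<le> 1" using Pb P(2)[OF b] by (auto simp: f_def)
    then show ?thesis by (simp add: abs_square_le_1)
  qed
  have cnt: "sum_list (map f w) = real (count_list w b) - real (length w) * P b" for w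
    by (induction w) (auto simp: f_def algebra_simps)
  have Pw: "0 \<le> prod_list (map P w)" if "w \<in> words I n" for w
    using that P(2) by (intro prod_list_nonneg) (auto simp: words_def)
  let ?B = "{w \<in> words I n. a \<le> real n * P b - real (count_list w b)}"
  have "a\<^sup>2 * (\<Sum>w\<in>?B. prod_list (map P w)) \<le> (\<Sum>w\<in>?B. prod_list (map P w) * (sum_list (map f w))\<^sup>2)"
    unfolding sum_distrib_left
  proof (rule sum_mono)
    fix w assume w: "w \<in> ?B"
    then have "a \<le> - sum_list (map f w)" by (auto simp: cnt words_def)
    then have "a\<^sup>2 \<le> (- sum_list (map f w))\<^sup>2" using a by (intro power_mono) auto
    then show "a\<^sup>2 * prod_list (map P w) \<le> prod_list (map P w) * (sum_list (map f w))\<^sup>2"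
      using Pw w by (simp add: mult.commute mult_left_mono)
  qed
  also have "\<dots> \<le> (\<Sum>w\<in>words I n. prod_list (map P w) * (sum_list (map f w))\<^sup>2)"
    using I Pw by (intro sum_mono2) auto
  also have "\<dots> = real n * (\<Sum>i\<in>I. P i * (f i)\<^sup>2)" by (rule words_variance[OF P(1) centered])
  also have "\<dots> \<le> real n * (\<Sum>i\<in>I. P i * 1)"
    using P bounded by (intro mult_left_mono sum_mono) auto
  finally have "a\<^sup>2 * (\<Sum>w\<in>?B. prod_list (map P w)) \<le> real n" using P(1) by simp
  then show ?thesis using a by (simp add: pos_le_divide_eq mult.commute)
qed

lemma words_frequencies_bound:
  assumes I: "finite I" and P: "sum P I = (1::real)" "\<And>i. i \<in> I \<Longrightarrow> 0 \<le> P i" and a: "0 < a"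
    and m: "\<And>i. i \<in> I \<Longrightarrow> 0 < m i \<Longrightarrow> real (m i) \<le> real n * P i - a"
  shows "1 - real (card I) * (real n / a\<^sup>2)
    \<le> (\<Sum>w\<in>words I n. prod_list (map P w) * of_bool (\<forall>i\<in>I. m i \<le> count_list w i))"
proof -
  let ?p = "\<lambda>w. prod_list (map P w)" and ?rare = "\<lambda>i w. a \<le> real n * P i - real (count_list w i)"
  let ?typical = "\<lambda>w. \<forall>i\<in>I. m i \<le> count_list w i"
  have nonneg: "0 \<le> ?p w" if "w \<in> words I n" for w
    using that P(2) by (intro prod_list_nonneg) (auto simp: words_def)
  have cover: "1 \<le> of_bool (?typical w) + (\<Sum>i\<in>I. of_bool (?rare i w) :: real)" for w
  proof (cases "?typical w")
    case True then show ?thesis by (simp add: sum_nonneg)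
  next
    case False
    then obtain i where i: "i \<in> I" "count_list w i < m i" by (auto simp: not_le)
    then have "?rare i w" using m[of i] by simp
    then show ?thesis
      using member_le_sum[OF i(1), of "\<lambda>i. of_bool (?rare i w) :: real"] I by simp
  qed
  have "1 = (\<Sum>w\<in>words I n. ?p w)" using sum_words_prob[OF P(1)] by simp
  also have "\<dots> \<le> (\<Sum>w\<in>words I n. ?p w * (of_bool (?typical w) + (\<Sum>i\<in>I. of_bool (?rare i w))))"
    using mult_left_mono[OF cover nonneg] by (intro sum_mono) simp
  also have "\<dots> = (\<Sum>w\<in>words I n. ?p w * of_bool (?typical w)) + (\<Sum>i\<in>I. \<Sum>w\<in>words I n. ?p w * of_bool (?rare i w))"
    by (simp add: distrib_left sum.distrib sum_distrib_left sum.swap[of _ I])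
  also have "(\<Sum>i\<in>I. \<Sum>w\<in>words I n. ?p w * of_bool (?rare i w)) \<le> (\<Sum>i\<in>I. real n / a\<^sup>2)"
    using words_Chebyshev[OF I P _ a] I by (intro sum_mono) (simp add: sum_mult_of_bool_eq Int_def)
  finally show ?thesis by simp
qed

lemma mset_map_words:
  "finite I \<Longrightarrow> set w \<subseteq> I \<Longrightarrow> mset (map T w) = (\<Sum>i\<in>I. replicate_mset (count_list w i) (T i))"
proof (induction w)
  case (Cons j w)
  have "(\<Sum>i\<in>I. replicate_mset (count_list (j # w) i) (T i))
     = (\<Sum>i\<in>I. (if i = j then {#T j#} else {#}) + replicate_mset (count_list w i) (T i))"
    by (intro sum.cong refl) auto
  also have "\<dots> = {#T j#} + (\<Sum>i\<in>I. replicate_mset (count_list w i) (T i))"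
    using Cons.prems by (simp add: sum.distrib)
  finally show ?case using Cons by simp
qed simp

lemma ensemble_words:
  assumes ens: "ensemble s I c T" and I: "finite I" and s: "s \<in> states k" and T: "\<And>i. i \<in> I \<Longrightarrow> T i \<in> states k"
    and N: "set_mset N \<subseteq> states k" and X: "set_mset X \<subseteq> states k"
    and v: "\<And>w. w \<in> words I n \<Longrightarrow> mconverts k (X + mset (map T w)) N (v w)"
  shows "mconverts k (X + replicate_mset n s) N (\<Sum>w\<in>words I n. prod_list (map (\<lambda>i. (cmod (c i))\<^sup>2) w) * v w)"
  using X v
proof (induction n arbitrary: X v)
  case 0 then show ?case by simp
next
  case (Suc n)
  have "mconverts k (add_mset s (X + replicate_mset n s)) N
      (\<Sum>i\<in>I. (cmod (c i))\<^sup>2 * (\<Sum>w\<in>words I n. prod_list (map (\<lambda>i. (cmod (c i))\<^sup>2) w) * v (i # w)))"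
  proof (rule ensemble_mconverts[OF ens s T _ N])
    show "set_mset (X + replicate_mset n s) \<subseteq> states k" using Suc s by auto
    fix i assume i: "i \<in> I"
    have "mconverts k (add_mset (T i) X + replicate_mset n s) N
        (\<Sum>w\<in>words I n. prod_list (map (\<lambda>i. (cmod (c i))\<^sup>2) w) * v (i # w))"
    proof (rule Suc.IH)
      show "set_mset (add_mset (T i) X) \<subseteq> states k" using Suc T[OF i] by auto
      fix w assume "w \<in> words I n"
      then have "i # w \<in> words I (Suc n)" using i by (auto simp: words_def)
      from Suc.prems(2)[OF this] show "mconverts k (add_mset (T i) X + mset (map T w)) N (v (i # w))" by simp
    qed
    then show "mconverts k (add_mset (T i) (X + replicate_mset n s)) N
        (\<Sum>w\<in>words I n. prod_list (map (\<lambda>i. (cmod (c i))\<^sup>2) w) * v (i # w))"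
      by simp
  qed
  moreover have "(\<Sum>w\<in>words I (Suc n). prod_list (map (\<lambda>i. (cmod (c i))\<^sup>2) w) * v w)
     = (\<Sum>i\<in>I. (cmod (c i))\<^sup>2 * (\<Sum>w\<in>words I n. prod_list (map (\<lambda>i. (cmod (c i))\<^sup>2) w) * v (i # w)))"
    unfolding sum_words_Suc by (simp add: sum_distrib_left mult.assoc)
  ultimately show ?case by simp
qed

lemma mconverts_zero: "set_mset M \<subseteq> states k \<Longrightarrow> set_mset N \<subseteq> states k \<Longrightarrow> mconverts k M N 0"
  unfolding mconverts_def by (intro converts_zero[of _ k] tensor_mset_in_states)

lemma mconverts_subset: "set_mset M \<subseteq> states k \<Longrightarrow> N \<subseteq># M \<Longrightarrow> mconverts k M N 1"
  using mconverts_discard[of N k "M - N"] by (metis in_diffD set_mset_mono subset_iff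
    subset_mset.add_diff_inverse)

lemma ensemble_mconverts_typical:
  assumes ens: "ensemble s I c T" and I: "finite I" and s: "s \<in> states k" and T: "\<And>i. i \<in> I \<Longrightarrow> T i \<in> states k"
  shows "mconverts k (replicate_mset n s) (\<Sum>i\<in>I. replicate_mset (m i) (T i))
    (\<Sum>w\<in>words I n. prod_list (map (\<lambda>i. (cmod (c i))\<^sup>2) w) * of_bool (\<forall>i\<in>I. m i \<le> count_list w i))"
    (is "mconverts k _ ?N _")
proof -
  have N: "set_mset ?N \<subseteq> states k"
    using I T by (induction I rule: finite_induct) (auto split: if_splits)
  have "mconverts k ({#} + mset (map T w)) ?N (of_bool (\<forall>i\<in>I. m i \<le> count_list w i))" if w: "w \<in> words I n"
    for w
  proof -
    have wI: "set w \<subseteq> I" using w by (simp add: words_def)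
    then have wS: "set_mset (mset (map T w)) \<subseteq> states k" using T by auto
    show ?thesis
    proof (cases "\<forall>i\<in>I. m i \<le> count_list w i")
      case True
      have "?N \<subseteq># (\<Sum>i\<in>I. replicate_mset (count_list w i) (T i))"
        using I True by (induction I rule: finite_induct)
          (auto intro: replicate_mset_subset subset_mset.add_mono)
      also have "\<dots> = mset (map T w)" by (rule mset_map_words[OF I wI, symmetric])
      finally show ?thesis using True mconverts_subset[OF wS] by simp
    next
      case False
      then show ?thesis using mconverts_zero[OF wS N] by (simp only: of_bool_eq add_0)
    qed
  qed
  then have "mconverts k ({#} + replicate_mset n s) ?N
      (\<Sum>w\<in>words I n. prod_list (map (\<lambda>i. (cmod (c i))\<^sup>2) w) * of_bool (\<forall>i\<in>I. m i \<le> count_list w i))"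
    by (intro ensemble_words[OF ens I s T N]) auto
  then show ?thesis by simp
qed

locale entanglement_functional =
  fixes k :: nat and E :: "statevec multiset \<Rightarrow> real"
  assumes k: "2 \<le> k"
    and E_add: "\<lbrakk>set_mset M \<subseteq> states k; set_mset N \<subseteq> states k\<rbrakk> \<Longrightarrow> E (M + N) = E M + E N"
    and E_ghz: "E {#ghz k 2#} = 1"
    and E_mono: "resource_theory.dominates (states k) (mconverts k) (ghz k 2) M N \<Longrightarrow> E N \<le> E M"
begin

sublocale resource_theory "states k" "mconverts k" "ghz k 2"
  by (rule entanglement_resource_theory[OF k])

definition val :: "statevec \<Rightarrow> real" where "val s = E {#s#}"

lemma E_empty [simp]: "E {#} = 0" using E_add[of "{#}" "{#}"] by simp

lemma E_repeat: "M \<in> resources \<Longrightarrow> E (repeat_mset n M) = real n * E M"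
proof (induction n)
  case (Suc n)
  then have "set_mset M \<subseteq> states k" "set_mset (repeat_mset n M) \<subseteq> states k" using resources_repeat[of M n]
    by (auto simp: resources_iff)
  then show ?case using E_add Suc by (simp add: algebra_simps)
qed simp

lemma E_replicate: "s \<in> states k \<Longrightarrow> E (replicate_mset n s) = real n * val s"
  using E_repeat[of "{#s#}" n] by (simp add: val_def)

lemma E_nonneg: "M \<in> resources \<Longrightarrow> 0 \<le> E M"
  using E_mono[OF dominates_subset[of M "{#}"]] by simp

lemma val_nonneg: "s \<in> states k \<Longrightarrow> 0 \<le> val s" unfolding val_def by (rule E_nonneg) simp

lemma E_sum_mset:
  "finite I \<Longrightarrow> (\<And>i. i \<in> I \<Longrightarrow> X i \<in> resources) \<Longrightarrow> (\<Sum>i\<in>I. X i) \<in> resources \<and> E (\<Sum>i\<in>I. X i) = (\<Sum>i\<in>I. E (X i))"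
proof (induction I rule: finite_induct)
  case (insert i I)
  then have "X i \<in> resources" "sum X I \<in> resources" by auto
  then show ?case using E_add[of "X i" "sum X I"] insert by (simp add: resources_iff)
qed simp

lemma E_mono_convertible:
  "M \<in> resources \<Longrightarrow> N \<in> resources \<Longrightarrow> (\<And>q. q < 1 \<Longrightarrow> mconverts k M N q) \<Longrightarrow> E N \<le> E M"
  by (intro E_mono dominates_of_convertible) (simp add: asymp_convertible_const_iff)

lemma val_mono_converts:
  assumes "s \<in> states k" "t \<in> states k" "\<And>q. q < 1 \<Longrightarrow> converts s t q"
  shows "val t \<le> val s"
  unfolding val_def
proof (rule E_mono_convertible)
  fix q :: real assume "q < 1"
  then have "converts (tensor_list k [s]) (tensor_list k [t]) q" using assms by (simp add: state_tensor_unit)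
  then have "mconverts k (mset [s]) (mset [t]) q" by (subst mconverts_tensor_list) (use assms in auto)
  then show "mconverts k {#s#} {#t#} q" by simp
qed (use assms in auto)

lemma val_tensor:
  assumes "s \<in> states k" "t \<in> states k"
  shows "val (state_tensor s t) = val s + val t"
proof -
  have same: "tensor_list k [state_tensor s t] = tensor_list k [s, t]"
    using assms by (simp add: state_tensor_unit state_tensor_in_states)
  have "converts (tensor_list k [s, t]) (tensor_list k [s, t]) q" if "q < 1" for q
    using that assms by (intro converts_antimono[OF converts_refl[OF tensor_list_in_states]]) auto
  then have "mconverts k (mset [state_tensor s t]) (mset [s, t]) q"
    "mconverts k (mset [s, t]) (mset [state_tensor s t]) q" if "q < 1" for q
    using that assms by (subst mconverts_tensor_list; auto simp: same[simplified] state_tensor_in_states)+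
  then have "E {#s, t#} \<le> E {#state_tensor s t#}" "E {#state_tensor s t#} \<le> E {#s, t#}"
    using assms by (auto intro!: E_mono_convertible simp: state_tensor_in_states)
  moreover have "E {#s, t#} = val s + val t" using E_add[of "{#s#}" "{#t#}"] assms
    by (simp add: val_def add_mset_commute)
  ultimately show ?thesis by (simp add: val_def)
qed

lemma val_le_log:
  assumes "s \<in> states k" "prod_list (fst s) \<le> 2 ^ n"
  shows "val s \<le> real n"
proof -
  have "mconverts k (replicate_mset n (ghz k 2)) {#s#} q" if "q < 1" for q
    using convertible_antimono[OF mconverts_from_ghz[OF _ assms]] k that by simp
  then have "E {#s#} \<le> E (replicate_mset n (ghz k 2))" using assms by (intro E_mono_convertible) auto
  then show ?thesis using E_replicate[OF g_in] E_ghz by (simp add: val_def)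
qed

lemma ensemble_dominates:
  assumes ens: "ensemble s I c T" and I: "finite I" and s: "s \<in> states k" and T: "\<And>i. i \<in> I \<Longrightarrow> T i \<in> states k"
    and P: "(\<Sum>i\<in>I. (cmod (c i))\<^sup>2) = 1" and "0 < \<delta>" "0 < l"
    and m: "\<And>i. i \<in> I \<Longrightarrow> 0 < m i \<Longrightarrow> real (m i) \<le> real l * ((cmod (c i))\<^sup>2 - \<delta>)"
  shows "dominates (replicate_mset l s) (\<Sum>i\<in>I. replicate_mset (m i) (T i))" (is "dominates _ ?Y")
proof (rule dominatesI)
  show s': "replicate_mset l s \<in> resources" using s by (auto simp: resources_iff)
  show Y: "?Y \<in> resources" using E_sum_mset[OF I, of "\<lambda>i. replicate_mset (m i) (T i)"] T
    by (auto simp: resources_iff)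
  let ?err = "\<lambda>n. real (card I) * (real (n * l) / (\<delta> * real (n * l))\<^sup>2)"
  have prob: "mconverts k (repeat_mset n (replicate_mset l s)) (repeat_mset n ?Y) (1 - ?err n)" if "0 < n" for n
  proof -
    have copies: "real (n * m i) \<le> real (n * l) * (cmod (c i))\<^sup>2 - \<delta> * real (n * l)" if "i \<in> I" "0 < n * m i"
      for i
      using mult_left_mono[OF m, of i "real n"] that by (simp add: algebra_simps)
    have "repeat_mset n ?Y = (\<Sum>i\<in>I. replicate_mset (n * m i) (T i))"
      using I by (induction I rule: finite_induct) auto
    moreover have "1 - ?err n \<le> (\<Sum>w\<in>words I (n * l). prod_list (map (\<lambda>i. (cmod (c i))\<^sup>2) w)
        * of_bool (\<forall>i\<in>I. n * m i \<le> count_list w i))"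
      using \<open>0 < \<delta>\<close> \<open>0 < l\<close> \<open>0 < n\<close> by (intro words_frequencies_bound I P copies) auto
    ultimately show ?thesis
      using convertible_antimono[OF ensemble_mconverts_typical[OF ens I s T, of "n * l" "\<lambda>i. n * m i"]] by simp
  qed
  have "?err \<longlonglongrightarrow> 0" using \<open>0 < \<delta>\<close> \<open>0 < l\<close> by real_asymp
  have "\<forall>\<^sub>F n in sequentially. mconverts k (repeat_mset n (replicate_mset l s)) (repeat_mset n ?Y) (1 - \<epsilon>)"
    if "0 < \<epsilon>" for \<epsilon>
    using order_tendstoD(2)[OF \<open>?err \<longlonglongrightarrow> 0\<close> that] eventually_gt_at_top[of 0]
  proof eventually_elim
    case (elim n)
    then show ?case by (intro convertible_antimono[OF prob]) auto
  qed
  then show "asymp_convertible (\<lambda>n. repeat_mset n (replicate_mset l s)) (\<lambda>n. repeat_mset n ?Y)"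
    using s' Y by (simp add: asymp_convertible_def del: repeat_replicate_mset)
qed

lemma val_average:
  assumes ens: "ensemble s I c T" and I: "finite I" and s: "s \<in> states k" and T: "\<And>i. i \<in> I \<Longrightarrow> T i \<in> states k"
    and P: "(\<Sum>i\<in>I. (cmod (c i))\<^sup>2) = 1"
  shows "(\<Sum>i\<in>I. (cmod (c i))\<^sup>2 * val (T i)) \<le> val s"
proof -
  define K where "K = (\<Sum>i\<in>I. val (T i))"
  have bound: "(\<Sum>i\<in>I. (cmod (c i))\<^sup>2 * val (T i)) \<le> val s + 2 * K / real l" if "l > 0" for l :: nat
  proof -
    define m where "m = (\<lambda>i. nat \<lfloor>real l * ((cmod (c i))\<^sup>2 - 1 / real l)\<rfloor>)"
    let ?Y = "\<Sum>i\<in>I. replicate_mset (m i) (T i)"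
    have "real (m i) \<le> real l * ((cmod (c i))\<^sup>2 - 1 / real l)" if "0 < m i" for i using that
      unfolding m_def by linarith
    then have "dominates (replicate_mset l s) ?Y"
      using \<open>l > 0\<close> by (intro ensemble_dominates[OF ens I s T P, of "1 / real l"]) auto
    then have "E ?Y \<le> real l * val s" using E_mono E_replicate[OF s] by metis
    moreover have "E ?Y = (\<Sum>i\<in>I. real (m i) * val (T i))"
      using E_sum_mset[OF I, of "\<lambda>i. replicate_mset (m i) (T i)"] T by (auto simp: E_replicate resources_iff)
    moreover have "(\<Sum>i\<in>I. (real l * (cmod (c i))\<^sup>2 - 2) * val (T i)) \<le> (\<Sum>i\<in>I. real (m i) * val (T i))"
    proof (rule sum_mono)
      fix i assume i: "i \<in> I"
      have "real l * ((cmod (c i))\<^sup>2 - 1 / real l) - 1 \<le> real (m i)" unfolding m_def by linarith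
      then have "real l * (cmod (c i))\<^sup>2 - 2 \<le> real (m i)" using \<open>l > 0\<close> by (simp add: right_diff_distrib)
      then show "(real l * (cmod (c i))\<^sup>2 - 2) * val (T i) \<le> real (m i) * val (T i)"
        using val_nonneg[OF T[OF i]] by (rule mult_right_mono)
    qed
    ultimately have "real l * (\<Sum>i\<in>I. (cmod (c i))\<^sup>2 * val (T i)) - 2 * K \<le> real l * val s"
      by (simp add: left_diff_distrib sum_subtractf sum_distrib_left K_def mult.assoc)
    then show ?thesis using \<open>l > 0\<close> by (simp add: field_simps)
  qed
  have "(\<lambda>l. val s + 2 * K / real l) \<longlonglongrightarrow> val s + 0" by (intro tendsto_intros lim_const_over_n)
  moreover have "\<forall>\<^sub>F l in sequentially. (\<Sum>i\<in>I. (cmod (c i))\<^sup>2 * val (T i)) \<le> val s + 2 * K / real l"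
    using bound by (auto intro: eventually_sequentiallyI[of 1])
  ultimately show ?thesis using tendsto_lowerbound by fastforce
qed

end

section \<open>Flagged superpositions\<close>

definition ket :: "nat \<Rightarrow> nat \<Rightarrow> amp" where
  "ket k s = (\<lambda>xs. if xs = replicate k s then 1 else 0)"

definition flag_amp :: "nat \<Rightarrow> nat \<Rightarrow> nat list \<Rightarrow> (nat \<Rightarrow> complex) \<Rightarrow> (nat \<Rightarrow> amp) \<Rightarrow> amp" where
  "flag_amp k r f c v = (\<lambda>xs. \<Sum>s<r. c s * tensor (replicate k r) (ket k s) f (v s) xs)"

text \<open>The locally flagged superposition \<open>\<Sum>\<^sub>s c\<^sub>s |s\<dots>s\<rangle> \<otimes> v\<^sub>s\<close>.\<close>

definition flag_state :: "nat \<Rightarrow> nat \<Rightarrow> nat list \<Rightarrow> (nat \<Rightarrow> complex) \<Rightarrow> (nat \<Rightarrow> amp) \<Rightarrow> statevec" where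
  "flag_state k r f c v = (dmul (replicate k r) f, flag_amp k r f c v)"

lemma fst_flag_state [simp]: "fst (flag_state k r f c v) = dmul (replicate k r) f" by (simp add: flag_state_def)

lemma snd_flag_state [simp]: "snd (flag_state k r f c v) = flag_amp k r f c v" by (simp add: flag_state_def)

lemma iprod_ket:
  assumes k: "0 < k" and s: "s < r" "s' < r"
  shows "iprod (replicate k r) (ket k s) (ket k s') = (if s = s' then 1 else 0)"
proof -
  have "iprod (replicate k r) (ket k s) (ket k s')
      = (\<Sum>xs\<in>ibox (replicate k r). if xs = replicate k s then (if s = s' then 1 else 0) else 0)"
    unfolding iprod_def ket_def using k by (intro sum.cong refl) auto
  then show ?thesis using s by simp
qed

lemma iprod_flag_amp:
  assumes k: "0 < k" and f: "length f = k"
  shows "iprod (dmul (replicate k r) f) (flag_amp k r f c v) (flag_amp k r f c' v')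
      = (\<Sum>s<r. cnj (c s) * c' s * iprod f (v s) (v' s))"
proof -
  have "iprod (dmul (replicate k r) f) (flag_amp k r f c v) (flag_amp k r f c' v')
    = (\<Sum>x\<in>ibox (dmul (replicate k r) f). \<Sum>s<r. \<Sum>s'<r. cnj (c s) * c' s' *
         (cnj (tensor (replicate k r) (ket k s) f (v s) x) * tensor (replicate k r) (ket k s') f (v' s') x))"
    unfolding iprod_def flag_amp_def cnj_sum sum_product by (intro sum.cong refl) (simp add: ac_simps)
  also have "\<dots> = (\<Sum>s<r. \<Sum>s'<r. cnj (c s) * c' s' * iprod (dmul (replicate k r) f)
         (tensor (replicate k r) (ket k s) f (v s)) (tensor (replicate k r) (ket k s') f (v' s')))"
    unfolding iprod_def sum_distrib_left
    by (rule trans[OF sum.swap]) (intro sum.cong refl sum.swap)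
  also have "\<dots> = (\<Sum>s<r. \<Sum>s'<r. if s' = s then cnj (c s) * c' s * iprod f (v s) (v' s) else 0)"
    using k f by (intro sum.cong refl) (auto simp: iprod_tensor iprod_ket)
  finally show ?thesis by simp
qed

lemma supported_sum: "(\<And>i. i \<in> I \<Longrightarrow> supported d (a i)) \<Longrightarrow> supported d (\<lambda>x. \<Sum>i\<in>I. w i * a i x)"
  by (auto simp: supported_def intro!: sum.neutral)

lemma supported_flag_amp: "supported (dmul (replicate k r) f) (flag_amp k r f c v)"
  unfolding flag_amp_def by (intro supported_sum supported_tensor)

lemma flag_state_in_states:
  assumes k: "0 < k" and r: "0 < r" and f: "valid_dims k f" and c: "(\<Sum>s<r. (cmod (c s))\<^sup>2) = 1"
    and v: "\<And>s. s < r \<Longrightarrow> sqnorm f (v s) = 1"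
  shows "flag_state k r f c v \<in> states k"
proof -
  have len: "length f = k" using f by (simp add: valid_dims_def)
  have "complex_of_real (sqnorm (dmul (replicate k r) f) (flag_amp k r f c v))
      = (\<Sum>s<r. cnj (c s) * c s * iprod f (v s) (v s))"
    unfolding iprod_self[symmetric] iprod_flag_amp[OF k len] ..
  also have "\<dots> = complex_of_real (\<Sum>s<r. (cmod (c s))\<^sup>2)"
    unfolding of_real_sum complex_norm_square by (intro sum.cong refl) (simp add: iprod_self v ac_simps)
  finally have "sqnorm (dmul (replicate k r) f) (flag_amp k r f c v) = 1" using c of_real_eq_iff by metis
  moreover have "valid_dims k (replicate k r)" using r by (simp add: valid_dims_def)
  ultimately show ?thesis using f by (simp add: states_def supported_flag_amp valid_dims_dmul)
qed

lemma tensor_sum_left: "tensor d (\<lambda>x. \<Sum>i\<in>I. w i * a i x) f b = (\<lambda>x. \<Sum>i\<in>I. w i * tensor d (a i) f b x)"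
  by (auto simp: tensor_def sum_distrib_right mult.assoc)

lemma tensor_sum_right: "tensor d a f (\<lambda>x. \<Sum>i\<in>I. w i * b i x) = (\<lambda>x. \<Sum>i\<in>I. w i * tensor d a f (b i) x)"
  by (auto simp: tensor_def sum_distrib_left mult.left_commute)

lemma state_tensor_flag_state:
  assumes "length f = k" "length h = k"
  shows "state_tensor (flag_state k r f c v) (h, b) = flag_state k r (dmul f h) c (\<lambda>s. tensor f (v s) h b)"
  unfolding state_tensor_def flag_state_def fst_conv snd_conv flag_amp_def tensor_sum_left dmul_assoc
  using assms by (simp add: tensor_assoc)

text \<open>Every party reads off the value \<open>s\<close> of the flag, renames it to \<open>\<iota> s\<close>, and applies the local relabelling
  \<open>\<pi> s\<close> with phases \<open>\<gamma> s\<close>.\<close>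

locale controlled_relabelling =
  fixes k r r' :: nat and f f' :: "nat list" and \<iota> :: "nat \<Rightarrow> nat"
    and \<pi> :: "nat \<Rightarrow> nat \<Rightarrow> nat \<Rightarrow> nat" and \<gamma> :: "nat \<Rightarrow> nat \<Rightarrow> nat \<Rightarrow> complex"
  assumes length_f: "length f = k" and length_f': "length f' = k"
    and inj_\<iota>: "inj_on \<iota> {..<r}" and \<iota>_less: "\<And>s. s < r \<Longrightarrow> \<iota> s < r'"
    and relabelling_\<pi>: "\<And>s. s < r \<Longrightarrow> relabelling f f' (\<pi> s) (\<gamma> s)"
begin

definition ctrl_map :: "nat \<Rightarrow> nat \<Rightarrow> nat" where
  "ctrl_map j x = \<iota> (x div f ! j) * f' ! j + \<pi> (x div f ! j) j (x mod f ! j)"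

definition ctrl_phase :: "nat \<Rightarrow> nat \<Rightarrow> complex" where
  "ctrl_phase j x = \<gamma> (x div f ! j) j (x mod f ! j)"

abbreviation R :: "nat list" where "R \<equiv> replicate k r"
abbreviation R' :: "nat list" where "R' \<equiv> replicate k r'"

lemma lengths: "length R = length f" "length R' = length f'" using length_f length_f' by auto

lemma ctrl_digits:
  assumes "j < k" "x < r * f ! j"
  shows "x div f ! j < r" "x mod f ! j < f ! j" "\<pi> (x div f ! j) j (x mod f ! j) < f' ! j"
    "cmod (ctrl_phase j x) = 1"
proof -
  show digits: "x div f ! j < r" "x mod f ! j < f ! j"
    using assms(2) less_mult_imp_pos[OF assms(2)] by (auto simp: less_mult_imp_div_less)
  then show "\<pi> (x div f ! j) j (x mod f ! j) < f' ! j" "cmod (ctrl_phase j x) = 1"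
    using relabelling_\<pi> assms(1) length_f by (auto simp: relabelling_def ctrl_phase_def)
qed

lemma inj_on_ctrl_map:
  assumes j: "j < k"
  shows "inj_on (ctrl_map j) {..<r * f ! j}"
proof (rule inj_onI)
  fix x y assume "x \<in> {..<r * f ! j}" "y \<in> {..<r * f ! j}" and same: "ctrl_map j x = ctrl_map j y"
  then have xy: "x < r * f ! j" "y < r * f ! j" by auto
  note x = ctrl_digits[OF j xy(1)] and y = ctrl_digits[OF j xy(2)]
  have flag: "\<iota> (x div f ! j) = \<iota> (y div f ! j)"
    using arg_cong[OF same, of "\<lambda>z. z div f' ! j"] x(3) y(3) unfolding ctrl_map_def by (simp only: mult_add_div)
  then have div: "x div f ! j = y div f ! j" using inj_\<iota> x(1) y(1) by (auto simp: inj_on_def)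
  then have "\<pi> (x div f ! j) j (x mod f ! j) = \<pi> (x div f ! j) j (y mod f ! j)"
    using same flag unfolding ctrl_map_def by simp
  then have "x mod f ! j = y mod f ! j"
    using relabelling_\<pi>[OF x(1)] x(2) y(2) j length_f by (auto simp: relabelling_def inj_on_def)
  then show "x = y" using div by (metis div_mult_mod_eq)
qed

lemma relabelling_ctrl: "relabelling (dmul R f) (dmul R' f') ctrl_map ctrl_phase"
  unfolding relabelling_def
proof (intro conjI allI impI)
  fix j assume "j < length (dmul R f)"
  then have j: "j < k" using length_f by simp
  show "ctrl_map j x < dmul R' f' ! j" "cmod (ctrl_phase j x) = 1" if "x < dmul R f ! j" for x
    using ctrl_digits[of j x] that j \<iota>_less length_f length_f' by (auto simp: ctrl_map_def mult_add_less_mult)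
  show "inj_on (ctrl_map j) {..<dmul R f ! j}" using inj_on_ctrl_map[OF j] j length_f by simp
qed (use length_f length_f' in auto)

lemma relabel_ctrl_map_join:
  assumes "us \<in> ibox R" "ys \<in> ibox f"
  shows "relabel ctrl_map (join f us ys) = join f' (map \<iota> us) (map (\<lambda>j. \<pi> (us ! j) j (ys ! j)) [0..<k])"
  using assms length_f length_f' nth_ibox[OF assms(2)]
  by (intro nth_equalityI) (auto simp: ctrl_map_def length_ibox)

lemma map_\<iota>_eq_replicate_iff:
  assumes "us \<in> ibox R" "s < r"
  shows "map \<iota> us = replicate k (\<iota> s) \<longleftrightarrow> us = replicate k s"
proof -
  have "us ! j < r" if "j < k" for j using nth_ibox[OF assms(1), of j] that by simp
  then show ?thesis
    using assms length_ibox[OF assms(1)] inj_\<iota> by (auto simp: list_eq_iff_nth_eq inj_on_def)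
qed

lemma tensor_ket_ctrl_map:
  assumes s: "s < r" and zs: "zs \<in> ibox (dmul R f)"
  shows "tensor R' (ket k (\<iota> s)) f' (monomial_act f f' (\<pi> s) (\<gamma> s) a) (relabel ctrl_map zs)
    = (\<Prod>j<length (dmul R f). ctrl_phase j (zs ! j)) * tensor R (ket k s) f a zs"
proof -
  obtain us ys where us: "us \<in> ibox R" and ys: "ys \<in> ibox f" and z: "zs = join f us ys"
    using ibox_dmul_cases[OF lengths(1) zs] by blast
  have "us ! j < r" if "j < k" for j using nth_ibox[OF us, of j] that by simp
  then have image: "map \<iota> us \<in> ibox R'" "map (\<lambda>j. \<pi> (us ! j) j (ys ! j)) [0..<k] \<in> ibox f'" (is "?w \<in> _")
    using \<iota>_less length_ibox[OF us] relabelling_\<pi> nth_ibox[OF ys] length_f length_f'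
    by (auto simp: ibox_def relabelling_def)
  have target: "tensor R' (ket k (\<iota> s)) f' (monomial_act f f' (\<pi> s) (\<gamma> s) a) (relabel ctrl_map zs)
      = ket k (\<iota> s) (map \<iota> us) * monomial_act f f' (\<pi> s) (\<gamma> s) a ?w"
    unfolding z relabel_ctrl_map_join[OF us ys] by (rule tensor_join[OF lengths(2) image])
  have source: "tensor R (ket k s) f a zs = ket k s us * a ys"
    unfolding z by (rule tensor_join[OF lengths(1) us ys])
  show ?thesis
  proof (cases "us = replicate k s")
    case True
    have "?w = relabel (\<pi> s) ys" using True length_ibox[OF ys] length_f by (intro nth_equalityI) auto
    then have "monomial_act f f' (\<pi> s) (\<gamma> s) a ?w = (\<Prod>j<length f. \<gamma> s j (ys ! j)) * a ys"
      using monomial_act_relabel[OF relabelling_\<pi>[OF s] ys] by simp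
    moreover have "(\<Prod>j<length (dmul R f). ctrl_phase j (zs ! j)) = (\<Prod>j<length f. \<gamma> s j (ys ! j))"
      using True length_f nth_ibox[OF ys] by (intro prod.cong) (auto simp: ctrl_phase_def z)
    ultimately show ?thesis unfolding target source using True by (simp add: ket_def)
  next
    case False
    then show ?thesis unfolding target source using map_\<iota>_eq_replicate_iff[OF us s] by (simp add: ket_def)
  qed
qed

lemma monomial_act_ctrl:
  assumes s: "s < r"
  shows "monomial_act (dmul R f) (dmul R' f') ctrl_map ctrl_phase (tensor R (ket k s) f a)
    = tensor R' (ket k (\<iota> s)) f' (monomial_act f f' (\<pi> s) (\<gamma> s) a)"
proof (rule monomial_act_eqI[OF relabelling_ctrl supported_tensor tensor_ket_ctrl_map[OF s]])
  fix zs assume "zs \<in> ibox (dmul R' f')" and outside: "zs \<notin> relabel ctrl_map ` ibox (dmul R f)"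
  then obtain us ys where z: "us \<in> ibox R'" "ys \<in> ibox f'" "zs = join f' us ys"
    using ibox_dmul_cases[OF lengths(2)] by blast
  have "monomial_act f f' (\<pi> s) (\<gamma> s) a ys = 0" if us: "us = replicate k (\<iota> s)"
  proof (rule monomial_act_outside_range, rule notI)
    assume "ys \<in> relabel (\<pi> s) ` ibox f"
    then obtain xs where xs: "xs \<in> ibox f" "ys = relabel (\<pi> s) xs" by blast
    have flag: "replicate k s \<in> ibox R" using s by simp
    have "relabel ctrl_map (join f (replicate k s) xs) = zs"
      unfolding relabel_ctrl_map_join[OF flag xs(1)] z(3) us xs(2)
      using xs(1) length_f length_f' by (intro nth_equalityI) (auto simp: length_ibox)
    then show False using outside join_in_ibox[OF lengths(1) flag xs(1)] by blast
  qed
  then show "tensor R' (ket k (\<iota> s)) f' (monomial_act f f' (\<pi> s) (\<gamma> s) a) zs = 0"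
    unfolding z(3) tensor_join[OF lengths(2) z(1,2)] by (simp add: ket_def)
qed

end

lemma relabels_flag_state:
  assumes f: "length f = k" "length f' = k"
    and \<iota>: "inj_on \<iota> {..<r}" "\<And>s. s < r \<Longrightarrow> \<iota> s < r'"
    and c: "\<And>s. s < r \<Longrightarrow> c' (\<iota> s) = c s" "\<And>s'. s' < r' \<Longrightarrow> s' \<notin> \<iota> ` {..<r} \<Longrightarrow> c' s' = 0"
    and v: "\<And>s. s < r \<Longrightarrow> relabels (f, v s) (f', v' (\<iota> s))"
  shows "relabels (flag_state k r f c v) (flag_state k r' f' c' v')"
proof -
  have "\<forall>s. \<exists>\<pi> \<gamma>. s < r \<longrightarrow> relabelling f f' \<pi> \<gamma> \<and> v' (\<iota> s) = monomial_act f f' \<pi> \<gamma> (v s)"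
    using v unfolding relabels_def relabel_map_def fst_conv snd_conv by metis
  then obtain \<pi> \<gamma> where \<pi>: "\<And>s. s < r \<Longrightarrow> relabelling f f' (\<pi> s) (\<gamma> s)"
    and v': "\<And>s. s < r \<Longrightarrow> v' (\<iota> s) = monomial_act f f' (\<pi> s) (\<gamma> s) (v s)" by metis
  interpret controlled_relabelling k r r' f f' \<iota> \<pi> \<gamma> by unfold_locales (use f \<iota> \<pi> in auto)
  let ?U = "monomial_act (dmul R f) (dmul R' f') ctrl_map ctrl_phase"
  have "?U (flag_amp k r f c v) = (\<lambda>x. \<Sum>s<r. c s * ?U (tensor R (ket k s) f (v s)) x)"
    unfolding flag_amp_def by (rule monomial_act_sum)
  also have "\<dots> = (\<lambda>x. \<Sum>s<r. c' (\<iota> s) * tensor R' (ket k (\<iota> s)) f' (v' (\<iota> s)) x)"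
    using monomial_act_ctrl c(1) v' by (intro ext sum.cong) auto
  also have "\<dots> = (\<lambda>x. \<Sum>s'\<in>\<iota> ` {..<r}. c' s' * tensor R' (ket k s') f' (v' s') x)"
    by (simp add: sum.reindex[OF \<iota>(1)])
  also have "\<dots> = flag_amp k r' f' c' v'"
    unfolding flag_amp_def using \<iota>(2) c(2) by (intro ext sum.mono_neutral_left) auto
  finally show ?thesis
    unfolding relabels_def relabel_map_def fst_flag_state snd_flag_state using relabelling_ctrl by metis
qed

lemma tensor_middle_swap:
  assumes len: "length R = n" "length R' = n" "length f = n" "length f' = n"
  shows "\<exists>U. relabel_map (dmul (dmul R R') (dmul f f')) (dmul (dmul R f) (dmul R' f')) U \<and>
    (\<forall>A B C D. U (tensor (dmul R R') (tensor R A R' B) (dmul f f') (tensor f C f' D))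
       = tensor (dmul R f) (tensor R A f C) (dmul R' f') (tensor R' B f' D))"
proof -
  obtain U1 where U1: "relabel_map (dmul R' f) (dmul f R') U1" "\<forall>B C. U1 (tensor R' B f C) = tensor f C R' B"
    using relabel_map_swap[of R' f] len by auto
  obtain U2 where U2: "relabel_map (dmul (dmul R' f) f') (dmul (dmul f R') f') U2"
     "\<forall>a b. U2 (tensor (dmul R' f) a f' b) = tensor (dmul f R') (U1 a) f' b"
    using relabel_map_tensor_right[OF U1(1), of f'] len by auto
  obtain U3 where U3: "relabel_map (dmul R (dmul (dmul R' f) f')) (dmul R (dmul (dmul f R') f')) U3"
     "\<forall>a b. U3 (tensor R b (dmul (dmul R' f) f') a) = tensor R b (dmul (dmul f R') f') (U2 a)"
    using relabel_map_tensor_left[OF U2(1), of R] len by auto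
  have "U3 (tensor (dmul R R') (tensor R A R' B) (dmul f f') (tensor f C f' D))
      = tensor (dmul R f) (tensor R A f C) (dmul R' f') (tensor R' B f' D)" for A B C D
  proof -
    have "tensor (dmul R R') (tensor R A R' B) (dmul f f') (tensor f C f' D)
        = tensor R A (dmul R' (dmul f f')) (tensor R' B (dmul f f') (tensor f C f' D))"
      using len by (intro tensor_assoc) auto
    also have "tensor R' B (dmul f f') (tensor f C f' D) = tensor (dmul R' f) (tensor R' B f C) f' D"
      using len by (intro tensor_assoc[symmetric]) auto
    finally have left: "tensor (dmul R R') (tensor R A R' B) (dmul f f') (tensor f C f' D)
        = tensor R A (dmul (dmul R' f) f') (tensor (dmul R' f) (tensor R' B f C) f' D)"
      by (simp add: dmul_assoc)
    have "tensor (dmul R f) (tensor R A f C) (dmul R' f') (tensor R' B f' D)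
        = tensor R A (dmul f (dmul R' f')) (tensor f C (dmul R' f') (tensor R' B f' D))"
      using len by (intro tensor_assoc) auto
    also have "tensor f C (dmul R' f') (tensor R' B f' D) = tensor (dmul f R') (tensor f C R' B) f' D"
      using len by (intro tensor_assoc[symmetric]) auto
    finally have right: "tensor (dmul R f) (tensor R A f C) (dmul R' f') (tensor R' B f' D)
        = tensor R A (dmul (dmul f R') f') (tensor (dmul f R') (tensor f C R' B) f' D)"
      by (simp add: dmul_assoc)
    show ?thesis unfolding left right using U1(2) U2(2) U3(2) by simp
  qed
  then show ?thesis using U3(1) by (intro exI[of _ U3]) (simp add: dmul_assoc)
qed

lemma tensor_ket:
  assumes k: "0 < k" and s: "s < r" "s' < r'"
  shows "tensor (replicate k r) (ket k s) (replicate k r') (ket k s') = ket k (s * r' + s')"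
proof -
  have d: "dmul (replicate k r) (replicate k r') = replicate k (r * r')" by (rule nth_equalityI) auto
  have "ket k (s * r' + s') = tensor (replicate k r) (ket k s) (replicate k r') (ket k s')"
  proof (rule tensor_eqI)
    show "supported (dmul (replicate k r) (replicate k r')) (ket k (s * r' + s'))"
      unfolding d using mult_add_less_mult[OF s] by (auto simp: supported_def ket_def)
    fix xs ys assume xs: "xs \<in> ibox (replicate k r)" and ys: "ys \<in> ibox (replicate k r')"
    have len: "length xs = k" "length ys = k" using xs ys by (auto simp: length_ibox)
    have "join (replicate k r') xs ys = replicate k (s * r' + s') \<longleftrightarrow> xs = replicate k s \<and> ys = replicate k s'"
    proof
      assume same: "join (replicate k r') xs ys = replicate k (s * r' + s')"
      have j: "xs ! j * r' + ys ! j = s * r' + s'" if "j < k" for j using arg_cong[OF same, of "\<lambda>l. l ! j"] that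
        by simp
      have y: "ys ! j < r'" if "j < k" for j using nth_ibox[OF ys, of j] that by simp
      have "xs ! j = s \<and> ys ! j = s'" if "j < k" for j
        using j[OF that] y[OF that] s(2) by (metis add_left_cancel mult_add_div)
      then show "xs = replicate k s \<and> ys = replicate k s'" using len by (auto simp: list_eq_iff_nth_eq)
    next
      assume "xs = replicate k s \<and> ys = replicate k s'"
      then show "join (replicate k r') xs ys = replicate k (s * r' + s')" by (intro nth_equalityI) auto
    qed
    then show "ket k (s * r' + s') (join (replicate k r') xs ys) = ket k s xs * ket k s' ys"
      by (simp add: ket_def)
  qed simp
  then show ?thesis by simp
qed

lemma relabels_flag_state_tensor:
  assumes k: "0 < k" and f: "length f = k" "length f' = k"
  shows "relabels
    (flag_state k (r * r') (dmul f f') (\<lambda>s. c (s div r') * c' (s mod r'))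
      (\<lambda>s. tensor f (v (s div r')) f' (v' (s mod r'))))
    (state_tensor (flag_state k r f c v) (flag_state k r' f' c' v'))"
proof -
  let ?R = "replicate k r" and ?R' = "replicate k r'"
  have d: "dmul ?R ?R' = replicate k (r * r')" by (rule nth_equalityI) auto
  obtain U where U: "relabel_map (dmul (dmul ?R ?R') (dmul f f')) (dmul (dmul ?R f) (dmul ?R' f')) U"
    "\<And>A B C D. U (tensor (dmul ?R ?R') (tensor ?R A ?R' B) (dmul f f') (tensor f C f' D))
        = tensor (dmul ?R f) (tensor ?R A f C) (dmul ?R' f') (tensor ?R' B f' D)"
    using tensor_middle_swap[of ?R k ?R' f f'] f by auto
  let ?I = "{..<r} \<times> {..<r'}"
  let ?w = "\<lambda>p. c (fst p) * c' (snd p)"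
  have "flag_amp k (r * r') (dmul f f') (\<lambda>s. c (s div r') * c' (s mod r'))
      (\<lambda>s. tensor f (v (s div r')) f' (v' (s mod r')))
    = (\<lambda>x. \<Sum>p\<in>?I. ?w p * tensor (dmul ?R ?R') (tensor ?R (ket k (fst p)) ?R' (ket k (snd p)))
        (dmul f f') (tensor f (v (fst p)) f' (v' (snd p))) x)"
    unfolding flag_amp_def sum_lessThan_mult d
  proof (rule ext, goal_cases)
    case (1 x)
    show ?case unfolding sum.cartesian_product
      by (intro sum.cong refl) (auto simp: tensor_ket[OF k])
  qed
  then have "U (flag_amp k (r * r') (dmul f f') (\<lambda>s. c (s div r') * c' (s mod r'))
      (\<lambda>s. tensor f (v (s div r')) f' (v' (s mod r'))))
    = (\<lambda>x. \<Sum>p\<in>?I. ?w p * tensor (dmul ?R f) (tensor ?R (ket k (fst p)) f (v (fst p)))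
        (dmul ?R' f') (tensor ?R' (ket k (snd p)) f' (v' (snd p))) x)"
    by (simp only: relabel_map_sum[OF U(1)] U(2))
  also have "\<dots> = tensor (dmul ?R f) (flag_amp k r f c v) (dmul ?R' f') (flag_amp k r' f' c' v')"
    unfolding flag_amp_def tensor_sum_left tensor_sum_right
    by (intro ext) (simp add: sum.cartesian_product[symmetric] sum_distrib_left mult.assoc case_prod_unfold
      sum.cartesian_product')
  finally show ?thesis using U(1) by (auto simp: relabels_def state_tensor_def d)
qed

lemma sum_binary_words: "(\<Sum>s<2 ^ n. h (digits (replicate n 2) s)) = (\<Sum>w\<in>words {..<2} n. h w)"
proof -
  have "ibox (replicate n 2) = words {..<2} n"
    by (auto simp: ibox_def words_def in_set_conv_nth) (metis lessThan_iff nth_mem subsetD)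
  then show ?thesis using sum_ibox_digits[of h "replicate n 2"] by (simp add: prod_list_replicate)
qed

lemma words_generating: "(\<Sum>w\<in>words {..<2::nat} n. x ^ sum_list w) = (1 + x) ^ n" for x :: real
proof (induction n)
  case (Suc n)
  have "(\<Sum>w\<in>words {..<2::nat} (Suc n). x ^ sum_list w)
      = (\<Sum>i<2. x ^ i * (\<Sum>w\<in>words {..<2::nat} n. x ^ sum_list w))"
    unfolding sum_words_Suc by (simp add: power_add sum_distrib_left)
  then show ?case using Suc by (simp add: numeral_2_eq_2 distrib_right)
qed simp

lemma count_list_binary_word: "set w \<subseteq> {..<2::nat} \<Longrightarrow> count_list w 0 + sum_list w = length w"
proof (induction w)
  case (Cons i w)
  then have "i = 0 \<or> i = 1" by auto
  then show ?case using Cons by auto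
qed simp

lemma mset_binary_word:
  "set w \<subseteq> {..<2::nat} \<Longrightarrow> mset w = replicate_mset (sum_list w) 1 + replicate_mset (length w - sum_list w) 0"
proof (induction w)
  case (Cons i w)
  have "sum_list w \<le> length w" using count_list_binary_word[of w] Cons.prems by auto
  moreover have "i = 0 \<or> i = 1" using Cons.prems by auto
  ultimately show ?case using Cons by (auto simp: Suc_diff_le)
qed simp

definition dpow :: "nat \<Rightarrow> nat list \<Rightarrow> nat \<Rightarrow> nat list" where
  "dpow k d n = foldr dmul (replicate n d) (replicate k 1)"

lemma dpow_0 [simp]: "dpow k d 0 = replicate k 1" by (simp add: dpow_def)

lemma dpow_Suc [simp]: "dpow k d (Suc n) = dmul d (dpow k d n)" by (simp add: dpow_def)

lemma valid_dims_dpow: "valid_dims k d \<Longrightarrow> valid_dims k (dpow k d n)"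
  by (induction n) (auto simp: valid_dims_dmul, simp add: valid_dims_def)

lemma prod_list_dmul: "length d = length f \<Longrightarrow> prod_list (dmul d f) = prod_list d * prod_list f"
  by (induction d f rule: list_induct2) (auto simp: dmul_def)

lemma prod_list_dpow: "valid_dims k d \<Longrightarrow> prod_list (dpow k d n) = prod_list d ^ n"
proof (induction n)
  case (Suc n)
  then have "length d = length (dpow k d n)" using valid_dims_dpow[of k d n] by (simp add: valid_dims_def)
  then show ?case using Suc by (simp add: prod_list_dmul)
qed (simp add: prod_list_replicate)

lemma fst_tensor_list_const: "fst (tensor_list k (map (\<lambda>\<beta>. (d, v \<beta>)) w)) = dpow k d (length w)"
  by (induction w) (auto simp: unit_state_def state_tensor_def)

lemma digits_replicate_Suc:
  "digits (replicate (Suc n) b) s = (s div b ^ n) # digits (replicate n b) (s mod b ^ n)"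
  by (simp add: prod_list_replicate)

lemma length_digits [simp]: "length (digits d s) = length d"
  by (induction d arbitrary: s) auto

locale flagged =
  fixes k :: nat and d :: "nat list" and c1 :: "nat \<Rightarrow> complex" and v1 :: "nat \<Rightarrow> amp"
  assumes k_pos: "0 < k"
    and v1_in_states: "\<And>\<beta>. (d, v1 \<beta>) \<in> states k"
    and c1_sum: "(cmod (c1 0))\<^sup>2 + (cmod (c1 1))\<^sup>2 = 1"
    and c1_0: "c1 0 \<noteq> 0"
begin

definition \<Phi> :: statevec where "\<Phi> = flag_state k 2 d c1 v1"

definition word_coeff :: "nat \<Rightarrow> nat \<Rightarrow> complex"
  where "word_coeff n s = prod_list (map c1 (digits (replicate n 2) s))"

definition word_state :: "nat \<Rightarrow> nat \<Rightarrow> statevec"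
  where "word_state n s = tensor_list k (map (\<lambda>\<beta>. (d, v1 \<beta>)) (digits (replicate n 2) s))"

definition weight :: "nat \<Rightarrow> nat \<Rightarrow> nat" where "weight n s = sum_list (digits (replicate n 2) s)"

lemma valid_dims_d: "valid_dims k d" using v1_in_states[of 0] by (simp add: states_def)

lemma length_d: "length d = k" using valid_dims_d by (simp add: valid_dims_def)

lemma length_dpow: "length (dpow k d n) = k" using valid_dims_dpow[OF valid_dims_d]
  by (simp add: valid_dims_def)

lemma word_state_in_states: "word_state n s \<in> states k" unfolding word_state_def
  using v1_in_states by (intro tensor_list_in_states) auto

lemma fst_word_state: "fst (word_state n s) = dpow k d n"
  unfolding word_state_def by (simp add: fst_tensor_list_const)

lemma word_state_pair: "(dpow k d n, snd (word_state n s)) = word_state n s"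
  using fst_word_state by (metis prod.collapse)

lemma sqnorm_word_state: "sqnorm (dpow k d n) (snd (word_state n s)) = 1"
  using word_state_in_states[of n s] fst_word_state[of n s] by (simp add: states_def)

lemma \<Phi>_in_states: "\<Phi> \<in> states k"
  unfolding \<Phi>_def using v1_in_states c1_sum
  by (intro flag_state_in_states[OF k_pos _ valid_dims_d]) (auto simp: states_def numeral_2_eq_2)

lemma cmod_word_coeff:
  "(cmod (word_coeff n s))\<^sup>2 = prod_list (map (\<lambda>\<beta>. (cmod (c1 \<beta>))\<^sup>2) (digits (replicate n 2) s))"
proof -
  have "(cmod (prod_list (map c1 w)))\<^sup>2 = prod_list (map (\<lambda>\<beta>. (cmod (c1 \<beta>))\<^sup>2) w)" for w
    by (induction w) (auto simp: norm_mult power_mult_distrib)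
  then show ?thesis by (simp add: word_coeff_def)
qed

lemma sum_cmod_sq_c1: "(\<Sum>\<beta><2. (cmod (c1 \<beta>))\<^sup>2) = 1" using c1_sum by (simp add: numeral_2_eq_2)

lemma sum_cmod_sq_word_coeff: "(\<Sum>s<2 ^ n. (cmod (word_coeff n s))\<^sup>2) = 1"
  unfolding cmod_word_coeff sum_binary_words[of "\<lambda>w. prod_list (map (\<lambda>\<beta>. (cmod (c1 \<beta>))\<^sup>2) w)" n]
  by (rule sum_words_prob[OF sum_cmod_sq_c1])

lemma word_coeff_Suc: "word_coeff (Suc n) s = c1 (s div 2 ^ n) * word_coeff n (s mod 2 ^ n)"
  unfolding word_coeff_def digits_replicate_Suc by simp

lemma word_state_Suc:
  "snd (word_state (Suc n) s) = tensor d (v1 (s div 2 ^ n)) (dpow k d n) (snd (word_state n (s mod 2 ^ n)))"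
  using fst_word_state[of n "s mod 2 ^ n"] unfolding word_state_def digits_replicate_Suc
  by (simp add: state_tensor_def)

definition flagged_power :: "nat \<Rightarrow> statevec" where
  "flagged_power n = flag_state k (2 ^ n) (dpow k d n) (word_coeff n) (\<lambda>s. snd (word_state n s))"

lemma flagged_power_in_states: "flagged_power n \<in> states k"
  unfolding flagged_power_def
  by (rule flag_state_in_states[OF k_pos _ valid_dims_dpow[OF valid_dims_d]
    sum_cmod_sq_word_coeff sqnorm_word_state]) simp

lemma relabels_flagged_power: "relabels (flagged_power n) (tensor_list k (replicate n \<Phi>))"
proof (induction n)
  case 0
  have "state_tensor (unit_state k) (unit_state k) = unit_state k"
    by (rule unit_state_tensor[OF unit_in_states])
  then have "tensor (replicate k 1) (ket k 0) (replicate k 1) (snd (unit_state k)) = snd (unit_state k)" and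
      "dmul (replicate k 1) (replicate k 1) = replicate k 1"
    by (simp_all add: state_tensor_def unit_state_def ket_def)
  then have "flagged_power 0 = unit_state k"
    by (simp add: flagged_power_def flag_state_def flag_amp_def word_coeff_def word_state_def)
      (simp add: unit_state_def)
  then show ?case using relabels_refl[OF unit_in_states] by simp
next
  case (Suc n)
  have "flagged_power (Suc n) = flag_state k (2 * 2 ^ n) (dmul d (dpow k d n))
      (\<lambda>s. c1 (s div 2 ^ n) * word_coeff n (s mod 2 ^ n))
      (\<lambda>s. tensor d (v1 (s div 2 ^ n)) (dpow k d n) (snd (word_state n (s mod 2 ^ n))))"
    by (simp add: flagged_power_def word_state_Suc) (simp add: word_coeff_Suc[abs_def])
  also have "relabels \<dots> (state_tensor \<Phi> (flagged_power n))"
    unfolding \<Phi>_def flagged_power_def by (rule relabels_flag_state_tensor[OF k_pos length_d length_dpow])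
  finally have "relabels (flagged_power (Suc n)) (state_tensor \<Phi> (flagged_power n))" .
  from relabels_trans[OF this relabels_tensor_left[OF Suc flagged_power_in_states \<Phi>_in_states]] show ?case
    by simp
qed

text \<open>A flag word \<open>s\<close> is typical if at most \<open>m\<close> of its letters are \<open>1\<close>. Projecting \<open>n\<close> copies of \<open>\<Phi>\<close> onto the
  typical words gives a state that needs only \<open>m\<close> of the \<open>n\<close> registers; the others hold \<open>v1 0\<close>.\<close>

definition typical :: "nat \<Rightarrow> nat \<Rightarrow> nat set" where
  "typical n m = {s. s < 2 ^ n \<and> weight n s \<le> m}"

definition typical_prob :: "nat \<Rightarrow> nat \<Rightarrow> real" where
  "typical_prob n m = (\<Sum>s\<in>typical n m. (cmod (word_coeff n s))\<^sup>2)"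

definition typical_coeff :: "nat \<Rightarrow> nat \<Rightarrow> nat \<Rightarrow> complex" where
  "typical_coeff n m s =
     (if s \<in> typical n m then word_coeff n s / complex_of_real (sqrt (typical_prob n m)) else 0)"

definition typical_state :: "nat \<Rightarrow> nat \<Rightarrow> statevec" where
  "typical_state n m = flag_state k (2 ^ n) (dpow k d n) (typical_coeff n m) (\<lambda>s. snd (word_state n s))"

lemma finite_typical [simp]: "finite (typical n m)" by (simp add: typical_def)

lemma digits_binary: "s < 2 ^ n \<Longrightarrow> set (digits (replicate n 2) s) \<subseteq> {..<2}"
  using digits_in_ibox[of s "replicate n 2"] by (auto simp: ibox_def in_set_conv_nth prod_list_replicate)

lemma digits_zero: "digits (replicate n 2) 0 = replicate n 0"
  by (induction n) (auto simp: prod_list_replicate)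

lemma zero_in_typical: "0 \<in> typical n m" by (simp add: typical_def weight_def digits_zero sum_list_replicate)

lemma typical_prob_pos: "0 < typical_prob n m"
proof -
  have "(cmod (word_coeff n 0))\<^sup>2 \<le> typical_prob n m"
    unfolding typical_prob_def by (rule member_le_sum[OF zero_in_typical]) auto
  moreover have "word_coeff n 0 \<noteq> 0" using c1_0 by (simp add: word_coeff_def digits_zero prod_list_replicate)
  ultimately show ?thesis by (smt (verit) norm_eq_zero zero_less_power2)
qed

lemma sum_typical_coeff: "(\<Sum>s\<in>typical n m. (cmod (typical_coeff n m s))\<^sup>2) = 1"
proof -
  have "(\<Sum>s\<in>typical n m. (cmod (typical_coeff n m s))\<^sup>2)
      = (\<Sum>s\<in>typical n m. (cmod (word_coeff n s))\<^sup>2 / typical_prob n m)"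
    using typical_prob_pos[of n m] by (intro sum.cong refl)
      (simp add: typical_coeff_def norm_divide power_divide)
  then show ?thesis using typical_prob_pos[of n m] by (simp add: typical_prob_def sum_divide_distrib[symmetric])
qed

lemma typical_state_in_states: "typical_state n m \<in> states k"
  unfolding typical_state_def
proof (rule flag_state_in_states[OF k_pos _ valid_dims_dpow[OF valid_dims_d] _ sqnorm_word_state])
  have "(\<Sum>s<2 ^ n. (cmod (typical_coeff n m s))\<^sup>2) = (\<Sum>s\<in>typical n m. (cmod (typical_coeff n m s))\<^sup>2)"
    by (intro sum.mono_neutral_right) (auto simp: typical_def typical_coeff_def)
  then show "(\<Sum>s<2 ^ n. (cmod (typical_coeff n m s))\<^sup>2) = 1" by (simp add: sum_typical_coeff)
qed simp

lemma converts_typical_state: "converts (typical_state n m) (flagged_power n) (typical_prob n m)"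
  unfolding converts_def
proof (rule pays.leaf)
  let ?p = "typical_prob n m"
  have "iprod (fst (flagged_power n)) (snd (flagged_power n)) (snd (typical_state n m))
      = (\<Sum>s<2 ^ n. cnj (word_coeff n s) * typical_coeff n m s)"
    by (simp add: flagged_power_def typical_state_def iprod_flag_amp[OF k_pos length_dpow] iprod_self
      sqnorm_word_state)
  also have "\<dots> = (\<Sum>s\<in>typical n m. complex_of_real ((cmod (word_coeff n s))\<^sup>2 / sqrt ?p))"
  proof (rule sum.mono_neutral_cong_right)
    fix s assume "s \<in> typical n m"
    then show "cnj (word_coeff n s) * typical_coeff n m s
        = complex_of_real ((cmod (word_coeff n s))\<^sup>2 / sqrt ?p)"
      unfolding of_real_divide complex_norm_square by (simp add: typical_coeff_def mult.commute)
  qed (auto simp: typical_def typical_coeff_def)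
  also have "\<dots> = complex_of_real (?p / sqrt ?p)"
    unfolding of_real_sum[symmetric] by (simp add: typical_prob_def sum_divide_distrib)
  also have "?p / sqrt ?p = sqrt ?p" using typical_prob_pos[of n m] by (simp add: real_div_sqrt)
  finally show "target (flagged_power n) (fst (typical_state n m)) (snd (typical_state n m)) ?p"
    using typical_prob_pos[of n m] by (simp add: target_def typical_state_def flagged_power_def)
qed

definition typical_index :: "nat \<Rightarrow> nat \<Rightarrow> nat \<Rightarrow> nat" where
  "typical_index n m = (SOME h. bij_betw h {..<card (typical n m)} (typical n m))"

lemma bij_typical_index: "bij_betw (typical_index n m) {..<card (typical n m)} (typical n m)"
proof -
  have "\<exists>h. bij_betw h {..<card (typical n m)} (typical n m)"
    using ex_bij_betw_nat_finite[of "typical n m"] by (simp add: atLeast0LessThan)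
  then show ?thesis unfolding typical_index_def by (rule someI_ex)
qed

definition short_word :: "nat \<Rightarrow> nat \<Rightarrow> nat \<Rightarrow> statevec list" where
  "short_word n m s = map (\<lambda>\<beta>. (d, v1 \<beta>)) (replicate (weight n s) 1 @ replicate (m - weight n s) 0)"

lemma set_short_word: "set (short_word n m s) \<subseteq> states k" using v1_in_states by (auto simp: short_word_def)

lemma fst_short_word: "s \<in> typical n m \<Longrightarrow> fst (tensor_list k (short_word n m s)) = dpow k d m"
  unfolding short_word_def fst_tensor_list_const by (simp add: typical_def)

definition compressed_state :: "nat \<Rightarrow> nat \<Rightarrow> statevec" where
  "compressed_state n m = flag_state k (card (typical n m)) (dpow k d m)
      (\<lambda>i. typical_coeff n m (typical_index n m i))
     (\<lambda>i. snd (tensor_list k (short_word n m (typical_index n m i))))"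

lemma compressed_state_in_states: "compressed_state n m \<in> states k"
  unfolding compressed_state_def
proof (rule flag_state_in_states[OF k_pos _ valid_dims_dpow[OF valid_dims_d]])
  show "0 < card (typical n m)" using zero_in_typical[of n m] by (auto simp: card_gt_0_iff)
  show "(\<Sum>i<card (typical n m). (cmod (typical_coeff n m (typical_index n m i)))\<^sup>2) = 1"
    using sum.reindex_bij_betw[OF bij_typical_index, of "\<lambda>s. (cmod (typical_coeff n m s))\<^sup>2"]
    by (simp add: sum_typical_coeff)
  fix i assume "i < card (typical n m)"
  then have "typical_index n m i \<in> typical n m" using bij_typical_index by (auto simp: bij_betw_def)
  then show "sqnorm (dpow k d m) (snd (tensor_list k (short_word n m (typical_index n m i)))) = 1"
    using tensor_list_in_states[OF set_short_word, of n m "typical_index n m i"] fst_short_word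
    by (simp add: states_def)
qed

lemma prod_list_fst_compressed_state:
  "prod_list (fst (compressed_state n m)) = card (typical n m) ^ k * prod_list d ^ m"
  unfolding compressed_state_def using length_dpow prod_list_dpow[OF valid_dims_d]
  by (simp add: prod_list_dmul prod_list_replicate)

lemma relabels_short_word:
  assumes s: "s \<in> typical n m" and mn: "m \<le> n"
  shows "relabels
    (state_tensor (tensor_list k (short_word n m s)) (tensor_list k (replicate (n - m) (d, v1 0)))) (word_state n s)"
proof -
  have "n - weight n s = (m - weight n s) + (n - m)" using s mn by (simp add: typical_def)
  then have "mset (short_word n m s @ replicate (n - m) (d, v1 0))
      = mset (map (\<lambda>\<beta>. (d, v1 \<beta>)) (digits (replicate n 2) s))"
    using arg_cong[OF mset_binary_word[OF digits_binary], of s n "image_mset (\<lambda>\<beta>. (d, v1 \<beta>))"] s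
    by (simp add: short_word_def weight_def replicate_mset_add typical_def)
  then have "relabels (tensor_list k (short_word n m s @ replicate (n - m) (d, v1 0))) (word_state n s)"
    unfolding word_state_def
    by (rule relabels_tensor_list_permute) (use set_short_word v1_in_states in auto)
  then show ?thesis using set_short_word v1_in_states by (subst (asm) tensor_list_append) auto
qed

lemma relabels_compressed_state:
  assumes mn: "m \<le> n"
  shows "relabels (state_tensor (compressed_state n m) (tensor_list k (replicate (n - m) (d, v1 0))))
      (typical_state n m)"
proof -
  let ?rest = "tensor_list k (replicate (n - m) (d, v1 0))" and ?h = "typical_index n m"
  let ?v = "\<lambda>i. snd (tensor_list k (short_word n m (?h i)))"
  have rest: "?rest = (dpow k d (n - m), snd ?rest)"
    using fst_tensor_list_const[of k d v1 "replicate (n - m) 0"] by (simp add: prod_eq_iff)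
  have "state_tensor (compressed_state n m) ?rest
      = flag_state k (card (typical n m)) (dmul (dpow k d m) (dpow k d (n - m)))
      (\<lambda>i. typical_coeff n m (?h i)) (\<lambda>i. tensor (dpow k d m) (?v i) (dpow k d (n - m)) (snd ?rest))"
    unfolding compressed_state_def by (subst rest) (rule state_tensor_flag_state[OF length_dpow length_dpow])
  moreover have "relabels \<dots> (typical_state n m)"
    unfolding typical_state_def
  proof (rule relabels_flag_state[OF _ length_dpow])
    show "length (dmul (dpow k d m) (dpow k d (n - m))) = k" by (simp add: length_dpow)
    show "inj_on ?h {..<card (typical n m)}" using bij_typical_index by (simp add: bij_betw_def)
    show "typical_coeff n m s' = 0" if "s' \<notin> ?h ` {..<card (typical n m)}" for s'
      using that bij_typical_index[of n m] by (simp add: bij_betw_def typical_coeff_def)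
    fix i assume "i < card (typical n m)"
    then have index: "?h i \<in> typical n m" using bij_typical_index by (auto simp: bij_betw_def)
    then show "?h i < 2 ^ n" by (simp add: typical_def)
    have "(dmul (dpow k d m) (dpow k d (n - m)), tensor (dpow k d m) (?v i) (dpow k d (n - m)) (snd ?rest))
        = state_tensor (tensor_list k (short_word n m (?h i))) ?rest"
      using fst_short_word[OF index] rest by (simp add: state_tensor_def prod_eq_iff)
    then show "relabels
        (dmul (dpow k d m) (dpow k d (n - m)), tensor (dpow k d m) (?v i) (dpow k d (n - m)) (snd ?rest))
        (dpow k d n, snd (word_state n (?h i)))"
      using relabels_short_word[OF index mn] by (simp add: word_state_pair)
  qed simp
  ultimately show ?thesis by simp
qed

lemma mconverts_compressed_state:
  assumes "m \<le> n"
  shows "mconverts k (add_mset (compressed_state n m) (replicate_mset (n - m) (d, v1 0))) (replicate_mset n \<Phi>)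
      (typical_prob n m)"
proof -
  have rest: "tensor_list k (replicate (n - m) (d, v1 0)) \<in> states k"
    using v1_in_states by (intro tensor_list_in_states) auto
  have "converts (typical_state n m) (tensor_list k (replicate n \<Phi>)) (typical_prob n m)"
    using \<Phi>_in_states
    by (intro converts_relabels_cong[OF converts_typical_state relabels_flagged_power typical_state_in_states]
      tensor_list_in_states) auto
  from converts_of_relabels[OF relabels_compressed_state[OF assms]
      state_tensor_in_states[OF compressed_state_in_states rest] typical_state_in_states this]
  have "mconverts k (mset (compressed_state n m # replicate (n - m) (d, v1 0))) (mset (replicate n \<Phi>))
      (typical_prob n m)"
    by (subst mconverts_tensor_list) (use compressed_state_in_states v1_in_states \<Phi>_in_states in auto)
  then show ?thesis by simp
qed

lemma typical_prob_ge:
  assumes q: "q = (cmod (c1 1))\<^sup>2" "0 < q" and m: "2 * q * real n \<le> real m" and n: "0 < n"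
  shows "1 - 2 / (real n * q\<^sup>2) \<le> typical_prob n m"
proof -
  define P where "P = (\<lambda>\<beta>. (cmod (c1 \<beta>))\<^sup>2)"
  have P: "sum P {..<2} = 1" "P 0 = 1 - q" using sum_cmod_sq_c1 c1_sum q by (auto simp: P_def)
  have zeros: "(\<forall>\<beta>\<in>{..<2}. (if \<beta> = 0 then n - m else 0) \<le> count_list w \<beta>) \<longleftrightarrow> sum_list w \<le> m"
    if "w \<in> words {..<2} n" for w
    using count_list_binary_word[of w] that by (auto simp: words_def)
  have zeros_prob: "real (n - m) \<le> real n * P 0 - q * real n" if "m < n"
    using that m by (simp add: P(2) of_nat_diff algebra_simps)
  have "1 - 2 / (real n * q\<^sup>2) = 1 - real (card {..<2::nat}) * (real n / (q * real n)\<^sup>2)"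
    using n by (simp add: power2_eq_square)
  also have "\<dots> \<le> (\<Sum>w\<in>words {..<2} n. prod_list (map P w) *
      of_bool (\<forall>\<beta>\<in>{..<2}. (if \<beta> = 0 then n - m else 0) \<le> count_list w \<beta>))"
    using P(1) \<open>0 < q\<close> n zeros_prob by (intro words_frequencies_bound) (auto simp: P_def split: if_splits)
  also have "\<dots> = (\<Sum>w\<in>words {..<2} n. prod_list (map P w) * of_bool (sum_list w \<le> m))"
    by (intro sum.cong refl) (simp only: zeros)
  also have "\<dots> = (\<Sum>s<2 ^ n. (cmod (word_coeff n s))\<^sup>2 * of_bool (weight n s \<le> m))"
    unfolding cmod_word_coeff weight_def P_def[symmetric] by (rule sum_binary_words[symmetric])
  also have "\<dots> = typical_prob n m"
    unfolding typical_prob_def typical_def by (simp add: Int_def)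
  finally show ?thesis .
qed

lemma card_typical_le:
  fixes x :: real
  assumes x: "0 < x" "x \<le> 1"
  shows "real (card (typical n m)) \<le> (1 + x) ^ n * (1 / x) ^ m"
proof -
  have "real (card (typical n m)) * x ^ m = (\<Sum>s\<in>typical n m. x ^ m)" by simp
  also have "\<dots> \<le> (\<Sum>s\<in>typical n m. x ^ weight n s)"
    using x by (intro sum_mono power_decreasing) (auto simp: typical_def)
  also have "\<dots> \<le> (\<Sum>s<2 ^ n. x ^ weight n s)" using x by (intro sum_mono2) (auto simp: typical_def)
  also have "\<dots> = (1 + x) ^ n"
    unfolding weight_def using sum_binary_words[of "\<lambda>w. x ^ sum_list w" n] words_generating[of x n] by simp
  finally show ?thesis using x by (simp add: field_simps power_divide)
qed

end

lemma prod_list_ge_1: "valid_dims k d \<Longrightarrow> 1 \<le> prod_list d"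
proof -
  assume "valid_dims k d"
  then have "\<forall>x\<in>set d. 0 < x" by (simp add: valid_dims_def)
  then have "0 < prod_list d" by (induction d) auto
  then show ?thesis by simp
qed

lemma iprod_commute: "iprod d b a = cnj (iprod d a b)"
  by (simp add: iprod_def cnj_sum mult.commute)

definition superpose :: "real \<Rightarrow> real \<Rightarrow> amp \<Rightarrow> amp \<Rightarrow> amp" where
  "superpose a b \<phi> \<xi> = (\<lambda>x. complex_of_real a * \<phi> x + complex_of_real b * \<xi> x)"

lemma iprod_superpose:
  "iprod d (superpose a b \<phi> \<xi>) (superpose a' b' \<phi> \<xi>) = complex_of_real (a * a') * iprod d \<phi> \<phi>
     + complex_of_real (a * b') * iprod d \<phi> \<xi> + complex_of_real (b * a') * iprod d \<xi> \<phi> + complex_of_real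
     (b * b') * iprod d \<xi> \<xi>"
  unfolding iprod_def superpose_def by (simp add: algebra_simps sum.distrib sum_distrib_left)

lemma superpose_in_states:
  assumes "(d, \<phi>) \<in> states k" "(d, \<xi>) \<in> states k" "iprod d \<phi> \<xi> = 0" "a\<^sup>2 + b\<^sup>2 = 1"
  shows "(d, superpose a b \<phi> \<xi>) \<in> states k"
proof -
  have "complex_of_real (sqnorm d (superpose a b \<phi> \<xi>)) = complex_of_real (a\<^sup>2 + b\<^sup>2)"
    using assms(1-3) iprod_commute[of d \<xi> \<phi>]
    by (simp add: iprod_self[symmetric] iprod_superpose) (simp add: iprod_self states_def power2_eq_square)
  then have "sqnorm d (superpose a b \<phi> \<xi>) = 1" unfolding of_real_eq_iff assms(4) .
  then show ?thesis using assms(1,2) by (simp add: states_def supported_def superpose_def)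
qed

lemma orthogonal_decomposition:
  assumes phi: "(d, \<phi>) \<in> states k" and psi: "(d, \<psi>) \<in> states k"
    and c: "iprod d \<phi> \<psi> = complex_of_real c" "c\<^sup>2 < 1"
  obtains \<xi> where "(d, \<xi>) \<in> states k" "iprod d \<phi> \<xi> = 0" "\<psi> = superpose c (sqrt (1 - c\<^sup>2)) \<phi> \<xi>"
proof
  define s where "s = sqrt (1 - c\<^sup>2)"
  define \<xi> where "\<xi> = (\<lambda>x. complex_of_real (1 / s) * (\<psi> x - iprod d \<phi> \<psi> * \<phi> x))"
  have s: "0 < s" "s\<^sup>2 = 1 - c\<^sup>2" using c(2) by (auto simp: s_def)
  have norms: "sqnorm d \<phi> = 1" "sqnorm d \<psi> = 1" using phi psi by (auto simp: states_def)
  have "sqnorm d \<xi> = (cmod (complex_of_real (1 / s)))\<^sup>2 * (sqnorm d \<psi> - (cmod (iprod d \<phi> \<psi>))\<^sup>2)"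
    unfolding \<xi>_def sqnorm_scale sqnorm_orthogonal_part[OF norms(1)] ..
  also have "\<dots> = 1" using s c by (simp add: norms norm_divide power_divide)
  finally show "(d, \<xi>) \<in> states k" using phi psi by (simp add: states_def supported_def \<xi>_def)
  have "iprod d \<phi> (\<lambda>x. \<psi> x - \<alpha> * \<phi> x) = iprod d \<phi> \<psi> - \<alpha> * iprod d \<phi> \<phi>" for \<alpha>
    by (simp add: iprod_def algebra_simps sum_subtractf sum_distrib_left)
  then show "iprod d \<phi> \<xi> = 0" unfolding \<xi>_def iprod_scale using norms by (simp add: iprod_self)
  show "\<psi> = superpose c (sqrt (1 - c\<^sup>2)) \<phi> \<xi>"
    using s by (simp add: superpose_def \<xi>_def c(1) s_def[symmetric])
qed

lemma obtain_phase_alignment: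
  obtains u where "cmod u = 1" "iprod d \<phi> (\<lambda>x. u * \<psi> x) = complex_of_real (cmod (iprod d \<phi> \<psi>))"
proof (cases "iprod d \<phi> \<psi> = 0")
  case True
  then show ?thesis using that[of 1] by simp
next
  case False
  let ?u = "cnj (iprod d \<phi> \<psi>) / complex_of_real (cmod (iprod d \<phi> \<psi>))"
  have "?u * iprod d \<phi> \<psi> = complex_of_real ((cmod (iprod d \<phi> \<psi>))\<^sup>2) / complex_of_real (cmod (iprod d \<phi> \<psi>))"
    unfolding complex_norm_square by (simp add: mult.commute)
  also have "\<dots> = complex_of_real (cmod (iprod d \<phi> \<psi>))" using False by (simp add: power2_eq_square)
  finally have "iprod d \<phi> (\<lambda>x. ?u * \<psi> x) = complex_of_real (cmod (iprod d \<phi> \<psi>))" unfolding iprod_scale .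
  moreover have "cmod ?u = 1" using False by (simp add: norm_divide)
  ultimately show ?thesis using that by blast
qed

definition hadamard :: "nat \<Rightarrow> nat \<Rightarrow> complex" where
  "hadamard t s = complex_of_real (1 / sqrt 2) * (-1) ^ (t * s)"

lemma hadamard_complete:
  assumes "s < 2" "s' < 2"
  shows "(\<Sum>t<2. cnj (hadamard t s) * hadamard t s') = (if s = s' then 1 else 0)"
proof -
  have half: "complex_of_real (1 / sqrt 2) * complex_of_real (1 / sqrt 2) = 1 / 2"
    unfolding of_real_mult[symmetric] by simp
  have summand: "cnj (hadamard t s) * hadamard t s' = 1 / 2 * (-1) ^ (t * (s + s'))" for t
    unfolding half[symmetric] by (simp add: hadamard_def power_add distrib_left)
  have "(\<Sum>t<2. cnj (hadamard t s) * hadamard t s') = 1 / 2 + 1 / 2 * (-1) ^ (s + s')"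
    unfolding summand by (simp add: numeral_2_eq_2)
  moreover have "s = 0 \<or> s = 1" "s' = 0 \<or> s' = 1" using assms by auto
  ultimately show ?thesis by auto
qed

lemma monomial_act_flag:
  assumes d: "length d = k" and s: "s < r" and v: "supported d v"
  shows "monomial_act (dmul (replicate k r) d) d (\<lambda>j x. x mod d ! j) (\<lambda>j x. h j (x div d ! j))
    (tensor (replicate k r) (ket k s) d v) = (\<lambda>zs. (\<Prod>j<k. h j s) * v zs)" (is "?l = _")
proof (rule supported_eqI[OF supported_monomial_act])
  let ?R = "replicate k r" and ?\<pi> = "\<lambda>j x. x mod d ! j" and ?c = "\<lambda>j x. h j (x div d ! j)"
  show "supported d (\<lambda>zs. (\<Prod>j<k. h j s) * v zs)" using v by (simp add: supported_def)
  have lengths: "length ?R = length d" "length (dmul ?R d) = k" using d by simp_all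
  have register: "relabel ?\<pi> (join d us ys) = ys" if "us \<in> ibox ?R" "ys \<in> ibox d" for us ys
    using that d nth_ibox[OF that(2)] by (intro nth_equalityI) (auto simp: length_ibox)
  fix zs assume zs: "zs \<in> ibox d"
  have "?l zs = (\<Sum>us\<in>ibox ?R. \<Sum>ys\<in>ibox d. if relabel ?\<pi> (join d us ys) = zs then
      (\<Prod>j<k. ?c j (join d us ys ! j)) * tensor ?R (ket k s) d v (join d us ys) else 0)"
    unfolding monomial_act_def lengths(2) if_P[OF zs] by (rule sum_ibox_dmul[OF lengths(1)])
  also have "\<dots> = (\<Sum>us\<in>ibox ?R. \<Sum>ys\<in>ibox d. if ys = zs then
      (if us = replicate k s then (\<Prod>j<k. ?c j (join d us zs ! j)) * v zs else 0) else 0)"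
    by (intro sum.cong refl) (auto simp: register tensor_join[OF lengths(1)] ket_def)
  also have "\<dots> = (\<Prod>j<k. ?c j (join d (replicate k s) zs ! j)) * v zs" using zs s by simp
  also have "(\<Prod>j<k. ?c j (join d (replicate k s) zs ! j)) = (\<Prod>j<k. h j s)"
    using d nth_ibox[OF zs] by (intro prod.cong) auto
  finally show "?l zs = (\<Prod>j<k. h j s) * v zs" .
qed

lemma prod_hadamard: "(\<Prod>j<k. hadamard (t j) s) = complex_of_real (1 / sqrt 2) ^ k * (-1) ^ (s * (\<Sum>j<k. t j))"
  unfolding hadamard_def prod.distrib power_sum[symmetric] by (simp add: sum_distrib_left mult.commute)

context flagged
begin

lemma monomial_act_hadamard:
  assumes y: "y \<in> ibox (replicate k 2)"
  shows "monomial_act (dmul (replicate k 2) d) d (\<lambda>j x. x mod d ! j) (\<lambda>j x. hadamard (y ! j) (x div d ! j))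
      (snd \<Phi>)
    = (\<lambda>x. complex_of_real (1 / sqrt 2) ^ k * (c1 0 * v1 0 x + (-1) ^ sum_list y * c1 1 * v1 1 x))"
proof -
  have "(\<Sum>j<k. y ! j) = sum_list y" using y by (simp add: sum_list_sum_nth length_ibox atLeast0LessThan)
  then have branch: "monomial_act (dmul (replicate k 2) d) d (\<lambda>j x. x mod d ! j)
      (\<lambda>j x. hadamard (y ! j) (x div d ! j))
      (tensor (replicate k 2) (ket k s) d (v1 s))
      = (\<lambda>x. complex_of_real (1 / sqrt 2) ^ k * (-1) ^ (s * sum_list y) * v1 s x)"
    if "s < 2" for s
    using monomial_act_flag[OF length_d that, of "v1 s" "\<lambda>j. hadamard (y ! j)"] v1_in_states
    by (simp add: prod_hadamard states_def)
  show ?thesis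
    unfolding \<Phi>_def snd_flag_state flag_amp_def monomial_act_sum
    using branch by (intro ext) (simp add: numeral_2_eq_2 algebra_simps)
qed

lemma ensemble_hadamard:
  "ensemble \<Phi> (ibox (replicate k 2)) (\<lambda>y. complex_of_real (1 / sqrt 2) ^ k)
    (\<lambda>y. (d, \<lambda>x. c1 0 * v1 0 x + (-1) ^ sum_list y * c1 1 * v1 1 x))"
  (is "ensemble _ (ibox ?R) _ ?T")
  unfolding ensemble_def
proof
  fix q :: "nat list \<Rightarrow> real"
  let ?\<kappa> = "complex_of_real (1 / sqrt 2) ^ k"
  let ?H = "\<lambda>d v p. \<exists>i\<in>ibox ?R. d = fst (?T i) \<and> v = (\<lambda>x. ?\<kappa> * snd (?T i) x) \<and> p \<le> q i"
  have d_pos: "0 < d ! j" if "j < k" for j using states_nth_pos[OF v1_in_states] that by simp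
  have "pays ?H (dmul ?R d) (snd \<Phi>) (\<Sum>i\<in>ibox ?R. q i)"
  proof (rule pays_monomial[where e = d and m = ?R and \<pi> = "\<lambda>j x. x mod d ! j"
    and \<mu> = "\<lambda>j t x. hadamard t (x div d ! j)" and q = q])
    show "supported (dmul ?R d) (snd \<Phi>)" by (simp add: \<Phi>_def supported_flag_amp)
    show "(\<Sum>t<?R ! j. cnj (hadamard t (x div d ! j)) * hadamard t (x' div d ! j)) = (if x = x' then 1 else 0)"
      if "j < length (dmul ?R d)" "x < dmul ?R d ! j" "x' < dmul ?R d ! j"
        and same: "x mod d ! j = x' mod d ! j" for j x x'
    proof -
      have "j < k" "x div d ! j < 2" "x' div d ! j < 2"
        using that length_d by (auto simp: less_mult_imp_div_less)
      moreover have "x = x'" if "x div d ! j = x' div d ! j" using that same by (metis div_mult_mod_eq)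
      ultimately show ?thesis by (auto simp: hadamard_complete)
    qed
    show "pays ?H d (monomial_act (dmul ?R d) d (\<lambda>j x. x mod d ! j) (\<lambda>j x. hadamard (y ! j) (x div d ! j)) (snd \<Phi>)) (q y)"
      if "y \<in> ibox ?R" for y
      unfolding monomial_act_hadamard[OF that] using that by (intro pays.leaf) (auto intro!: bexI[of _ y])
    show "?H d' v p'" if "?H d' v p" "p' \<le> p" for d' v p p' using that by (meson order_trans)
  qed (use length_d d_pos in auto)
  then show "pays ?H (fst \<Phi>) (snd \<Phi>) (\<Sum>i\<in>ibox ?R. q i)" by (simp add: \<Phi>_def)
qed

end

text \<open>Midpoint concavity up to an error \<open>S\<close> makes the increments over steps of length \<open>t\<close> decrease
  up to \<open>2 S\<close>; \<open>n\<close> of them sum to at most \<open>B\<close>.\<close>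

lemma approx_concave_increment:
  fixes g :: "real \<Rightarrow> real"
  assumes g: "\<And>x. 0 \<le> g x" "\<And>x. g x \<le> B" and mid: "\<And>x. g (x + t) + g (x - t) \<le> 2 * g x + 2 * S"
    and "0 \<le> S" "0 < n"
  shows "g t - g 0 \<le> B / real n + real n * S"
proof -
  define D where "D = (\<lambda>j::nat. g ((1 - real j) * t) - g (- real j * t))"
  have step: "D j - 2 * S \<le> D (Suc j)" for j
  proof -
    have "- real j * t + t = (1 - real j) * t" "- real j * t - t = - real (Suc j) * t"
      "(1 - real (Suc j)) * t = - real j * t"
      by (simp_all add: algebra_simps)
    then show ?thesis using mid[of "- real j * t"] unfolding D_def by simp
  qed
  have increments: "D 0 - 2 * real j * S \<le> D j" for j
  proof (induction j)
    case (Suc j) then show ?case using step[of j] by (simp add: algebra_simps)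
  qed simp
  have telescope: "(\<Sum>j<n. D j) = g t - g ((1 - real n) * t)" for n
  proof (induction n)
    case (Suc n)
    have "(1 - real (Suc n)) * t = - real n * t" by simp
    then show ?case using Suc by (simp add: D_def)
  qed simp
  have "(\<Sum>j<n. 2 * real j) = real n * (real n - 1)" for n
    by (induction n) (auto simp: algebra_simps)
  then have "real n * D 0 - real n * (real n - 1) * S = (\<Sum>j<n. D 0 - 2 * real j * S)"
    by (simp add: sum_subtractf sum_distrib_right[symmetric])
  also have "\<dots> \<le> (\<Sum>j<n. D j)" using increments by (intro sum_mono) auto
  also have "\<dots> \<le> B" unfolding telescope using g(1)[of "(1 - real n) * t"] g(2)[of t] by linarith
  finally have "real n * D 0 \<le> B + real n * (real n - 1) * S" by simp
  also have "\<dots> \<le> B + real n * (real n * S)" using \<open>0 \<le> S\<close> by (simp add: algebra_simps)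
  finally have "D 0 \<le> (B + real n * (real n * S)) / real n"
    using \<open>0 < n\<close> by (simp add: pos_le_divide_eq mult.commute)
  then show ?thesis using \<open>0 < n\<close> by (simp add: D_def add_divide_distrib)
qed

lemma sum_bits_parity:
  fixes A B :: real
  shows "(\<Sum>y\<in>ibox (replicate (Suc k) 2). if even (sum_list y) then A else B) = 2 ^ k * (A + B)"
proof -
  have "(\<Sum>y\<in>ibox (replicate (Suc k) 2). if even (sum_list y) then A else B)
      = (\<Sum>ys\<in>ibox (replicate k 2). \<Sum>z<2. if even (sum_list (z # ys)) then A else B)"
    unfolding replicate_Suc sum_ibox_Cons by (rule sum.swap)
  also have "\<dots> = (\<Sum>ys\<in>ibox (replicate k 2). A + B)"
    using lessThan_Suc[of 1] by (intro sum.cong refl) (auto simp: numeral_2_eq_2[symmetric])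
  finally show ?thesis by (simp add: card_ibox prod_list_replicate)
qed

definition flag_error :: "nat \<Rightarrow> real \<Rightarrow> real" where
  "flag_error k q = real k * (log 2 (1 + q) + 2 * q * log 2 (1 / q)) + 2 * q"

lemma flag_entropy_nonneg:
  fixes q :: real
  assumes "0 \<le> q" "q \<le> 1"
  shows "0 \<le> log 2 (1 + q) + 2 * q * log 2 (1 / q)"
proof -
  have "0 \<le> log 2 (1 + q)" using assms(1) by (subst zero_le_log_cancel_iff) auto
  moreover have "0 \<le> log 2 (1 / q)" using assms by (cases "q = 0") (simp add: log_def, simp)
  ultimately show ?thesis using assms by simp
qed

lemma flag_error_nonneg: "0 \<le> q \<Longrightarrow> q \<le> 1 \<Longrightarrow> 0 \<le> flag_error k q"
  using flag_entropy_nonneg[of q] by (simp add: flag_error_def)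

lemma flag_error_tendsto: "(flag_error k \<longlongrightarrow> 0) (at_right 0)"
  unfolding flag_error_def by real_asymp

context entanglement_functional
begin

lemma k_pos: "0 < k" using k by simp

lemma val_bound:
  assumes "s \<in> states k"
  shows "val s \<le> 1 + log 2 (real (prod_list (fst s)))"
proof -
  define D where "D = prod_list (fst s)"
  have D: "1 \<le> D" using assms prod_list_ge_1 by (auto simp: D_def states_def)
  define n where "n = nat \<lceil>log 2 (real D)\<rceil>"
  have "log 2 (real D) \<le> real n" unfolding n_def by linarith
  then have "real D \<le> real (2 ^ n)" using D by (simp add: log_le_iff powr_realpow)
  then have "D \<le> 2 ^ n" by (simp only: of_nat_le_iff)
  then have "val s \<le> real n" using val_le_log[OF assms] by (simp add: D_def)
  also have "0 \<le> log 2 (real D)" using D by simp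
  then have "real n \<le> 1 + log 2 (real D)" unfolding n_def by linarith
  finally show ?thesis by (simp add: D_def)
qed

lemma log_dim_nonneg: "(d, \<phi>) \<in> states k \<Longrightarrow> 0 \<le> log 2 (real (prod_list d))"
  using prod_list_ge_1[of k d] by (simp add: states_def)

end

locale flagged_functional = entanglement_functional k E + flagged k d c1 v1 for k E d c1 v1 +
  fixes q :: real
  assumes q: "q = (cmod (c1 1))\<^sup>2" "0 < q" "q \<le> 1 / 4"
begin

lemma mconverts_ghz_compressed_state:
  assumes "((1 + q) ^ l * (1 / q) ^ m) ^ k * real (prod_list d) ^ m \<le> 2 ^ c"
  shows "mconverts k (replicate_mset (n * c) (ghz k 2)) {#compressed_state (n * l) (n * m)#} 1"
proof (rule mconverts_from_ghz[OF k_pos compressed_state_in_states])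
  let ?b = "((1 + q) ^ l * (1 / q) ^ m) ^ k * real (prod_list d) ^ m"
  have "real (card (typical (n * l) (n * m))) \<le> (1 + q) ^ (n * l) * (1 / q) ^ (n * m)"
    using q by (intro card_typical_le) auto
  then have "real (card (typical (n * l) (n * m))) ^ k * real (prod_list d) ^ (n * m)
      \<le> ((1 + q) ^ (n * l) * (1 / q) ^ (n * m)) ^ k * real (prod_list d) ^ (n * m)"
    by (intro mult_right_mono power_mono) auto
  also have "\<dots> = ?b ^ n" by (simp add: power_mult_distrib power_mult[symmetric] ac_simps del: power_divide)
  also have "\<dots> \<le> (2 ^ c) ^ n" using assms q by (intro power_mono mult_nonneg_nonneg zero_le_power) auto
  finally have "real (card (typical (n * l) (n * m)) ^ k * prod_list d ^ (n * m)) \<le> real (2 ^ (n * c))"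
    by (simp add: power_mult[symmetric] mult.commute)
  then show "prod_list (fst (compressed_state (n * l) (n * m))) \<le> 2 ^ (n * c)"
    unfolding prod_list_fst_compressed_state by (simp only: of_nat_le_iff)
qed

lemma typical_prob_tendsto:
  assumes "2 * q * real l \<le> real m" "0 < l" "0 < \<epsilon>"
  shows "\<forall>\<^sub>F n in sequentially. 1 - \<epsilon> \<le> typical_prob (n * l) (n * m)"
proof -
  have "(\<lambda>n. 2 / (real (n * l) * q\<^sup>2)) \<longlonglongrightarrow> 0" using assms(2) q(2) by real_asymp
  then have "\<forall>\<^sub>F n in sequentially. 2 / (real (n * l) * q\<^sup>2) < \<epsilon>" using assms(3) by (auto dest: order_tendstoD)
  then show ?thesis using eventually_gt_at_top[of 0]
  proof eventually_elim
    case (elim n)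
    have "2 * q * real (n * l) \<le> real (n * m)" using mult_left_mono[OF assms(1), of "real n"]
      by (simp add: ac_simps)
    then have "1 - 2 / (real (n * l) * q\<^sup>2) \<le> typical_prob (n * l) (n * m)"
      using q elim assms(2) by (intro typical_prob_ge) auto
    then show ?case using elim by linarith
  qed
qed

lemma dominates_flagged_copies:
  assumes "m \<le> l" "2 * q * real l \<le> real m" "0 < l"
    and c: "((1 + q) ^ l * (1 / q) ^ m) ^ k * real (prod_list d) ^ m \<le> 2 ^ c"
  shows "dominates (replicate_mset (l - m) (d, v1 0) + replicate_mset c (ghz k 2)) (replicate_mset l \<Phi>)" (is
    "dominates ?M ?N")
proof (rule dominatesI)
  let ?C = "\<lambda>n. add_mset (compressed_state (n * l) (n * m)) (replicate_mset (n * l - n * m) (d, v1 0))"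
  show M: "?M \<in> resources" and N: "?N \<in> resources" using v1_in_states \<Phi>_in_states g_in
    by (auto simp: resources_iff)
  have C: "?C n \<in> resources" for n using v1_in_states compressed_state_in_states by (auto simp: resources_iff)
  have prepare: "mconverts k (repeat_mset n ?M) (?C n) 1" for n
  proof -
    have "mconverts k (replicate_mset (n * c) (ghz k 2) + replicate_mset (n * l - n * m) (d, v1 0))
       ({#compressed_state (n * l) (n * m)#} + replicate_mset (n * l - n * m) (d, v1 0)) 1"
      using mconverts_ghz_compressed_state[OF c] v1_in_states compressed_state_in_states g_in
      by (intro mconverts_add) auto
    moreover have copies: "repeat_mset n ?M = replicate_mset (n * c) (ghz k 2) + replicate_mset (n * l - n * m)
        (d, v1 0)"
      by (simp add: diff_mult_distrib2 add.commute)
    ultimately show ?thesis unfolding copies by simp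
  qed
  have "asymp_convertible (\<lambda>n. repeat_mset n ?M) ?C"
    by (rule asymp_convertibleI[OF resources_repeat[OF M] C prepare]) auto
  also have "mconverts k (?C n) (repeat_mset n ?N) (typical_prob (n * l) (n * m))" for n
    using mconverts_compressed_state[of "n * m" "n * l"] \<open>m \<le> l\<close> by simp
  then have "asymp_convertible ?C (\<lambda>n. repeat_mset n ?N)"
    by (rule asymp_convertibleI[OF C resources_repeat[OF N] _ typical_prob_tendsto[OF assms(2,3)]])
  finally show "asymp_convertible (\<lambda>n. repeat_mset n ?M) (\<lambda>n. repeat_mset n ?N)" .
qed

lemma log_typical_dim:
  "log 2 (((1 + q) ^ l * (1 / q) ^ m) ^ k * real (prod_list d) ^ m)
     = real k * (real l * log 2 (1 + q) + real m * log 2 (1 / q)) + real m * log 2 (real (prod_list d))"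
proof -
  have pos: "0 < 1 + q" "0 < 1 / q" "0 < real (prod_list d)" using q(2) prod_list_ge_1[OF valid_dims_d]
    by simp_all
  then have "0 < (1 + q) ^ l" "0 < (1 / q) ^ m" "0 < ((1 + q) ^ l * (1 / q) ^ m) ^ k"
    "0 < real (prod_list d) ^ m"
    by (simp_all only: zero_less_power mult_pos_pos)
  then show ?thesis by (simp only: log_mult_pos log_nat_power pos mult_pos_pos less_imp_le)
qed

lemma val_flagged_copies_le:
  assumes "m \<le> l" "2 * q * real l \<le> real m" "0 < l"
  shows "real l * val \<Phi> \<le> real l * val (d, v1 0) + 1
     + real k * (real l * log 2 (1 + q) + real m * log 2 (1 / q)) + real m * log 2 (real (prod_list d))"
proof -
  define b where "b = ((1 + q) ^ l * (1 / q) ^ m) ^ k * real (prod_list d) ^ m"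
  have "1 \<le> 1 + q" "1 \<le> 1 / q" "1 \<le> real (prod_list d)" using q(2,3) prod_list_ge_1[OF valid_dims_d] by simp_all
  then have "1 * 1 \<le> ((1 + q) ^ l * (1 / q) ^ m) ^ k * real (prod_list d) ^ m"
    by (intro mult_mono one_le_power mult_ge1_I) auto
  then have b: "1 \<le> b" by (simp add: b_def)
  define c where "c = nat \<lceil>log 2 b\<rceil>"
  have c: "log 2 b \<le> real c" "real c \<le> 1 + log 2 b" using zero_le_log_cancel_iff[of 2 b] b
    unfolding c_def by linarith+
  then have "b \<le> 2 ^ c" using b by (simp add: log_le_iff powr_realpow)
  then have "E (replicate_mset l \<Phi>) \<le> E (replicate_mset (l - m) (d, v1 0) + replicate_mset c (ghz k 2))"
    using assms by (intro E_mono dominates_flagged_copies) (auto simp: b_def)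
  also have "\<dots> = real (l - m) * val (d, v1 0) + real c"
    using E_add[of "replicate_mset (l - m) (d, v1 0)" "replicate_mset c (ghz k 2)"] v1_in_states g_in E_ghz
    by (simp add: E_replicate) (simp add: val_def)
  also have "real (l - m) * val (d, v1 0) \<le> real l * val (d, v1 0)" using val_nonneg[OF v1_in_states]
    by (intro mult_right_mono) auto
  finally show ?thesis using c(2) log_typical_dim[of l m] E_replicate[OF \<Phi>_in_states] by (simp add: b_def)
qed

lemma val_flag_state_le:
  "val \<Phi> \<le> val (d, v1 0) + real k * (log 2 (1 + q) + 2 * q * log 2 (1 / q)) + 2 * q * log 2
      (real (prod_list d))" (is "_ \<le> ?B")
proof (rule tendsto_lowerbound)
  let ?K = "1 + real k * log 2 (1 / q) + log 2 (real (prod_list d))"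
  show "(\<lambda>l. ?B + ?K / real l) \<longlonglongrightarrow> ?B" using tendsto_add[OF tendsto_const lim_const_over_n, of ?B ?K] by simp
  have "val \<Phi> \<le> ?B + ?K / real l" if l: "2 \<le> l" for l
  proof -
    define m where "m = nat \<lceil>2 * q * real l\<rceil>"
    have m: "2 * q * real l \<le> real m" "real m \<le> 2 * q * real l + 1"
      using mult_nonneg_nonneg[of "2 * q" "real l"] q(2) unfolding m_def by linarith+
    have "2 * q * real l \<le> 2 * (1 / 4) * real l" using q by (intro mult_right_mono) auto
    then have "m \<le> l" using m(2) l by linarith
    have "real m * log 2 (1 / q) \<le> (2 * q * real l + 1) * log 2 (1 / q)"
      "real m * log 2 (real (prod_list d)) \<le> (2 * q * real l + 1) * log 2 (real (prod_list d))"
      using m(2) q log_dim_nonneg[OF v1_in_states] by (auto intro: mult_right_mono)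
    moreover from this(1) have "real k * (real m * log 2 (1 / q))
        \<le> real k * ((2 * q * real l + 1) * log 2 (1 / q))"
      by (intro mult_left_mono) auto
    ultimately have "real l * val \<Phi> \<le> real l * ?B + ?K"
      using val_flagged_copies_le[OF \<open>m \<le> l\<close> m(1)] l by (simp add: algebra_simps)
    then show ?thesis using l by (simp add: field_simps)
  qed
  then show "\<forall>\<^sub>F l in sequentially. val \<Phi> \<le> ?B + ?K / real l" by (auto intro: eventually_sequentiallyI[of 2])
qed simp

end

context entanglement_functional
begin

lemma val_midpoint:
  assumes phi: "(d, \<phi>) \<in> states k" and xi: "(d, \<xi>) \<in> states k" and orth: "iprod d \<phi> \<xi> = 0"
    and ab: "a\<^sup>2 + b\<^sup>2 = 1" and b: "0 < b\<^sup>2" "b\<^sup>2 \<le> 1 / 4"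
  shows "val (d, superpose a b \<phi> \<xi>) + val (d, superpose a (- b) \<phi> \<xi>)
    \<le> 2 * val (d, \<phi>) + 2 * (flag_error k (b\<^sup>2) * (1 + log 2 (real (prod_list d))))" (is "?p + ?m \<le> _")
proof -
  let ?c = "\<lambda>\<beta>::nat. if \<beta> = 0 then complex_of_real a else complex_of_real b"
    and ?v = "\<lambda>\<beta>::nat. if \<beta> = 0 then \<phi> else \<xi>"
  let ?T = "\<lambda>y. (d, \<lambda>x. ?c 0 * ?v 0 x + (-1) ^ sum_list y * ?c 1 * ?v 1 x)"
  interpret flagged_functional k E d ?c ?v "b\<^sup>2"
    using ab b phi xi k_pos by unfold_locales auto
  obtain k' where k': "k = Suc k'" using k_pos by (cases k) auto
  have prob: "(cmod (complex_of_real (1 / sqrt 2) ^ k))\<^sup>2 = (1 / 2) ^ k"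
    by (simp add: norm_power norm_divide power_mult[symmetric] mult.commute[of k])
      (simp add: power_mult power_divide)
  have T: "?T y = (d, superpose a (if even (sum_list y) then b else - b) \<phi> \<xi>)" for y
    by (auto simp: superpose_def)
  have "(\<Sum>y\<in>ibox (replicate k 2). (cmod (complex_of_real (1 / sqrt 2) ^ k))\<^sup>2 * val (?T y)) \<le> val \<Phi>"
  proof (rule val_average[OF ensemble_hadamard _ \<Phi>_in_states])
    show "?T y \<in> states k" for y unfolding T using superpose_in_states[OF phi xi orth] ab by simp
    show "(\<Sum>y\<in>ibox (replicate k 2). (cmod (complex_of_real (1 / sqrt 2) ^ k))\<^sup>2) = 1"
      unfolding prob by (simp add: card_ibox prod_list_replicate power_divide)
  qed simp
  also have "(\<Sum>y\<in>ibox (replicate k 2). (cmod (complex_of_real (1 / sqrt 2) ^ k))\<^sup>2 * val (?T y))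
      = (1 / 2) ^ k * (\<Sum>y\<in>ibox (replicate k 2). if even (sum_list y) then ?p else ?m)"
    unfolding prob T sum_distrib_left by (intro sum.cong refl) simp
  also have "\<dots> = (?p + ?m) / 2"
    unfolding k' sum_bits_parity by (simp add: power_divide)
  finally have "(?p + ?m) / 2 \<le> val \<Phi>" .
  moreover have "real k * (log 2 (1 + b\<^sup>2) + 2 * b\<^sup>2 * log 2 (1 / b\<^sup>2)) + 2 * b\<^sup>2 * log 2 (real (prod_list d))
      \<le> flag_error k (b\<^sup>2) * (1 + log 2 (real (prod_list d)))" (is "?A + _ \<le> _")
  proof -
    have "0 \<le> ?A * log 2 (real (prod_list d))"
      using b log_dim_nonneg[OF phi] flag_entropy_nonneg[of "b\<^sup>2"] by (intro mult_nonneg_nonneg) auto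
    then show ?thesis using b by (simp add: flag_error_def algebra_simps)
  qed
  ultimately show ?thesis using val_flag_state_le by simp
qed

lemma val_phase:
  assumes s: "(d, \<phi>) \<in> states k" and u: "cmod u = 1"
  shows "(d, \<lambda>x. u * \<phi> x) \<in> states k" "val (d, \<lambda>x. u * \<phi> x) = val (d, \<phi>)"
proof -
  have unit: "sqnorm d \<phi> = 1" using s by (simp add: states_def)
  show scaled: "(d, \<lambda>x. u * \<phi> x) \<in> states k" using s u by (auto simp: states_def sqnorm_scale supported_def)
  have "converts (d, \<lambda>x. u * \<phi> x) (d, \<phi>) 1"
    unfolding converts_def by (rule pays.leaf) (use unit u in \<open>simp add: target_def iprod_scale iprod_self\<close>)
  moreover have "converts (d, \<phi>) (d, \<lambda>x. u * \<phi> x) 1"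
    unfolding converts_def
  proof (rule pays.leaf)
    have "iprod d (\<lambda>x. u * \<phi> x) \<phi> = cnj u * iprod d \<phi> \<phi>" by (simp add: iprod_def sum_distrib_left mult.assoc)
    then show "target (d, \<lambda>x. u * \<phi> x) (fst (d, \<phi>)) (snd (d, \<phi>)) 1"
      using unit u by (simp add: target_def iprod_self)
  qed
  ultimately show "val (d, \<lambda>x. u * \<phi> x) = val (d, \<phi>)"
    using s scaled by (intro antisym val_mono_converts) (auto intro: converts_antimono less_imp_le)
qed

lemma val_great_circle:
  assumes phi: "(d, \<phi>) \<in> states k" and xi: "(d, \<xi>) \<in> states k" and orth: "iprod d \<phi> \<xi> = 0"
    and \<theta>: "0 < (sin \<theta>)\<^sup>2" "(sin \<theta>)\<^sup>2 \<le> 1 / 4" and n: "0 < n"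
  shows "\<bar>val (d, \<phi>) - val (d, superpose (cos \<theta>) (sin \<theta>) \<phi> \<xi>)\<bar>
    \<le> (1 / real n + real n * flag_error k ((sin \<theta>)\<^sup>2)) * (1 + log 2 (real (prod_list d)))"
proof -
  define g where "g = (\<lambda>t. val (d, superpose (cos t) (sin t) \<phi> \<xi>))"
  define S where "S = flag_error k ((sin \<theta>)\<^sup>2) * (1 + log 2 (real (prod_list d)))"
  have circle: "(d, superpose (cos t) (sin t) \<phi> \<xi>) \<in> states k" "(d, superpose (- sin t) (cos t) \<phi> \<xi>) \<in> states k"
    for t
    using superpose_in_states[OF phi xi orth] by auto
  have mid: "g (x + \<theta>) + g (x - \<theta>) \<le> 2 * g x + 2 * S" for x
  proof -
    let ?\<gamma> = "superpose (cos x) (sin x) \<phi> \<xi>" and ?\<gamma>' = "superpose (- sin x) (cos x) \<phi> \<xi>"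
    have "iprod d ?\<gamma> ?\<gamma>' = 0"
      using orth iprod_commute[of d \<xi> \<phi>] phi xi
      by (simp add: iprod_superpose iprod_self states_def mult.commute)
    moreover have "superpose (cos (x + \<theta>)) (sin (x + \<theta>)) \<phi> \<xi> = superpose (cos \<theta>) (sin \<theta>) ?\<gamma> ?\<gamma>'"
      "superpose (cos (x - \<theta>)) (sin (x - \<theta>)) \<phi> \<xi> = superpose (cos \<theta>) (- sin \<theta>) ?\<gamma> ?\<gamma>'"
      by (auto simp: superpose_def cos_add sin_add cos_diff sin_diff algebra_simps)
    ultimately show ?thesis
      using val_midpoint[OF circle(1)[of x] circle(2)[of x], of "cos \<theta>" "sin \<theta>"] \<theta> by (simp add: g_def S_def)
  qed
  have g: "0 \<le> g x" "g x \<le> 1 + log 2 (real (prod_list d))" for x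
    unfolding g_def using val_nonneg[OF circle(1)] val_bound[OF circle(1)] by auto
  have "0 \<le> S" unfolding S_def using \<theta> log_dim_nonneg[OF phi]
    by (intro mult_nonneg_nonneg flag_error_nonneg) auto
  have "g \<theta> - g 0 \<le> (1 + log 2 (real (prod_list d))) / real n + real n * S"
    by (rule approx_concave_increment[OF g mid \<open>0 \<le> S\<close> n])
  moreover have "g (\<theta> - \<theta>) - g (\<theta> - 0) \<le> (1 + log 2 (real (prod_list d))) / real n + real n * S"
  proof (rule approx_concave_increment[OF g _ \<open>0 \<le> S\<close> n])
    show "g (\<theta> - (x + \<theta>)) + g (\<theta> - (x - \<theta>)) \<le> 2 * g (\<theta> - x) + 2 * S" for x
      using mid[of "\<theta> - x"] by (simp add: algebra_simps)
  qed
  moreover have "g 0 = val (d, \<phi>)" "g \<theta> = val (d, superpose (cos \<theta>) (sin \<theta>) \<phi> \<xi>)"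
    by (simp_all add: g_def superpose_def)
  moreover have "(1 / real n + real n * flag_error k ((sin \<theta>)\<^sup>2)) * (1 + log 2 (real (prod_list d)))
      = (1 + log 2 (real (prod_list d))) / real n + real n * S"
    by (simp add: S_def algebra_simps add_divide_distrib)
  ultimately show ?thesis by (simp add: abs_le_iff)
qed

lemma val_close:
  assumes phi: "(d, \<phi>) \<in> states k" and psi: "(d, \<psi>) \<in> states k"
    and q: "q = 1 - (cmod (iprod d \<phi> \<psi>))\<^sup>2" "q \<le> 1 / 4" and n: "0 < n"
  shows "\<bar>val (d, \<phi>) - val (d, \<psi>)\<bar> \<le> (1 / real n + real n * flag_error k q) * (1 + log 2 (real (prod_list d)))"
proof (cases "q = 0")
  case True
  have "converts (d, \<phi>) (d, \<psi>) 1" "converts (d, \<psi>) (d, \<phi>) 1"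
    unfolding converts_def using True q by (auto intro!: pays.leaf simp: target_def iprod_commute[of d \<psi> \<phi>])
  then have "val (d, \<phi>) = val (d, \<psi>)"
    using phi psi by (intro antisym val_mono_converts) (auto intro: converts_antimono less_imp_le)
  then show ?thesis using log_dim_nonneg[OF phi] True by (simp add: flag_error_def)
next
  case False
  define c where "c = cmod (iprod d \<phi> \<psi>)"
  have "c\<^sup>2 \<le> 1" using Cauchy_Schwarz_iprod[of d \<phi> \<psi>] phi psi by (simp add: c_def states_def)
  moreover have "c\<^sup>2 \<noteq> 1" "0 \<le> c" using False q(1) by (auto simp: c_def)
  ultimately have c: "0 \<le> c" "c \<le> 1" "c\<^sup>2 < 1" by (auto simp: abs_square_le_1 less_le)
  then have q_pos: "0 < q" using q(1) by (simp add: c_def)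
  obtain u where u: "cmod u = 1" "iprod d \<phi> (\<lambda>x. u * \<psi> x) = complex_of_real c"
    using obtain_phase_alignment unfolding c_def by blast
  obtain \<xi> where \<xi>: "(d, \<xi>) \<in> states k" "iprod d \<phi> \<xi> = 0" "(\<lambda>x. u * \<psi> x) = superpose c (sqrt (1 - c\<^sup>2)) \<phi> \<xi>"
    using orthogonal_decomposition[OF phi val_phase(1)[OF psi u(1)] u(2) c(3)] .
  define \<theta> where "\<theta> = arccos c"
  have \<theta>: "cos \<theta> = c" "sin \<theta> = sqrt (1 - c\<^sup>2)" using c by (simp_all add: \<theta>_def sin_arccos)
  then have "(sin \<theta>)\<^sup>2 = q" using c(3) q(1) by (simp add: c_def)
  then show ?thesis
    using val_great_circle[OF phi \<xi>(1,2), of \<theta> n] val_phase(2)[OF psi u(1)] q_pos q(2) n \<xi>(3) by (simp add: \<theta>)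
qed

lemma val_continuity:
  assumes "\<epsilon> > 0"
  shows "\<exists>\<delta>>0. \<forall>d \<phi> \<psi>. (d, \<phi>) \<in> states k \<and> (d, \<psi>) \<in> states k \<and> 1 - (cmod (iprod d \<phi> \<psi>))\<^sup>2 < \<delta>
    \<longrightarrow> \<bar>val (d, \<phi>) - val (d, \<psi>)\<bar> < \<epsilon> * (1 + log 2 (real (prod_list d)))"
proof -
  obtain n :: nat where n: "real n > 4 / \<epsilon>" using reals_Archimedean2 by blast
  have "0 < n" using n assms by (cases n) auto
  then have "\<forall>\<^sub>F q in at_right 0. flag_error k q < \<epsilon> / (4 * real n)"
    using order_tendstoD(2)[OF flag_error_tendsto[of k], of "\<epsilon> / (4 * real n)"] assms by simp
  then obtain b where b: "b > 0" "\<And>q. 0 < q \<Longrightarrow> q < b \<Longrightarrow> flag_error k q < \<epsilon> / (4 * real n)"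
    unfolding eventually_at_right_field by auto
  have "\<bar>val (d, \<phi>) - val (d, \<psi>)\<bar> < \<epsilon> * (1 + log 2 (real (prod_list d)))"
    if phi: "(d, \<phi>) \<in> states k" and psi: "(d, \<psi>) \<in> states k"
      and close: "1 - (cmod (iprod d \<phi> \<psi>))\<^sup>2 < min b (1 / 4)" for d \<phi> \<psi>
  proof -
    define q where "q = 1 - (cmod (iprod d \<phi> \<psi>))\<^sup>2"
    have "0 \<le> q" using Cauchy_Schwarz_iprod[of d \<phi> \<psi>] phi psi by (simp add: q_def states_def)
    then have "flag_error k q < \<epsilon> / (4 * real n)"
      using b(2)[of q] close assms \<open>0 < n\<close> by (cases "q = 0") (auto simp: flag_error_def q_def[symmetric])
    then have "real n * flag_error k q < \<epsilon> / 4" using \<open>0 < n\<close> by (simp add: field_simps)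
    moreover have "1 / real n < \<epsilon> / 4" using n \<open>0 < n\<close> assms by (simp add: field_simps)
    ultimately have "1 / real n + real n * flag_error k q < \<epsilon>" using assms by linarith
    then have "(1 / real n + real n * flag_error k q) * (1 + log 2 (real (prod_list d)))
        < \<epsilon> * (1 + log 2 (real (prod_list d)))"
      using log_dim_nonneg[OF phi] by (intro mult_strict_right_mono) auto
    moreover have "\<bar>val (d, \<phi>) - val (d, \<psi>)\<bar> \<le> (1 / real n + real n * flag_error k q) *
        (1 + log 2 (real (prod_list d)))"
      using val_close[OF phi psi q_def _ \<open>0 < n\<close>] close by (simp add: q_def)
    ultimately show ?thesis by linarith
  qed
  moreover have "0 < min b (1 / 4)" using b(1) by simp
  ultimately show ?thesis by blast
qed

end

section \<open>LOCC channels as matrices\<close>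

definition vec_of :: "nat list \<Rightarrow> amp \<Rightarrow> complex vec" where
  "vec_of d a = vec (prod_list d) (\<lambda>i. a (digits d i))"

definition amp_of :: "nat list \<Rightarrow> complex vec \<Rightarrow> amp" where
  "amp_of d v = (\<lambda>xs. if xs \<in> ibox d then v $ enc d xs else 0)"

lemma dim_vec_of [simp]: "dim_vec (vec_of d a) = prod_list d" by (simp add: vec_of_def)

lemma vec_of_amp: "dim_vec v = prod_list d \<Longrightarrow> vec_of d (amp_of d v) = v"
  by (rule eq_vecI) (auto simp: vec_of_def amp_of_def digits_in_ibox enc_digits)

lemma supported_amp_of: "supported d (amp_of d v)" by (simp add: supported_def amp_of_def)

lemma amp_of_vec: "supported d a \<Longrightarrow> amp_of d (vec_of d a) = a"
  by (rule supported_eqI[OF supported_amp_of]) (auto simp: vec_of_def amp_of_def digits_enc enc_less)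

lemma iprod_vec_of: "iprod d a b = (\<Sum>i<prod_list d. cnj (vec_of d a $ i) * vec_of d b $ i)"
  unfolding iprod_def sum_ibox_digits by (simp add: vec_of_def)

lemma sqnorm_vec_of: "sqnorm d a = (\<Sum>i<prod_list d. (cmod (vec_of d a $ i))\<^sup>2)"
  unfolding sqnorm_def sum_ibox_digits by (simp add: vec_of_def)

lemma local_op_carrier: "local_op d j e L \<in> carrier_mat (prod_list (d[j := e])) (prod_list d)"
  by (simp add: local_op_def Let_def)

lemma agree_off_iff:
  assumes xs: "xs \<in> ibox (d[j := 1])" and zs: "length zs = length d" and j: "j < length d"
  shows "(\<forall>i<length d. i \<noteq> j \<longrightarrow> zs ! i = xs[j := y] ! i) \<longleftrightarrow> xs = zs[j := 0]"
proof
  assume agree: "\<forall>i<length d. i \<noteq> j \<longrightarrow> zs ! i = xs[j := y] ! i"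
  have len: "length xs = length d" and "xs ! j = 0" using length_ibox[OF xs] nth_ibox[OF xs, of j] j by simp_all
  show "xs = zs[j := 0]"
  proof (rule nth_equalityI)
    fix i assume "i < length xs"
    then show "xs ! i = zs[j := 0] ! i" using agree \<open>xs ! j = 0\<close> len zs by (cases "i = j") auto
  qed (use len zs in simp)
qed (use zs j in auto)

lemma local_op_mult:
  assumes j: "j < length d" and L: "dim_row L = e"
  shows "local_op d j e L *\<^sub>v vec_of d a = vec_of (d[j := e]) (local_act d j L a)"
proof (rule eq_vecI)
  show "dim_vec (local_op d j e L *\<^sub>v vec_of d a) = dim_vec (vec_of (d[j := e]) (local_act d j L a))"
    using local_op_carrier[of d j e L] by simp
  fix r assume "r < dim_vec (vec_of (d[j := e]) (local_act d j L a))"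
  then have r: "r < prod_list (d[j := e])" by simp
  define zs where "zs = digits (d[j := e]) r"
  have zs: "zs \<in> ibox (d[j := e])" unfolding zs_def using r by (rule digits_in_ibox)
  have len: "length zs = length d" using length_ibox[OF zs] by simp
  let ?entry = "\<lambda>xs. if \<forall>i<length d. i \<noteq> j \<longrightarrow> zs ! i = xs ! i then L $$ (zs ! j, xs ! j) else 0"
  have "(local_op d j e L *\<^sub>v vec_of d a) $ r = (\<Sum>c<prod_list d. ?entry (digits d c) * a (digits d c))"
    unfolding zs_def using r by (simp add: local_op_def Let_def mult_mat_vec_def scalar_prod_def vec_of_def
      atLeast0LessThan)
  also have "\<dots> = (\<Sum>xs\<in>ibox d. ?entry xs * a xs)" by (rule sum_ibox_digits[symmetric])
  also have "\<dots> = (\<Sum>xs\<in>ibox (d[j := 1]).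
      \<Sum>y<d ! j. if xs = zs[j := 0] then L $$ (zs ! j, y) * a (zs[j := y]) else 0)"
    unfolding sum_ibox_split[OF j]
    by (intro sum.cong refl) (use agree_off_iff[OF _ len j] j len in \<open>auto simp: length_ibox\<close>)
  also have "\<dots> = (\<Sum>xs\<in>ibox (d[j := 1]).
      if xs = zs[j := 0] then (\<Sum>y<d ! j. L $$ (zs ! j, y) * a (zs[j := y])) else 0)"
    by (intro sum.cong refl) simp
  also have "\<dots> = (\<Sum>y<d ! j. L $$ (zs ! j, y) * a (zs[j := y]))"
    using list_update_in_ibox_list_update[OF zs, of 0 1] by simp
  also have "\<dots> = local_act d j L a zs" using zs L by (simp add: local_act_def)
  finally show "(local_op d j e L *\<^sub>v vec_of d a) $ r = vec_of (d[j := e]) (local_act d j L a) $ r"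
    using r by (simp add: vec_of_def zs_def)
qed

lemma msum_entry:
  assumes "\<forall>A\<in>set As. A \<in> carrier_mat n m"
  shows "msum n m As \<in> carrier_mat n m \<and> (\<forall>i<n. \<forall>j<m. msum n m As $$ (i, j) = (\<Sum>A\<leftarrow>As. A $$ (i, j)))"
  using assms
proof (induction As)
  case Nil show ?case by (simp add: msum_def)
next
  case (Cons A As)
  then have "msum n m As \<in> carrier_mat n m" by simp
  moreover have "msum n m (A # As) = A + msum n m As" by (simp add: msum_def)
  ultimately show ?case using Cons by auto
qed

lemma instrument_iff:
  assumes L: "\<And>i. i < m \<Longrightarrow> 0 < dim_row (L i) \<and> dim_col (L i) = D"
  shows "instrument D m L \<longleftrightarrow> msum D D (map (\<lambda>i. adj (L i) * L i) [0..<m]) = 1\<^sub>m D" (is "_ \<longleftrightarrow> ?M = _")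
proof -
  have carrier: "\<forall>A\<in>set (map (\<lambda>i. adj (L i) * L i) [0..<m]). A \<in> carrier_mat D D"
    using L by (auto simp: adj_def)
  have entry: "?M $$ (y, y') = (\<Sum>i<m. \<Sum>z<dim_row (L i). cnj (L i $$ (z, y)) * L i $$ (z, y'))"
    if "y < D" "y' < D" for y y'
  proof -
    have "?M $$ (y, y') = (\<Sum>i<m. (adj (L i) * L i) $$ (y, y'))"
      using msum_entry[OF carrier] that by (simp add: comp_def interv_sum_list_conv_sum_set_nat
        atLeast0LessThan)
    also have "\<dots> = (\<Sum>i<m. \<Sum>z<dim_row (L i). cnj (L i $$ (z, y)) * L i $$ (z, y'))"
      using L that by (intro sum.cong refl) (simp add: adj_def scalar_prod_def times_mat_def atLeast0LessThan)
    finally show ?thesis .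
  qed
  show ?thesis
  proof
    show "?M = 1\<^sub>m D" if "instrument D m L"
      by (rule eq_matI) (use msum_entry[OF carrier] entry that in \<open>auto simp: instrument_def\<close>)
    show "instrument D m L" if "?M = 1\<^sub>m D" unfolding instrument_def using L entry that by auto
  qed
qed

lemma concat_map2_index:
  assumes "length Ps = length Ls"
  shows "concat (map2 (\<lambda>(e, L) P. map (\<lambda>K. K * local_op d j e L) P) Ls Ps)
    = concat (map (\<lambda>i. map (\<lambda>K. K * local_op d j (fst (Ls ! i)) (snd (Ls ! i))) (Ps ! i)) [0..<length Ls])"
  using assms by (intro arg_cong[of _ _ concat] nth_equalityI) (auto simp: case_prod_unfold)

lemma locc_structure:
  assumes "locc d e Ks"
  shows "(\<forall>K\<in>set Ks. K \<in> carrier_mat (prod_list e) (prod_list d)) \<and> length e = length d \<and> (\<forall>x\<in>set d. 0 < x)"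
  using assms
proof (induction rule: locc.induct)
  case (stop d) then show ?case by simp
next
  case (round j d Ls Ps d')
  have "\<forall>K\<in>set (map (\<lambda>K. K * local_op d j (fst (Ls ! i)) (snd (Ls ! i))) (Ps ! i)). K \<in> carrier_mat
      (prod_list d') (prod_list d)"
    if "i < length Ls" for i
    using round.IH that by (auto intro!: mult_carrier_mat[OF _ local_op_carrier])
  moreover have "Ls \<noteq> []"
  proof
    assume "Ls = []"
    then have "0\<^sub>m (d ! j) (d ! j) = (1\<^sub>m (d ! j) :: complex mat)" using round by (simp add: msum_def)
    then have "(0\<^sub>m (d ! j) (d ! j) :: complex mat) $$ (0, 0) = 1\<^sub>m (d ! j) $$ (0, 0)" by simp
    moreover have "0 < d ! j" using round by simp
    ultimately show False by simp
  qed
  then have "0 < length Ls" by simp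
  then have "length d' = length d" using round.IH by auto
  ultimately show ?case using round unfolding concat_map2_index[OF round(5)] by auto
qed

lemma locc_round_instrument:
  assumes "\<forall>(e, L)\<in>set Ls. 0 < e \<and> L \<in> carrier_mat e D" "msum D D (map (\<lambda>(e, L). adj L * L) Ls) = 1\<^sub>m D"
  shows "instrument D (length Ls) (\<lambda>i. snd (Ls ! i))" "\<And>i. i < length Ls
      \<Longrightarrow> dim_row (snd (Ls ! i)) = fst (Ls ! i)"
proof -
  have kraus: "0 < fst (Ls ! i) \<and> snd (Ls ! i) \<in> carrier_mat (fst (Ls ! i)) D" if "i < length Ls" for i
    using assms(1) nth_mem[OF that] by (auto simp: case_prod_unfold)
  then show "\<And>i. i < length Ls \<Longrightarrow> dim_row (snd (Ls ! i)) = fst (Ls ! i)" by auto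
  have "map (\<lambda>(e, L). adj L * L) Ls = map (\<lambda>i. adj (snd (Ls ! i)) * snd (Ls ! i)) [0..<length Ls]"
    by (intro nth_equalityI) (auto simp: case_prod_unfold)
  moreover have "0 < dim_row (snd (Ls ! i)) \<and> dim_col (snd (Ls ! i)) = D" if "i < length Ls" for i
    using kraus[OF that] by auto
  ultimately show "instrument D (length Ls) (\<lambda>i. snd (Ls ! i))"
    using instrument_iff[of "length Ls" "\<lambda>i. snd (Ls ! i)" D] assms(2) by simp
qed

definition branches :: "nat list \<Rightarrow> nat list \<Rightarrow> complex mat list \<Rightarrow> amp \<Rightarrow> amp list" where
  "branches d e Ks a = map (\<lambda>K. amp_of e (K *\<^sub>v vec_of d a)) Ks"

lemma length_branches [simp]: "length (branches d e Ks a) = length Ks" by (simp add: branches_def)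

lemma branches_stop: "supported d a \<Longrightarrow> branches d d [1\<^sub>m (prod_list d)] a = [a]"
  using one_mult_mat_vec[of "vec_of d a" "prod_list d"] by (simp add: branches_def amp_of_vec carrier_vecI)

lemma branches_local_op:
  assumes "locc (d[j := e]) d' Ks" "j < length d" "dim_row L = e"
  shows "branches d d' (map (\<lambda>K. K * local_op d j e L) Ks) a = branches (d[j := e]) d' Ks (local_act d j L a)"
proof -
  have "(K * local_op d j e L) *\<^sub>v vec_of d a = K *\<^sub>v vec_of (d[j := e]) (local_act d j L a)" if "K \<in> set Ks"
    for K
  proof -
    have "K \<in> carrier_mat (prod_list d') (prod_list (d[j := e]))" using locc_structure[OF assms(1)] that
      by blast
    then show ?thesis
      using assoc_mult_mat_vec[OF _ local_op_carrier, of K _ d j e "vec_of d a"] local_op_mult[OF assms(2,3)]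
      by (simp add: carrier_vecI)
  qed
  then show ?thesis by (simp add: branches_def)
qed

lemma branches_concat: "branches d e (concat (map Ks is)) a = concat (map (\<lambda>i. branches d e (Ks i) a) is)"
  by (simp add: branches_def map_concat comp_def)

lemma locc_branches_induct [consumes 2, case_names stop round]:
  assumes locc: "locc d e Ks" and a: "supported d a"
    and stop: "\<And>a. supported e a \<Longrightarrow> P e a [a]"
    and round: "\<And>d j n L a X. \<lbrakk>j < length d; instrument (d ! j) n L; supported d a;
      \<And>i. i < n \<Longrightarrow> P (d[j := dim_row (L i)]) (local_act d j (L i) a) (X i)\<rbrakk> \<Longrightarrow> P d a (concat (map X [0..<n]))"
  shows "P d a (branches d e Ks a)"
  using locc a stop
proof (induction arbitrary: a rule: locc.induct)
  case (stop d)
  then show ?case by (simp add: branches_stop)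
next
  case (round j d Ls Ps d')
  let ?e = "\<lambda>i. fst (Ls ! i)" and ?L = "\<lambda>i. snd (Ls ! i)"
  have instr: "instrument (d ! j) (length Ls) ?L" and dims: "\<And>i. i < length Ls \<Longrightarrow> dim_row (?L i) = ?e i"
    using locc_round_instrument[OF round(3,4)] by auto
  have locc: "locc (d[j := ?e i]) d' (Ps ! i)" if "i < length Ls" for i using round.IH that by blast
  have "branches d d' (concat (map2 (\<lambda>(e, L) P. map (\<lambda>K. K * local_op d j e L) P) Ls Ps)) a
    = concat (map (\<lambda>i. branches (d[j := ?e i]) d' (Ps ! i) (local_act d j (?L i) a)) [0..<length Ls])"
    unfolding concat_map2_index[OF round(5)] branches_concat
    by (intro arg_cong[of _ _ concat] map_cong refl) (use branches_local_op[OF locc round(1) dims] in auto)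
  moreover have "P (d[j := dim_row (?L i)]) (local_act d j (?L i) a)
      (branches (d[j := ?e i]) d' (Ps ! i) (local_act d j (?L i) a))"
    if "i < length Ls" for i
    using round.IH round.prems(2) that dims[OF that] supported_local_act[of d j "?L i" a] by simp
  ultimately show ?case using assms(4)[OF round(1) instr round.prems(1)] by simp
qed

lemma sum_list_concat_map_upt:
  "sum_list (map f (concat (map g [0..<n]))) = (\<Sum>i<n. sum_list (map f (g i)))"
    for f :: "'c \<Rightarrow> 'b::comm_monoid_add"
  by (induction n) auto

lemma list_all2_concat_split:
  "list_all2 P (concat xss) qs \<Longrightarrow> \<exists>qss. qs = concat qss \<and> list_all2 (list_all2 P) xss qss"
proof (induction xss arbitrary: qs)
  case (Cons xs xss)
  then obtain us vs where "qs = us @ vs" "list_all2 P xs us" "list_all2 P (concat xss) vs"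
    by (auto simp: list_all2_append1)
  moreover from Cons.IH[OF this(3)] obtain vss where "vs = concat vss" "list_all2 (list_all2 P) xss vss"
    by blast
  ultimately show ?case by (intro exI[of _ "us # vss"]) auto
qed simp

lemma pays_branches:
  assumes "locc d e Ks" "supported d a" "list_all2 (pays H e) (branches d e Ks a) qs"
  shows "pays H d a (sum_list qs)"
  using assms
proof (induction arbitrary: qs rule: locc_branches_induct)
  case (stop a)
  then show ?case by (auto simp: list_all2_Cons1)
next
  case (round d j n L a X)
  obtain qss where qss: "qs = concat qss" "list_all2 (list_all2 (pays H e)) (map X [0..<n]) qss"
    using list_all2_concat_split[OF round(5)] by blast
  have len: "length qss = n" using list_all2_lengthD[OF qss(2)] by simp
  have "pays H d a (\<Sum>i<n. sum_list (qss ! i))"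
    using round(4) list_all2_nthD[OF qss(2)] by (intro pays.round[OF round(1,2)]) auto
  moreover have "sum_list qs = (\<Sum>i<n. sum_list (qss ! i))"
    using sum_list_concat_map_upt[of "\<lambda>x. x" "(!) qss" n] map_nth[of qss] by (simp add: qss(1) len)
  ultimately show ?case by simp
qed

lemma sum_sqnorm_branches:
  assumes "locc d e Ks" "supported d a"
  shows "(\<Sum>v\<leftarrow>branches d e Ks a. sqnorm e v) = sqnorm d a"
  using assms
proof (induction rule: locc_branches_induct)
  case (round d j n L a X)
  then show ?case using sum_sqnorm_local_act[OF round(1,2)] by (simp add: sum_list_concat_map_upt)
qed simp

lemma locc_round_exists:
  assumes j: "j < length d" and d: "\<forall>x\<in>set d. 0 < x" and L: "instrument (d ! j) m L"
    and Ks: "\<And>i. i < m \<Longrightarrow> locc (d[j := dim_row (L i)]) e (Ks i)"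
  shows "\<exists>Ks'. locc d e Ks' \<and>
    (\<forall>a. branches d e Ks' a = concat (map (\<lambda>i. branches (d[j := dim_row (L i)]) e (Ks i) (local_act d j (L i) a)) [0..<m]))"
proof (intro exI conjI allI)
  define Ls where "Ls = map (\<lambda>i. (dim_row (L i), L i)) [0..<m]"
  define Ps where "Ps = map Ks [0..<m]"
  let ?Ks' = "concat (map2 (\<lambda>(e, L) P. map (\<lambda>K. K * local_op d j e L) P) Ls Ps)"
  have dims: "0 < dim_row (L i)" "dim_col (L i) = d ! j" if "i < m" for i
    using L that by (auto simp: instrument_def)
  show "locc d e ?Ks'"
  proof (rule locc.round[OF j d])
    show "\<forall>(e, L)\<in>set Ls. 0 < e \<and> L \<in> carrier_mat e (d ! j)" using dims by (auto simp: Ls_def)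
    have "map (\<lambda>(e, L). adj L * L) Ls = map (\<lambda>i. adj (L i) * L i) [0..<m]" by (simp add: Ls_def comp_def)
    then show "msum (d ! j) (d ! j) (map (\<lambda>(e, L). adj L * L) Ls) = 1\<^sub>m (d ! j)"
      using instrument_iff[of m L "d ! j"] L dims by simp
    show "\<forall>i<length Ls. locc (d[j := fst (Ls ! i)]) e (Ps ! i)" using Ks by (simp add: Ls_def Ps_def)
  qed (simp add: Ls_def Ps_def)
  have Ks': "?Ks' = concat (map (\<lambda>i. map (\<lambda>K. K * local_op d j (dim_row (L i)) (L i)) (Ks i)) [0..<m])"
    by (subst concat_map2_index) (auto simp: Ls_def Ps_def intro!: arg_cong[of _ _ concat])
  show "branches d e ?Ks' a = concat (map (\<lambda>i. branches (d[j := dim_row (L i)]) e (Ks i) (local_act d j (L i) a)) [0..<m])" for a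
    unfolding Ks' branches_concat using branches_local_op[OF Ks j refl]
    by (intro arg_cong[of _ _ concat] map_cong) auto
qed

lemma pays_imp_locc:
  assumes "pays (target t) d a p" "supported d a" "\<forall>x\<in>set d. 0 < x"
  shows "\<exists>Ks. locc d (fst t) Ks \<and> p \<le> (\<Sum>v\<leftarrow>branches d (fst t) Ks a. (cmod (iprod (fst t) (snd t) v))\<^sup>2)"
  using assms
proof (induction rule: pays.induct)
  case (leaf d a p)
  then show ?case using locc.stop[OF leaf(3)] branches_stop[OF leaf(2)]
    by (auto simp: target_def intro!: exI[of _ "[1\<^sub>m (prod_list d)]"])
next
  case (round j d m L a q p)
  let ?d = "\<lambda>i. d[j := dim_row (L i)]" and ?F = "\<lambda>v. (cmod (iprod (fst t) (snd t) v))\<^sup>2"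
  have "\<exists>Ks. locc (?d i) (fst t) Ks \<and> q i \<le> (\<Sum>v\<leftarrow>branches (?d i) (fst t) Ks (local_act d j (L i) a). ?F v)"
    if "i < m" for i
  proof -
    have "0 < dim_row (L i)" using round(2) that by (auto simp: instrument_def)
    then have "\<forall>x\<in>set (?d i). 0 < x" using round.prems(2) set_update_subset_insert[of d j "dim_row (L i)"]
      by auto
    then show ?thesis using round.IH that supported_local_act[of d j "L i" a] by blast
  qed
  then obtain Ks where Ks: "\<And>i. i < m \<Longrightarrow> locc (?d i) (fst t) (Ks i)"
     "\<And>i. i < m \<Longrightarrow> q i \<le> (\<Sum>v\<leftarrow>branches (?d i) (fst t) (Ks i) (local_act d j (L i) a). ?F v)" by metis
  obtain Ks' where Ks': "locc d (fst t) Ks'"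
    "\<And>a. branches d (fst t) Ks' a = concat (map (\<lambda>i. branches (?d i) (fst t) (Ks i) (local_act d j (L i) a)) [0..<m])"
    using locc_round_exists[where L = L and Ks = Ks, OF round(1) round.prems(2) round(2) Ks(1)] by blast
  have "p \<le> (\<Sum>i<m. q i)" by (rule round(3))
  also have "\<dots> \<le> (\<Sum>v\<leftarrow>branches d (fst t) Ks' a. ?F v)"
    unfolding Ks'(2) sum_list_concat_map_upt using Ks(2) by (intro sum_mono) auto
  finally show ?case using Ks'(1) by blast
qed

section \<open>Fidelity with pure states\<close>

lemma two_point_form:
  fixes s :: "nat \<Rightarrow> nat \<Rightarrow> complex"
  assumes "a < n" "b < n"
  defines "w \<equiv> \<lambda>x z i. (if i = a then x else 0) + (if i = b then z else 0)"
  shows "(\<Sum>i<n. cnj (w x z i) * (\<Sum>j<n. s i j * w x z j))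
    = cnj x * (s a a * x + s a b * z) + cnj z * (s b a * x + s b b * z)"
proof -
  have column: "(\<Sum>j<n. s i j * w x z j) = s i a * x + s i b * z" for i
  proof -
    have "(\<Sum>j<n. s i j * w x z j) = (\<Sum>j<n. (if j = a then s i a * x else 0) + (if j = b then s i b * z else 0))"
      by (intro sum.cong refl) (auto simp: w_def distrib_left)
    then show ?thesis using assms(1,2) by (simp add: sum.distrib)
  qed
  have "(\<Sum>i<n. cnj (w x z i) * (\<Sum>j<n. s i j * w x z j))
      = (\<Sum>i<n. (if i = a then cnj x * (s a a * x + s a b * z) else 0)
      + (if i = b then cnj z * (s b a * x + s b b * z) else 0))"
    unfolding column by (intro sum.cong refl) (auto simp: w_def algebra_simps)
  then show ?thesis using assms(1,2) by (simp add: sum.distrib)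
qed

lemma hermitian_of_real_form:
  fixes s :: "nat \<Rightarrow> nat \<Rightarrow> complex"
  assumes real: "\<And>w. Im (\<Sum>i<n. cnj (w i) * (\<Sum>j<n. s i j * w j)) = 0" and ab: "a < n" "b < n"
  shows "s b a = cnj (s a b)"
proof -
  have form: "Im (cnj x * (s a a * x + s a b * z) + cnj z * (s b a * x + s b b * z)) = 0" for x z
    using real[of "\<lambda>i. (if i = a then x else 0) + (if i = b then z else 0)"] unfolding two_point_form[OF ab] .
  have "Im (s a a) = 0" "Im (s b b) = 0" using form[of 1 0] form[of 0 1] by auto
  then show ?thesis using form[of 1 1] form[of 1 \<i>] by (simp add: complex_eq_iff)
qed

lemma sum_cnj_mult_self: "(\<Sum>i\<in>A. cnj (v i) * v i) = complex_of_real (\<Sum>i\<in>A. (cmod (v i))\<^sup>2)"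
  unfolding of_real_sum complex_norm_square by (simp add: mult.commute)

text \<open>A positive square root \<open>s\<close> of \<open>c v v\<^sup>*\<close> satisfies
  \<open>\<bar>s w\<bar>\<^sup>2 = c \<bar>v\<^sup>* w\<bar>\<^sup>2\<close>, so it annihilates the orthogonal complement of \<open>v\<close>.\<close>

locale rank_one_sqrt =
  fixes n :: nat and s :: "nat \<Rightarrow> nat \<Rightarrow> complex" and v :: "nat \<Rightarrow> complex" and c :: real
  assumes real_form: "\<And>w. Im (\<Sum>i<n. cnj (w i) * (\<Sum>j<n. s i j * w j)) = 0"
    and nonneg_form: "\<And>w. 0 \<le> Re (\<Sum>i<n. cnj (w i) * (\<Sum>j<n. s i j * w j))"
    and square: "\<And>i j. i < n \<Longrightarrow> j < n \<Longrightarrow> (\<Sum>l<n. s i l * s l j) = complex_of_real c * (v i * cnj (v j))"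
    and unit: "(\<Sum>i<n. (cmod (v i))\<^sup>2) = 1"
begin

definition image :: "(nat \<Rightarrow> complex) \<Rightarrow> nat \<Rightarrow> complex" where "image w i = (\<Sum>j<n. s i j * w j)"

lemma hermitian: "a < n \<Longrightarrow> b < n \<Longrightarrow> s b a = cnj (s a b)"
  by (rule hermitian_of_real_form[OF real_form])

lemma inner_unit: "(\<Sum>i<n. cnj (v i) * v i) = 1" unfolding sum_cnj_mult_self unit by simp

lemma norm_image: "(\<Sum>i<n. (cmod (image w i))\<^sup>2) = c * (cmod (\<Sum>i<n. cnj (v i) * w i))\<^sup>2"
proof -
  have "complex_of_real (\<Sum>i<n. (cmod (image w i))\<^sup>2) = (\<Sum>i<n. \<Sum>j<n. \<Sum>l<n. cnj (w j) * w l * (s j i * s i l))"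
    unfolding sum_cnj_mult_self[symmetric] image_def cnj_sum sum_product
    by (intro sum.cong refl) (auto simp: hermitian[symmetric])
  also have "\<dots> = (\<Sum>j<n. \<Sum>i<n. \<Sum>l<n. cnj (w j) * w l * (s j i * s i l))" by (rule sum.swap)
  also have "\<dots> = (\<Sum>j<n. \<Sum>l<n. \<Sum>i<n. cnj (w j) * w l * (s j i * s i l))" by (intro sum.cong refl sum.swap)
  also have "\<dots> = (\<Sum>j<n. \<Sum>l<n. complex_of_real c * (cnj (cnj (v j) * w j) * (cnj (v l) * w l)))"
    by (intro sum.cong refl) (simp add: sum_distrib_left[symmetric] square ac_simps)
  also have "\<dots> = complex_of_real c * ((\<Sum>j<n. cnj (cnj (v j) * w j)) * (\<Sum>l<n. cnj (v l) * w l))"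
    unfolding sum_product by (simp only: sum_distrib_left)
  also have "\<dots> = complex_of_real (c * (cmod (\<Sum>i<n. cnj (v i) * w i))\<^sup>2)"
    unfolding of_real_mult complex_norm_square cnj_sum by (simp only: mult.commute)
  finally show ?thesis unfolding of_real_eq_iff .
qed

lemma entry_eq_image:
  assumes "a < n" "b < n"
  shows "s a b = image v a * cnj (v b)"
proof -
  define w where "w = (\<lambda>i. (if i = b then 1 else 0) - cnj (v b) * v i)"
  have "(\<Sum>i<n. cnj (v i) * w i) = (\<Sum>i<n. (if i = b then cnj (v b) else 0) - cnj (v b) * (cnj (v i) * v i))"
    unfolding w_def by (intro sum.cong refl) (auto simp: algebra_simps)
  also have "\<dots> = 0" using assms inner_unit by (simp add: sum_subtractf sum_distrib_left[symmetric])
  finally have "(\<Sum>i<n. (cmod (image w i))\<^sup>2) = 0" unfolding norm_image by simp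
  then have "image w a = 0" using assms by (simp add: sum_nonneg_eq_0_iff)
  moreover have "image w a = (\<Sum>j<n. (if j = b then s a b else 0) - cnj (v b) * (s a j * v j))"
    unfolding image_def w_def by (intro sum.cong refl) (auto simp: algebra_simps)
  ultimately show ?thesis using assms by (simp add: sum_subtractf sum_distrib_left[symmetric] image_def
    mult.commute)
qed

definition eigenvalue :: complex where "eigenvalue = (\<Sum>i<n. cnj (image v i) * v i)"

lemma image_eq:
  assumes "b < n"
  shows "image v b = eigenvalue * v b"
proof -
  have "image v b = (\<Sum>i<n. cnj (image v i) * v i * v b)"
    unfolding image_def[of v b]
    by (intro sum.cong refl) (use assms hermitian[of _ b] entry_eq_image[of _ b] in simp)
  then show ?thesis by (simp add: eigenvalue_def sum_distrib_right)
qed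

lemma eigenvalue_eq: "eigenvalue = complex_of_real (sqrt c)"
proof -
  have "(\<Sum>i<n. cnj (v i) * (\<Sum>j<n. s i j * v j)) = (\<Sum>i<n. eigenvalue * (cnj (v i) * v i))"
    using image_eq by (intro sum.cong refl) (simp add: image_def)
  then have "0 \<le> Re eigenvalue" "Im eigenvalue = 0"
    using real_form[of v] nonneg_form[of v] inner_unit by (simp_all add: sum_distrib_left[symmetric])
  then have "eigenvalue = complex_of_real (cmod eigenvalue)" by (simp add: complex_eq_iff cmod_eq_Re)
  moreover have "(\<Sum>i<n. (cmod (image v i))\<^sup>2) = (cmod eigenvalue)\<^sup>2 * (\<Sum>i<n. (cmod (v i))\<^sup>2)"
    unfolding sum_distrib_left by (intro sum.cong refl) (simp add: image_eq norm_mult power_mult_distrib)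
  then have "(cmod eigenvalue)\<^sup>2 = c" unfolding norm_image inner_unit unit by simp
  ultimately show ?thesis by (metis norm_ge_zero real_sqrt_unique)
qed

lemma entry_eq: "i < n \<Longrightarrow> j < n \<Longrightarrow> s i j = complex_of_real (sqrt c) * (v i * cnj (v j))"
  by (simp add: entry_eq_image image_eq eigenvalue_eq)

end

lemma proj_entry: "i < dim_vec v \<Longrightarrow> j < dim_vec v \<Longrightarrow> proj v $$ (i, j) = v $ i * cnj (v $ j)"
  by (simp add: proj_def)

lemma proj_carrier: "proj v \<in> carrier_mat (dim_vec v) (dim_vec v)" by (simp add: proj_def)

lemma dim_proj [simp]: "dim_row (proj v) = dim_vec v" "dim_col (proj v) = dim_vec v" by (simp_all add: proj_def)

lemma qform_entries:
  assumes "A \<in> carrier_mat (dim_vec w) (dim_vec w)"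
  shows "qform A w = (\<Sum>i<dim_vec w. cnj (w $ i) * (\<Sum>j<dim_vec w. A $$ (i, j) * w $ j))"
  using assms by (auto simp: qform_def mult_mat_vec_def scalar_prod_def atLeast0LessThan intro!: sum.cong)

lemma unit_norm_sum: "unit_norm v \<Longrightarrow> (\<Sum>l<dim_vec v. cnj (v $ l) * v $ l) = 1"
  unfolding sum_cnj_mult_self by (simp add: unit_norm_def)

lemma qform_proj:
  assumes "dim_vec p = dim_vec w"
  shows "qform (proj p) w = complex_of_real ((cmod (\<Sum>i<dim_vec w. cnj (w $ i) * p $ i))\<^sup>2)"
proof -
  let ?n = "dim_vec w"
  have "qform (proj p) w = (\<Sum>i<?n. \<Sum>j<?n. cnj (w $ i) * p $ i * cnj (cnj (w $ j) * p $ j))"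
    using assms by (subst qform_entries) (auto simp: proj_def sum_distrib_left ac_simps intro!: sum.cong)
  also have "\<dots> = complex_of_real ((cmod (\<Sum>i<?n. cnj (w $ i) * p $ i))\<^sup>2)"
    unfolding complex_norm_square cnj_sum sum_product ..
  finally show ?thesis .
qed

lemma psd_scaled_proj:
  assumes "0 \<le> c"
  shows "psd (complex_of_real c \<cdot>\<^sub>m proj v)"
  unfolding psd_def
proof (intro conjI allI impI)
  fix w :: "complex vec" assume "dim_vec w = dim_row (complex_of_real c \<cdot>\<^sub>m proj v)"
  then have "dim_vec v = dim_vec w" by simp
  moreover from this have "qform (complex_of_real c \<cdot>\<^sub>m proj v) w = complex_of_real c * qform (proj v) w"
    by (subst (1 2) qform_entries) (auto simp: proj_def sum_distrib_left ac_simps intro!: sum.cong)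
  ultimately show "Im (qform (complex_of_real c \<cdot>\<^sub>m proj v) w) = 0"
    "0 \<le> Re (qform (complex_of_real c \<cdot>\<^sub>m proj v) w)"
    using assms by (simp_all add: qform_proj)
qed simp

lemma proj_sandwich:
  assumes "R \<in> carrier_mat (dim_vec v) (dim_vec v)"
  shows "proj v * R * proj v = qform R v \<cdot>\<^sub>m proj v"
proof (rule eq_matI)
  let ?n = "dim_vec v"
  fix i j assume "i < dim_row (qform R v \<cdot>\<^sub>m proj v)" "j < dim_col (qform R v \<cdot>\<^sub>m proj v)"
  then have ij: "i < ?n" "j < ?n" by auto
  have "(proj v * R * proj v) $$ (i, j) = (\<Sum>b<?n. (\<Sum>a<?n. v $ i * cnj (v $ a) * R $$ (a, b))
      * (v $ b * cnj (v $ j)))"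
    using ij assms by (simp add: times_mat_def scalar_prod_def proj_def atLeast0LessThan)
  also have "\<dots> = (\<Sum>b<?n. \<Sum>a<?n. cnj (v $ a) * (R $$ (a, b) * v $ b) * (v $ i * cnj (v $ j)))"
    unfolding sum_distrib_right by (intro sum.cong refl) (simp add: ac_simps)
  also have "\<dots> = (\<Sum>a<?n. \<Sum>b<?n. cnj (v $ a) * (R $$ (a, b) * v $ b) * (v $ i * cnj (v $ j)))" by (rule sum.swap)
  also have "\<dots> = qform R v * (v $ i * cnj (v $ j))"
    unfolding qform_entries[OF assms] sum_distrib_left sum_distrib_right ..
  finally show "(proj v * R * proj v) $$ (i, j) = (qform R v \<cdot>\<^sub>m proj v) $$ (i, j)"
    using ij by (simp add: proj_def)
qed (use assms in auto)

lemma proj_mult_self: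
  assumes "unit_norm v"
  shows "proj v * proj v = proj v"
proof (rule eq_matI)
  let ?n = "dim_vec v"
  fix i j assume "i < dim_row (proj v)" "j < dim_col (proj v)"
  then have ij: "i < ?n" "j < ?n" by auto
  then have "(proj v * proj v) $$ (i, j) = (\<Sum>l<?n. v $ i * cnj (v $ j) * (cnj (v $ l) * v $ l))"
    by (auto simp: times_mat_def scalar_prod_def proj_def atLeast0LessThan ac_simps intro!: sum.cong)
  then show "(proj v * proj v) $$ (i, j) = proj v $$ (i, j)"
    using ij unit_norm_sum[OF assms] by (simp add: sum_distrib_left[symmetric] proj_entry)
qed auto

lemma psd_sqrt_unique:
  assumes "S \<in> carrier_mat (dim_vec v) (dim_vec v)" "psd S" "S * S = complex_of_real c \<cdot>\<^sub>m proj v" "unit_norm v"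
  shows "S = complex_of_real (sqrt c) \<cdot>\<^sub>m proj v"
proof (rule eq_matI)
  let ?n = "dim_vec v"
  have form: "(\<Sum>i<?n. cnj (w i) * (\<Sum>j<?n. S $$ (i, j) * w j)) = qform S (vec ?n w)" for w
    using assms(1) by (subst qform_entries) auto
  have psd: "Im (qform S (vec ?n w)) = 0" "0 \<le> Re (qform S (vec ?n w))" for w
    using assms(1,2) by (auto simp: psd_def)
  have square: "(\<Sum>l<?n. S $$ (a, l) * S $$ (l, b)) = complex_of_real c * (v $ a * cnj (v $ b))" if "a < ?n"
    "b < ?n" for a b
  proof -
    have "(\<Sum>l<?n. S $$ (a, l) * S $$ (l, b)) = (S * S) $$ (a, b)"
      using that assms(1) by (simp add: times_mat_def scalar_prod_def atLeast0LessThan)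
    then show ?thesis using that unfolding assms(3) by (simp add: proj_def)
  qed
  interpret rank_one_sqrt ?n "\<lambda>i j. S $$ (i, j)" "($) v" c
    by unfold_locales (use psd square assms(4) in \<open>auto simp: form unit_norm_def\<close>)
  fix i j assume "i < dim_row (complex_of_real (sqrt c) \<cdot>\<^sub>m proj v)"
    "j < dim_col (complex_of_real (sqrt c) \<cdot>\<^sub>m proj v)"
  then show "S $$ (i, j) = (complex_of_real (sqrt c) \<cdot>\<^sub>m proj v) $$ (i, j)" by (simp add: entry_eq proj_entry)
qed (use assms(1) in auto)

lemma msqrt_scaled_proj:
  assumes "unit_norm v" "0 \<le> c"
  shows "msqrt (complex_of_real c \<cdot>\<^sub>m proj v) = complex_of_real (sqrt c) \<cdot>\<^sub>m proj v"
  unfolding msqrt_def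
proof (rule the_equality)
  have "(complex_of_real (sqrt c) \<cdot>\<^sub>m proj v) * (complex_of_real (sqrt c) \<cdot>\<^sub>m proj v)
      = complex_of_real (sqrt c * sqrt c) \<cdot>\<^sub>m (proj v * proj v)"
    using proj_carrier[of v] by (auto simp: mult_smult_assoc_mat[OF _ smult_carrier_mat] mult_smult_distrib
      simp del: real_sqrt_mult_self intro!: eq_matI)
  then show "complex_of_real (sqrt c) \<cdot>\<^sub>m proj v \<in> carrier_mat (dim_row (complex_of_real c \<cdot>\<^sub>m proj v))
      (dim_row (complex_of_real c \<cdot>\<^sub>m proj v)) \<and>
      psd (complex_of_real (sqrt c) \<cdot>\<^sub>m proj v) \<and>
      (complex_of_real (sqrt c) \<cdot>\<^sub>m proj v) * (complex_of_real (sqrt c) \<cdot>\<^sub>m proj v)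
      = complex_of_real c \<cdot>\<^sub>m proj v"
    using assms proj_carrier[of v] psd_scaled_proj[of "sqrt c" v] proj_mult_self[of v] by simp
qed (use psd_sqrt_unique assms(1) in auto)

lemma fidelity_pure:
  assumes v: "unit_norm v" and R: "R \<in> carrier_mat (dim_vec v) (dim_vec v)"
    and C: "qform R v = complex_of_real C" "0 \<le> C"
  shows "fidelity R (proj v) = sqrt C"
proof -
  have "1 \<cdot>\<^sub>m proj v = proj v" by (rule eq_matI) auto
  then have "msqrt (proj v) = proj v" using msqrt_scaled_proj[OF v, of 1] by simp
  then have "fidelity R (proj v) = Re (mtrace (complex_of_real (sqrt C) \<cdot>\<^sub>m proj v))"
    unfolding fidelity_def using proj_sandwich[OF R] C msqrt_scaled_proj[OF v] by simp
  also have "mtrace (complex_of_real (sqrt C) \<cdot>\<^sub>m proj v)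
      = complex_of_real (sqrt C) * (\<Sum>i<dim_vec v. cnj (v $ i) * v $ i)"
    unfolding mtrace_def sum_distrib_left by (simp add: proj_def ac_simps)
  finally show ?thesis by (simp add: unit_norm_sum[OF v])
qed

lemma kraus_entry:
  assumes K: "K \<in> carrier_mat n m" and p: "dim_vec p = m" and ab: "a < n" "b < n"
  shows "(K * proj p * adj K) $$ (a, b) = (K *\<^sub>v p) $ a * cnj ((K *\<^sub>v p) $ b)"
proof -
  have "(K * proj p * adj K) $$ (a, b) = (\<Sum>j<m. (\<Sum>i<m. K $$ (a, i) * (p $ i * cnj (p $ j)))
      * cnj (K $$ (b, j)))"
    using K p ab by (simp add: times_mat_def scalar_prod_def proj_def adj_def atLeast0LessThan)
  also have "\<dots> = (\<Sum>j<m. \<Sum>i<m. K $$ (a, i) * p $ i * cnj (K $$ (b, j) * p $ j))"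
    unfolding sum_distrib_right by (intro sum.cong refl) simp
  also have "\<dots> = (\<Sum>i<m. \<Sum>j<m. K $$ (a, i) * p $ i * cnj (K $$ (b, j) * p $ j))" by (rule sum.swap)
  also have "\<dots> = (\<Sum>i<m. K $$ (a, i) * p $ i) * (\<Sum>j<m. cnj (K $$ (b, j) * p $ j))"
    by (rule sum_product[symmetric])
  also have "\<dots> = (K *\<^sub>v p) $ a * cnj ((K *\<^sub>v p) $ b)"
    using K p ab by (simp add: mult_mat_vec_def scalar_prod_def atLeast0LessThan cnj_sum)
  finally show ?thesis .
qed

lemma kraus_sum_entry:
  assumes K: "\<And>K. K \<in> set Ks \<Longrightarrow> K \<in> carrier_mat n m" and p: "dim_vec p = m"
  shows "msum n n (map (\<lambda>K. K * proj p * adj K) Ks) \<in> carrier_mat n n"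
    "\<And>a b. a < n \<Longrightarrow> b < n \<Longrightarrow> msum n n (map (\<lambda>K. K * proj p * adj K) Ks) $$ (a, b)
        = (\<Sum>K\<leftarrow>Ks. (K *\<^sub>v p) $ a * cnj ((K *\<^sub>v p) $ b))"
proof -
  have "K * proj p * adj K \<in> carrier_mat n n" if "K \<in> set Ks" for K
    using K[OF that] p by (intro carrier_matI) (auto simp: adj_def)
  then have carrier: "\<forall>A\<in>set (map (\<lambda>K. K * proj p * adj K) Ks). A \<in> carrier_mat n n" by auto
  then show "msum n n (map (\<lambda>K. K * proj p * adj K) Ks) \<in> carrier_mat n n" using msum_entry by blast
  fix a b assume ab: "a < n" "b < n"
  have "msum n n (map (\<lambda>K. K * proj p * adj K) Ks) $$ (a, b) = (\<Sum>K\<leftarrow>Ks. (K * proj p * adj K) $$ (a, b))"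
    using msum_entry[OF carrier] ab by (simp add: comp_def)
  also have "\<dots> = (\<Sum>K\<leftarrow>Ks. (K *\<^sub>v p) $ a * cnj ((K *\<^sub>v p) $ b))"
    using kraus_entry[OF K p ab] by (intro arg_cong[of _ _ sum_list] map_cong) auto
  finally show "msum n n (map (\<lambda>K. K * proj p * adj K) Ks) $$ (a, b)
      = (\<Sum>K\<leftarrow>Ks. (K *\<^sub>v p) $ a * cnj ((K *\<^sub>v p) $ b))" .
qed

lemma qform_kraus:
  assumes K: "\<And>K. K \<in> set Ks \<Longrightarrow> K \<in> carrier_mat (dim_vec v) (dim_vec p)"
  shows "qform (apply_kraus (dim_vec v) Ks (proj p)) v
      = complex_of_real (\<Sum>K\<leftarrow>Ks. (cmod (\<Sum>a<dim_vec v. cnj (v $ a) * (K *\<^sub>v p) $ a))\<^sup>2)"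
proof -
  let ?n = "dim_vec v" and ?w = "\<lambda>K. K *\<^sub>v p"
  have "qform (apply_kraus ?n Ks (proj p)) v =
      (\<Sum>a<?n. cnj (v $ a) * (\<Sum>b<?n. (\<Sum>K\<leftarrow>Ks. ?w K $ a * cnj (?w K $ b)) * v $ b))"
    unfolding apply_kraus_def using kraus_sum_entry[OF K refl] by (subst qform_entries) auto
  also have "\<dots> = (\<Sum>K\<leftarrow>Ks. \<Sum>a<?n. cnj (v $ a) * (\<Sum>b<?n. ?w K $ a * cnj (?w K $ b) * v $ b))"
    by (induction Ks) (simp_all add: distrib_right distrib_left sum.distrib)
  also have "\<dots> = (\<Sum>K\<leftarrow>Ks. complex_of_real ((cmod (\<Sum>a<?n. cnj (v $ a) * ?w K $ a))\<^sup>2))"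
    unfolding complex_norm_square cnj_sum sum_product by (simp add: sum_distrib_left ac_simps)
  also have "\<dots> = complex_of_real (\<Sum>K\<leftarrow>Ks. (cmod (\<Sum>a<?n. cnj (v $ a) * ?w K $ a))\<^sup>2)"
    by (induction Ks) simp_all
  finally show ?thesis .
qed

lemma fidelity_kraus:
  assumes K: "\<And>K. K \<in> set Ks \<Longrightarrow> K \<in> carrier_mat (dim_vec v) (dim_vec p)" and v: "unit_norm v"
  shows "fidelity (apply_kraus (dim_vec v) Ks (proj p)) (proj v)
      = sqrt (\<Sum>K\<leftarrow>Ks. (cmod (\<Sum>a<dim_vec v. cnj (v $ a) * (K *\<^sub>v p) $ a))\<^sup>2)"
  using kraus_sum_entry(1)[OF K refl] qform_kraus[OF K]
  by (intro fidelity_pure[OF v]) (auto simp: apply_kraus_def intro!: sum_list_nonneg)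

lemma fidelity_proj:
  assumes "dim_vec p = dim_vec v" "unit_norm v"
  shows "fidelity (proj p) (proj v) = cmod (\<Sum>a<dim_vec v. cnj (v $ a) * p $ a)"
  using fidelity_pure[OF assms(2) _ qform_proj[OF assms(1)]] assms(1) proj_carrier[of p] by simp

section \<open>Pure states as operators\<close>

definition kop_of :: "statevec \<Rightarrow> kop" where "kop_of s = (fst s, proj (vec_of (fst s) (snd s)))"

lemma fst_kop_of [simp]: "fst (kop_of s) = fst s" by (simp add: kop_of_def)

lemma unit_norm_vec_of: "s \<in> states k \<Longrightarrow> unit_norm (vec_of (fst s) (snd s))"
  by (simp add: unit_norm_def sqnorm_vec_of[symmetric] states_def)

lemma kpure_kop_of: "s \<in> states k \<Longrightarrow> kpure k (kop_of s)"
  unfolding kpure_def using unit_norm_vec_of[of s k]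
  by (auto simp: kop_of_def states_def intro!: exI[of _ "vec_of (fst s) (snd s)"])

lemma amp_of_in_states:
  assumes "valid_dims k d" "dim_vec v = prod_list d" "unit_norm v"
  shows "(d, amp_of d v) \<in> states k" "kop_of (d, amp_of d v) = (d, proj v)"
proof -
  have "sqnorm d (amp_of d v) = 1" using assms unfolding sqnorm_vec_of vec_of_amp[OF assms(2)]
    by (simp add: unit_norm_def)
  then show "(d, amp_of d v) \<in> states k" using assms by (simp add: states_def supported_amp_of)
  show "kop_of (d, amp_of d v) = (d, proj v)" by (simp add: kop_of_def vec_of_amp[OF assms(2)])
qed

lemma kpure_imp_kop_of: "kpure k x \<Longrightarrow> \<exists>s\<in>states k. kop_of s = x"
proof -
  assume "kpure k x"
  then obtain v where v: "valid_dims k (fst x)" "dim_vec v = prod_list (fst x)" "unit_norm v" "snd x = proj v"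
    by (auto simp: kpure_def)
  then show ?thesis using amp_of_in_states[OF v(1-3)]
    by (intro bexI[of _ "(fst x, amp_of (fst x) v)"]) (auto simp: prod_eq_iff)
qed

lemma kop_of_entry:
  "x \<in> ibox (fst s) \<Longrightarrow> y \<in> ibox (fst s) \<Longrightarrow> snd (kop_of s) $$ (enc (fst s) x, enc (fst s) y) = snd s x * cnj (snd s y)"
  by (simp add: kop_of_def proj_def vec_of_def enc_less digits_enc)

lemma ktensor_kop_of:
  assumes "s \<in> states k" "t \<in> states k"
  shows "ktensor (kop_of s) (kop_of t) = kop_of (state_tensor s t)"
proof -
  have len: "length (fst s) = length (fst t)" using states_length assms by metis
  let ?de = "dmul (fst s) (fst t)"
  have "snd (ktensor (kop_of s) (kop_of t)) = snd (kop_of (state_tensor s t))"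
  proof (rule eq_matI)
    show "dim_row (snd (ktensor (kop_of s) (kop_of t))) = dim_row (snd (kop_of (state_tensor s t)))"
      "dim_col (snd (ktensor (kop_of s) (kop_of t))) = dim_col (snd (kop_of (state_tensor s t)))"
      by (simp_all add: ktensor_def Let_def kop_of_def state_tensor_def proj_def dmul_def)
    fix r c assume "r < dim_row (snd (kop_of (state_tensor s t)))"
      "c < dim_col (snd (kop_of (state_tensor s t)))"
    then have rc: "r < prod_list ?de" "c < prod_list ?de" by (auto simp: kop_of_def state_tensor_def proj_def)
    have bx: "digits ?de r \<in> ibox ?de" "digits ?de c \<in> ibox ?de" using rc digits_in_ibox by auto
    have "snd (ktensor (kop_of s) (kop_of t)) $$ (r, c) =
        snd (kop_of s) $$ (enc (fst s) (map2 (div) (digits ?de r) (fst t)), enc (fst s) (map2 (div) (digits ?de c) (fst t))) *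
        snd (kop_of t) $$ (enc (fst t) (map2 (mod) (digits ?de r) (fst t)), enc (fst t) (map2 (mod) (digits ?de c) (fst t)))"
      using rc by (simp add: ktensor_def Let_def dmul_def)
    also have "\<dots> = tensor (fst s) (snd s) (fst t) (snd t) (digits ?de r) * cnj
        (tensor (fst s) (snd s) (fst t) (snd t) (digits ?de c))"
      using bx div_in_ibox[OF len] mod_in_ibox[OF len] by (simp add: kop_of_entry tensor_def)
    also have "\<dots> = snd (kop_of (state_tensor s t)) $$ (r, c)"
      using rc by (simp add: kop_of_def state_tensor_def proj_def vec_of_def)
    finally show "snd (ktensor (kop_of s) (kop_of t)) $$ (r, c) = snd (kop_of (state_tensor s t)) $$ (r, c)" .
  qed
  moreover have "fst (ktensor (kop_of s) (kop_of t)) = fst (kop_of (state_tensor s t))"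
    by (simp add: ktensor_def Let_def state_tensor_def dmul_def)
  ultimately show ?thesis by (simp add: prod_eq_iff)
qed

lemma kop_of_unit_state:
  assumes "s \<in> states k" "fst s = replicate k 1"
  shows "kop_of s = trivial_kop k"
proof -
  have "sqnorm (replicate k 1) (snd s) = 1" using assms by (simp add: states_def)
  then have "(cmod (snd s (replicate k 0)))\<^sup>2 = 1\<^sup>2" unfolding sqnorm_def ibox_ones by simp
  then have modulus: "cmod (snd s (replicate k 0)) = 1" by (rule power2_eq_imp_eq) auto
  have "digits (replicate k 1) 0 = replicate k 0" by (induction k) auto
  then have "vec_of (replicate k 1) (snd s) $ 0 = snd s (replicate k 0)"
    by (simp add: vec_of_def prod_list_replicate)
  moreover have "snd s (replicate k 0) * cnj (snd s (replicate k 0)) = 1"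
    using modulus by (metis complex_norm_square of_real_1 one_power2)
  ultimately have "proj (vec_of (replicate k 1) (snd s)) = 1\<^sub>m 1"
    by (intro eq_matI) (auto simp: proj_def prod_list_replicate)
  then show ?thesis using assms by (simp add: kop_of_def trivial_kop_def)
qed

lemma kpow_kop_of: "s \<in> states k \<Longrightarrow> kpow k (kop_of s) n = kop_of (tensor_list k (replicate n s))"
proof (induction n)
  case 0 then show ?case using kop_of_unit_state[OF unit_in_states] by (simp add: unit_state_def)
next
  case (Suc n)
  have r: "replicate (Suc n) s = replicate n s @ [s]" by (simp add: replicate_append_same)
  have sub: "set (replicate n s) \<subseteq> states k" "set [s] \<subseteq> states k" using Suc by auto
  have "tensor_list k (replicate (Suc n) s) = state_tensor (tensor_list k (replicate n s)) s"
    unfolding r tensor_list_append[OF sub] using Suc by (simp add: state_tensor_unit)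
  then show ?case using Suc ktensor_kop_of[OF tensor_list_in_states[OF sub(1)] Suc(2)] by simp
qed

lemma kop_of_ghz: "0 < k \<Longrightarrow> kop_of (ghz k r) = GHZ k r"
proof -
  assume k: "0 < k"
  have "vec_of (replicate k r) (snd (ghz k r)) = ghz_vec k r"
  proof (rule eq_vecI)
    show "dim_vec (vec_of (replicate k r) (snd (ghz k r))) = dim_vec (ghz_vec k r)"
      by (simp add: ghz_vec_def prod_list_replicate)
    fix i assume "i < dim_vec (ghz_vec k r)"
    then have i: "i < prod_list (replicate k r)" by (simp add: ghz_vec_def prod_list_replicate)
    let ?xs = "digits (replicate k r) i"
    have xs: "?xs \<in> ibox (replicate k r)" using i by (rule digits_in_ibox)
    have "(\<exists>i<r. ?xs = replicate k i) \<longleftrightarrow> (\<forall>x\<in>set ?xs. x = hd ?xs)"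
    proof
      assume "\<exists>i<r. ?xs = replicate k i"
      then show "\<forall>x\<in>set ?xs. x = hd ?xs" using k by (cases k) auto
    next
      assume "\<forall>x\<in>set ?xs. x = hd ?xs"
      then have "?xs = replicate k (hd ?xs)" by (metis length_digits length_replicate replicate_length_same)
      moreover have "hd ?xs < r"
        using nth_ibox[OF xs, of 0] k length_ibox[OF xs] by (cases ?xs) auto
      ultimately show "\<exists>i<r. ?xs = replicate k i" by blast
    qed
    then show "vec_of (replicate k r) (snd (ghz k r)) $ i = ghz_vec k r $ i"
      using i by (simp add: vec_of_def ghz_vec_def ghz_def prod_list_replicate)
  qed
  then show ?thesis by (simp add: kop_of_def GHZ_def ghz_def)
qed

definition overlap :: "statevec \<Rightarrow> statevec \<Rightarrow> complex mat list \<Rightarrow> real" where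
  "overlap s t Ks = (\<Sum>v\<leftarrow>branches (fst s) (fst t) Ks (snd s). (cmod (iprod (fst t) (snd t) v))\<^sup>2)"

lemma purified_dist_kraus:
  assumes t: "t \<in> states k" and Ks: "locc (fst s) (fst t) Ks"
  shows "purified_dist (apply_kraus (prod_list (fst t)) Ks (snd (kop_of s))) (snd (kop_of t))
      = sqrt (1 - overlap s t Ks)"
proof -
  let ?v = "vec_of (fst t) (snd t)" and ?p = "vec_of (fst s) (snd s)"
  have K: "K \<in> carrier_mat (prod_list (fst t)) (prod_list (fst s))" if "K \<in> set Ks" for K
    using locc_structure[OF Ks] that by blast
  have "cmod (iprod (fst t) (snd t) (amp_of (fst t) (K *\<^sub>v ?p)))
      = cmod (\<Sum>a<dim_vec ?v. cnj (?v $ a) * (K *\<^sub>v ?p) $ a)" if "K \<in> set Ks" for K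
    using K[OF that] unfolding iprod_vec_of by (simp add: vec_of_amp)
  then have "overlap s t Ks = (\<Sum>K\<leftarrow>Ks. (cmod (\<Sum>a<dim_vec ?v. cnj (?v $ a) * (K *\<^sub>v ?p) $ a))\<^sup>2)"
    unfolding overlap_def branches_def map_map comp_def by (intro arg_cong[of _ _ sum_list] map_cong) auto
  moreover have "fidelity (apply_kraus (dim_vec ?v) Ks (proj ?p)) (proj ?v)
      = sqrt (\<Sum>K\<leftarrow>Ks. (cmod (\<Sum>a<dim_vec ?v. cnj (?v $ a) * (K *\<^sub>v ?p) $ a))\<^sup>2)"
    using K by (intro fidelity_kraus unit_norm_vec_of[OF t]) auto
  moreover have "0 \<le> overlap s t Ks" unfolding overlap_def by (auto intro!: sum_list_nonneg)
  ultimately show ?thesis by (simp add: purified_dist_def kop_of_def)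
qed

lemma purified_dist_kop_of:
  assumes s: "s \<in> states k" and t: "t \<in> states k" and same_dims: "fst s = fst t"
  shows "purified_dist (snd (kop_of s)) (snd (kop_of t)) = sqrt (1 - (cmod (iprod (fst t) (snd t) (snd s)))\<^sup>2)"
  unfolding purified_dist_def kop_of_def snd_conv using same_dims
  by (subst fidelity_proj) (use unit_norm_vec_of[OF t] in \<open>auto simp: iprod_vec_of\<close>)

lemma converts_locc_trans:
  assumes conversion: "converts s t p" and s: "s \<in> states k" and t: "t \<in> states k" and \<epsilon>: "0 \<le> \<epsilon>" "1 - \<epsilon>\<^sup>2 \<le> p"
  shows "locc_trans (kop_of s) \<epsilon> (kop_of t)"
proof -
  obtain Ks where Ks: "locc (fst s) (fst t) Ks" "p \<le> overlap s t Ks"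
    using pays_imp_locc[of t "fst s" "snd s" p] conversion s
    by (auto simp: converts_def states_def valid_dims_def overlap_def)
  have "sqrt (1 - overlap s t Ks) \<le> sqrt (\<epsilon>\<^sup>2)" using Ks(2) \<epsilon> by (intro real_sqrt_le_mono) simp
  then have "sqrt (1 - overlap s t Ks) \<le> \<epsilon>" using \<epsilon> by simp
  then show ?thesis unfolding locc_trans_def using Ks(1) purified_dist_kraus[OF t Ks(1)] by auto
qed

lemma locc_trans_overlap:
  assumes "locc_trans (kop_of s) \<epsilon> (kop_of t)" and t: "t \<in> states k" and \<epsilon>: "0 \<le> \<epsilon>"
  shows "\<exists>Ks. locc (fst s) (fst t) Ks \<and> 1 - \<epsilon>\<^sup>2 \<le> overlap s t Ks"
proof -
  obtain Ks where Ks: "locc (fst s) (fst t) Ks" "sqrt (1 - overlap s t Ks) \<le> \<epsilon>"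
    using assms(1) purified_dist_kraus[OF t, of s] unfolding locc_trans_def by auto
  have "1 - overlap s t Ks \<le> \<epsilon>\<^sup>2"
  proof (cases "0 \<le> 1 - overlap s t Ks")
    case True then show ?thesis using Ks(2) \<epsilon> by (metis real_sqrt_le_iff real_sqrt_abs abs_of_nonneg)
  next
    case False then show ?thesis using zero_le_power2[of \<epsilon>] by linarith
  qed
  then show ?thesis using Ks(1) by (intro exI[of _ Ks]) simp
qed


section \<open>Admissible functionals bound the rate\<close>

definition outcome_amp :: "statevec \<Rightarrow> statevec \<Rightarrow> complex mat \<Rightarrow> amp" where
  "outcome_amp s t K = amp_of (fst t) (K *\<^sub>v vec_of (fst s) (snd s))"

definition outcome_prob :: "statevec \<Rightarrow> statevec \<Rightarrow> complex mat \<Rightarrow> real" where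
  "outcome_prob s t K = sqnorm (fst t) (outcome_amp s t K)"

text \<open>An outcome of probability \<open>0\<close> is given the arbitrary state \<open>t\<close>.\<close>

definition outcome_state :: "statevec \<Rightarrow> statevec \<Rightarrow> complex mat \<Rightarrow> statevec" where
  "outcome_state s t K = (if outcome_prob s t K = 0 then t
     else (fst t, \<lambda>x. complex_of_real (1 / sqrt (outcome_prob s t K)) * outcome_amp s t K x))"

lemma branches_outcome_amp: "branches (fst s) (fst t) Ks (snd s) = map (outcome_amp s t) Ks"
  by (simp add: branches_def outcome_amp_def)

lemma outcome_prob_nonneg: "0 \<le> outcome_prob s t K" by (simp add: outcome_prob_def sqnorm_nonneg)

lemma fst_outcome_state [simp]: "fst (outcome_state s t K) = fst t" by (simp add: outcome_state_def)

lemma outcome_state_in_states: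
  assumes "t \<in> states k"
  shows "outcome_state s t K \<in> states k"
proof (cases "outcome_prob s t K = 0")
  case False
  then have "0 < outcome_prob s t K" using outcome_prob_nonneg[of s t K] by simp
  then have "sqnorm (fst t) (\<lambda>x. complex_of_real (1 / sqrt (outcome_prob s t K)) * outcome_amp s t K x) = 1"
    unfolding sqnorm_scale by (simp add: norm_divide power_divide outcome_prob_def)
  then show ?thesis
    using assms False supported_amp_of[of "fst t"]
    by (simp add: outcome_state_def outcome_amp_def states_def supported_def)
qed (use assms in \<open>simp add: outcome_state_def\<close>)

lemma outcome_amp_eq:
  assumes "x \<in> ibox (fst t)"
  shows "outcome_amp s t K x = complex_of_real (sqrt (outcome_prob s t K)) * snd (outcome_state s t K) x"
proof (cases "outcome_prob s t K = 0")
  case True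
  then have "(cmod (outcome_amp s t K x))\<^sup>2 = 0"
    using assms unfolding outcome_prob_def sqnorm_def by (simp add: sum_nonneg_eq_0_iff)
  then show ?thesis using True by simp
next
  case False
  then show ?thesis using outcome_prob_nonneg[of s t K] by (simp add: outcome_state_def)
qed

lemma sum_outcome_prob: "s \<in> states k \<Longrightarrow> locc (fst s) (fst t) Ks \<Longrightarrow> (\<Sum>K\<leftarrow>Ks. outcome_prob s t K) = 1"
  using sum_sqnorm_branches[of "fst s" "fst t" Ks "snd s"]
  by (simp add: branches_outcome_amp comp_def states_def outcome_prob_def[symmetric])

lemma overlap_outcomes:
  "overlap s t Ks = (\<Sum>K\<leftarrow>Ks. outcome_prob s t K * (cmod (iprod (fst t) (snd t) (snd (outcome_state s t K))))\<^sup>2)"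
proof -
  have "iprod (fst t) (snd t) (outcome_amp s t K)
      = complex_of_real (sqrt (outcome_prob s t K)) * iprod (fst t) (snd t) (snd (outcome_state s t K))" for K
    unfolding iprod_def sum_distrib_left by (intro sum.cong refl) (simp add: outcome_amp_eq)
  then have "(cmod (iprod (fst t) (snd t) (outcome_amp s t K)))\<^sup>2
      = outcome_prob s t K * (cmod (iprod (fst t) (snd t) (snd (outcome_state s t K))))\<^sup>2" for K
    using outcome_prob_nonneg[of s t K] by (simp add: norm_mult power_mult_distrib)
  then show ?thesis by (simp add: overlap_def branches_outcome_amp comp_def)
qed

lemma kraus_outcome_state:
  assumes K: "K \<in> carrier_mat (prod_list (fst t)) (prod_list (fst s))"
  shows "K * snd (kop_of s) * adj K = complex_of_real (outcome_prob s t K) \<cdot>\<^sub>m snd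
      (kop_of (outcome_state s t K))"
proof (rule eq_matI)
  let ?n = "prod_list (fst t)" and ?p = "vec_of (fst s) (snd s)"
    and ?u = "vec_of (fst t) (snd (outcome_state s t K))"
  let ?c = "complex_of_real (sqrt (outcome_prob s t K))"
  fix a b assume "a < dim_row (complex_of_real (outcome_prob s t K) \<cdot>\<^sub>m snd (kop_of (outcome_state s t K)))"
    "b < dim_col (complex_of_real (outcome_prob s t K) \<cdot>\<^sub>m snd (kop_of (outcome_state s t K)))"
  then have ab: "a < ?n" "b < ?n" by (auto simp: kop_of_def)
  have image: "(K *\<^sub>v ?p) $ i = ?c * ?u $ i" if "i < ?n" for i
  proof -
    have "(K *\<^sub>v ?p) $ i = outcome_amp s t K (digits (fst t) i)"
      using that by (simp add: outcome_amp_def amp_of_def digits_in_ibox enc_digits)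
    then show ?thesis using outcome_amp_eq[OF digits_in_ibox[OF that]] that by (simp add: vec_of_def)
  qed
  have "(K * snd (kop_of s) * adj K) $$ (a, b) = (K *\<^sub>v ?p) $ a * cnj ((K *\<^sub>v ?p) $ b)"
    unfolding kop_of_def snd_conv using K ab by (intro kraus_entry) auto
  also have "\<dots> = complex_of_real (sqrt (outcome_prob s t K) * sqrt (outcome_prob s t K)) *
      (?u $ a * cnj (?u $ b))"
    unfolding image[OF ab(1)] image[OF ab(2)] by (simp del: real_sqrt_mult_self)
  finally show "(K * snd (kop_of s) * adj K) $$ (a, b)
      = (complex_of_real (outcome_prob s t K) \<cdot>\<^sub>m snd (kop_of (outcome_state s t K))) $$ (a, b)"
    using ab outcome_prob_nonneg[of s t K] by (simp add: kop_of_def proj_entry)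
qed (use K in \<open>auto simp: kop_of_def adj_def\<close>)

lemma monotone_on_average_outcomes:
  assumes E: "monotone_on_average k E" and s: "s \<in> states k" and t: "t \<in> states k"
    and Ks: "locc (fst s) (fst t) Ks"
  shows "(\<Sum>K\<leftarrow>Ks. outcome_prob s t K * E (kop_of (outcome_state s t K))) \<le> E (kop_of s)"
proof -
  let ?d = "fst s" and ?e = "fst t" and ?\<phi> = "vec_of (fst s) (snd s)" and ?m = "length Ks"
  let ?p = "\<lambda>l. outcome_prob s t (Ks ! l)" and ?u = "\<lambda>l. vec_of (fst t) (snd (outcome_state s t (Ks ! l)))"
  have kop: "kop_of s = (?d, proj ?\<phi>)" "kop_of (outcome_state s t (Ks ! l)) = (?e, proj (?u l))" for l
    by (simp_all add: kop_of_def)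
  have "(\<Sum>l<?m. ?p l * E (?e, proj (?u l))) \<le> E (?d, proj ?\<phi>)"
  proof (rule E[unfolded monotone_on_average_def, rule_format, where f = "\<lambda>b. b"
    and Ks = Ks], intro conjI allI impI)
    show "kpure k (?d, proj ?\<phi>)" using kpure_kop_of[OF s] unfolding kop .
    show "locc ?d ?e Ks" by (rule Ks)
    show "sum ?p {..<?m} = 1" using sum_outcome_prob[OF s Ks] by (simp add: sum_list_sum_nth atLeast0LessThan)
    fix l assume l: "l < ?m"
    show "kpure k (?e, proj (?u l))" using kpure_kop_of[OF outcome_state_in_states[OF t, of s "Ks ! l"]]
      unfolding kop .
    have K: "Ks ! l \<in> carrier_mat (prod_list ?e) (prod_list ?d)" using locc_structure[OF Ks] l by simp
    have "[0..<?m] = [0..<l] @ l # [Suc l..<?m]"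
      using l by (metis le0 less_imp_le_nat upt_add_eq_append upt_conv_Cons le_add_diff_inverse)
    then have "filter (\<lambda>b. b = l) [0..<?m] = [l]" by auto
    moreover have "Ks ! l * proj ?\<phi> * adj (Ks ! l) = complex_of_real (?p l) \<cdot>\<^sub>m proj (?u l)"
      using kraus_outcome_state[OF K] by (simp add: kop)
    moreover have "complex_of_real (?p l) \<cdot>\<^sub>m proj (?u l) \<in> carrier_mat (prod_list ?e) (prod_list ?e)"
      by (intro carrier_matI) simp_all
    ultimately show "msum (prod_list ?e) (prod_list ?e)
        (map (\<lambda>b. Ks ! b * proj ?\<phi> * adj (Ks ! b)) (filter (\<lambda>b. b = l) [0..<?m]))
        = complex_of_real (?p l) \<cdot>\<^sub>m proj (?u l)"
      by (simp add: msum_def)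
  qed (use outcome_prob_nonneg in auto)
  then show ?thesis by (simp add: sum_list_sum_nth atLeast0LessThan kop)
qed

lemma limsup_Inf_eq_0_iff:
  fixes A :: "nat \<Rightarrow> real set"
  assumes "\<And>n x. x \<in> A n \<Longrightarrow> 0 \<le> x"
  shows "limsup (\<lambda>n. Inf (ereal ` A n)) = 0 \<longleftrightarrow> (\<forall>\<epsilon>>0. \<forall>\<^sub>F n in sequentially. \<exists>x\<in>A n. x < \<epsilon>)"
proof
  assume lim: "limsup (\<lambda>n. Inf (ereal ` A n)) = 0"
  show "\<forall>\<epsilon>>0. \<forall>\<^sub>F n in sequentially. \<exists>x\<in>A n. x < \<epsilon>"
  proof (intro allI impI)
    fix \<epsilon> :: real assume "0 < \<epsilon>"
    then have "\<forall>\<^sub>F n in sequentially. Inf (ereal ` A n) < ereal \<epsilon>" using lim by (intro Limsup_lessD) simp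
    then show "\<forall>\<^sub>F n in sequentially. \<exists>x\<in>A n. x < \<epsilon>" by eventually_elim (auto simp: Inf_less_iff)
  qed
next
  assume small: "\<forall>\<epsilon>>0. \<forall>\<^sub>F n in sequentially. \<exists>x\<in>A n. x < \<epsilon>"
  have "limsup (\<lambda>n. Inf (ereal ` A n)) \<le> 0"
  proof (rule ereal_le_epsilon2)
    fix \<epsilon> :: real assume "0 < \<epsilon>"
    then have "\<forall>\<^sub>F n in sequentially. \<exists>x\<in>A n. x < \<epsilon>" using small by blast
    then have "\<forall>\<^sub>F n in sequentially. Inf (ereal ` A n) \<le> ereal \<epsilon>"
      by eventually_elim (auto intro: Inf_lower2)
    then show "limsup (\<lambda>n. Inf (ereal ` A n)) \<le> 0 + ereal \<epsilon>" by (simp add: Limsup_bounded)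
  qed
  moreover have "0 \<le> limsup (\<lambda>n. Inf (ereal ` A n))"
    using assms by (intro le_Limsup always_eventually allI Inf_greatest) auto
  ultimately show "limsup (\<lambda>n. Inf (ereal ` A n)) = 0" by (rule antisym)
qed

lemma achievable_kop_of_iff:
  assumes k: "0 < k" and s: "s \<in> states k" and t: "t \<in> states k"
  shows "achievable k (kop_of s) (kop_of t) r \<longleftrightarrow> 0 \<le> r \<and> (\<forall>\<delta>>0. \<forall>\<epsilon>>0. \<forall>\<^sub>F n in sequentially. \<exists>\<epsilon>'\<ge>0.
    locc_trans (kop_of (tensor_list k (replicate n s @ replicate (nat \<lfloor>\<delta> * real n\<rfloor>) (ghz k 2)))) \<epsilon>'
      (kop_of (tensor_list k (replicate (nat \<lceil>r * real n\<rceil>) t))) \<and> \<epsilon>' < \<epsilon>)"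
proof -
  have ghz: "ghz k 2 \<in> states k" using k by (simp add: ghz_in_states)
  have "ktensor (kpow k (kop_of s) n) (kpow k (GHZ k 2) m)
      = kop_of (tensor_list k (replicate n s @ replicate m (ghz k 2)))" for n m
  proof -
    have copies: "set (replicate n s) \<subseteq> states k" "set (replicate m (ghz k 2)) \<subseteq> states k" using s ghz by auto
    show ?thesis
      unfolding tensor_list_append[OF copies] ktensor_kop_of[OF copies[THEN tensor_list_in_states], symmetric]
      by (simp add: kop_of_ghz[OF k, symmetric] kpow_kop_of[OF s] kpow_kop_of[OF ghz])
  qed
  then show ?thesis
    unfolding achievable_def kpow_kop_of[OF t] by (subst limsup_Inf_eq_0_iff) auto
qed

locale admissible_functional =
  fixes k :: nat and E :: "kop \<Rightarrow> real"
  assumes k_pos: "0 < k" and admissible: "admissible k E"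
begin

lemma E_ghz: "E (kop_of (ghz k 2)) = 1"
  using admissible by (simp add: admissible_def kop_of_ghz[OF k_pos])

lemma monotone: "monotone_on_average k E" using admissible by (simp add: admissible_def)

lemma E_tensor:
  assumes "s \<in> states k" "t \<in> states k"
  shows "E (kop_of (state_tensor s t)) = E (kop_of s) + E (kop_of t)"
  unfolding ktensor_kop_of[OF assms, symmetric]
  using admissible kpure_kop_of[OF assms(1)] kpure_kop_of[OF assms(2)]
  unfolding admissible_def fully_additive_def by blast

lemma E_trivial: "E (trivial_kop k) = 0"
  using E_tensor[OF unit_in_states unit_in_states] kop_of_unit_state[OF unit_in_states[of k]]
  by (simp add: unit_state_tensor[OF unit_in_states]) (simp add: unit_state_def)

lemma E_nonneg:
  assumes s: "s \<in> states k"
  shows "0 \<le> E (kop_of s)"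
proof -
  obtain Ks where Ks: "locc (fst s) (fst (unit_state k)) Ks"
    using pays_imp_locc[of "unit_state k" "fst s" "snd s" 0] converts_zero[OF s unit_in_states] s
    by (auto simp: converts_def states_def valid_dims_def)
  have "E (kop_of (outcome_state s (unit_state k) K)) = 0" for K
    using kop_of_unit_state[OF outcome_state_in_states[OF unit_in_states[of k], of s K]] E_trivial
    by (simp add: unit_state_def)
  then show ?thesis using monotone_on_average_outcomes[OF monotone s unit_in_states Ks] by simp
qed

lemma E_tensor_list: "set xs \<subseteq> states k \<Longrightarrow> E (kop_of (tensor_list k xs)) = (\<Sum>s\<leftarrow>xs. E (kop_of s))"
proof (induction xs)
  case Nil
  then show ?case using E_trivial kop_of_unit_state[OF unit_in_states] by (simp add: unit_state_def)
next
  case (Cons s xs)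
  then show ?case by (simp add: E_tensor tensor_list_in_states)
qed

lemma log_dim_nonneg: "s \<in> states k \<Longrightarrow> 0 \<le> log 2 (real (prod_list (fst s)))"
  using prod_list_ge_1[of k "fst s"] by (simp add: states_def)

lemma close_states_bound:
  assumes "0 < \<eta>"
  shows "\<exists>\<delta>>0. \<forall>t\<in>states k. \<forall>u\<in>states k. fst u = fst t \<longrightarrow>
    E (kop_of t) - \<eta> * (1 + log 2 (real (prod_list (fst t)))) - E (kop_of t) *
    ((1 - (cmod (iprod (fst t) (snd t) (snd u)))\<^sup>2) / \<delta>\<^sup>2)
      \<le> E (kop_of u)"
proof -
  obtain \<delta> where \<delta>: "\<delta> > 0" "\<And>s t. kpure k s \<Longrightarrow> kpure k t \<Longrightarrow> kdist s t < \<delta> \<Longrightarrow>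
        \<bar>E s / (1 + log 2 (real (prod_list (fst s)))) - E t / (1 + log 2 (real (prod_list (fst t))))\<bar> < \<eta>"
    using admissible \<open>0 < \<eta>\<close> unfolding admissible_def asymptotically_continuous_def by meson
  have "E (kop_of t) - \<eta> * (1 + log 2 (real (prod_list (fst t)))) - E (kop_of t) * ((1 - F) / \<delta>\<^sup>2)
      \<le> E (kop_of u)"
    if t: "t \<in> states k" and u: "u \<in> states k" "fst u = fst t"
      and F: "F = (cmod (iprod (fst t) (snd t) (snd u)))\<^sup>2" for t u F
  proof -
    let ?N = "1 + log 2 (real (prod_list (fst t)))"
    have N: "0 < ?N" using log_dim_nonneg[OF t] by simp
    have "F \<le> 1" using Cauchy_Schwarz_iprod[of "fst t" "snd t" "snd u"] t u by (simp add: F states_def)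
    show ?thesis
    proof (cases "1 - F < \<delta>\<^sup>2")
      case True
      have "kdist (kop_of u) (kop_of t) = sqrt (1 - F)"
        using purified_dist_kop_of[OF u(1) t u(2)] u(2) by (simp add: kdist_def F)
      also have "\<dots> < sqrt (\<delta>\<^sup>2)" by (rule real_sqrt_less_mono) (rule True)
      finally have "kdist (kop_of u) (kop_of t) < \<delta>" using \<delta>(1) by simp
      from \<delta>(2)[OF kpure_kop_of[OF u(1)] kpure_kop_of[OF t] this]
      have "E (kop_of t) / ?N - \<eta> < E (kop_of u) / ?N" by (simp add: u(2) abs_less_iff)
      then have "(E (kop_of t) / ?N - \<eta>) * ?N < E (kop_of u) / ?N * ?N" using N by (rule mult_strict_right_mono)
      then have "E (kop_of t) - \<eta> * ?N < E (kop_of u)" using N by (simp add: left_diff_distrib)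
      moreover have "0 \<le> E (kop_of t) * ((1 - F) / \<delta>\<^sup>2)" using E_nonneg[OF t] \<open>F \<le> 1\<close> by simp
      ultimately show ?thesis by linarith
    next
      case False
      then have "1 \<le> (1 - F) / \<delta>\<^sup>2" using \<delta>(1) by (simp add: pos_le_divide_eq)
      then have "E (kop_of t) * 1 \<le> E (kop_of t) * ((1 - F) / \<delta>\<^sup>2)"
        using E_nonneg[OF t] by (rule mult_left_mono)
      moreover have "0 \<le> \<eta> * ?N" using \<open>0 < \<eta>\<close> N by simp
      ultimately show ?thesis using E_nonneg[OF u(1)] by linarith
    qed
  qed
  then show ?thesis using \<delta>(1) by blast
qed

lemma approx_monotone:
  assumes "0 < \<eta>"
  shows "\<exists>\<delta>>0. \<forall>s t \<epsilon>. s \<in> states k \<and> t \<in> states k \<and> 0 \<le> \<epsilon> \<and> locc_trans (kop_of s) \<epsilon> (kop_of t) \<longrightarrow>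
     E (kop_of t) * (1 - \<epsilon>\<^sup>2 / \<delta>\<^sup>2) - \<eta> * (1 + log 2 (real (prod_list (fst t)))) \<le> E (kop_of s)"
proof -
  obtain \<delta> where \<delta>: "\<delta> > 0" "\<And>t u. t \<in> states k \<Longrightarrow> u \<in> states k \<Longrightarrow> fst u = fst t \<Longrightarrow>
      E (kop_of t) - \<eta> * (1 + log 2 (real (prod_list (fst t)))) - E (kop_of t) *
      ((1 - (cmod (iprod (fst t) (snd t) (snd u)))\<^sup>2) / \<delta>\<^sup>2)
        \<le> E (kop_of u)"
    using close_states_bound[OF assms] by blast
  have "E (kop_of t) * (1 - \<epsilon>\<^sup>2 / \<delta>\<^sup>2) - \<eta> * (1 + log 2 (real (prod_list (fst t)))) \<le> E (kop_of s)"
    if s: "s \<in> states k" and t: "t \<in> states k" and \<epsilon>: "0 \<le> \<epsilon>" and trans: "locc_trans (kop_of s) \<epsilon> (kop_of t)"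
      for s t \<epsilon>
  proof -
    define A where "A = E (kop_of t) - \<eta> * (1 + log 2 (real (prod_list (fst t))))"
    let ?p = "outcome_prob s t" and ?F = "\<lambda>K. (cmod (iprod (fst t) (snd t) (snd (outcome_state s t K))))\<^sup>2"
    obtain Ks where Ks: "locc (fst s) (fst t) Ks" "1 - \<epsilon>\<^sup>2 \<le> overlap s t Ks"
      using locc_trans_overlap[OF trans t \<epsilon>] by blast
    have linear: "(\<Sum>K\<leftarrow>Ks. ?p K * (A - E (kop_of t) * ((1 - ?F K) / \<delta>\<^sup>2)))
        = (\<Sum>K\<leftarrow>Ks. ?p K) * A - E (kop_of t) * (((\<Sum>K\<leftarrow>Ks. ?p K) - (\<Sum>K\<leftarrow>Ks. ?p K * ?F K)) / \<delta>\<^sup>2)" for Ks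
      by (induction Ks) (simp_all add: algebra_simps add_divide_distrib diff_divide_distrib)
    have "(1 - overlap s t Ks) / \<delta>\<^sup>2 \<le> \<epsilon>\<^sup>2 / \<delta>\<^sup>2" using Ks(2) by (intro divide_right_mono) auto
    then have "E (kop_of t) * ((1 - overlap s t Ks) / \<delta>\<^sup>2) \<le> E (kop_of t) * (\<epsilon>\<^sup>2 / \<delta>\<^sup>2)"
      using E_nonneg[OF t] by (rule mult_left_mono)
    then have "E (kop_of t) * (1 - \<epsilon>\<^sup>2 / \<delta>\<^sup>2) - \<eta> * (1 + log 2 (real (prod_list (fst t))))
        \<le> A - E (kop_of t) * ((1 - overlap s t Ks) / \<delta>\<^sup>2)"
      by (simp add: A_def right_diff_distrib)
    also have "\<dots> = (\<Sum>K\<leftarrow>Ks. ?p K * (A - E (kop_of t) * ((1 - ?F K) / \<delta>\<^sup>2)))"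
      unfolding linear sum_outcome_prob[OF s Ks(1)] overlap_outcomes by simp
    also have "\<dots> \<le> (\<Sum>K\<leftarrow>Ks. ?p K * E (kop_of (outcome_state s t K)))"
      using \<delta>(2)[OF t outcome_state_in_states[OF t]] outcome_prob_nonneg
      by (intro sum_list_mono mult_left_mono) (auto simp: A_def)
    also have "\<dots> \<le> E (kop_of s)" by (rule monotone_on_average_outcomes[OF monotone s t Ks(1)])
    finally show ?thesis .
  qed
  then show ?thesis using \<delta>(1) by blast
qed

lemma log_dim_copies:
  assumes "t \<in> states k"
  shows "log 2 (real (prod_list (fst (tensor_list k (replicate m t)))))
      = real m * log 2 (real (prod_list (fst t)))"
proof -
  have "valid_dims k (fst t)" using assms by (simp add: states_def)
  moreover have "fst (tensor_list k (replicate m t)) = dpow k (fst t) m"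
    using fst_tensor_list_const[of k "fst t" "\<lambda>_. snd t" "replicate m 0"] by (simp add: map_replicate)
  ultimately show ?thesis using prod_list_ge_1[of k "fst t"] by (simp add: prod_list_dpow log_nat_power)
qed

lemma achievable_copies_bound:
  assumes s: "s \<in> states k" and t: "t \<in> states k" and r: "achievable k (kop_of s) (kop_of t) r" and \<eta>: "0 < \<eta>"
    "\<eta> < 1"
  shows "\<exists>n\<ge>1. real (nat \<lceil>r * real n\<rceil>) * E (kop_of t) * (1 - \<eta>)
    \<le> real n * E (kop_of s) + \<eta> * real n + \<eta> * (1 + real (nat \<lceil>r * real n\<rceil>) * log 2 (real (prod_list (fst t))))"
proof -
  have ghz: "ghz k 2 \<in> states k" using k_pos by (simp add: ghz_in_states)
  let ?S = "\<lambda>n. tensor_list k (replicate n s @ replicate (nat \<lfloor>\<eta> * real n\<rfloor>) (ghz k 2))"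
  let ?T = "\<lambda>n. tensor_list k (replicate (nat \<lceil>r * real n\<rceil>) t)"
  obtain \<delta> where \<delta>: "\<delta> > 0" "\<And>s t \<epsilon>. s \<in> states k \<Longrightarrow> t \<in> states k \<Longrightarrow> 0 \<le> \<epsilon> \<Longrightarrow> locc_trans (kop_of s) \<epsilon> (kop_of t) \<Longrightarrow>
     E (kop_of t) * (1 - \<epsilon>\<^sup>2 / \<delta>\<^sup>2) - \<eta> * (1 + log 2 (real (prod_list (fst t)))) \<le> E (kop_of s)"
    using approx_monotone[OF \<eta>(1)] by blast
  have "\<forall>\<^sub>F n in sequentially. \<exists>\<epsilon>\<ge>0. locc_trans (kop_of (?S n)) \<epsilon> (kop_of (?T n)) \<and> \<epsilon> < \<delta> * \<eta>"
    using r \<delta>(1) \<eta>(1) unfolding achievable_kop_of_iff[OF k_pos s t] by simp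
  then obtain n \<epsilon> where n: "1 \<le> n" and \<epsilon>: "0 \<le> \<epsilon>" "\<epsilon> < \<delta> * \<eta>"
    and trans: "locc_trans (kop_of (?S n)) \<epsilon> (kop_of (?T n))"
    unfolding eventually_sequentially by (metis max.cobounded1 max.cobounded2)
  let ?m = "real (nat \<lceil>r * real n\<rceil>)"
  have copies: "set (replicate n s @ replicate (nat \<lfloor>\<eta> * real n\<rfloor>) (ghz k 2)) \<subseteq> states k"
    "set (replicate (nat \<lceil>r * real n\<rceil>) t) \<subseteq> states k"
    using s t ghz by auto
  have "E (kop_of (?S n)) = real n * E (kop_of s) + real (nat \<lfloor>\<eta> * real n\<rfloor>)"
    "E (kop_of (?T n)) = ?m * E (kop_of t)"
    unfolding copies[THEN E_tensor_list] by (simp_all add: sum_list_replicate E_ghz)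
  then have "?m * E (kop_of t) * (1 - \<epsilon>\<^sup>2 / \<delta>\<^sup>2) - \<eta> * (1 + ?m * log 2 (real (prod_list (fst t))))
      \<le> real n * E (kop_of s) + real (nat \<lfloor>\<eta> * real n\<rfloor>)"
    using \<delta>(2)[OF copies[THEN tensor_list_in_states] \<epsilon>(1) trans] log_dim_copies[OF t] by simp
  moreover have "\<epsilon>\<^sup>2 / \<delta>\<^sup>2 \<le> \<eta>"
  proof -
    have "\<epsilon>\<^sup>2 / \<delta>\<^sup>2 \<le> (\<delta> * \<eta>)\<^sup>2 / \<delta>\<^sup>2" using \<epsilon> by (intro divide_right_mono power_mono) auto
    also have "\<dots> \<le> \<eta>" using \<delta>(1) \<eta> by (simp add: power_mult_distrib) (simp add: power2_eq_square mult_left_le)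
    finally show ?thesis .
  qed
  then have "?m * E (kop_of t) * (1 - \<eta>) \<le> ?m * E (kop_of t) * (1 - \<epsilon>\<^sup>2 / \<delta>\<^sup>2)"
    using E_nonneg[OF t] by (intro mult_left_mono) auto
  moreover have "real (nat \<lfloor>\<eta> * real n\<rfloor>) \<le> \<eta> * real n" using \<eta> by (intro of_nat_floor) simp
  ultimately show ?thesis using n by (intro exI[of _ n]) linarith
qed

lemma rate_bound:
  assumes s: "s \<in> states k" and t: "t \<in> states k" and r: "achievable k (kop_of s) (kop_of t) r"
  shows "r * E (kop_of t) \<le> E (kop_of s)"
proof (rule tendsto_lowerbound)
  let ?L = "log 2 (real (prod_list (fst t)))"
  let ?B = "2 + (r + 1) * E (kop_of t) + (r + 1) * ?L"
  have "0 \<le> r" using r by (simp add: achievable_def)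
  have "r * E (kop_of t) \<le> E (kop_of s) + \<eta> * ?B" if \<eta>: "0 < \<eta>" "\<eta> < 1" for \<eta>
  proof -
    obtain n m where n: "1 \<le> n" and m_def: "m = real (nat \<lceil>r * real n\<rceil>)"
      and copies: "m * E (kop_of t) * (1 - \<eta>) \<le> real n * E (kop_of s) + \<eta> * real n + \<eta> * (1 + m * ?L)"
      using achievable_copies_bound[OF s t r \<eta>] by blast
    have "0 \<le> r * real n" using \<open>0 \<le> r\<close> by simp
    then have m: "r * real n \<le> m" "m \<le> r * real n + 1" unfolding m_def by linarith+
    then have "m \<le> (r + 1) * real n" using n by (simp add: distrib_right)
    then have "m * x \<le> (r + 1) * real n * x" if "0 \<le> x" for x using that by (rule mult_right_mono)
    then have "\<eta> * (m * E (kop_of t)) \<le> \<eta> * ((r + 1) * real n * E (kop_of t))"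
      "\<eta> * (1 + m * ?L) \<le> \<eta> * (real n + (r + 1) * real n * ?L)"
      using E_nonneg[OF t] log_dim_nonneg[OF t] \<eta> n by (intro mult_left_mono add_mono; simp)+
    moreover have "r * real n * E (kop_of t) \<le> m * E (kop_of t)"
      using m(1) E_nonneg[OF t] by (rule mult_right_mono)
    ultimately have "real n * (r * E (kop_of t)) \<le> real n * (E (kop_of s) + \<eta> * ?B)"
      using copies by (simp add: algebra_simps)
    then show ?thesis using n by simp
  qed
  then show "\<forall>\<^sub>F \<eta> in at_right 0. r * E (kop_of t) \<le> E (kop_of s) + \<eta> * ?B"
    unfolding eventually_at_right_field by (intro exI[of _ 1]) auto
  show "((\<lambda>\<eta>. E (kop_of s) + \<eta> * ?B) \<longlongrightarrow> E (kop_of s)) (at_right 0)"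
    by (rule tendsto_eq_intros refl)+ simp
qed simp

lemma R_LOCCq_le_ratio:
  assumes s: "s \<in> states k" and t: "t \<in> states k" and "E (kop_of t) \<noteq> 0"
  shows "R_LOCCq k (kop_of s) (kop_of t) \<le> ereal (E (kop_of s) / E (kop_of t))"
  unfolding R_LOCCq_def
proof (rule Sup_least)
  have "0 < E (kop_of t)" using E_nonneg[OF t] assms(3) by simp
  then show "x \<le> ereal (E (kop_of s) / E (kop_of t))" if "x \<in> ereal ` {r. achievable k (kop_of s) (kop_of t) r}"
    for x
    using that rate_bound[OF s t] by (auto simp: pos_le_divide_eq)
qed

end

section \<open>Functionals on pure states from functionals on multisets\<close>

lemma dominates_imp_achievable:
  assumes k: "2 \<le> k" and s: "s \<in> states k" and t: "t \<in> states k" and q: "0 < q"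
    and dominance: "resource_theory.dominates (states k) (mconverts k) (ghz k 2) (replicate_mset q s)
        (replicate_mset p t)"
  shows "achievable k (kop_of s) (kop_of t) (real p / real q)"
proof -
  interpret resource_theory "states k" "mconverts k" "ghz k 2" by (rule entanglement_resource_theory[OF k])
  let ?S = "\<lambda>\<delta> n. replicate n s @ replicate (nat \<lfloor>\<delta> * real n\<rfloor>) (ghz k 2)"
  let ?T = "\<lambda>n. replicate (nat \<lceil>real p / real q * real n\<rceil>) t"
  have "\<forall>\<^sub>F n in sequentially. \<exists>\<epsilon>'\<ge>0. locc_trans (kop_of (tensor_list k (?S \<delta> n))) \<epsilon>'
      (kop_of (tensor_list k (?T n))) \<and> \<epsilon>' < \<epsilon>"
    if "0 < \<delta>" "0 < \<epsilon>" for \<delta> \<epsilon>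
  proof -
    have "\<forall>\<^sub>F n in sequentially. mconverts k (mset (?S \<delta> n)) (mset (?T n)) (1 - (\<epsilon> / 2)\<^sup>2)"
      using dominates_rate[OF s t q \<open>0 < \<delta>\<close> dominance] \<open>0 < \<epsilon>\<close> by (simp add: asymp_convertible_def)
    then show ?thesis
    proof eventually_elim
      case (elim n)
      have ST: "set (?S \<delta> n) \<subseteq> states k" "set (?T n) \<subseteq> states k" using s t g_in by auto
      have "converts (tensor_list k (?S \<delta> n)) (tensor_list k (?T n)) (1 - (\<epsilon> / 2)\<^sup>2)" using elim
        unfolding mconverts_tensor_list[OF ST] .
      then have "locc_trans (kop_of (tensor_list k (?S \<delta> n))) (\<epsilon> / 2) (kop_of (tensor_list k (?T n)))"
        using \<open>0 < \<epsilon>\<close> by (intro converts_locc_trans[OF _ ST[THEN tensor_list_in_states]]) auto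
      then show ?case using \<open>0 < \<epsilon>\<close> by (intro exI[of _ "\<epsilon> / 2"]) simp
    qed
  qed
  then show ?thesis using k by (subst achievable_kop_of_iff[OF _ s t]) auto
qed

lemma kpure_proj:
  assumes p: "kpure k (d, proj v)" and d: "dim_vec v = prod_list d"
  shows "valid_dims k d" "unit_norm v"
proof -
  obtain w where w: "valid_dims k d" "dim_vec w = prod_list d" "unit_norm w" "proj v = proj w"
    using p by (auto simp: kpure_def)
  show "valid_dims k d" by (rule w(1))
  have "(cmod (v $ i))\<^sup>2 = (cmod (w $ i))\<^sup>2" if "i < prod_list d" for i
  proof -
    have "complex_of_real ((cmod (v $ i))\<^sup>2) = complex_of_real ((cmod (w $ i))\<^sup>2)"
      unfolding complex_norm_square using proj_entry[of i v i] proj_entry[of i w i] that d w(2,4) by simp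
    then show ?thesis unfolding of_real_eq_iff .
  qed
  then show "unit_norm v" using w(2,3) d by (simp add: unit_norm_def)
qed

lemma rank_one_mixture_form:
  fixes W :: "'i \<Rightarrow> nat \<Rightarrow> complex"
  assumes "\<And>a c. a < D \<Longrightarrow> c < D \<Longrightarrow> (\<Sum>b\<in>B. W b a * cnj (W b c)) = complex_of_real P * (u a * cnj (u c))"
  shows "(\<Sum>b\<in>B. (cmod (\<Sum>a<D. cnj (z a) * W b a))\<^sup>2) = P * (cmod (\<Sum>a<D. cnj (z a) * u a))\<^sup>2"
proof -
  have expand: "complex_of_real ((cmod (\<Sum>a<D. cnj (z a) * v a))\<^sup>2)
      = (\<Sum>a<D. \<Sum>c<D. cnj (z a) * z c * (v a * cnj (v c)))" for v
    unfolding complex_norm_square cnj_sum sum_product by (intro sum.cong refl) simp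
  have "complex_of_real (\<Sum>b\<in>B. (cmod (\<Sum>a<D. cnj (z a) * W b a))\<^sup>2)
      = (\<Sum>b\<in>B. \<Sum>a<D. \<Sum>c<D. cnj (z a) * z c * (W b a * cnj (W b c)))" unfolding of_real_sum expand ..
  also have "\<dots> = (\<Sum>a<D. \<Sum>b\<in>B. \<Sum>c<D. cnj (z a) * z c * (W b a * cnj (W b c)))" by (rule sum.swap)
  also have "\<dots> = (\<Sum>a<D. \<Sum>c<D. \<Sum>b\<in>B. cnj (z a) * z c * (W b a * cnj (W b c)))" by (intro sum.cong refl sum.swap)
  also have "\<dots> = complex_of_real P * (\<Sum>a<D. \<Sum>c<D. cnj (z a) * z c * (u a * cnj (u c)))"
    unfolding sum_distrib_left by (intro sum.cong refl) (simp add: sum_distrib_left[symmetric] assms mult_ac)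
  also have "\<dots> = complex_of_real (P * (cmod (\<Sum>a<D. cnj (z a) * u a))\<^sup>2)" unfolding of_real_mult expand ..
  finally show ?thesis unfolding of_real_eq_iff .
qed

lemma rank_one_mixture:
  fixes W :: "'i \<Rightarrow> nat \<Rightarrow> complex"
  assumes fin: "finite B" and u: "(\<Sum>a<D. cnj (u a) * u a) = 1"
    and mix: "\<And>a c. a < D \<Longrightarrow> c < D \<Longrightarrow> (\<Sum>b\<in>B. W b a * cnj (W b c)) = complex_of_real P * (u a * cnj (u c))"
  shows "(\<Sum>b\<in>B. (cmod (\<Sum>a<D. cnj (u a) * W b a))\<^sup>2) = P"
    and "\<And>b a. b \<in> B \<Longrightarrow> a < D \<Longrightarrow> W b a = (\<Sum>a<D. cnj (u a) * W b a) * u a"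
proof -
  show "(\<Sum>b\<in>B. (cmod (\<Sum>a<D. cnj (u a) * W b a))\<^sup>2) = P" using rank_one_mixture_form[OF mix, where z = u] u
    by simp
  fix b a assume b: "b \<in> B" and a: "a < D"
  define \<alpha> where "\<alpha> = (\<Sum>a<D. cnj (u a) * W b a)"
  define z where "z = (\<lambda>a. W b a - \<alpha> * u a)"
  have "(\<Sum>a<D. cnj (u a) * z a) = \<alpha> - \<alpha> * (\<Sum>a<D. cnj (u a) * u a)"
    unfolding z_def \<alpha>_def[symmetric] right_diff_distrib sum_subtractf sum_distrib_left
    by (simp add: \<alpha>_def mult_ac)
  then have "cnj (\<Sum>a<D. cnj (u a) * z a) = 0" using u by simp
  then have zu: "(\<Sum>a<D. cnj (z a) * u a) = 0" unfolding cnj_sum by (simp add: mult.commute)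
  then have "(\<Sum>b\<in>B. (cmod (\<Sum>a<D. cnj (z a) * W b a))\<^sup>2) = 0" using rank_one_mixture_form[OF mix, where z = z]
    by simp
  then have zW: "(\<Sum>a<D. cnj (z a) * W b a) = 0" using b fin by (simp add: sum_nonneg_eq_0_iff)
  have "complex_of_real (\<Sum>a<D. (cmod (z a))\<^sup>2) = (\<Sum>a<D. cnj (z a) * (W b a - \<alpha> * u a))"
    unfolding sum_cnj_mult_self[symmetric] by (simp add: z_def)
  also have "\<dots> = (\<Sum>a<D. cnj (z a) * W b a) - \<alpha> * (\<Sum>a<D. cnj (z a) * u a)"
    unfolding right_diff_distrib sum_subtractf sum_distrib_left by (simp add: mult_ac)
  also have "\<dots> = complex_of_real 0" unfolding zu zW by simp
  finally have "(\<Sum>a<D. (cmod (z a))\<^sup>2) = 0" unfolding of_real_eq_iff .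
  then have "z a = 0" using a by (simp add: sum_nonneg_eq_0_iff)
  then show "W b a = (\<Sum>a<D. cnj (u a) * W b a) * u a" by (simp add: z_def \<alpha>_def)
qed

lemma kraus_fibre_pure:
  fixes Ks :: "complex mat list"
  assumes K: "\<And>b. b < length Ks \<Longrightarrow> Ks ! b \<in> carrier_mat D (dim_vec \<phi>)" and u: "unit_norm u" "dim_vec u = D"
    and pure: "msum D D (map (\<lambda>b. Ks ! b * proj \<phi> * adj (Ks ! b)) (filter (\<lambda>b. f b = x) [0..<length Ks]))
        = complex_of_real P \<cdot>\<^sub>m proj u"
  shows "(\<Sum>b\<in>{b\<in>{..<length Ks}. f b = x}. (cmod (\<Sum>a<D. cnj (u $ a) * (Ks ! b *\<^sub>v \<phi>) $ a))\<^sup>2) = P"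
    and "\<And>b. b < length Ks \<Longrightarrow> f b = x \<Longrightarrow> Ks ! b *\<^sub>v \<phi> = (\<Sum>a<D. cnj (u $ a) * (Ks ! b *\<^sub>v \<phi>) $ a) \<cdot>\<^sub>v u"
proof -
  let ?B = "{b\<in>{..<length Ks}. f b = x}" and ?bs = "filter (\<lambda>b. f b = x) [0..<length Ks]"
    and ?W = "\<lambda>b a. (Ks ! b *\<^sub>v \<phi>) $ a"
  have mix: "(\<Sum>b\<in>?B. ?W b a * cnj (?W b c)) = complex_of_real P * (u $ a * cnj (u $ c))" if "a < D" "c < D"
    for a c
  proof -
    have "(\<Sum>b\<in>?B. ?W b a * cnj (?W b c)) = (\<Sum>b\<in>set ?bs. ?W b a * cnj (?W b c))" by (intro sum.cong) auto
    also have "\<dots> = (\<Sum>b\<leftarrow>?bs. ?W b a * cnj (?W b c))" by (simp add: sum_list_distinct_conv_sum_set)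
    also have "\<dots> = (\<Sum>K\<leftarrow>map ((!) Ks) ?bs. (K *\<^sub>v \<phi>) $ a * cnj ((K *\<^sub>v \<phi>) $ c))" by (simp add: comp_def)
    also have "\<dots> = msum D D (map (\<lambda>K. K * proj \<phi> * adj K) (map ((!) Ks) ?bs)) $$ (a, c)"
      using that K by (intro kraus_sum_entry(2)[symmetric]) auto
    also have "\<dots> = (complex_of_real P \<cdot>\<^sub>m proj u) $$ (a, c)" using pure by (simp add: comp_def)
    finally show ?thesis using that u(2) by (simp add: proj_def)
  qed
  have unit: "(\<Sum>a<D. cnj (u $ a) * u $ a) = 1" using unit_norm_sum[OF u(1)] u(2) by simp
  show "(\<Sum>b\<in>?B. (cmod (\<Sum>a<D. cnj (u $ a) * ?W b a))\<^sup>2) = P" by (rule rank_one_mixture(1)[OF _ unit mix]) auto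
  show "Ks ! b *\<^sub>v \<phi> = (\<Sum>a<D. cnj (u $ a) * ?W b a) \<cdot>\<^sub>v u" if "b < length Ks" "f b = x" for b
    using that rank_one_mixture(2)[OF _ unit mix, of b] K[of b] u(2) by (intro eq_vecI) auto
qed

lemma ensemble_branches:
  assumes locc: "locc (fst s) e Ks" and s: "s \<in> states k"
    and branch: "\<And>b. b < length Ks \<Longrightarrow> branches (fst s) e Ks (snd s) ! b = (\<lambda>x. \<alpha> b * snd (T b) x)
        \<and> fst (T b) = e"
  shows "ensemble s {..<length Ks} \<alpha> T"
  unfolding ensemble_def
proof
  fix q :: "nat \<Rightarrow> real"
  let ?H = "\<lambda>d v p. \<exists>b\<in>{..<length Ks}. d = fst (T b) \<and> v = (\<lambda>x. \<alpha> b * snd (T b) x) \<and> p \<le> q b"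
  have "list_all2 (pays ?H e) (branches (fst s) e Ks (snd s)) (map q [0..<length Ks])"
    unfolding list_all2_conv_all_nth using branch by (auto intro!: pays.leaf)
  then have "pays ?H (fst s) (snd s) (sum_list (map q [0..<length Ks]))"
    using pays_branches[OF locc] s by (simp add: states_def)
  then show "pays ?H (fst s) (snd s) (\<Sum>b<length Ks. q b)"
    by (simp add: interv_sum_list_conv_sum_set_nat atLeast0LessThan)
qed

lemma sum_weighted_fibres:
  fixes w g P :: "nat \<Rightarrow> real"
  assumes "\<forall>b<n. f b < m" "\<And>x. x < m \<Longrightarrow> (\<Sum>b\<in>{b\<in>{..<n}. f b = x}. w b) = P x"
  shows "(\<Sum>b<n. w b * g (f b)) = (\<Sum>x<m. P x * g x)"
proof -
  have "(\<Sum>b<n. w b * g (f b)) = (\<Sum>x<m. \<Sum>b\<in>{b\<in>{..<n}. f b = x}. w b * g (f b))"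
    using assms(1) by (intro sum.group[symmetric]) auto
  also have "\<dots> = (\<Sum>x<m. (\<Sum>b\<in>{b\<in>{..<n}. f b = x}. w b) * g x)"
    unfolding sum_distrib_right by (intro sum.cong refl) auto
  also have "\<dots> = (\<Sum>x<m. P x * g x)" using assms(2) by (intro sum.cong refl) simp
  finally show ?thesis .
qed

context entanglement_functional
begin

lemma val_cong_kop_of:
  assumes "s \<in> states k" "t \<in> states k" "kop_of s = kop_of t"
  shows "val s = val t"
proof -
  have "val t \<le> val s" if s: "s \<in> states k" and t: "t \<in> states k" and same: "kop_of s = kop_of t" for s t
  proof (rule val_mono_converts[OF s t])
    fix q :: real assume "q < 1"
    have fst: "fst s = fst t" using same by (metis fst_kop_of)
    have "sqrt (1 - (cmod (iprod (fst t) (snd t) (snd s)))\<^sup>2)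
        = sqrt (1 - (cmod (iprod (fst t) (snd t) (snd t)))\<^sup>2)"
      using purified_dist_kop_of[OF s t fst] purified_dist_kop_of[OF t t refl] same by simp
    also have "\<dots> = 0" using t by (simp add: iprod_self states_def)
    finally have "(cmod (iprod (fst t) (snd t) (snd s)))\<^sup>2 = 1" by simp
    then show "converts s t q" unfolding converts_def
      using fst \<open>q < 1\<close> by (intro pays.leaf) (simp add: target_def)
  qed
  then show ?thesis using assms by (intro antisym) simp_all
qed

definition pure_val :: "kop \<Rightarrow> real" where "pure_val x = val (SOME s. s \<in> states k \<and> kop_of s = x)"

lemma pure_val_kop_of:
  assumes "s \<in> states k"
  shows "pure_val (kop_of s) = val s"
proof -
  have "\<exists>t. t \<in> states k \<and> kop_of t = kop_of s" using assms by blast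
  note representative = someI_ex[OF this]
  show ?thesis
    unfolding pure_val_def
    by (rule val_cong_kop_of[OF conjunct1[OF representative] assms conjunct2[OF representative]])
qed

lemma pure_val_continuous: "asymptotically_continuous k pure_val"
  unfolding asymptotically_continuous_def
proof (intro allI impI)
  fix \<epsilon> :: real assume "\<epsilon> > 0"
  obtain \<delta> where \<delta>: "\<delta> > 0" "\<And>d \<phi> \<psi>. (d, \<phi>) \<in> states k \<Longrightarrow> (d, \<psi>) \<in> states k \<Longrightarrow> 1 - (cmod (iprod d \<phi> \<psi>))\<^sup>2 < \<delta>
    \<Longrightarrow> \<bar>val (d, \<phi>) - val (d, \<psi>)\<bar> < \<epsilon> * (1 + log 2 (real (prod_list d)))"
    using val_continuity[OF \<open>\<epsilon> > 0\<close>] by blast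
  have "\<bar>pure_val x / (1 + log 2 (real (prod_list (fst x)))) - pure_val y /
      (1 + log 2 (real (prod_list (fst y))))\<bar> < \<epsilon>"
    if pure: "kpure k x" "kpure k y" and close: "kdist x y < min 1 (sqrt \<delta>)" for x y
  proof -
    obtain d \<phi> d' \<psi> where x: "(d, \<phi>) \<in> states k" "kop_of (d, \<phi>) = x" and y: "(d', \<psi>) \<in> states k"
      "kop_of (d', \<psi>) = y"
      using kpure_imp_kop_of[OF pure(1)] kpure_imp_kop_of[OF pure(2)] by (metis surj_pair)
    have "fst x = fst y" using close by (auto simp: kdist_def split: if_splits)
    then have d: "d = d'" using x(2) y(2) by auto
    let ?N = "1 + log 2 (real (prod_list d))"
    have "sqrt (1 - (cmod (iprod d \<psi> \<phi>))\<^sup>2) < sqrt \<delta>"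
      using close \<open>fst x = fst y\<close> purified_dist_kop_of[OF x(1) y(1)] x(2) y(2) by (simp add: kdist_def d)
    then have "\<bar>val (d, \<phi>) - val (d, \<psi>)\<bar> < \<epsilon> * ?N"
      using \<delta>(2)[of d \<psi> \<phi>] x(1) y(1) by (simp add: d abs_minus_commute)
    moreover have "0 < ?N" using log_dim_nonneg[OF x(1)] by simp
    ultimately have "\<bar>val (d, \<phi>) / ?N - val (d, \<psi>) / ?N\<bar> < \<epsilon>"
      unfolding diff_divide_distrib[symmetric] abs_divide by (simp add: pos_divide_less_eq)
    then show ?thesis using pure_val_kop_of x y d by (metis fst_kop_of fst_conv)
  qed
  then show "\<exists>\<delta>>0. \<forall>s t. kpure k s \<and> kpure k t \<and> kdist s t < \<delta> \<longrightarrow>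
      \<bar>pure_val s / (1 + log 2 (real (prod_list (fst s)))) - pure_val t /
      (1 + log 2 (real (prod_list (fst t))))\<bar> < \<epsilon>"
    using \<delta>(1) by (intro exI[of _ "min 1 (sqrt \<delta>)"]) auto
qed

lemma pure_val_additive: "fully_additive k pure_val"
  unfolding fully_additive_def
proof (intro allI impI)
  fix x y assume "kpure k x \<and> kpure k y"
  then obtain s t where "s \<in> states k" "kop_of s = x" "t \<in> states k" "kop_of t = y"
    using kpure_imp_kop_of by metis
  then show "pure_val (ktensor x y) = pure_val x + pure_val y"
    using ktensor_kop_of[of s k t] pure_val_kop_of[of s] pure_val_kop_of[of t] val_tensor[of s t]
      pure_val_kop_of[OF state_tensor_in_states[of s k t]] by auto
qed

lemma pure_val_monotone: "monotone_on_average k pure_val"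
  unfolding monotone_on_average_def
proof (intro allI impI, elim conjE)
  fix d :: "nat list" and \<phi> :: "complex vec" and d' Ks and m :: nat and f :: "nat \<Rightarrow> nat" and P :: "nat \<Rightarrow> real"
    and \<phi>s :: "nat \<Rightarrow> complex vec"
  assume pure: "kpure k (d, proj \<phi>)" and dim: "dim_vec \<phi> = prod_list d" and locc: "locc d d' Ks"
    and f: "\<forall>b<length Ks. f b < m" and P: "(\<Sum>x<m. P x) = 1"
    and out: "\<forall>x<m. kpure k (d', proj (\<phi>s x)) \<and> dim_vec (\<phi>s x) = prod_list d' \<and>
          msum (prod_list d') (prod_list d')
             (map (\<lambda>b. Ks ! b * proj \<phi> * adj (Ks ! b)) (filter (\<lambda>b. f b = x) [0..<length Ks]))
          = complex_of_real (P x) \<cdot>\<^sub>m proj (\<phi>s x)"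
  define s where "s = (d, amp_of d \<phi>)"
  define u where "u = (\<lambda>x. (d', amp_of d' (\<phi>s x)))"
  define \<alpha> where "\<alpha> = (\<lambda>b. \<Sum>a<prod_list d'. cnj (\<phi>s (f b) $ a) * (Ks ! b *\<^sub>v \<phi>) $ a)"
  have s: "s \<in> states k" "kop_of s = (d, proj \<phi>)"
    unfolding s_def using amp_of_in_states kpure_proj[OF pure dim] dim by blast+
  have u: "u x \<in> states k" "kop_of (u x) = (d', proj (\<phi>s x))" "unit_norm (\<phi>s x)" if "x < m" for x
    unfolding u_def using amp_of_in_states kpure_proj[of k d' "\<phi>s x"] out that by blast+
  have K: "Ks ! b \<in> carrier_mat (prod_list d') (dim_vec \<phi>)" if "b < length Ks" for b
    using locc_structure[OF locc] that dim by simp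
  have prob: "(\<Sum>b\<in>{b\<in>{..<length Ks}. f b = x}. (cmod (\<alpha> b))\<^sup>2) = P x" if "x < m" for x
  proof -
    have "(\<Sum>b\<in>{b\<in>{..<length Ks}. f b = x}. (cmod (\<alpha> b))\<^sup>2)
        = (\<Sum>b\<in>{b\<in>{..<length Ks}. f b = x}. (cmod (\<Sum>a<prod_list d'. cnj (\<phi>s x $ a) * (Ks ! b *\<^sub>v \<phi>) $ a))\<^sup>2)"
      by (rule sum.cong) (auto simp: \<alpha>_def)
    then show ?thesis using kraus_fibre_pure(1)[OF K u(3)[OF that], of f x "P x"] out that by simp
  qed
  have "branches d d' Ks (snd s) ! b = (\<lambda>y. \<alpha> b * snd (u (f b)) y)" if "b < length Ks" for b
  proof -
    have "f b < m" using f that by blast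
    then have "Ks ! b *\<^sub>v \<phi> = \<alpha> b \<cdot>\<^sub>v \<phi>s (f b)"
      unfolding \<alpha>_def using out by (intro kraus_fibre_pure(2)[OF K u(3)]) (auto simp: that)
    moreover have "vec_of d (snd s) = \<phi>" by (simp add: s_def vec_of_amp[OF dim])
    ultimately show ?thesis
      using that out \<open>f b < m\<close> by (auto simp: branches_def u_def amp_of_def enc_less)
  qed
  then have "ensemble s {..<length Ks} \<alpha> (\<lambda>b. u (f b))"
    using ensemble_branches[of s d' Ks k] locc s(1) by (simp add: s_def u_def)
  moreover have fibres: "(\<Sum>b<length Ks. (cmod (\<alpha> b))\<^sup>2 * g (f b)) = (\<Sum>x<m. P x * g x)" for g
    by (rule sum_weighted_fibres[OF f prob])
  moreover have "(\<Sum>b<length Ks. (cmod (\<alpha> b))\<^sup>2) = 1" using fibres[of "\<lambda>_. 1"] P by simp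
  ultimately have "(\<Sum>x<m. P x * val (u x)) \<le> val s"
    using val_average[of s "{..<length Ks}" \<alpha> "\<lambda>b. u (f b)"] f s(1) u(1) fibres[of "\<lambda>x. val (u x)"] by simp
  then show "(\<Sum>x<m. P x * pure_val (d', proj (\<phi>s x))) \<le> pure_val (d, proj \<phi>)"
    using pure_val_kop_of[OF s(1)] pure_val_kop_of[OF u(1)] s(2) u(2) by simp
qed

lemma pure_val_admissible: "admissible k pure_val"
proof -
  have "pure_val (GHZ k 2) = 1" using pure_val_kop_of[OF g_in] E_ghz kop_of_ghz[OF k_pos] by (simp add: val_def)
  then show ?thesis unfolding admissible_def using pure_val_additive pure_val_monotone pure_val_continuous
    by blast
qed

end

lemma not_dominates_imp_admissible:
  assumes k: "2 \<le> k" and s: "s \<in> states k" and t: "t \<in> states k" and q: "0 < q"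
    and not_dom: "\<not> resource_theory.dominates (states k) (mconverts k) (ghz k 2) (replicate_mset q s)
        (replicate_mset p t)"
  shows "\<exists>E. admissible k E \<and> E (kop_of t) \<noteq> 0 \<and> E (kop_of s) / E (kop_of t) < real p / real q"
proof -
  interpret resource_theory "states k" "mconverts k" "ghz k 2" by (rule entanglement_resource_theory[OF k])
  have "replicate_mset q s \<in> resources" "replicate_mset p t \<in> resources" using s t by (auto simp: resources_iff)
  from separating_functional_exists[OF this not_dom] obtain E where
    E: "\<And>M N. M \<in> resources \<Longrightarrow> N \<in> resources \<Longrightarrow> E (M + N) = E M + E N" "E {#ghz k 2#} = (1::real)"
      "\<And>M N. dominates M N \<Longrightarrow> E N \<le> E M" and separates: "E (replicate_mset q s) < E (replicate_mset p t)"
        by blast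
  interpret F: entanglement_functional k E
    by unfold_locales (use k E in \<open>auto simp: resources_iff\<close>)
  have less: "real q * F.val s < real p * F.val t"
    using separates unfolding F.E_replicate[OF s] F.E_replicate[OF t] .
  moreover have "0 \<le> real q * F.val s" using F.val_nonneg[OF s] by simp
  ultimately have "0 < real p * F.val t" by linarith
  then have "0 < F.val t" by (simp add: zero_less_mult_iff)
  then have "F.val t \<noteq> 0 \<and> F.val s / F.val t < real p / real q" using less q by (simp add: field_simps)
  then show ?thesis
    using F.pure_val_admissible F.pure_val_kop_of[OF s] F.pure_val_kop_of[OF t]
    by (intro exI[of _ F.pure_val]) simp
qed

lemma admissible_ratio_below:
  assumes k: "2 \<le> k" and s: "s \<in> states k" and t: "t \<in> states k" and a: "R_LOCCq k (kop_of s) (kop_of t) < a"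
  shows "\<exists>E. admissible k E \<and> E (kop_of t) \<noteq> 0 \<and> ereal (E (kop_of s) / E (kop_of t)) < a"
proof -
  interpret resource_theory "states k" "mconverts k" "ghz k 2" by (rule entanglement_resource_theory[OF k])
  let ?R = "R_LOCCq k (kop_of s) (kop_of t)"
  have rate: "ereal (real p / real q) \<le> ?R" if "0 < q" "dominates (replicate_mset q s) (replicate_mset p t)"
    for p q
    unfolding R_LOCCq_def using dominates_imp_achievable[OF k s t that] by (intro Sup_upper) blast
  have "dominates (replicate_mset 1 s) (replicate_mset 0 t)" using s by (intro dominates_subset) auto
  from rate[OF _ this] have "0 \<le> ?R" by (simp add: zero_ereal_def)
  obtain b :: rat where b: "?R < ereal (real_of_rat b)" "ereal (real_of_rat b) < a"
    using ereal_dense3[OF a] by blast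
  have "0 < ereal (real_of_rat b)" using \<open>0 \<le> ?R\<close> b(1) by (rule le_less_trans)
  moreover obtain p q :: nat where "q \<noteq> 0" "\<bar>real_of_rat b\<bar> = real p / real q"
    by (rule Rats_abs_nat_div_natE[of "real_of_rat b"]) auto
  ultimately have pq: "real_of_rat b = real p / real q" "0 < q" by auto
  then have "\<not> dominates (replicate_mset q s) (replicate_mset p t)" using rate[of q p] b(1) by auto
  from not_dominates_imp_admissible[OF k s t pq(2) this] obtain E
    where "admissible k E" "E (kop_of t) \<noteq> 0" "E (kop_of s) / E (kop_of t) < real_of_rat b"
      unfolding pq(1) by blast
  then show ?thesis using b(2) less_trans less_ereal.simps(1) by blast
qed

lemma R_LOCCq_kop_of:
  assumes k: "2 \<le> k" and s: "s \<in> states k" and t: "t \<in> states k"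
  shows "R_LOCCq k (kop_of s) (kop_of t) = Inf {ereal (E (kop_of s) / E (kop_of t)) | E. admissible k E
      \<and> E (kop_of t) \<noteq> 0}"
    (is "?R = Inf ?ratios")
proof (rule antisym)
  show "?R \<le> Inf ?ratios"
  proof (rule Inf_greatest)
    fix y assume "y \<in> ?ratios"
    then obtain E where E: "y = ereal (E (kop_of s) / E (kop_of t))" "admissible k E" "E (kop_of t) \<noteq> 0"
      by blast
    interpret admissible_functional k E using k E(2) by unfold_locales auto
    show "?R \<le> y" unfolding E(1) by (rule R_LOCCq_le_ratio[OF s t E(3)])
  qed
  show "Inf ?ratios \<le> ?R"
  proof (rule ccontr)
    assume "\<not> Inf ?ratios \<le> ?R"
    then obtain E where "admissible k E" "E (kop_of t) \<noteq> 0" "ereal (E (kop_of s) / E (kop_of t)) < Inf ?ratios"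
      using admissible_ratio_below[OF k s t] by (meson not_le)
    moreover from this have "Inf ?ratios \<le> ereal (E (kop_of s) / E (kop_of t))" by (intro Inf_lower) blast
    ultimately show False by simp
  qed
qed

theorem theorem1:
  fixes k :: nat and d e :: "nat list" and \<phi> \<psi> :: "complex vec"
  assumes "k \<ge> 2"
    and "valid_dims k d" and "dim_vec \<phi> = prod_list d" and "unit_norm \<phi>"
    and "valid_dims k e" and "dim_vec \<psi> = prod_list e" and "unit_norm \<psi>"
  shows "R_LOCCq k (d, proj \<phi>) (e, proj \<psi>) =
    Inf {ereal (E (d, proj \<phi>) / E (e, proj \<psi>)) | E. admissible k E \<and> E (e, proj \<psi>) \<noteq> 0}"
  using R_LOCCq_kop_of[OF assms(1) amp_of_in_states(1)[OF assms(2-4)] amp_of_in_states(1)[OF assms(5-7)]]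
  by (simp add: amp_of_in_states(2)[OF assms(2-4)] amp_of_in_states(2)[OF assms(5-7)])

end
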